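(* Let $A$ be an $N\times N$ matrix and $B$ an $M\times M$ matrix, both with nonnegative integer entries, irreducible and not permutation matrices, and suppose $A=CD$ and $B=DC$ for nonnegative integer rectangular matrices $C$ (of size $N\times M$) and $D$ (of size $M\times N$). Then there exist an isomorphism $\Phi:\mathcal{O}_A\otimes\mathcal{K}\to\mathcal{O}_B\otimes\mathcal{K}$ of $C^*$-algebras satisfying $\Phi(\mathcal{D}_A\otimes\mathcal{C})=\mathcal{D}_B\otimes\mathcal{C}$ and, for each $f\in C(X_A,\mathbb{Z})$, a unitary representation $t\in\mathbb{T}\mapsto u_t^f\in M(\mathcal{D}_A\otimes\mathcal{C})$ such that $$\Phi\circ\operatorname{Ad}(u_t^f)\circ(\rho^{A,f}_t\otimes\operatorname{id})=(\rho^{B,\phi(f)}_t\otimes\operatorname{id})\circ\Phi\qquad\text{for all } f\in C(X_A,\mathbb{Z}),\ t\in\mathbb{T},$$ and such that the diagram formed by $\Phi_*:K_0(\mathcal{O}_A)\to K_0(\mathcal{O}_B)$, $\epsilon_A$, $\epsilon_B$ and $\Phi_{C^t}$ commutes: $$\epsilon_B\circ\Phi_*=\Phi_{C^t}\circ\epsilon_A:\ K_0(\mathcal{O}_A)\to\mathbb{Z}^M/(\operatorname{id}-B^t)\mathbb{Z}^M,$$ where $\Phi_{C^t}:\mathbb{Z}^N/(\operatorname{id}-A^t)\mathbb{Z}^N\to\mathbb{Z}^M/(\operatorname{id}-B^t)\mathbb{Z}^M$ is the isomorphism induced by multiplication by the transpose matrix $C^t$.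
   Context: $\mathbb{T}=\mathbb{R}/\mathbb{Z}$; $\mathcal{K}$ is the algebra of compact operators on $\ell^2(\mathbb{N})$, $\mathcal{C}\subset\mathcal{K}$ the maximal abelian $C^*$-subalgebra of diagonal operators; $M(\cdot)$ is the multiplier algebra. $K_0(\mathcal{O}_A\otimes\mathcal{K})$ is identified with $K_0(\mathcal{O}_A)$ via $a\mapsto a\otimes p_1$, $p_1$ a rank one projection. A square matrix is irreducible if for all $i,j$ some power $n\ge1$ has positive $(i,j)$ entry. For an $N\times N$ nonnegative integer matrix $A$, $G_A=(V_A,E_A)$ is the directed graph with vertices $v_1^A,\dots,v_N^A$ and $A(i,j)$ edges from $v_i^A$ to $v_j^A$; $s,t$ are source and terminal maps. $\mathcal{O}_A$ is the universal $C^*$-algebra generated by partial isometries $S_a$, $a\in E_A$, with $\sum_{b}S_bS_b^*=1$ and $S_a^*S_a=\sum_{s(b)=t(a)}S_bS_b^*$. $\mathcal{D}_A$ is the $C^*$-subalgebra generated by the projections $S_{a_1}\cdots S_{a_n}S_{a_n}^*\cdots S_{a_1}^*$; it is identified with $C(X_A)$, where $X_A=\{(x_n)_{n\in\mathbb{N}}\in E_A^{\mathbb{N}}: t(x_n)=s(x_{n+1})\}$, this projection corresponding to the characteristic function of the cylinder set of $(a_1,\dots,a_n)$. $C(X_A,\mathbb{Z})$ is the group of continuous integer-valued functions on $X_A$. For $f\in C(X_A,\mathbb{Z})$, put $U_t(f)=\exp(2\pi\sqrt{-1}tf)\in\mathcal{D}_A$, and let $\rho^{A,f}_t$ be the automorphism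 of $\mathcal{O}_A$ with $\rho^{A,f}_t(S_a)=U_t(f)S_a$, $a\in E_A$. The map $\phi$. Let $E_C$ be a set with $C(i,k)$ edges from $v_i^A$ to $v_k^B$, and $E_D$ a set with $D(k,j)$ edges from $v_k^B$ to $v_j^A$. Since $A=CD$, $B=DC$, fix source- and terminal-preserving bijections from $E_A$ onto the set of composable pairs $cd$ ($c\in E_C$, $d\in E_D$, terminal vertex of $c$ = source of $d$) and from $E_B$ onto the set of composable pairs $dc$. Then $X_A$ is identified with the set of infinite paths $c_1d_1c_2d_2\cdots$ and $X_B$ with the set of infinite paths $d_1c_1d_2c_2\cdots$. The homomorphism $\phi:C(X_A,\mathbb{Z})\to C(X_B,\mathbb{Z})$ is $\phi(f)(d_1c_1d_2c_2\cdots)=f(c_1d_2c_2d_3\cdots)$ (in the Cuntz--Krieger algebra of the block matrix $\begin{bmatrix} 0 & C \\ D & 0 \end{bmatrix}$ this is $\phi(f)=\sum_{d\in E_D}S_dfS_d^*$). $\epsilon_A:K_0(\mathcal{O}_A)\to\mathbb{Z}^N/(\operatorname{id}-A^t)\mathbb{Z}^N$ is the group isomorphism determined by $\epsilon_A([S_aS_a^*])=[e_j]$ when $t(a)=v_j^A$, $e_j$ being the $j$-th standard basis vector; it satisfies $\epsilon_A([1_A])=[(1,\dots,1)]$ for the unit $1_A$. $\epsilon_B$ is defined likewise. *)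

theory Defs
  imports "HOL-Analysis.Analysis" "HOL-Algebra.Coset"
begin

section \<open>The Hilbert space \<open>\<ell>\<^sup>2(I)\<close>\<close>

class scaleC =
  fixes scaleC :: "complex \<Rightarrow> 'a \<Rightarrow> 'a" (infixr "*\<^sub>C" 75)

class star_algebra = ring + scaleC +
  fixes adj :: "'a \<Rightarrow> 'a"
  assumes scaleC_add_right: "c *\<^sub>C (x + y) = c *\<^sub>C x + c *\<^sub>C y"
    and scaleC_add_left: "(c + d) *\<^sub>C x = c *\<^sub>C x + d *\<^sub>C x"
    and scaleC_scaleC: "c *\<^sub>C d *\<^sub>C x = (c * d) *\<^sub>C x"
    and scaleC_one: "1 *\<^sub>C x = x"
    and mult_scaleC_left: "(c *\<^sub>C x) * y = c *\<^sub>C (x * y)"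
    and mult_scaleC_right: "x * (c *\<^sub>C y) = c *\<^sub>C (x * y)"
    and adj_adj: "adj (adj x) = x"
    and adj_add: "adj (x + y) = adj x + adj y"
    and adj_mult: "adj (x * y) = adj y * adj x"
    and adj_scaleC: "adj (c *\<^sub>C x) = cnj c *\<^sub>C adj x"

instantiation complex :: star_algebra
begin
definition "scaleC_complex = ((*) :: complex \<Rightarrow> complex \<Rightarrow> complex)"
definition "adj_complex = cnj"
instance
  by standard (simp_all add: scaleC_complex_def adj_complex_def algebra_simps)
end

definition sq_summable :: "('i \<Rightarrow> complex) \<Rightarrow> bool" where
  "sq_summable f \<longleftrightarrow> (\<lambda>i. (cmod (f i))\<^sup>2) summable_on UNIV"

lemma sq_summable_add:
  assumes "sq_summable f" "sq_summable g" shows "sq_summable (\<lambda>i. f i + g i)"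
  unfolding sq_summable_def
proof (rule summable_on_comparison_test)
  show "(\<lambda>i. 2 * (cmod (f i))\<^sup>2 + 2 * (cmod (g i))\<^sup>2) summable_on UNIV"
    using assms unfolding sq_summable_def
    by (intro summable_on_add summable_on_cmult_right)
  fix i
  have "(cmod (f i + g i))\<^sup>2 \<le> (cmod (f i) + cmod (g i))\<^sup>2"
    by (intro power_mono norm_triangle_ineq) simp
  also have "\<dots> \<le> 2 * (cmod (f i))\<^sup>2 + 2 * (cmod (g i))\<^sup>2"
    using sum_squares_bound[of "cmod (f i)" "cmod (g i)"] by (simp add: power2_sum)
  finally show "(cmod (f i + g i))\<^sup>2 \<le> 2 * (cmod (f i))\<^sup>2 + 2 * (cmod (g i))\<^sup>2" .
qed simp

lemma sq_summable_scale:
  assumes "sq_summable f" shows "sq_summable (\<lambda>i. c * f i)"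
  using assms unfolding sq_summable_def
  by (auto simp: norm_mult power_mult_distrib intro: summable_on_cmult_right)

lemma sq_summable_prod:
  assumes "sq_summable f" "sq_summable g"
  shows "(\<lambda>i. cnj (f i) * g i) summable_on UNIV"
proof (rule abs_summable_summable, rule summable_on_comparison_test)
  show "(\<lambda>i. (cmod (f i))\<^sup>2 + (cmod (g i))\<^sup>2) summable_on UNIV"
    using assms unfolding sq_summable_def by (rule summable_on_add)
  fix i
  have "2 * (cmod (f i) * cmod (g i)) \<le> (cmod (f i))\<^sup>2 + (cmod (g i))\<^sup>2"
    using sum_squares_bound[of "cmod (f i)" "cmod (g i)"] by simp
  moreover have "0 \<le> cmod (f i) * cmod (g i)" by simp
  moreover have "norm (cnj (f i) * g i) = cmod (f i) * cmod (g i)" by (simp add: norm_mult)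
  ultimately show "norm (cnj (f i) * g i) \<le> (cmod (f i))\<^sup>2 + (cmod (g i))\<^sup>2"
    by linarith
qed simp

typedef 'i ell2 = "{f :: 'i \<Rightarrow> complex. sq_summable f}"
  morphisms coord Abs_ell2
  by (rule exI[of _ "\<lambda>_. 0"]) (simp add: sq_summable_def)

setup_lifting type_definition_ell2

lemma sq_summable_coord [simp]: "sq_summable (coord v)"
  using coord[of v] by simp

lemma coord_Abs: "sq_summable f \<Longrightarrow> coord (Abs_ell2 f) = f"
  by (simp add: Abs_ell2_inverse)

lemma ell2_eqI: "(\<And>i. coord x i = coord y i) \<Longrightarrow> x = y"
  by (simp add: coord_inject[symmetric] fun_eq_iff)

instantiation ell2 :: (type) "{scaleC, real_vector}"
begin
lift_definition zero_ell2 :: "'a ell2" is "\<lambda>_. 0" by (simp add: sq_summable_def)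
lift_definition plus_ell2 :: "'a ell2 \<Rightarrow> 'a ell2 \<Rightarrow> 'a ell2" is "\<lambda>f g i. f i + g i"
  by (rule sq_summable_add)
lift_definition uminus_ell2 :: "'a ell2 \<Rightarrow> 'a ell2" is "\<lambda>f i. - f i"
  by (simp add: sq_summable_def)
lift_definition minus_ell2 :: "'a ell2 \<Rightarrow> 'a ell2 \<Rightarrow> 'a ell2" is "\<lambda>f g i. f i - g i"
  using sq_summable_add sq_summable_scale[of _ "-1"] by fastforce
lift_definition scaleC_ell2 :: "complex \<Rightarrow> 'a ell2 \<Rightarrow> 'a ell2" is "\<lambda>c f i. c * f i"
  by (rule sq_summable_scale)
lift_definition scaleR_ell2 :: "real \<Rightarrow> 'a ell2 \<Rightarrow> 'a ell2" is "\<lambda>r f i. of_real r * f i"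
  by (rule sq_summable_scale)
instance
  by standard (transfer; simp add: fun_eq_iff algebra_simps)+
end

lemmas coord_simps [simp] = zero_ell2.rep_eq plus_ell2.rep_eq uminus_ell2.rep_eq
  minus_ell2.rep_eq scaleC_ell2.rep_eq scaleR_ell2.rep_eq

definition cinner :: "'i ell2 \<Rightarrow> 'i ell2 \<Rightarrow> complex" where
  "cinner x y = (\<Sum>\<^sub>\<infinity>i. cnj (coord x i) * coord y i)"

lemma cinner_summable [simp]: "(\<lambda>i. cnj (coord x i) * coord y i) summable_on UNIV"
  by (simp add: sq_summable_prod)

lemma cinner_add_right: "cinner x (y + z) = cinner x y + cinner x z"
  by (simp add: cinner_def distrib_left infsum_add)

lemma cinner_scaleC_right: "cinner x (c *\<^sub>C y) = c * cinner x y"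
  by (simp add: cinner_def mult.left_commute[of _ c] infsum_cmult_right)

lemma cinner_commute: "cinner x y = cnj (cinner y x)"
  by (simp add: cinner_def infsum_cnj[symmetric] mult.commute)

lemma cinner_add_left: "cinner (x + y) z = cinner x z + cinner y z"
  by (metis cinner_commute cinner_add_right complex_cnj_add)

lemma cinner_scaleC_left: "cinner (c *\<^sub>C x) y = cnj c * cinner x y"
  by (metis cinner_commute cinner_scaleC_right complex_cnj_mult)

lemma scaleR_scaleC: "(r::real) *\<^sub>R (x::'i ell2) = of_real r *\<^sub>C x"
  by (rule ell2_eqI) simp

lemma cinner_self: "cinner x x = of_real (\<Sum>\<^sub>\<infinity>i. (cmod (coord x i))\<^sup>2)"
proof -
  have "((\<lambda>i. (cmod (coord x i))\<^sup>2) has_sum (\<Sum>\<^sub>\<infinity>i. (cmod (coord x i))\<^sup>2)) UNIV"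
    using sq_summable_coord[of x] unfolding sq_summable_def by (rule has_sum_infsum)
  hence "((\<lambda>i. of_real ((cmod (coord x i))\<^sup>2)) has_sum
      (of_real (\<Sum>\<^sub>\<infinity>i. (cmod (coord x i))\<^sup>2) :: complex)) UNIV"
    by (rule has_sum_of_real)
  moreover have "(\<lambda>i. of_real ((cmod (coord x i))\<^sup>2)) = (\<lambda>i. cnj (coord x i) * coord x i)"
    using complex_norm_square by (auto simp: fun_eq_iff mult.commute)
  ultimately show ?thesis unfolding cinner_def by (metis infsumI)
qed

instantiation ell2 :: (type) real_inner
begin
definition "inner_ell2 (x :: 'a ell2) y = Re (cinner x y)"
definition "norm_ell2 (x :: 'a ell2) = sqrt (inner x x)"
definition "dist_ell2 (x :: 'a ell2) y = norm (x - y)"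
definition "sgn_ell2 (x :: 'a ell2) = inverse (norm x) *\<^sub>R x"
definition "uniformity_ell2 = (INF e\<in>{0<..}. principal {(x :: 'a ell2, y). dist x y < e})"
definition "open_ell2 (U :: 'a ell2 set) \<longleftrightarrow>
  (\<forall>x\<in>U. eventually (\<lambda>(x', y). x' = x \<longrightarrow> y \<in> U) uniformity)"
instance
proof
  fix x y z :: "'a ell2" and r :: real
  show "inner x y = inner y x"
    unfolding inner_ell2_def by (subst cinner_commute) simp
  show "inner (x + y) z = inner x z + inner y z"
    by (simp add: inner_ell2_def cinner_add_left)
  show "inner (r *\<^sub>R x) y = r * inner x y"
    by (simp add: inner_ell2_def scaleR_scaleC cinner_scaleC_left)
  show "0 \<le> inner x x"
    by (simp add: inner_ell2_def cinner_self infsum_nonneg)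
  show "inner x x = 0 \<longleftrightarrow> x = 0"
  proof
    assume "inner x x = 0"
    hence "(\<Sum>\<^sub>\<infinity>i. (cmod (coord x i))\<^sup>2) = 0" by (simp add: inner_ell2_def cinner_self)
    hence "(cmod (coord x i))\<^sup>2 = 0" for i
      using nonneg_infsum_le_0D[of "\<lambda>i. (cmod (coord x i))\<^sup>2" UNIV i]
        sq_summable_coord[of x, unfolded sq_summable_def] by simp
    thus "x = 0" by (intro ell2_eqI) simp
  qed (simp add: inner_ell2_def cinner_def)
qed (simp_all add: norm_ell2_def dist_ell2_def sgn_ell2_def uniformity_ell2_def open_ell2_def)
end

lemma norm_ell2_sq: "(norm (x :: 'i ell2))\<^sup>2 = (\<Sum>\<^sub>\<infinity>i. (cmod (coord x i))\<^sup>2)"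
  by (simp add: power2_norm_eq_inner inner_ell2_def cinner_self)

lemma norm_ell2_bound:
  assumes "\<And>F. finite F \<Longrightarrow> (\<Sum>i\<in>F. (cmod (f i))\<^sup>2) \<le> b\<^sup>2" "0 \<le> b"
  shows "sq_summable f" "norm (Abs_ell2 f) \<le> b"
proof -
  show s: "sq_summable f" unfolding sq_summable_def
    by (rule nonneg_bdd_above_summable_on) (auto intro!: bdd_aboveI2[of _ _ "b\<^sup>2"] assms)
  have "(norm (Abs_ell2 f))\<^sup>2 = (\<Sum>\<^sub>\<infinity>i. (cmod (f i))\<^sup>2)"
    by (simp add: norm_ell2_sq coord_Abs s)
  also have "\<dots> \<le> b\<^sup>2"
    using s unfolding sq_summable_def by (rule infsum_le_finite_sums) (simp add: assms)
  finally show "norm (Abs_ell2 f) \<le> b" using assms(2) by (rule power2_le_imp_le)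
qed

lemma norm_ell2_finite_sum: "finite F \<Longrightarrow> (\<Sum>i\<in>F. (cmod (coord x i))\<^sup>2) \<le> (norm (x :: 'i ell2))\<^sup>2"
  unfolding norm_ell2_sq using sq_summable_coord[of x, unfolded sq_summable_def]
  by (intro finite_sum_le_infsum) auto

lemma norm_scaleC_ell2 [simp]: "norm (c *\<^sub>C (x :: 'i ell2)) = cmod c * norm x"
proof -
  have "(norm (c *\<^sub>C x))\<^sup>2 = (cmod c * norm x)\<^sup>2"
    using sq_summable_coord[of x, unfolded sq_summable_def]
    by (simp add: norm_ell2_sq norm_mult power_mult_distrib infsum_cmult_right)
  thus ?thesis by (simp add: power2_eq_iff_nonneg)
qed

lemma norm_cinner: "cmod (cinner x y) \<le> norm x * norm y"
proof (cases "cinner x y = 0")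
  case False
  define c where "c = cnj (sgn (cinner x y))"
  have "c * cinner x y = of_real (cmod (cinner x y))"
    using False by (simp add: c_def sgn_div_norm scaleR_conv_of_real field_simps complex_norm_square[symmetric])
      (metis complex_norm_square power2_eq_square mult.commute)
  hence "cmod (cinner x y) = inner x (c *\<^sub>C y)"
    by (simp add: inner_ell2_def cinner_scaleC_right)
  also have "\<dots> \<le> norm x * norm (c *\<^sub>C y)" by (rule norm_cauchy_schwarz)
  also have "\<dots> = norm x * norm y" using False by (simp add: c_def norm_sgn)
  finally show ?thesis .
qed simp

lift_definition ket :: "'i \<Rightarrow> 'i ell2" is "\<lambda>i j. if j = i then 1 else 0"
  unfolding sq_summable_def by (rule finite_nonzero_values_imp_summable_on) (simp add: if_distrib cong: if_cong)

lemma coord_ket: "coord (ket i) j = (if j = i then 1 else 0)" by transfer simp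

lemma cinner_ket: "cinner (ket i) v = coord v i"
proof -
  have "(\<Sum>\<^sub>\<infinity>j. cnj (coord (ket i) j) * coord v j) = (\<Sum>\<^sub>\<infinity>j\<in>{i}. coord v j)"
    by (rule infsum_cong_neutral) (auto simp: coord_ket)
  thus ?thesis by (simp add: cinner_def)
qed

lemma coord_sum: "coord (\<Sum>i\<in>F. x i) j = (\<Sum>i\<in>F. coord (x i) j)"
  by (induction F rule: infinite_finite_induct) auto

lemma has_sum_ket: "((\<lambda>i. coord w i *\<^sub>C ket i) has_sum w) UNIV"
proof -
  have "((\<lambda>i. (cmod (coord w i))\<^sup>2) has_sum (norm w)\<^sup>2) UNIV"
    unfolding norm_ell2_sq
    using sq_summable_coord[of w] unfolding sq_summable_def by (rule has_sum_infsum)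
  hence l: "((\<lambda>F. \<Sum>i\<in>F. (cmod (coord w i))\<^sup>2) \<longlongrightarrow> (norm w)\<^sup>2) (finite_subsets_at_top UNIV)"
    by (simp add: has_sum_def)
  have e: "(norm (w - (\<Sum>i\<in>F. coord w i *\<^sub>C ket i)))\<^sup>2 = (norm w)\<^sup>2 - (\<Sum>i\<in>F. (cmod (coord w i))\<^sup>2)"
    if "finite F" for F
  proof -
    have s: "(\<lambda>i. (cmod (coord w i))\<^sup>2) summable_on UNIV"
      using sq_summable_coord[of w, unfolded sq_summable_def] .
    have "coord (w - (\<Sum>i\<in>F. coord w i *\<^sub>C ket i)) j = (if j \<in> F then 0 else coord w j)" for j
      using that by (simp add: coord_sum coord_ket if_distrib[of "(*) _"] sum.delta cong: if_cong)
    hence "(norm (w - (\<Sum>i\<in>F. coord w i *\<^sub>C ket i)))\<^sup>2 =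
        (\<Sum>\<^sub>\<infinity>j. (cmod (if j \<in> F then 0 else coord w j))\<^sup>2)"
      by (simp add: norm_ell2_sq)
    also have "\<dots> = (\<Sum>\<^sub>\<infinity>j\<in>-F. (cmod (coord w j))\<^sup>2)"
      by (rule infsum_cong_neutral) auto
    also have "\<dots> = (norm w)\<^sup>2 - (\<Sum>i\<in>F. (cmod (coord w i))\<^sup>2)"
      using infsum_Un_disjoint[of "\<lambda>i. (cmod (coord w i))\<^sup>2" F "-F"] that
        summable_on_subset_banach[OF s, of "-F"] by (simp add: norm_ell2_sq)
    finally show ?thesis .
  qed
  have "((\<lambda>F. (norm (w - (\<Sum>i\<in>F. coord w i *\<^sub>C ket i)))\<^sup>2) \<longlongrightarrow> 0) (finite_subsets_at_top UNIV)"
  proof (rule Lim_transform_eventually)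
    show "((\<lambda>F. (norm w)\<^sup>2 - (\<Sum>i\<in>F. (cmod (coord w i))\<^sup>2)) \<longlongrightarrow> 0) (finite_subsets_at_top UNIV)"
      using tendsto_diff[OF tendsto_const[of "(norm w)\<^sup>2"] l] by simp
    show "\<forall>\<^sub>F F in finite_subsets_at_top UNIV. (norm w)\<^sup>2 - (\<Sum>i\<in>F. (cmod (coord w i))\<^sup>2) =
        (norm (w - (\<Sum>i\<in>F. coord w i *\<^sub>C ket i)))\<^sup>2"
      by (rule eventually_finite_subsets_at_top_weakI) (simp add: e)
  qed
  hence "((\<lambda>F. sqrt ((norm (w - (\<Sum>i\<in>F. coord w i *\<^sub>C ket i)))\<^sup>2)) \<longlongrightarrow> sqrt 0) (finite_subsets_at_top UNIV)"
    by (rule tendsto_real_sqrt)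
  hence "((\<lambda>F. norm (w - (\<Sum>i\<in>F. coord w i *\<^sub>C ket i))) \<longlongrightarrow> 0) (finite_subsets_at_top UNIV)"
    by simp
  hence "((\<lambda>F. dist (\<Sum>i\<in>F. coord w i *\<^sub>C ket i) w) \<longlongrightarrow> 0) (finite_subsets_at_top UNIV)"
    by (simp add: dist_norm norm_minus_commute)
  thus ?thesis unfolding has_sum_def by (simp add: tendsto_dist_iff[symmetric])
qed

lifting_forget ell2.lifting


section \<open>Bounded complex linear operators on \<open>\<ell>\<^sup>2(I)\<close>\<close>

typedef 'i cop = "{T :: 'i ell2 \<Rightarrow>\<^sub>L 'i ell2. \<forall>c v. blinfun_apply T (c *\<^sub>C v) = c *\<^sub>C blinfun_apply T v}"
  morphisms blinfun_of Abs_cop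
  by (rule exI[of _ 0]) (auto intro: ell2_eqI simp: zero_blinfun.rep_eq)

setup_lifting type_definition_cop

lift_definition app :: "'i cop \<Rightarrow> 'i ell2 \<Rightarrow> 'i ell2" is blinfun_apply .

lemma cop_eqI: "(\<And>v. app S v = app T v) \<Longrightarrow> S = T"
  by transfer (rule blinfun_eqI)

lemma app_scaleC [simp]: "app T (c *\<^sub>C v) = c *\<^sub>C app T v"
  by transfer simp

lemma app_add [simp]: "app T (v + w) = app T v + app T w"
  by transfer (rule blinfun.add_right)

lemma bounded_linear_app [intro]: "bounded_linear (app T)"
  by transfer (rule blinfun.bounded_linear_right)

lemma bounded_linear_scaleC_ell2: "bounded_linear (\<lambda>v :: 'i ell2. c *\<^sub>C v)"
  by (rule bounded_linear_intro[where K = "cmod c"])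
    (auto intro!: ell2_eqI simp: algebra_simps)

lift_definition scal :: "complex \<Rightarrow> 'i cop" is "\<lambda>c. Blinfun (\<lambda>v. c *\<^sub>C v)"
  by (auto simp: bounded_linear_Blinfun_apply bounded_linear_scaleC_ell2 intro!: ell2_eqI)

instantiation cop :: (type) real_normed_algebra_1
begin
lift_definition zero_cop :: "'a cop" is 0 by (auto intro: ell2_eqI simp: zero_blinfun.rep_eq)
lift_definition one_cop :: "'a cop" is id_blinfun by simp
lift_definition plus_cop :: "'a cop \<Rightarrow> 'a cop \<Rightarrow> 'a cop" is "(+)"
  by (auto intro!: ell2_eqI simp: blinfun.add_left distrib_left)
lift_definition uminus_cop :: "'a cop \<Rightarrow> 'a cop" is uminus
  by (auto intro!: ell2_eqI simp: blinfun.minus_left)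
lift_definition minus_cop :: "'a cop \<Rightarrow> 'a cop \<Rightarrow> 'a cop" is "(-)"
  by (auto intro!: ell2_eqI simp: blinfun.diff_left right_diff_distrib)
lift_definition times_cop :: "'a cop \<Rightarrow> 'a cop \<Rightarrow> 'a cop" is blinfun_compose
  by simp
lift_definition scaleR_cop :: "real \<Rightarrow> 'a cop \<Rightarrow> 'a cop" is scaleR
  by (auto intro!: ell2_eqI simp: blinfun.scaleR_left)
lift_definition norm_cop :: "'a cop \<Rightarrow> real" is norm .
definition "dist_cop (x :: 'a cop) y = norm (x - y)"
definition "sgn_cop (x :: 'a cop) = inverse (norm x) *\<^sub>R x"
definition "uniformity_cop = (INF e\<in>{0<..}. principal {(x :: 'a cop, y). dist x y < e})"
definition "open_cop (U :: 'a cop set) \<longleftrightarrow>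
  (\<forall>x\<in>U. eventually (\<lambda>(x', y). x' = x \<longrightarrow> y \<in> U) uniformity)"
instance
proof
  fix x y z :: "'a cop" and a b :: real
  have ne: "ket undefined \<noteq> (0 :: 'a ell2)"
    by (metis (full_types) coord_ket coord_simps(1) zero_neq_one)
  have "norm (id_blinfun :: 'a ell2 \<Rightarrow>\<^sub>L 'a ell2) = 1"
  proof (rule antisym)
    show "norm (id_blinfun :: 'a ell2 \<Rightarrow>\<^sub>L 'a ell2) \<le> 1" by (rule norm_blinfun_id_le)
    show "1 \<le> norm (id_blinfun :: 'a ell2 \<Rightarrow>\<^sub>L 'a ell2)"
      using norm_blinfun[of id_blinfun "ket undefined :: 'a ell2"] ne by simp
  qed
  thus n1: "norm (1 :: 'a cop) = 1" by transfer
  show "(0 :: 'a cop) \<noteq> 1"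
    using n1 by (metis norm_cop.rep_eq norm_zero zero_cop.rep_eq zero_neq_one)
  show "norm (x * y) \<le> norm x * norm y" by transfer (rule norm_blinfun_compose)
  show "norm (x + y) \<le> norm x + norm y" by transfer (rule norm_triangle_ineq)
  show "norm x = 0 \<longleftrightarrow> x = 0" by transfer simp
  show "norm (a *\<^sub>R x) = \<bar>a\<bar> * norm x" by transfer simp
  show "x * y * z = x * (y * z)" by transfer (auto intro: blinfun_eqI)
  show "x + y + z = x + (y + z)" "x + y = y + x" "0 + x = x" "- x + x = 0" "x - y = x + - y"
    by (transfer; simp)+
  show "a *\<^sub>R (x + y) = a *\<^sub>R x + a *\<^sub>R y" "(a + b) *\<^sub>R x = a *\<^sub>R x + b *\<^sub>R x"
    "a *\<^sub>R b *\<^sub>R x = (a * b) *\<^sub>R x" "1 *\<^sub>R x = x"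
    by (transfer; simp add: algebra_simps)+
  show "a *\<^sub>R x * y = a *\<^sub>R (x * y)" "x * a *\<^sub>R y = a *\<^sub>R (x * y)"
    "(x + y) * z = x * z + y * z" "x * (y + z) = x * y + x * z" "1 * x = x" "x * 1 = x"
    by (transfer; auto intro!: blinfun_eqI simp: blinfun.bilinear_simps)+
qed (simp_all add: dist_cop_def sgn_cop_def uniformity_cop_def open_cop_def)
end

lemma app_simps [simp]:
  "app 0 v = 0" "app 1 v = v" "app (S + T) v = app S v + app T v" "app (- T) v = - app T v"
  "app (S - T) v = app S v - app T v" "app (S * T) v = app S (app T v)"
  "app (r *\<^sub>R T) v = r *\<^sub>R app T v"
  by (transfer; simp add: blinfun.bilinear_simps)+

lemma norm_app: "norm (app T v) \<le> norm T * norm v"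
  by transfer (rule norm_blinfun)

text \<open>The operator with a prescribed, complex linear and bounded, action on vectors.\<close>

definition mk_cop :: "('i ell2 \<Rightarrow> 'i ell2) \<Rightarrow> 'i cop" where
  "mk_cop f = Abs_cop (Blinfun f)"

lemma
  assumes add: "\<And>v w. f (v + w) = f v + f w" and scale: "\<And>c v. f (c *\<^sub>C v) = c *\<^sub>C f v"
    and bound: "\<And>v. norm (f v) \<le> norm v * b"
  shows app_mk_cop: "app (mk_cop f) v = f v"
    and norm_mk_cop: "0 \<le> b \<Longrightarrow> norm (mk_cop f) \<le> b"
proof -
  have "bounded_linear f"
    by (rule bounded_linear_intro[of _ b]) (simp_all add: add scale bound scaleR_scaleC)
  hence B: "blinfun_apply (Blinfun f) = f" by (rule bounded_linear_Blinfun_apply)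
  hence "blinfun_of (mk_cop f) = Blinfun f"
    by (simp add: mk_cop_def Abs_cop_inverse scale)
  thus "app (mk_cop f) v = f v" "0 \<le> b \<Longrightarrow> norm (mk_cop f) \<le> b"
    by (auto simp: app.rep_eq B norm_cop.rep_eq bound mult.commute intro!: norm_blinfun_bound)
      (metis bound mult.commute)
qed

lemma bounded_linear_cinner_right: "bounded_linear (cinner v)"
  by (rule bounded_linear_intro[of _ "norm v"])
    (simp_all add: cinner_add_right cinner_scaleC_right scaleR_scaleC scaleR_conv_of_real
      norm_cinner mult.commute[of _ "norm v"])

lemma adj_exists:
  fixes T :: "'i cop"
  defines "g \<equiv> \<lambda>v i. cinner (app T (ket i)) v"
  shows "norm (Abs_ell2 (g v)) \<le> norm v * norm T"
    and "cinner (Abs_ell2 (g v)) w = cinner v (app T w)"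
    and "sq_summable (g v)"
proof -
  have fin: "(\<Sum>i\<in>F. (cmod (g v i))\<^sup>2) \<le> (norm v * norm T)\<^sup>2" if F: "finite F" for F
  proof -
    define w where "w = (\<Sum>i\<in>F. g v i *\<^sub>C ket i)"
    define s where "s = (\<Sum>i\<in>F. (cmod (g v i))\<^sup>2)"
    have s0: "0 \<le> s" by (simp add: s_def sum_nonneg)
    have cw: "coord w i = (if i \<in> F then g v i else 0)" for i
      using F by (simp add: w_def coord_sum coord_ket if_distrib[of "(*) _"] cong: if_cong)
    have "(norm w)\<^sup>2 = (\<Sum>\<^sub>\<infinity>i\<in>F. (cmod (g v i))\<^sup>2)"
      unfolding norm_ell2_sq by (rule infsum_cong_neutral) (auto simp: cw)
    hence nw: "(norm w)\<^sup>2 = s" using F by (simp add: s_def)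
    have lin: "app T w = (\<Sum>i\<in>F. g v i *\<^sub>C app T (ket i))"
      unfolding w_def
      by (subst linear_sum[OF bounded_linear.linear[OF bounded_linear_app[of T]]]) simp
    have "cinner v (app T w) = (\<Sum>i\<in>F. g v i * cinner v (app T (ket i)))"
      unfolding lin
      by (subst linear_sum[OF bounded_linear.linear[OF bounded_linear_cinner_right[of v]]])
        (simp add: cinner_scaleC_right)
    also have "\<dots> = of_real s"
      by (simp add: s_def g_def cinner_commute[of v] flip: complex_norm_square)
    finally have "s = cmod (cinner v (app T w))" using s0 by simp
    also have "\<dots> \<le> norm v * norm (app T w)" by (rule norm_cinner)
    also have "\<dots> \<le> norm v * (norm T * norm w)" by (intro mult_left_mono norm_app) simp
    finally have "norm w * norm w \<le> (norm v * norm T) * norm w"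
      by (simp add: nw[symmetric] power2_eq_square mult_ac)
    hence "norm w \<le> norm v * norm T"
      by (cases "norm w = 0") (simp_all add: mult_le_cancel_right)
    thus ?thesis using nw by (simp add: s_def[symmetric] nw[symmetric] power_mono)
  qed
  show "sq_summable (g v)" by (rule norm_ell2_bound(1)[OF fin]) simp_all
  show "norm (Abs_ell2 (g v)) \<le> norm v * norm T" by (rule norm_ell2_bound(2)[OF fin]) simp_all
  have *: "((\<lambda>i. cinner v (app T (coord w i *\<^sub>C ket i))) has_sum cinner v (app T w)) UNIV"
    using has_sum_bounded_linear[OF bounded_linear_compose[OF bounded_linear_cinner_right[of v] bounded_linear_app[of T]] has_sum_ket[of w]]
    by simp
  have "cinner (Abs_ell2 (g v)) w = (\<Sum>\<^sub>\<infinity>i. cinner v (app T (coord w i *\<^sub>C ket i)))"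
    unfolding cinner_def[of "Abs_ell2 (g v)"]
    by (rule infsum_cong)
      (simp add: coord_Abs \<open>sq_summable (g v)\<close> cinner_scaleC_right, simp add: g_def cinner_commute[of v])
  thus "cinner (Abs_ell2 (g v)) w = cinner v (app T w)"
    using infsumI[OF *] by simp
qed

lemma cinner_eqI: "(\<And>w. cinner x w = cinner y w) \<Longrightarrow> x = y"
  by (rule ell2_eqI) (metis cinner_commute cinner_ket)

instantiation cop :: (type) star_algebra
begin
definition scaleC_cop :: "complex \<Rightarrow> 'a cop \<Rightarrow> 'a cop" where
  "scaleC_cop c T = mk_cop (\<lambda>v. c *\<^sub>C app T v)"
definition adj_cop :: "'a cop \<Rightarrow> 'a cop" where
  "adj_cop T = mk_cop (\<lambda>v. Abs_ell2 (\<lambda>i. cinner (app T (ket i)) v))"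

lemma app_scaleC_cop: "app (c *\<^sub>C T) v = c *\<^sub>C app T v" for T :: "'a cop"
  unfolding scaleC_cop_def
proof (rule app_mk_cop[where b = "norm T * cmod c"])
  fix w show "norm (c *\<^sub>C app T w) \<le> norm w * (norm T * cmod c)"
    using mult_left_mono[OF norm_app[of T w], of "cmod c"] by (simp add: mult_ac)
qed (auto intro!: ell2_eqI simp: algebra_simps)

lemma cinner_app_adj: "cinner (app (adj T) v) w = cinner v (app T w)" for T :: "'a cop"
proof -
  have "app (adj T) v = Abs_ell2 (\<lambda>i. cinner (app T (ket i)) v)"
    unfolding adj_cop_def
    by (rule app_mk_cop[where b = "norm T"])
      (auto intro!: cinner_eqI adj_exists(1) simp: adj_exists(2) cinner_add_left cinner_scaleC_left)
  thus ?thesis by (simp add: adj_exists(2))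
qed

instance
proof
  fix S T U :: "'a cop" and c d
  note ext = cop_eqI cinner_eqI
  show "c *\<^sub>C (S + T) = c *\<^sub>C S + c *\<^sub>C T" "(c + d) *\<^sub>C S = c *\<^sub>C S + d *\<^sub>C S"
    "c *\<^sub>C d *\<^sub>C S = (c * d) *\<^sub>C S" "1 *\<^sub>C S = S"
    "c *\<^sub>C S * T = c *\<^sub>C (S * T)" "S * c *\<^sub>C T = c *\<^sub>C (S * T)"
    by (auto intro!: cop_eqI ell2_eqI simp: app_scaleC_cop algebra_simps)
  show "adj (S + T) = adj S + adj T"
    by (auto intro!: ext simp: cinner_app_adj cinner_add_left cinner_add_right)
  show "adj (S * T) = adj T * adj S"
    by (auto intro!: ext simp: cinner_app_adj)
  show "adj (c *\<^sub>C S) = cnj c *\<^sub>C adj S"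
    by (auto intro!: ext simp: cinner_app_adj app_scaleC_cop cinner_scaleC_left cinner_scaleC_right)
  show "adj (adj S) = S"
    by (auto intro!: ext simp: cinner_app_adj)
      (metis cinner_app_adj cinner_commute)
qed
end


section \<open>Direct sums and tensor products of operators\<close>

definition slice :: "('x \<times> 'i) ell2 \<Rightarrow> 'x \<Rightarrow> 'i ell2" where
  "slice v x = Abs_ell2 (\<lambda>i. coord v (x, i))"

lemma coord_slice: "coord (slice v x) i = coord v (x, i)"
  and sum_norm_slice: "finite X \<Longrightarrow> (\<Sum>x\<in>X. (norm (slice v x))\<^sup>2) \<le> (norm v)\<^sup>2"
proof -
  have s: "(\<lambda>p. (cmod (coord v p))\<^sup>2) summable_on UNIV"
    using sq_summable_coord[of v] by (simp add: sq_summable_def)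
  have sX: "(\<lambda>p. (cmod (coord v p))\<^sup>2) summable_on (X \<times> UNIV)" for X
    by (rule summable_on_subset_banach[OF s]) simp
  have sq: "sq_summable (\<lambda>i. coord v (x, i))" for x
    unfolding sq_summable_def
    using summable_on_SigmaD1[of "\<lambda>a b. (cmod (coord v (a, b)))\<^sup>2" UNIV "\<lambda>_. UNIV" x] s
    by (simp add: case_prod_unfold)
  show c: "coord (slice v x) i = coord v (x, i)" for x i
    by (simp add: slice_def coord_Abs sq)
  show "(\<Sum>x\<in>X. (norm (slice v x))\<^sup>2) \<le> (norm v)\<^sup>2" if "finite X"
  proof -
    have "(\<Sum>x\<in>X. (norm (slice v x))\<^sup>2) = (\<Sum>\<^sub>\<infinity>x\<in>X. \<Sum>\<^sub>\<infinity>i. (cmod (coord v (x, i)))\<^sup>2)"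
      using that by (simp add: norm_ell2_sq c)
    also have "\<dots> = (\<Sum>\<^sub>\<infinity>p\<in>X \<times> UNIV. (cmod (coord v p))\<^sup>2)"
      using infsum_Sigma'_banach[of "\<lambda>a b. (cmod (coord v (a, b)))\<^sup>2" X "\<lambda>_. UNIV"] sX[of X]
      by (simp add: case_prod_unfold)
    also have "\<dots> \<le> (norm v)\<^sup>2"
      unfolding norm_ell2_sq by (rule infsum_mono_neutral) (use sX s in auto)
    finally show ?thesis .
  qed
qed

text \<open>The block diagonal operator with blocks \<open>T x\<close>, provided these are uniformly bounded.\<close>

definition block_diag :: "('x \<Rightarrow> 'i cop) \<Rightarrow> ('x \<times> 'i) cop" where
  "block_diag T = mk_cop (\<lambda>v. Abs_ell2 (\<lambda>(x, i). coord (app (T x) (slice v x)) i))"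

lemma slice_add: "slice (v + w) x = slice v x + slice w x"
  and slice_scaleC: "slice (c *\<^sub>C v) x = c *\<^sub>C slice v x"
  by (rule ell2_eqI; simp add: coord_slice)+

lemma
  assumes bnd: "\<And>x. norm (T x) \<le> b"
  shows coord_block_diag: "coord (app (block_diag T) v) (x, i) = coord (app (T x) (slice v x)) i"
    and norm_block_diag: "norm (block_diag T) \<le> b"
proof -
  define g where "g v = (\<lambda>(x, i). coord (app (T x) (slice v x)) i)" for v
  have b0: "0 \<le> b" using bnd norm_ge_zero order_trans by blast
  have fin: "(\<Sum>p\<in>F. (cmod (g v p))\<^sup>2) \<le> (norm v * b)\<^sup>2" if F: "finite F" for F v
  proof -
    have "(\<Sum>p\<in>F. (cmod (g v p))\<^sup>2) \<le> (\<Sum>p\<in>fst ` F \<times> snd ` F. (cmod (g v p))\<^sup>2)"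
      using F by (intro sum_mono2) force+
    also have "\<dots> = (\<Sum>x\<in>fst ` F. \<Sum>i\<in>snd ` F. (cmod (coord (app (T x) (slice v x)) i))\<^sup>2)"
      by (simp add: sum.cartesian_product g_def case_prod_unfold)
    also have "\<dots> \<le> (\<Sum>x\<in>fst ` F. (b * norm (slice v x))\<^sup>2)"
    proof (intro sum_mono)
      fix x
      have "(\<Sum>i\<in>snd ` F. (cmod (coord (app (T x) (slice v x)) i))\<^sup>2) \<le> (norm (app (T x) (slice v x)))\<^sup>2"
        using F by (intro norm_ell2_finite_sum) simp
      also have "\<dots> \<le> (b * norm (slice v x))\<^sup>2"
        by (intro power_mono order_trans[OF norm_app] mult_right_mono bnd) simp_all
      finally show "(\<Sum>i\<in>snd ` F. (cmod (coord (app (T x) (slice v x)) i))\<^sup>2) \<le> (b * norm (slice v x))\<^sup>2" .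
    qed
    also have "\<dots> = b\<^sup>2 * (\<Sum>x\<in>fst ` F. (norm (slice v x))\<^sup>2)"
      by (simp add: power_mult_distrib sum_distrib_left)
    also have "\<dots> \<le> b\<^sup>2 * (norm v)\<^sup>2"
      using F by (intro mult_left_mono sum_norm_slice) simp_all
    finally show ?thesis by (simp add: power_mult_distrib mult.commute)
  qed
  have nn: "0 \<le> norm v * b" for v :: "('a \<times> 'b) ell2" using b0 by simp
  have sq: "sq_summable (g v)" for v by (rule norm_ell2_bound(1)[OF fin nn])
  have lin: "Abs_ell2 (g (v + w)) = Abs_ell2 (g v) + Abs_ell2 (g w)"
    "Abs_ell2 (g (c *\<^sub>C v)) = c *\<^sub>C Abs_ell2 (g v)" for v w c
    by (auto intro!: ell2_eqI simp: coord_Abs sq)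
      (auto simp: g_def slice_add slice_scaleC)
  have bd: "norm (Abs_ell2 (g v)) \<le> norm v * b" for v by (rule norm_ell2_bound(2)[OF fin nn])
  have "app (block_diag T) v = Abs_ell2 (g v)"
    unfolding block_diag_def g_def[symmetric] by (rule app_mk_cop[OF lin bd])
  thus "coord (app (block_diag T) v) (x, i) = coord (app (T x) (slice v x)) i"
    by (simp add: coord_Abs sq) (simp add: g_def)
  show "norm (block_diag T) \<le> b"
    unfolding block_diag_def g_def[symmetric] by (rule norm_mk_cop[OF lin bd b0])
qed

definition swap_ell2 :: "('i \<times> 'j) ell2 \<Rightarrow> ('j \<times> 'i) ell2" where
  "swap_ell2 v = Abs_ell2 (\<lambda>(j, i). coord v (i, j))"

lemma coord_swap: "coord (swap_ell2 v) (j, i) = coord v (i, j)"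
  and norm_swap: "norm (swap_ell2 v) = norm v"
proof -
  have 1: "(\<lambda>p. (cmod (coord v (prod.swap p)))\<^sup>2) summable_on UNIV"
    using summable_on_reindex_bij_betw[OF bij_swap, of "\<lambda>p. (cmod (coord v p))\<^sup>2"]
      sq_summable_coord[of v] by (simp add: sq_summable_def)
  have e: "(\<lambda>(j, i). coord v (i, j)) = (\<lambda>p. coord v (prod.swap p))" by auto
  have sq: "sq_summable (\<lambda>(j, i). coord v (i, j))" using 1 unfolding e sq_summable_def .
  show c: "coord (swap_ell2 v) (j, i) = coord v (i, j)" for j i
    by (simp add: swap_ell2_def coord_Abs sq)
  have "(norm (swap_ell2 v))\<^sup>2 = (\<Sum>\<^sub>\<infinity>p. (cmod (coord v (prod.swap p)))\<^sup>2)"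
    unfolding norm_ell2_sq by (rule infsum_cong) (metis c prod.swap_def surjective_pairing)
  also have "\<dots> = (norm v)\<^sup>2"
    using infsum_reindex_bij_betw[OF bij_swap, of "\<lambda>p. (cmod (coord v p))\<^sup>2"] by (simp add: norm_ell2_sq)
  finally show "norm (swap_ell2 v) = norm v" by (simp add: power2_eq_iff_nonneg)
qed

definition tensor_op :: "'i cop \<Rightarrow> 'j cop \<Rightarrow> ('i \<times> 'j) cop" (infixr "\<otimes>\<^sub>o" 72) where
  "S \<otimes>\<^sub>o T = mk_cop (\<lambda>v. swap_ell2 (app (block_diag (\<lambda>_. S)) (swap_ell2 v))) * block_diag (\<lambda>_. T)"

lemma swap_add: "swap_ell2 (v + w) = swap_ell2 v + swap_ell2 w"
  and swap_scaleC: "swap_ell2 (c *\<^sub>C v) = c *\<^sub>C swap_ell2 v"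
  by (auto intro!: ell2_eqI simp: coord_swap)

lemma app_tensor_op_swap:
  "app (S \<otimes>\<^sub>o T) v =
    swap_ell2 (app (block_diag (\<lambda>_. S)) (swap_ell2 (app (block_diag (\<lambda>_. T)) v)))"
proof -
  have "app (mk_cop (\<lambda>v. swap_ell2 (app (block_diag (\<lambda>_. S)) (swap_ell2 v)))) w =
      swap_ell2 (app (block_diag (\<lambda>_. S)) (swap_ell2 w))" for w :: "('a \<times> 'b) ell2"
  proof (rule app_mk_cop[where b = "norm S"])
    fix v :: "('a \<times> 'b) ell2"
    have "norm (app (block_diag (\<lambda>_. S)) (swap_ell2 v)) \<le> norm (block_diag (\<lambda>_ :: 'b. S)) * norm v"
      using norm_app[of "block_diag (\<lambda>_. S)" "swap_ell2 v"] by (simp add: norm_swap)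
    also have "\<dots> \<le> norm S * norm v" by (intro mult_right_mono norm_block_diag) auto
    finally show "norm (swap_ell2 (app (block_diag (\<lambda>_. S)) (swap_ell2 v))) \<le> norm v * norm S"
      by (simp add: norm_swap mult.commute)
  qed (simp_all add: swap_add swap_scaleC)
  thus ?thesis by (simp add: tensor_op_def)
qed

text \<open>The defining property of \<open>S \<otimes>\<^sub>o T\<close>.\<close>

definition tensor_vec :: "'i ell2 \<Rightarrow> 'j ell2 \<Rightarrow> ('i \<times> 'j) ell2" where
  "tensor_vec v w = Abs_ell2 (\<lambda>(i, j). coord v i * coord w j)"

lemma coord_tensor_vec: "coord (tensor_vec v w) (i, j) = coord v i * coord w j"
proof -
  have "(\<lambda>(i, j). (cmod (coord v i))\<^sup>2 * (cmod (coord w j))\<^sup>2) summable_on (UNIV \<times> UNIV)"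
    by (rule summable_on_SigmaI[where g = "\<lambda>i. (cmod (coord v i))\<^sup>2 * (norm w)\<^sup>2"])
      (use sq_summable_coord[of v] sq_summable_coord[of w] in
        \<open>auto simp: sq_summable_def norm_ell2_sq intro!: has_sum_cmult_right summable_on_cmult_left\<close>)
  hence "sq_summable (\<lambda>(i, j). coord v i * coord w j)"
    by (simp add: sq_summable_def norm_mult power_mult_distrib case_prod_unfold)
  thus ?thesis by (simp add: tensor_vec_def coord_Abs)
qed

lemma slice_tensor_vec: "slice (tensor_vec v w) i = coord v i *\<^sub>C w"
  by (rule ell2_eqI) (simp add: coord_slice coord_tensor_vec)

lemma swap_tensor_vec: "swap_ell2 (tensor_vec v w) = tensor_vec w v"
  by (rule ell2_eqI) (auto simp: coord_swap coord_tensor_vec)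

lemma block_diag_const_tensor_vec:
  "app (block_diag (\<lambda>_. T)) (tensor_vec v w) = tensor_vec v (app T w)"
  by (rule ell2_eqI) (auto simp: coord_block_diag[OF order_refl] slice_tensor_vec coord_tensor_vec)

lemma app_tensor_op: "app (S \<otimes>\<^sub>o T) (tensor_vec v w) = tensor_vec (app S v) (app T w)"
  by (simp add: app_tensor_op_swap swap_tensor_vec block_diag_const_tensor_vec)


section \<open>Concrete \<open>C\<^sup>*\<close>-algebras\<close>

definition star_subalgebra :: "'a :: star_algebra set \<Rightarrow> bool" where
  "star_subalgebra E \<longleftrightarrow> 0 \<in> E \<and> (\<forall>x\<in>E. \<forall>y\<in>E. x + y \<in> E \<and> x * y \<in> E) \<and>
    (\<forall>x\<in>E. adj x \<in> E \<and> (\<forall>c. c *\<^sub>C x \<in> E))"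

definition cstar_generated :: "'i cop set \<Rightarrow> 'i cop set" where
  "cstar_generated G = (\<lambda>E. star_subalgebra E \<and> closed E) hull G"

text \<open>A bijective \<open>*\<close>-homomorphism between \<open>C\<^sup>*\<close>-algebras is automatically isometric, so the
  condition on the norm is no restriction.\<close>

definition cstar_isomorphism :: "'i cop set \<Rightarrow> 'j cop set \<Rightarrow> ('i cop \<Rightarrow> 'j cop) \<Rightarrow> bool" where
  "cstar_isomorphism E F \<Phi> \<longleftrightarrow> bij_betw \<Phi> E F \<and>
    (\<forall>x\<in>E. \<forall>y\<in>E. \<Phi> (x + y) = \<Phi> x + \<Phi> y \<and> \<Phi> (x * y) = \<Phi> x * \<Phi> y) \<and>
    (\<forall>x\<in>E. \<Phi> (adj x) = adj (\<Phi> x) \<and> norm (\<Phi> x) = norm x \<and> (\<forall>c. \<Phi> (c *\<^sub>C x) = c *\<^sub>C \<Phi> x))"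

text \<open>
  The spatial tensor product. It is only used with \<open>E\<close>, \<open>F\<close> complex subspaces, so that the real
  span is the complex one, and with \<open>F\<close> the compacts or the diagonal compacts; these are nuclear,
  so this is the only \<open>C\<^sup>*\<close>-tensor product.
\<close>

definition cstar_tensor :: "'i cop set \<Rightarrow> 'j cop set \<Rightarrow> ('i \<times> 'j) cop set" (infixr "\<otimes>\<^sub>*" 72) where
  "E \<otimes>\<^sub>* F = closure (span {S \<otimes>\<^sub>o T | S T. S \<in> E \<and> T \<in> F})"

text \<open>
  The idealizer, which is the multiplier algebra of \<open>E\<close> when \<open>E\<close> acts nondegenerately. It is used
  for \<open>\<D>\<^sub>A \<otimes> \<C>\<close>, which contains the operators \<open>1 \<otimes> e\<^sub>i\<^sub>i\<close>.
\<close>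

definition multipliers :: "'i cop set \<Rightarrow> 'i cop set" where
  "multipliers E = {T. \<forall>S\<in>E. T * S \<in> E \<and> S * T \<in> E}"

definition compacts :: "nat cop set" where
  "compacts = {T. compact (closure (app T ` cball 0 1))}"

definition diagonal_compacts :: "nat cop set" where
  "diagonal_compacts = {T \<in> compacts. \<forall>i j. i \<noteq> j \<longrightarrow> coord (app T (ket j)) i = 0}"

definition rank_one_proj :: "nat cop" where
  "rank_one_proj = mk_cop (\<lambda>v. coord v 0 *\<^sub>C ket 0)"

definition Ad :: "'i cop \<Rightarrow> 'i cop \<Rightarrow> 'i cop" where
  "Ad u x = u * x * adj u"

text \<open>
  A representation of \<open>\<real> / \<int>\<close>, as a 1-periodic one of \<open>\<real>\<close>, by unitaries in \<open>M(E)\<close>, continuous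
  in the strict topology (continuity of \<open>t \<mapsto> S * u t\<close> follows by taking adjoints).
\<close>

definition circle_unitary_rep :: "'i cop set \<Rightarrow> (real \<Rightarrow> 'i cop) \<Rightarrow> bool" where
  "circle_unitary_rep E u \<longleftrightarrow>
    (\<forall>t. u t \<in> multipliers E \<and> adj (u t) * u t = 1 \<and> u t * adj (u t) = 1) \<and>
    (\<forall>s t. u (s + t) = u s * u t) \<and> u 1 = 1 \<and>
    (\<forall>S\<in>E. continuous_on UNIV (\<lambda>t. u t * S))"

text \<open>\<open>\<alpha> \<otimes> id\<close> on \<open>E \<otimes> \<K>\<close>, for an automorphism \<open>\<alpha>\<close> of \<open>E\<close>.\<close>

definition stabilize :: "'i cop set \<Rightarrow> ('i cop \<Rightarrow> 'i cop) \<Rightarrow> ('i \<times> nat) cop \<Rightarrow> ('i \<times> nat) cop" where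
  "stabilize E \<alpha> = (THE \<beta>. \<beta> \<in> extensional (E \<otimes>\<^sub>* compacts) \<and>
    cstar_isomorphism (E \<otimes>\<^sub>* compacts) (E \<otimes>\<^sub>* compacts) \<beta> \<and>
    (\<forall>S\<in>E. \<forall>T\<in>compacts. \<beta> (S \<otimes>\<^sub>o T) = \<alpha> S \<otimes>\<^sub>o T))"


section \<open>\<open>K\<^sub>0\<close>\<close>

text \<open>The unitization \<open>\<complex> \<oplus> A\<close>; a new unit is adjoined even if \<open>A\<close> has one.\<close>

datatype 'a unitization = Unitz (scalar_part: complex) (alg_part: 'a)

instantiation unitization :: (star_algebra) star_algebra
begin
definition "0 = Unitz 0 0"
definition "x + y = Unitz (scalar_part x + scalar_part y) (alg_part x + alg_part y)"
definition "- x = Unitz (- scalar_part x) (- alg_part x)"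
definition "x - y = Unitz (scalar_part x - scalar_part y) (alg_part x - alg_part y)"
definition "x * y = Unitz (scalar_part x * scalar_part y)
  (scalar_part x *\<^sub>C alg_part y + scalar_part y *\<^sub>C alg_part x + alg_part x * alg_part y)"
definition "c *\<^sub>C x = Unitz (c * scalar_part x) (c *\<^sub>C alg_part x)"
definition "adj x = Unitz (cnj (scalar_part x)) (adj (alg_part x))"
instance
  by standard
    (simp_all add: zero_unitization_def plus_unitization_def uminus_unitization_def
      minus_unitization_def times_unitization_def scaleC_unitization_def adj_unitization_def
      algebra_simps scaleC_add_right scaleC_add_left scaleC_scaleC scaleC_one mult_scaleC_left
      mult_scaleC_right adj_adj adj_add adj_mult adj_scaleC)
end

definition unitize :: "'a set \<Rightarrow> 'a unitization set" where
  "unitize E = {Unitz c x | c x. x \<in> E}"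

text \<open>\<open>M\<^sub>\<infinity>(R) = \<Union>\<^sub>n M\<^sub>n(R)\<close>, as finitely supported infinite matrices.\<close>

definition Minf :: "'a :: zero set \<Rightarrow> (nat \<Rightarrow> nat \<Rightarrow> 'a) set" where
  "Minf R = {P. (\<forall>i j. P i j \<in> R) \<and> finite {(i, j). P i j \<noteq> 0}}"

definition minf_mult :: "(nat \<Rightarrow> nat \<Rightarrow> 'a :: ring) \<Rightarrow> (nat \<Rightarrow> nat \<Rightarrow> 'a) \<Rightarrow> nat \<Rightarrow> nat \<Rightarrow> 'a" where
  "minf_mult P Q i j = (\<Sum>k | P i k \<noteq> 0. P i k * Q k j)"

definition minf_adj :: "(nat \<Rightarrow> nat \<Rightarrow> 'a :: star_algebra) \<Rightarrow> nat \<Rightarrow> nat \<Rightarrow> 'a" where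
  "minf_adj P i j = adj (P j i)"

text \<open>
  The orthogonal sum with \<open>P\<close> placed at the even and \<open>Q\<close> at the odd indices. Up to Murray-von
  Neumann equivalence this is the block diagonal matrix \<open>diag(P, Q)\<close>.
\<close>

definition minf_oplus :: "(nat \<Rightarrow> nat \<Rightarrow> 'a :: zero) \<Rightarrow> (nat \<Rightarrow> nat \<Rightarrow> 'a) \<Rightarrow> nat \<Rightarrow> nat \<Rightarrow> 'a"
    (infixr "\<oplus>\<^sub>m" 65) where
  "(P \<oplus>\<^sub>m Q) i j =
    (if even i \<and> even j then P (i div 2) (j div 2)
     else if odd i \<and> odd j then Q (i div 2) (j div 2) else 0)"

definition minf_projs :: "'a :: star_algebra set \<Rightarrow> (nat \<Rightarrow> nat \<Rightarrow> 'a) set" where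
  "minf_projs R = {P \<in> Minf R. minf_mult P P = P \<and> minf_adj P = P}"

definition murray_von_neumann ::
    "'a :: star_algebra set \<Rightarrow> (nat \<Rightarrow> nat \<Rightarrow> 'a) \<Rightarrow> (nat \<Rightarrow> nat \<Rightarrow> 'a) \<Rightarrow> bool" where
  "murray_von_neumann R P Q \<longleftrightarrow>
    (\<exists>V\<in>Minf R. minf_mult (minf_adj V) V = P \<and> minf_mult V (minf_adj V) = Q)"

type_synonym 'a proj_pair = "(nat \<Rightarrow> nat \<Rightarrow> 'a) \<times> (nat \<Rightarrow> nat \<Rightarrow> 'a)"

text \<open>
  The Grothendieck group of the Murray-von Neumann classes of projections in \<open>M\<^sub>\<infinity>(R)\<close>; the
  class of the pair \<open>(P, Q)\<close> is the formal difference \<open>[P] - [Q]\<close>.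
\<close>

definition K00_rel :: "'a :: star_algebra set \<Rightarrow> 'a proj_pair rel" where
  "K00_rel R = {((P, Q), (P', Q')).
    {P, Q, P', Q'} \<subseteq> minf_projs R \<and>
    (\<exists>S\<in>minf_projs R. murray_von_neumann R (P \<oplus>\<^sub>m Q' \<oplus>\<^sub>m S) (P' \<oplus>\<^sub>m Q \<oplus>\<^sub>m S))}"

definition K00 :: "'a :: star_algebra set \<Rightarrow> 'a proj_pair set monoid" where
  "K00 R = \<lparr>carrier = (minf_projs R \<times> minf_projs R) // K00_rel R,
    mult = (\<lambda>X Y. \<Union>(P, Q)\<in>X. \<Union>(P', Q')\<in>Y. K00_rel R `` {(P \<oplus>\<^sub>m P', Q \<oplus>\<^sub>m Q')}),
    one = K00_rel R `` {(\<lambda>_ _. 0, \<lambda>_ _. 0)}\<rparr>"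

definition K00_map :: "'b :: star_algebra set \<Rightarrow> ('a \<Rightarrow> 'b) \<Rightarrow> 'a proj_pair set \<Rightarrow> 'b proj_pair set" where
  "K00_map R' \<phi> X = (\<Union>(P, Q)\<in>X. K00_rel R' `` {(\<lambda>i j. \<phi> (P i j), \<lambda>i j. \<phi> (Q i j))})"

text \<open>
  \<open>K\<^sub>0(E)\<close> is the kernel of the map \<open>K\<^sub>0(\<complex> \<oplus> E) \<rightarrow> K\<^sub>0(\<complex>)\<close> induced by the projection onto
  the scalars.
\<close>

definition K0 :: "'a :: star_algebra set \<Rightarrow> 'a unitization proj_pair set monoid" where
  "K0 E = (K00 (unitize E))\<lparr>carrier :=
    kernel (K00 (unitize E)) (K00 (UNIV :: complex set)) (K00_map UNIV scalar_part)\<rparr>"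

definition K0_map :: "'b :: star_algebra set \<Rightarrow> ('a \<Rightarrow> 'b) \<Rightarrow>
    'a unitization proj_pair set \<Rightarrow> 'b unitization proj_pair set" where
  "K0_map F \<phi> = K00_map (unitize F) (map_unitization \<phi>)"

definition K0_class :: "'a :: star_algebra set \<Rightarrow> 'a \<Rightarrow> 'a unitization proj_pair set" where
  "K0_class E p = K00_rel (unitize E) ``
    {(\<lambda>i j. if i = 0 \<and> j = 0 then Unitz 0 p else 0, \<lambda>_ _. 0)}"

text \<open>The homomorphism \<open>K\<^sub>0(E) \<rightarrow> K\<^sub>0(E \<otimes> \<K>)\<close> induced by \<open>a \<mapsto> a \<otimes> p\<^sub>1\<close>, and the map
  \<open>K\<^sub>0(E) \<rightarrow> K\<^sub>0(F)\<close> that \<open>\<Phi> : E \<otimes> \<K> \<rightarrow> F \<otimes> \<K>\<close> induces under these identifications.\<close>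

definition K0_stab :: "'i cop set \<Rightarrow>
    'i cop unitization proj_pair set \<Rightarrow> ('i \<times> nat) cop unitization proj_pair set" where
  "K0_stab E = K0_map (E \<otimes>\<^sub>* compacts) (\<lambda>S. S \<otimes>\<^sub>o rank_one_proj)"

definition K0_induced :: "'i cop set \<Rightarrow> 'j cop set \<Rightarrow> (('i \<times> nat) cop \<Rightarrow> ('j \<times> nat) cop) \<Rightarrow>
    'i cop unitization proj_pair set \<Rightarrow> 'j cop unitization proj_pair set" where
  "K0_induced E F \<Phi> =
    the_inv_into (carrier (K0 F)) (K0_stab F) \<circ> K0_map (F \<otimes>\<^sub>* compacts) \<Phi> \<circ> K0_stab E"


section \<open>Matrices, graphs and path spaces\<close>

definition irreducible_matrix :: "nat ^ 'n ^ 'n \<Rightarrow> bool" where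
  "irreducible_matrix A \<longleftrightarrow> (\<forall>i j. \<exists>n\<ge>1. (((\<lambda>X. A ** X) ^^ n) (mat 1)) $ i $ j > 0)"

definition permutation_matrix :: "nat ^ 'n ^ 'n \<Rightarrow> bool" where
  "permutation_matrix A \<longleftrightarrow> (\<exists>p. bij p \<and> A = (\<chi> i j. if j = p i then 1 else 0))"

text \<open>For a rectangular matrix the edges go from row indices to column indices.\<close>

type_synonym ('n, 'm) edge = "'n \<times> 'm \<times> nat"

definition edges :: "nat ^ 'm ^ 'n \<Rightarrow> ('n, 'm) edge set" where
  "edges A = {(i, j, l). l < A $ i $ j}"

definition src :: "('n, 'm) edge \<Rightarrow> 'n" where "src a = fst a"

definition tgt :: "('n, 'm) edge \<Rightarrow> 'm" where "tgt a = fst (snd a)"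

text \<open>For \<open>A = C D\<close>: a source and target preserving bijection from the edges of \<open>A\<close> onto the
  composable pairs \<open>cd\<close>.\<close>

definition edge_splitting :: "nat ^ 'n ^ 'n \<Rightarrow> nat ^ 'm ^ 'n \<Rightarrow> nat ^ 'n ^ 'm \<Rightarrow>
    (('n, 'n) edge \<Rightarrow> ('n, 'm) edge \<times> ('m, 'n) edge) \<Rightarrow> bool" where
  "edge_splitting A C D \<kappa> \<longleftrightarrow>
    bij_betw \<kappa> (edges A) {(c, d). c \<in> edges C \<and> d \<in> edges D \<and> tgt c = src d} \<and>
    (\<forall>a\<in>edges A. src (fst (\<kappa> a)) = src a \<and> tgt (snd (\<kappa> a)) = tgt a)"

definition path_space :: "nat ^ 'n ^ 'n \<Rightarrow> (nat \<Rightarrow> ('n, 'n) edge) set" where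
  "path_space A = {x. \<forall>n. x n \<in> edges A \<and> tgt (x n) = src (x (Suc n))}"

definition path_topology :: "nat ^ 'n ^ 'n \<Rightarrow> (nat \<Rightarrow> ('n, 'n) edge) topology" where
  "path_topology A =
    subtopology (product_topology (\<lambda>_. discrete_topology UNIV) UNIV) (path_space A)"

definition finite_paths :: "nat ^ 'n ^ 'n \<Rightarrow> ('n, 'n) edge list set" where
  "finite_paths A = {\<mu>. \<mu> \<noteq> [] \<and> set \<mu> \<subseteq> edges A \<and>
    (\<forall>k. Suc k < length \<mu> \<longrightarrow> tgt (\<mu> ! k) = src (\<mu> ! Suc k))}"

definition cylinder :: "nat ^ 'n ^ 'n \<Rightarrow> ('n, 'n) edge list \<Rightarrow> (nat \<Rightarrow> ('n, 'n) edge) set" where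
  "cylinder A \<mu> = {x \<in> path_space A. \<forall>k < length \<mu>. x k = \<mu> ! k}"

definition C_int :: "nat ^ 'n ^ 'n \<Rightarrow> ((nat \<Rightarrow> ('n, 'n) edge) \<Rightarrow> int) set" where
  "C_int A = {f. continuous_map (path_topology A) (discrete_topology UNIV) f}"

definition C_complex :: "nat ^ 'n ^ 'n \<Rightarrow> ((nat \<Rightarrow> ('n, 'n) edge) \<Rightarrow> complex) set" where
  "C_complex A = {g \<in> extensional (path_space A). continuous_map (path_topology A) euclidean g}"

text \<open>
  The map \<open>\<phi>\<close>: if the \<open>n\<close>-th edge of \<open>y\<close> is \<open>d\<^sub>n c\<^sub>n\<close>, then \<open>f\<close> is evaluated at the path with
  \<open>n\<close>-th edge \<open>c\<^sub>n d\<^sub>n\<^sub>+\<^sub>1\<close>.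
\<close>

definition shift_map :: "nat ^ 'n ^ 'n \<Rightarrow>
    (('n, 'n) edge \<Rightarrow> ('n, 'm) edge \<times> ('m, 'n) edge) \<Rightarrow>
    (('m, 'm) edge \<Rightarrow> ('m, 'n) edge \<times> ('n, 'm) edge) \<Rightarrow>
    ((nat \<Rightarrow> ('n, 'n) edge) \<Rightarrow> int) \<Rightarrow> (nat \<Rightarrow> ('m, 'm) edge) \<Rightarrow> int" where
  "shift_map A \<kappa>\<^sub>A \<kappa>\<^sub>B f y =
    f (\<lambda>n. the_inv_into (edges A) \<kappa>\<^sub>A (snd (\<kappa>\<^sub>B (y n)), fst (\<kappa>\<^sub>B (y (Suc n)))))"


section \<open>Cuntz-Krieger algebras\<close>

definition ck_family :: "nat ^ 'n ^ 'n \<Rightarrow> (('n, 'n) edge \<Rightarrow> 'i cop) \<Rightarrow> bool" where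
  "ck_family A S \<longleftrightarrow>
    (\<forall>a\<in>edges A. S a * adj (S a) * S a = S a) \<and>
    (\<Sum>b\<in>edges A. S b * adj (S b)) = 1 \<and>
    (\<forall>a\<in>edges A. adj (S a) * S a = (\<Sum>b | b \<in> edges A \<and> src b = tgt a. S b * adj (S b)))"

text \<open>
  The universal family: the direct sum of all Cuntz-Krieger families on \<open>\<ell>\<^sup>2(\<nat>)\<close>. A \<open>C\<^sup>*\<close>-algebra
  generated by such a family is separable, hence faithfully represented on \<open>\<ell>\<^sup>2(\<nat>)\<close>, so the norm
  this induces on polynomials in the generators is the supremum over all families in all
  \<open>C\<^sup>*\<close>-algebras, and the algebra generated is the universal one. A summand whose index is not a
  Cuntz-Krieger family is replaced by one that is, to make the direct sum of the units the
  identity operator.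
\<close>

type_synonym 'n ck_index = "(('n, 'n) edge \<Rightarrow> nat cop) \<times> nat"

definition ck_gen :: "nat ^ 'n ^ 'n \<Rightarrow> ('n, 'n) edge \<Rightarrow> 'n ck_index cop" where
  "ck_gen A a = block_diag (\<lambda>S. (if ck_family A S then S else (SOME S'. ck_family A S')) a)"

lemma slice_block_diag:
  assumes "\<And>x. norm (T x) \<le> b"
  shows "slice (app (block_diag T) v) x = app (T x) (slice v x)"
  by (rule ell2_eqI) (simp add: coord_slice coord_block_diag[OF assms])

lemma slice_eqI: "(\<And>x. slice v x = slice w x) \<Longrightarrow> v = w"
  by (rule ell2_eqI) (metis coord_slice surj_pair)

lemma slice_simps [simp]: "slice 0 x = 0" "slice (v + w) x = slice v x + slice w x"
  by (rule ell2_eqI; simp add: coord_slice)+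

lemma block_diag_one: "block_diag (\<lambda>_. 1) = 1"
  by (intro cop_eqI slice_eqI) (simp add: slice_block_diag[where b = 1])

lemma block_diag_mult:
  assumes S: "\<And>x. norm (S x) \<le> a" and T: "\<And>x. norm (T x) \<le> b"
  shows "block_diag S * block_diag T = block_diag (\<lambda>x. S x * T x)"
proof -
  have "0 \<le> a" using S norm_ge_zero order_trans by blast
  hence *: "norm (S x * T x) \<le> a * b" for x
    by (intro order_trans[OF norm_mult_ineq] mult_mono S T) simp_all
  show ?thesis
    by (intro cop_eqI slice_eqI)
      (simp add: slice_block_diag[of S, OF S] slice_block_diag[of T, OF T] slice_block_diag[OF *])
qed

lemma block_diag_sum:
  fixes T :: "'a \<Rightarrow> 'b \<Rightarrow> 'c cop"
  assumes T: "\<And>a x. a \<in> F \<Longrightarrow> norm (T a x) \<le> b" and F: "finite F"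
  shows "(\<Sum>a\<in>F. block_diag (T a)) = block_diag (\<lambda>x. \<Sum>a\<in>F. T a x)"
proof -
  have *: "norm (\<Sum>a\<in>F. T a x) \<le> (\<Sum>a\<in>F. b)" for x
    by (rule sum_norm_le) (rule T)
  have 1: "app (\<Sum>a\<in>G. U a) v = (\<Sum>a\<in>G. app (U a) v)" for G and U :: "'a \<Rightarrow> ('b \<times> 'c) cop" and v
    by (induction G rule: infinite_finite_induct) auto
  have 2: "slice (\<Sum>a\<in>G. u a) x = (\<Sum>a\<in>G. slice (u a) x)"
    for G and u :: "'a \<Rightarrow> ('b \<times> 'c) ell2" and x
    by (induction G rule: infinite_finite_induct) auto
  have 3: "app (\<Sum>a\<in>G. U a) v = (\<Sum>a\<in>G. app (U a) v)" for G and U :: "'a \<Rightarrow> 'c cop" and v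
    by (induction G rule: infinite_finite_induct) auto
  have "slice (app (\<Sum>a\<in>F. block_diag (T a)) v) x = app (\<Sum>a\<in>F. T a x) (slice v x)" for v x
    by (simp add: 1 2 3 slice_block_diag[OF T])
  thus ?thesis
    by (intro cop_eqI slice_eqI) (simp add: slice_block_diag[of "\<lambda>x. \<Sum>a\<in>F. T a x", OF *])
qed

lemma norm_adj: "norm (adj T) = norm (T :: 'i cop)"
proof -
  have "norm (adj T) \<le> norm T" for T :: "'i cop"
    unfolding adj_cop_def
    by (rule norm_mk_cop)
      (auto intro!: cinner_eqI adj_exists(1) simp: adj_exists(2) cinner_add_left cinner_scaleC_left)
  from this[of T] this[of "adj T"] show ?thesis by (simp add: adj_adj)
qed

lemma adj_block_diag:
  fixes T :: "'x \<Rightarrow> 'i cop"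
  assumes T: "\<And>x. norm (T x) \<le> b"
  shows "adj (block_diag T) = block_diag (\<lambda>x. adj (T x))"
proof (rule cop_eqI, rule ell2_eqI)
  have T': "norm (adj (T x)) \<le> b" for x by (simp add: norm_adj T)
  fix v and p :: "'x \<times> 'i"
  obtain x i where p: "p = (x, i)" by fastforce
  have k: "app (block_diag T) (ket (x, i)) = tensor_vec (ket x) (app (T x) (ket i))"
  proof (rule slice_eqI)
    fix y
    have "slice (ket (x, i)) y = (if y = x then ket i else 0)"
      by (rule ell2_eqI) (auto simp: coord_slice coord_ket)
    thus "slice (app (block_diag T) (ket (x, i))) y = slice (tensor_vec (ket x) (app (T x) (ket i))) y"
      by (auto intro!: ell2_eqI simp: slice_block_diag[OF T] slice_tensor_vec coord_ket
          linear_0[OF bounded_linear.linear[OF bounded_linear_app]])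
  qed
  have "coord (app (adj (block_diag T)) v) p = cinner (app (block_diag T) (ket p)) v"
    by (metis adj_adj cinner_app_adj cinner_ket)
  also have "\<dots> = (\<Sum>\<^sub>\<infinity>q. cnj (coord (tensor_vec (ket x) (app (T x) (ket i))) q) * coord v q)"
    by (simp add: p k cinner_def)
  also have "\<dots> = (\<Sum>\<^sub>\<infinity>q\<in>range (Pair x). cnj (coord (tensor_vec (ket x) (app (T x) (ket i))) q) * coord v q)"
    by (rule infsum_cong_neutral) (auto simp: coord_tensor_vec coord_ket image_iff)
  also have "\<dots> = cinner (app (T x) (ket i)) (slice v x)"
    by (subst infsum_reindex) (auto simp: inj_on_def cinner_def coord_tensor_vec coord_ket coord_slice o_def)
  also have "\<dots> = coord (app (adj (T x)) (slice v x)) i"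
    by (metis adj_adj cinner_app_adj cinner_ket)
  also have "\<dots> = coord (app (block_diag (\<lambda>x. adj (T x))) v) p"
    by (simp add: p coord_block_diag[OF T'])
  finally show "coord (app (adj (block_diag T)) v) p = coord (app (block_diag (\<lambda>x. adj (T x))) v) p" .
qed

lemma partial_isometry_norm_le:
  assumes "T * adj T * T = (T :: 'i cop)"
  shows "norm T \<le> 1"
proof -
  define P where "P = adj T * T"
  have P: "adj P = P" "P * P = P"
    using assms by (simp_all add: P_def adj_mult adj_adj mult.assoc)
  have *: "(norm x)\<^sup>2 = Re (cinner x x)" for x :: "'i ell2"
    by (simp add: power2_norm_eq_inner inner_ell2_def)
  have "norm (app T v) \<le> norm v" for v
  proof -
    have "(norm (app P v))\<^sup>2 = Re (cinner (app P v) v)"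
      unfolding * by (metis P cinner_app_adj app_simps(6))
    also have "\<dots> \<le> norm (app P v) * norm v"
      using norm_cinner complex_Re_le_cmod order_trans by blast
    finally have "norm (app P v) \<le> norm v"
      by (cases "app P v = 0") (simp_all add: power2_eq_square)
    have "(norm (app T v))\<^sup>2 = Re (cinner (app P v) v)"
      unfolding * P_def by (simp add: cinner_app_adj)
    also have "\<dots> \<le> norm (app P v) * norm v"
      using norm_cinner complex_Re_le_cmod order_trans by blast
    also have "\<dots> \<le> (norm v)\<^sup>2"
      using \<open>norm (app P v) \<le> norm v\<close> by (simp add: power2_eq_square mult_right_mono)
    finally show ?thesis by (rule power2_le_imp_le) simp
  qed
  thus ?thesis by (auto simp: norm_cop.rep_eq app.rep_eq intro!: norm_blinfun_bound)
qed

lemma finite_edges [simp]: "finite (edges (A :: nat ^ 'm ^ 'n))"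
proof (rule finite_subset)
  show "edges A \<subseteq> (\<Union>i. \<Union>j. {i} \<times> {j} \<times> {..< A $ i $ j})" by (auto simp: edges_def)
qed auto

lemma ck_family_ck_gen:
  fixes A :: "nat ^ 'n ^ 'n" and S\<^sub>0 :: "('n, 'n) edge \<Rightarrow> nat cop"
  assumes "ck_family A S\<^sub>0"
  shows "ck_family A (ck_gen A)"
proof -
  define r where "r S = (if ck_family A S then S else (SOME S'. ck_family A S'))"
    for S :: "('n, 'n) edge \<Rightarrow> nat cop"
  have r: "ck_family A (r S)" for S
    using someI[of "ck_family A", OF assms] by (auto simp: r_def)
  have g: "ck_gen A a = block_diag (\<lambda>S. r S a)" for a
    by (simp add: ck_gen_def r_def)
  have n: "norm (r S a) \<le> 1" "norm (adj (r S a)) \<le> 1" if "a \<in> edges A" for S a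
    using r[of S] that by (auto simp: ck_family_def norm_adj intro!: partial_isometry_norm_le)
  have n2: "norm (r S a * adj (r S a)) \<le> 1" "norm (adj (r S a) * r S a) \<le> 1" if "a \<in> edges A" for S a
    using n[OF that, of S] by (auto intro!: order_trans[OF norm_mult_ineq] mult_le_one)
  have aa: "ck_gen A a * adj (ck_gen A a) = block_diag (\<lambda>S. r S a * adj (r S a))"
    "adj (ck_gen A a) * ck_gen A a = block_diag (\<lambda>S. adj (r S a) * r S a)"
    "ck_gen A a * adj (ck_gen A a) * ck_gen A a = block_diag (\<lambda>S. r S a * adj (r S a) * r S a)"
    if a: "a \<in> edges A" for a
    by (simp_all add: g adj_block_diag[OF n(1)[OF a]] block_diag_mult[OF n(1)[OF a] n(2)[OF a]]
        block_diag_mult[OF n(2)[OF a] n(1)[OF a]] block_diag_mult[OF n2(1)[OF a] n(1)[OF a]])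
  have s: "(\<Sum>b\<in>F. ck_gen A b * adj (ck_gen A b)) = block_diag (\<lambda>S. \<Sum>b\<in>F. r S b * adj (r S b))"
    if "F \<subseteq> edges A" for F
    using that finite_subset[OF that finite_edges]
    by (subst block_diag_sum[symmetric, where b = 1]) (auto intro!: sum.cong aa n2)
  show ?thesis
    unfolding ck_family_def
  proof (intro conjI ballI)
    fix a assume a: "a \<in> edges A"
    show "ck_gen A a * adj (ck_gen A a) * ck_gen A a = ck_gen A a"
      unfolding aa(3)[OF a] using r a by (simp add: ck_family_def g)
    show "adj (ck_gen A a) * ck_gen A a =
        (\<Sum>b | b \<in> edges A \<and> src b = tgt a. ck_gen A b * adj (ck_gen A b))"
      using r a unfolding aa(2)[OF a] by (subst s) (auto simp: ck_family_def)
  next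
    show "(\<Sum>b\<in>edges A. ck_gen A b * adj (ck_gen A b)) = 1"
      using r by (subst s) (simp_all add: ck_family_def block_diag_one)
  qed
qed

definition ck_algebra :: "nat ^ 'n ^ 'n \<Rightarrow> 'n ck_index cop set" ("\<O>") where
  "\<O> A = cstar_generated (ck_gen A ` edges A)"

definition ck_proj :: "nat ^ 'n ^ 'n \<Rightarrow> ('n, 'n) edge list \<Rightarrow> 'n ck_index cop" where
  "ck_proj A \<mu> = prod_list (map (ck_gen A) \<mu>) * adj (prod_list (map (ck_gen A) \<mu>))"

definition ck_diagonal :: "nat ^ 'n ^ 'n \<Rightarrow> 'n ck_index cop set" ("\<D>") where
  "\<D> A = cstar_generated (ck_proj A ` finite_paths A)"

text \<open>The identification of \<open>C(X\<^sub>A)\<close> with \<open>\<D>\<^sub>A\<close>.\<close>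

definition diagonal_iso :: "nat ^ 'n ^ 'n \<Rightarrow> ((nat \<Rightarrow> ('n, 'n) edge) \<Rightarrow> complex) \<Rightarrow> 'n ck_index cop" where
  "diagonal_iso A = (THE \<theta>. \<theta> \<in> extensional (C_complex A) \<and> bij_betw \<theta> (C_complex A) (\<D> A) \<and>
    (\<forall>g\<in>C_complex A. \<forall>h\<in>C_complex A.
      \<theta> (\<lambda>x\<in>path_space A. g x + h x) = \<theta> g + \<theta> h \<and>
      \<theta> (\<lambda>x\<in>path_space A. g x * h x) = \<theta> g * \<theta> h) \<and>
    (\<forall>g\<in>C_complex A. \<theta> (\<lambda>x\<in>path_space A. cnj (g x)) = adj (\<theta> g) \<and>
      norm (\<theta> g) = (SUP x\<in>path_space A. cmod (g x)) \<and>
      (\<forall>c. \<theta> (\<lambda>x\<in>path_space A. c * g x) = c *\<^sub>C \<theta> g)) \<and>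
    (\<forall>\<mu>\<in>finite_paths A. \<theta> (\<lambda>x\<in>path_space A. indicator (cylinder A \<mu>) x) = ck_proj A \<mu>))"

definition U_fun :: "nat ^ 'n ^ 'n \<Rightarrow> ((nat \<Rightarrow> ('n, 'n) edge) \<Rightarrow> int) \<Rightarrow> real \<Rightarrow> 'n ck_index cop" where
  "U_fun A f t = diagonal_iso A
    (\<lambda>x\<in>path_space A. exp (2 * of_real pi * \<i> * of_real t * of_int (f x)))"

definition gauge_action :: "nat ^ 'n ^ 'n \<Rightarrow> ((nat \<Rightarrow> ('n, 'n) edge) \<Rightarrow> int) \<Rightarrow> real \<Rightarrow>
    'n ck_index cop \<Rightarrow> 'n ck_index cop" ("\<rho>") where
  "\<rho> A f t = (THE \<alpha>. \<alpha> \<in> extensional (\<O> A) \<and> cstar_isomorphism (\<O> A) (\<O> A) \<alpha> \<and>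
    (\<forall>a\<in>edges A. \<alpha> (ck_gen A a) = U_fun A f t * ck_gen A a))"


section \<open>The groups \<open>\<int>\<^sup>N / (id - A\<^sup>t) \<int>\<^sup>N\<close>\<close>

definition int_vectors :: "(int ^ 'n) monoid" where
  "int_vectors = \<lparr>carrier = UNIV, mult = (+), one = 0\<rparr>"

definition bf_image :: "nat ^ 'n ^ 'n \<Rightarrow> (int ^ 'n) set" where
  "bf_image A = range (\<lambda>x. (mat 1 - transpose (map_matrix int A)) *v x)"

definition bf_group :: "nat ^ 'n ^ 'n \<Rightarrow> (int ^ 'n) set monoid" where
  "bf_group A = int_vectors Mod bf_image A"

definition bf_class :: "nat ^ 'n ^ 'n \<Rightarrow> int ^ 'n \<Rightarrow> (int ^ 'n) set" where
  "bf_class A x = bf_image A #>\<^bsub>int_vectors\<^esub> x"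

text \<open>The map \<open>[x] \<mapsto> [C\<^sup>t x]\<close> into \<open>bf_group B\<close>.\<close>

definition bf_map :: "nat ^ 'm ^ 'm \<Rightarrow> nat ^ 'm ^ 'n \<Rightarrow> (int ^ 'n) set \<Rightarrow> (int ^ 'm) set" where
  "bf_map B C X = (\<Union>x\<in>X. bf_class B (transpose (map_matrix int C) *v x))"

definition is_epsilon :: "nat ^ 'n ^ 'n \<Rightarrow>
    ('n ck_index cop unitization proj_pair set \<Rightarrow> (int ^ 'n) set) \<Rightarrow> bool" where
  "is_epsilon A \<epsilon> \<longleftrightarrow> \<epsilon> \<in> iso (K0 (\<O> A)) (bf_group A) \<and>
    (\<forall>a\<in>edges A. \<epsilon> (K0_class (\<O> A) (ck_gen A a * adj (ck_gen A a))) = bf_class A (axis (tgt a) 1))"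

end

theory Submission
  imports Defs
begin

text \<open>
  Choose, for every vertex \<open>v\<close> of \<open>B\<close>, isometries \<open>\<tau>\<^sub>c\<close> on \<open>\<ell>\<^sup>2(\<nat>)\<close>, for the edges \<open>c\<close> of \<open>C\<close> ending
  at \<open>v\<close>, with \<open>\<Sum>\<^sub>c \<tau>\<^sub>c \<tau>\<^sub>c\<^sup>* = 1\<close>. The isomorphism is given on the generators, for \<open>a = c d\<close>, by
  \<open>S\<^sub>a \<otimes> k \<mapsto> \<Sum>\<^sub>c\<^sub>' S\<^sub>d\<^sub>c\<^sub>' \<otimes> \<tau>\<^sub>c k \<tau>\<^sub>c\<^sub>'\<^sup>*\<close>, the sum being over the edges \<open>c'\<close> of \<open>C\<close> starting at the end of \<open>d\<close>.
  Composed with the analogous map for \<open>B = D C\<close> it is the conjugation by a unitary, so it is bijective. It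
  maps \<open>S\<^sub>\<mu> S\<^sub>\<mu>\<^sup>* \<otimes> e\<^sub>i\<^sub>i\<close>, for a path \<open>\<mu> = c\<^sub>1 d\<^sub>1 \<dots> c\<^sub>n d\<^sub>n\<close>, to a sum of projections
  \<open>S\<^sub>\<nu> S\<^sub>\<nu>\<^sup>* \<otimes> e\<^sub>m\<^sub>m\<close> with \<open>\<nu> = d\<^sub>1 c\<^sub>2 \<dots> d\<^sub>n c'\<close>, hence it respects the diagonals. With
  \<open>u\<^sub>t = U\<^sub>-\<^sub>t(f) \<otimes> 1\<close> the automorphism \<open>Ad(u\<^sub>t) \<circ> (\<rho>\<^sub>t \<otimes> id)\<close> multiplies \<open>S\<^sub>a S\<^sub>\<mu> S\<^sub>\<mu>\<^sup>* \<otimes> k\<close>, for \<open>\<mu>\<close> long enough,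
  by the value of \<open>exp(2\<pi>itf)\<close> on the cylinder of \<open>\<mu>\<close>, and \<open>\<rho>\<^sub>t \<otimes> id\<close> for \<open>\<phi>(f)\<close> does the same to its image.

  For \<open>K\<^sub>0\<close>, the isomorphism \<open>\<epsilon>\<^sub>A\<close> makes every class a difference of sums of classes \<open>[S\<^sub>a S\<^sub>a\<^sup>*]\<close>. Such
  a class is sent to \<open>\<Sum>\<^sub>c\<^sub>' [S\<^sub>d\<^sub>c\<^sub>' S\<^sub>d\<^sub>c\<^sub>'\<^sup>*]\<close>, which realizes multiplication by \<open>C\<^sup>t\<close>. That
  \<open>K\<^sub>0(\<O>\<^sub>B) \<rightarrow> K\<^sub>0(\<O>\<^sub>B \<otimes> \<K>)\<close> is injective needs no stability theorem: as \<open>B\<close> is irreducible and not a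
  permutation matrix, \<open>\<O>\<^sub>B\<close> contains isometries \<open>s\<^sub>i\<close> with orthogonal ranges, and
  \<open>x \<otimes> e\<^sub>i\<^sub>j \<mapsto> s\<^sub>i x s\<^sub>j\<^sup>*\<close> induces a left inverse.
\<close>

subsection \<open>Star algebras\<close>

text \<open>\<open>ck_algebra\<close> is a concrete algebra, acting on the direct sum of all
  families on \<open>\<ell>\<^sup>2(\<nat>)\<close>, so homomorphisms out of it have to be
  constructed. What does the work of a universal property is that a family is itself the index of a
  block, and compression to this block sends the generators to the family. Compressions,
  conjugations and block sums are defined for all bounded operators. Hence the homomorphisms are
  restrictions of contractive star-linear maps, and multiplicativity becomes membership in a
  multiplicative domain. Two such maps that are inverse to each other on the algebras preserve norms
  automatically.

  With \<open>k = 1\<close> the images of the generators form a family for \<open>A\<close> on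
  \<open>H \<otimes> \<ell>\<^sup>2\<close>; the sum of its range projections is 1 only because the
  ranges of the isometries at a vertex fill \<open>\<ell>\<^sup>2(\<nat>)\<close>. The stabilization
  of this family acts on \<open>H \<otimes> \<ell>\<^sup>2 \<otimes> \<ell>\<^sup>2\<close>, which
  is one factor too many, and the partial isometry \<open>intertwiner\<close> removes it.\<close>

lemma adj_zero [simp]: "adj (0 :: 'a :: star_algebra) = 0"
  by (metis adj_add add_cancel_right_right)

lemma adj_uminus [simp]: "adj (- x :: 'a :: star_algebra) = - adj x"
  by (metis adj_add adj_zero add.right_inverse neg_eq_iff_add_eq_0)

lemma adj_diff: "adj (x - y :: 'a :: star_algebra) = adj x - adj y"
  by (metis adj_add adj_uminus add_uminus_conv_diff)

lemma adj_sum: "adj (\<Sum>i\<in>I. f i :: 'a :: star_algebra) = (\<Sum>i\<in>I. adj (f i))"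
  by (induction I rule: infinite_finite_induct) (auto simp: adj_add)

lemma scaleC_zero_right [simp]: "c *\<^sub>C (0 :: 'a :: star_algebra) = 0"
  by (metis scaleC_add_right add_cancel_right_right)

lemma scaleC_zero_left [simp]: "0 *\<^sub>C (x :: 'a :: star_algebra) = 0"
  by (metis scaleC_add_left add_cancel_right_right)

lemma scaleC_minus_one: "(- 1) *\<^sub>C (x :: 'a :: star_algebra) = - x"
proof -
  have "(-1) *\<^sub>C x + 1 *\<^sub>C x = (-1 + 1) *\<^sub>C x" by (simp only: scaleC_add_left)
  thus ?thesis by (simp add: scaleC_one eq_neg_iff_add_eq_0)
qed

lemma scaleC_sum_right: "c *\<^sub>C (\<Sum>i\<in>I. f i :: 'a :: star_algebra) = (\<Sum>i\<in>I. c *\<^sub>C f i)"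
  by (induction I rule: infinite_finite_induct) (auto simp: scaleC_add_right)

lemma adj_one [simp]: "adj (1 :: 'i cop) = 1"
  by (metis adj_adj adj_mult mult_1 mult_1_right)

lemma star_subalgebra_diff: "star_subalgebra E \<Longrightarrow> x \<in> E \<Longrightarrow> y \<in> E \<Longrightarrow> x - y \<in> E"
  unfolding star_subalgebra_def by (metis scaleC_minus_one add_uminus_conv_diff)

lemma star_subalgebra_sum:
  "star_subalgebra E \<Longrightarrow> (\<And>i. i \<in> I \<Longrightarrow> f i \<in> E) \<Longrightarrow> (\<Sum>i\<in>I. f i) \<in> E"
  by (induction I rule: infinite_finite_induct) (auto simp: star_subalgebra_def)

subsection \<open>Matrix coefficients of operators\<close>

definition mel :: "'i cop \<Rightarrow> 'i \<Rightarrow> 'i \<Rightarrow> complex" where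
  "mel X i j = coord (app X (ket j)) i"

lemma has_sum_coord_app: "((\<lambda>k. mel X i k * coord v k) has_sum coord (app X v) i) UNIV"
proof -
  have "((\<lambda>k. cinner (ket i) (app X (coord v k *\<^sub>C ket k))) has_sum cinner (ket i) (app X v)) UNIV"
    using has_sum_bounded_linear[OF bounded_linear_compose[OF bounded_linear_cinner_right
          bounded_linear_app] has_sum_ket] .
  thus ?thesis by (simp add: cinner_ket mel_def mult.commute)
qed

text \<open>The workhorse for identities between compressions, block diagonal operators and tensor
  products, which entrywise become bookkeeping of indices. It holds because
  \<open>has_sum_coord_app\<close> recovers \<open>X v\<close> from the matrix coefficients.\<close>

lemma cop_eqI_mel: "(\<And>i j. mel X i j = mel Y i j) \<Longrightarrow> X = Y"
  by (intro cop_eqI ell2_eqI) (metis (no_types, lifting) ext has_sum_coord_app has_sum_unique)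

lemma cop_eqI_ket: "(\<And>j. app X (ket j) = app Y (ket j)) \<Longrightarrow> X = Y"
  by (rule cop_eqI_mel) (simp add: mel_def)

lemma mel_zero [simp]: "mel 0 i j = 0"
  and mel_one: "mel 1 i j = (if i = j then 1 else 0)"
  and mel_add: "mel (X + Y) i j = mel X i j + mel Y i j"
  and mel_diff: "mel (X - Y) i j = mel X i j - mel Y i j"
  and mel_scaleC: "mel (c *\<^sub>C X) i j = c * mel X i j"
  and mel_scaleR: "mel (r *\<^sub>R X) i j = of_real r * mel X i j"
  by (simp_all add: mel_def coord_ket app_scaleC_cop)

lemma mel_sum: "mel (\<Sum>a\<in>I. f a) i j = (\<Sum>a\<in>I. mel (f a) i j)"
  by (induction I rule: infinite_finite_induct) (auto simp: mel_add)

lemma mel_adj: "mel (adj X) i j = cnj (mel X j i)"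
  unfolding mel_def by (metis cinner_app_adj cinner_commute cinner_ket)

lemma has_sum_mel_mult: "((\<lambda>k. mel X i k * mel Y k j) has_sum mel (X * Y) i j) UNIV"
  using has_sum_coord_app[of X i "app Y (ket j)"] by (simp add: mel_def)

lemma mel_mult: "mel (X * Y) i j = (\<Sum>\<^sub>\<infinity>k. mel X i k * mel Y k j)"
  using infsumI[OF has_sum_mel_mult[of X i Y j]] by simp

lemma norm_ket [simp]: "norm (ket i) = 1"
proof -
  have "(norm (ket i))\<^sup>2 = (1::real)"
    by (simp add: power2_norm_eq_inner inner_ell2_def cinner_ket coord_ket)
  thus ?thesis by (metis norm_ge_zero one_power2 power2_eq_iff_nonneg zero_le_one)
qed

lemma cmod_coord_le: "cmod (coord v i) \<le> norm v"
  using norm_cinner[of "ket i" v] by (simp add: cinner_ket)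

lemma cmod_mel_le: "cmod (mel X i j) \<le> norm X"
  unfolding mel_def using cmod_coord_le norm_app[of X "ket j"] by (metis mult_1_right norm_ket order_trans)

lemma norm_copI: "0 \<le> b \<Longrightarrow> (\<And>v. norm (app X v) \<le> b * norm v) \<Longrightarrow> norm (X :: 'i cop) \<le> b"
  by (auto simp: norm_cop.rep_eq app.rep_eq intro!: norm_blinfun_bound)

lemma norm_scaleC_cop [simp]: "norm (c *\<^sub>C (X :: 'i cop)) = cmod c * norm X"
proof -
  have le: "norm (c *\<^sub>C (X :: 'i cop)) \<le> cmod c * norm X" for c X
    by (rule norm_copI) (auto simp: app_scaleC_cop mult.assoc intro!: mult_left_mono norm_app)
  show ?thesis
  proof (cases "c = 0")
    case False
    have "norm X = norm (inverse c *\<^sub>C c *\<^sub>C X)" using False by (simp add: scaleC_scaleC scaleC_one)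
    also have "\<dots> \<le> inverse (cmod c) * norm (c *\<^sub>C X)" using le[of "inverse c" "c *\<^sub>C X"] by (simp add: norm_inverse)
    finally show ?thesis using le[of c X] False by (simp add: field_simps)
  qed simp
qed

lemma scaleR_eq_scaleC_cop: "r *\<^sub>R (X :: 'i cop) = of_real r *\<^sub>C X"
  by (rule cop_eqI_mel) (simp add: mel_scaleR mel_scaleC)

text \<open>Evaluated at a vector \<open>v\<close>, the sum of the \<open>adj (X i) * X i\<close> is
  the sum of the squared norms of the vectors \<open>X i v\<close>.\<close>

lemma sum_adj_mult_eq_0:
  fixes X :: "'a \<Rightarrow> 'i cop"
  assumes "finite I" "(\<Sum>i\<in>I. adj (X i) * X i) = 0" "i \<in> I"
  shows "X i = 0"
proof (rule cop_eqI)
  fix v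
  have "(norm (app (X j) v))\<^sup>2 = Re (cinner (app (adj (X j) * X j) v) v)" for j
    by (simp add: power2_norm_eq_inner inner_ell2_def cinner_app_adj)
  hence "(\<Sum>j\<in>I. (norm (app (X j) v))\<^sup>2) = (\<Sum>j\<in>I. Re (cinner (app (adj (X j) * X j) v) v))" by simp
  also have "\<dots> = Re (cinner (app (\<Sum>j\<in>I. adj (X j) * X j) v) v)"
    using assms(1) by (induction I) (simp_all add: cinner_add_left, simp add: cinner_def)
  also have "\<dots> = 0" using assms(2) by (simp add: cinner_def)
  finally have "(norm (app (X i) v))\<^sup>2 = 0"
    using assms(1,3) by (simp add: sum_nonneg_eq_0_iff)
  thus "app (X i) v = app 0 v" by simp
qed

lemma adj_mult_eq_0: "adj X * X = 0 \<Longrightarrow> (X :: 'i cop) = 0"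
  using sum_adj_mult_eq_0[of "{()}" "\<lambda>_. X"] by simp

subsection \<open>Completeness\<close>

text \<open>Completeness of \<open>\<ell>\<^sup>2\<close> gives that of the operators, where
  \<open>theta\<close> is later defined as a limit of step functions.\<close>

instance ell2 :: (type) banach
proof
  fix X :: "nat \<Rightarrow> 'a ell2" assume X: "Cauchy X"
  have "Cauchy (\<lambda>n. coord (X n) i)" for i
  proof (rule metric_CauchyI)
    fix e :: real assume "e > 0"
    then obtain M where M: "\<forall>m\<ge>M. \<forall>n\<ge>M. dist (X m) (X n) < e" using X metric_CauchyD by metis
    have "dist (coord (X m) i) (coord (X n) i) \<le> dist (X m) (X n)" for m n
      using cmod_coord_le[of "X m - X n" i] by (simp add: dist_norm)
    thus "\<exists>M. \<forall>m\<ge>M. \<forall>n\<ge>M. dist (coord (X m) i) (coord (X n) i) < e"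
      using M le_less_trans by blast
  qed
  hence "\<exists>l. (\<lambda>n. coord (X n) i) \<longlonglongrightarrow> l" for i using Cauchy_convergent convergent_def by blast
  then obtain f where f: "\<And>i. (\<lambda>n. coord (X n) i) \<longlonglongrightarrow> f i" using choice[of "\<lambda>i l. (\<lambda>n. coord (X n) i) \<longlonglongrightarrow> l"] by blast
  \<comment> \<open>For a finite sum the limit in \<open>m\<close> can be taken termwise; the bound
    is uniform in \<open>F\<close> and so becomes an estimate of the norm.\<close>
  have key: "\<exists>M. \<forall>n\<ge>M. \<forall>F :: 'a set. finite F \<longrightarrow> (\<Sum>i\<in>F. (cmod (coord (X n) i - f i))\<^sup>2) \<le> e\<^sup>2" if e: "e > 0" for e
  proof -
    obtain M where M: "\<forall>m\<ge>M. \<forall>n\<ge>M. dist (X m) (X n) < e" using X e metric_CauchyD by metis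
    show ?thesis
    proof (intro exI[of _ M] allI impI)
      fix n and F :: "'a set" assume n: "M \<le> n" and F: "finite F"
      have "(\<lambda>m. \<Sum>i\<in>F. (cmod (coord (X n) i - coord (X m) i))\<^sup>2) \<longlonglongrightarrow> (\<Sum>i\<in>F. (cmod (coord (X n) i - f i))\<^sup>2)"
        by (intro tendsto_intros f)
      moreover have "(\<Sum>i\<in>F. (cmod (coord (X n) i - coord (X m) i))\<^sup>2) \<le> e\<^sup>2" if "m \<ge> M" for m
      proof -
        have "(\<Sum>i\<in>F. (cmod (coord (X n - X m) i))\<^sup>2) \<le> (norm (X n - X m))\<^sup>2"
          using F by (rule norm_ell2_finite_sum)
        also have "\<dots> \<le> e\<^sup>2" using M n that by (intro power_mono) (auto simp: dist_norm less_imp_le)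
        finally show ?thesis by simp
      qed
      ultimately show "(\<Sum>i\<in>F. (cmod (coord (X n) i - f i))\<^sup>2) \<le> e\<^sup>2"
        by (meson LIMSEQ_le_const2)
    qed
  qed
  obtain M where M: "\<forall>F :: 'a set. finite F \<longrightarrow> (\<Sum>i\<in>F. (cmod (coord (X M) i - f i))\<^sup>2) \<le> 1\<^sup>2"
    using key[of 1] by (metis order_refl zero_less_one)
  have "sq_summable (\<lambda>i. coord (X M) i - f i)" by (rule norm_ell2_bound(1)[of _ 1]) (use M in auto)
  hence "sq_summable (\<lambda>i. coord (X M) i + (- 1) * (coord (X M) i - f i))"
    by (intro sq_summable_add sq_summable_scale) simp_all
  hence fs: "sq_summable f" by simp
  have "X \<longlonglongrightarrow> Abs_ell2 f"
  proof (rule LIMSEQ_I)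
    fix r :: real assume r: "r > 0"
    obtain M where M: "\<forall>n\<ge>M. \<forall>F :: 'a set. finite F \<longrightarrow> (\<Sum>i\<in>F. (cmod (coord (X n) i - f i))\<^sup>2) \<le> (r/2)\<^sup>2"
      using key[of "r/2"] r by auto
    show "\<exists>no. \<forall>n\<ge>no. norm (X n - Abs_ell2 f) < r"
    proof (intro exI[of _ M] allI impI)
      fix n assume "n \<ge> M"
      hence "norm (Abs_ell2 (\<lambda>i. coord (X n) i - f i)) \<le> r/2"
        using M r by (intro norm_ell2_bound(2)) auto
      moreover have "sq_summable (\<lambda>i. coord (X n) i - f i)"
        using M \<open>n \<ge> M\<close> r by (intro norm_ell2_bound(1)[of _ "r/2"]) auto
      hence "X n - Abs_ell2 f = Abs_ell2 (\<lambda>i. coord (X n) i - f i)"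
        by (intro ell2_eqI) (simp add: coord_Abs fs)
      ultimately show "norm (X n - Abs_ell2 f) < r" using r by simp
    qed
  qed
  thus "convergent X" by (auto simp: convergent_def)
qed

instance cop :: (type) banach
proof
  fix X :: "nat \<Rightarrow> 'a cop" assume X: "Cauchy X"
  have d: "dist x y = dist (blinfun_of x) (blinfun_of y)" for x y :: "'a cop"
    by (simp add: dist_norm norm_cop.rep_eq minus_cop.rep_eq)
  have "Cauchy (\<lambda>n. blinfun_of (X n))" using X by (simp add: Cauchy_def d)
  then obtain L where L: "(\<lambda>n. blinfun_of (X n)) \<longlonglongrightarrow> L"
    using Cauchy_convergent convergent_def by blast
  have "blinfun_apply L (c *\<^sub>C v) = c *\<^sub>C blinfun_apply L v" for c v
  proof -
    have lim: "(\<lambda>n. blinfun_apply (blinfun_of (X n)) w) \<longlonglongrightarrow> blinfun_apply L w" for w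
      by (intro tendsto_intros L)
    have "(\<lambda>n. c *\<^sub>C blinfun_apply (blinfun_of (X n)) v) \<longlonglongrightarrow> c *\<^sub>C blinfun_apply L v"
      using bounded_linear.tendsto[OF bounded_linear_scaleC_ell2 lim] .
    moreover have "c *\<^sub>C blinfun_apply (blinfun_of (X n)) v = blinfun_apply (blinfun_of (X n)) (c *\<^sub>C v)" for n
      using blinfun_of[of "X n"] by simp
    ultimately have "(\<lambda>n. blinfun_apply (blinfun_of (X n)) (c *\<^sub>C v)) \<longlonglongrightarrow> c *\<^sub>C blinfun_apply L v"
      by simp
    thus ?thesis by (rule LIMSEQ_unique[OF lim])
  qed
  hence "blinfun_of (Abs_cop L) = L" by (simp add: Abs_cop_inverse)
  moreover have "(\<lambda>n. dist (blinfun_of (X n)) L) \<longlonglongrightarrow> 0" using L by (subst (asm) tendsto_dist_iff)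
  ultimately have "X \<longlonglongrightarrow> Abs_cop L" by (subst tendsto_dist_iff) (simp add: d)
  thus "convergent X" by (auto simp: convergent_def)
qed

subsection \<open>Generated \<open>C\<^sup>*\<close>-algebras and multiplicative domains\<close>

lemma star_subalgebra_cstar_generated [simp]: "star_subalgebra (cstar_generated G)"
  and closed_cstar_generated [simp]: "closed (cstar_generated G)"
proof -
  have "star_subalgebra (cstar_generated G) \<and> closed (cstar_generated G)"
    unfolding cstar_generated_def by (rule hull_in) (auto simp: star_subalgebra_def intro: closed_Inter)
  thus "star_subalgebra (cstar_generated G)" "closed (cstar_generated G)" by auto
qed

lemma cstar_generated_superset: "G \<subseteq> cstar_generated G"
  unfolding cstar_generated_def by (rule hull_subset)

lemma cstar_generated_minimal:
  "G \<subseteq> E \<Longrightarrow> star_subalgebra E \<Longrightarrow> closed E \<Longrightarrow> cstar_generated G \<subseteq> E"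
  unfolding cstar_generated_def by (rule hull_minimal) auto

lemma
  assumes "star_subalgebra E"
  shows sub_zero: "0 \<in> E" and sub_add: "x \<in> E \<Longrightarrow> y \<in> E \<Longrightarrow> x + y \<in> E"
    and sub_mult: "x \<in> E \<Longrightarrow> y \<in> E \<Longrightarrow> x * y \<in> E" and sub_adj: "x \<in> E \<Longrightarrow> adj x \<in> E"
    and sub_scaleC: "x \<in> E \<Longrightarrow> c *\<^sub>C x \<in> E"
  using assms by (auto simp: star_subalgebra_def)

text \<open>These maps are total on the bounded operators, so they compose without side conditions
  on domains. Being a homomorphism is a property relative to a subalgebra and is kept out of the
  definition.\<close>

definition star_map :: "('i cop \<Rightarrow> 'j cop) \<Rightarrow> bool" where
  "star_map \<Theta> \<longleftrightarrow> (\<forall>x y. \<Theta> (x + y) = \<Theta> x + \<Theta> y) \<and> (\<forall>c x. \<Theta> (c *\<^sub>C x) = c *\<^sub>C \<Theta> x) \<and>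
    (\<forall>x. \<Theta> (adj x) = adj (\<Theta> x)) \<and> (\<forall>x. norm (\<Theta> x) \<le> norm x)"

text \<open>The multiplicative domain of a contractive \<open>*\<close>-linear map is a \<open>C\<^sup>*\<close>-algebra, so multiplicativity
  of such a map on \<open>cstar_generated G\<close> has to be checked on \<open>G\<close> only.\<close>

definition mult_domain :: "('i cop \<Rightarrow> 'j cop) \<Rightarrow> 'i cop set" where
  "mult_domain \<Theta> = {x. \<forall>y. \<Theta> (x * y) = \<Theta> x * \<Theta> y \<and> \<Theta> (y * x) = \<Theta> y * \<Theta> x}"

lemma
  assumes "star_map \<Theta>"
  shows star_map_add: "\<Theta> (x + y) = \<Theta> x + \<Theta> y" and star_map_scaleC: "\<Theta> (c *\<^sub>C x) = c *\<^sub>C \<Theta> x"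
    and star_map_adj: "\<Theta> (adj x) = adj (\<Theta> x)" and star_map_norm: "norm (\<Theta> x) \<le> norm x"
  using assms by (auto simp: star_map_def)

lemma star_map_bounded_linear: "star_map \<Theta> \<Longrightarrow> bounded_linear \<Theta>"
  by (rule bounded_linear_intro[where K = 1])
    (auto simp: star_map_add star_map_scaleC star_map_norm scaleR_eq_scaleC_cop)

lemma star_map_zero [simp]: "star_map \<Theta> \<Longrightarrow> \<Theta> 0 = 0"
  by (metis star_map_scaleC scaleC_zero_left)

lemma star_map_sum: "star_map \<Theta> \<Longrightarrow> \<Theta> (\<Sum>i\<in>I. f i) = (\<Sum>i\<in>I. \<Theta> (f i))"
  by (induction I rule: infinite_finite_induct) (auto simp: star_map_add)

lemma star_map_comp: "star_map \<Theta>1 \<Longrightarrow> star_map \<Theta>2 \<Longrightarrow> star_map (\<lambda>x. \<Theta>2 (\<Theta>1 x))"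
  unfolding star_map_def by (auto intro: order_trans)

lemma mult_domainD: "x \<in> mult_domain \<Theta> \<Longrightarrow> \<Theta> (x * y) = \<Theta> x * \<Theta> y"
  "x \<in> mult_domain \<Theta> \<Longrightarrow> \<Theta> (y * x) = \<Theta> y * \<Theta> x"
  by (auto simp: mult_domain_def)

lemma mult_domain_comp:
  "x \<in> mult_domain \<Theta>1 \<Longrightarrow> \<Theta>1 x \<in> mult_domain \<Theta>2 \<Longrightarrow> x \<in> mult_domain (\<lambda>x. \<Theta>2 (\<Theta>1 x))"
  by (auto simp: mult_domain_def)

lemma star_subalgebra_mult_domain:
  assumes "star_map \<Theta>" shows "star_subalgebra (mult_domain \<Theta>)"
proof -
  have "adj x \<in> mult_domain \<Theta>" if x: "x \<in> mult_domain \<Theta>" for x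
  proof -
    have "\<Theta> (adj x * y) = adj (\<Theta> (adj y * x))" "\<Theta> (y * adj x) = adj (\<Theta> (x * adj y))" for y
      by (simp_all add: star_map_adj[OF assms, symmetric] adj_mult adj_adj)
    thus ?thesis using x by (simp add: mult_domain_def adj_mult adj_adj star_map_adj[OF assms])
  qed
  thus ?thesis using assms
    by (auto simp: star_subalgebra_def mult_domain_def star_map_add star_map_scaleC mult_scaleC_left
        mult_scaleC_right distrib_left distrib_right mult.assoc)
      (metis mult.assoc)
qed

lemma closed_mult_domain:
  assumes "star_map \<Theta>" shows "closed (mult_domain \<Theta>)"
proof -
  have c: "continuous_on UNIV \<Theta>"
    by (rule linear_continuous_on[OF star_map_bounded_linear[OF assms]])
  have c': "continuous_on UNIV (\<lambda>x. \<Theta> (f x))" if "continuous_on UNIV f" for f :: "'a cop \<Rightarrow> 'a cop"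
    using continuous_on_compose2[OF c that] by auto
  show ?thesis unfolding mult_domain_def
    by (intro closed_Collect_all closed_Collect_conj closed_Collect_eq continuous_intros c')
qed

text \<open>The elements of the multiplicative domain that are sent into \<open>F\<close> form a
  closed star subalgebra. The two conditions are proved together, because stability of the second
  under products uses the first.\<close>

lemma star_map_generated_subset:
  assumes "star_map \<Theta>" "G \<subseteq> mult_domain \<Theta>" "\<Theta> ` G \<subseteq> F" "star_subalgebra F" "closed F"
  shows "cstar_generated G \<subseteq> mult_domain \<Theta>" "\<Theta> ` cstar_generated G \<subseteq> F"
proof -
  have "closed (\<Theta> -` F)"
    by (rule continuous_closed_vimage[OF assms(5)])
      (rule linear_continuous_at[OF star_map_bounded_linear[OF assms(1)]])
  moreover have "star_subalgebra (mult_domain \<Theta> \<inter> \<Theta> -` F)"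
    using star_subalgebra_mult_domain[OF assms(1)] assms(1,4)
    by (auto simp: star_subalgebra_def star_map_add star_map_scaleC star_map_adj mult_domainD)
  ultimately have "cstar_generated G \<subseteq> mult_domain \<Theta> \<inter> \<Theta> -` F"
    using assms closed_mult_domain by (intro cstar_generated_minimal closed_Int) auto
  thus "cstar_generated G \<subseteq> mult_domain \<Theta>" "\<Theta> ` cstar_generated G \<subseteq> F" by auto
qed

lemma star_map_generated_eqI:
  assumes "star_map \<Theta>1" "star_map \<Theta>2" "G \<subseteq> mult_domain \<Theta>1" "G \<subseteq> mult_domain \<Theta>2"
    and "\<And>x. x \<in> G \<Longrightarrow> \<Theta>1 x = \<Theta>2 x" and "x \<in> cstar_generated G"
  shows "\<Theta>1 x = \<Theta>2 x"
proof -
  let ?E = "{x. \<Theta>1 x = \<Theta>2 x}"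
  have "closed ?E"
    by (intro closed_Collect_eq linear_continuous_on star_map_bounded_linear assms)
  moreover have "star_subalgebra (mult_domain \<Theta>1 \<inter> mult_domain \<Theta>2 \<inter> ?E)"
    using star_subalgebra_mult_domain[OF assms(1)] star_subalgebra_mult_domain[OF assms(2)] assms(1,2)
    by (auto simp: star_subalgebra_def star_map_add star_map_scaleC star_map_adj mult_domainD)
  ultimately have "cstar_generated G \<subseteq> mult_domain \<Theta>1 \<inter> mult_domain \<Theta>2 \<inter> ?E"
    using assms closed_mult_domain by (intro cstar_generated_minimal closed_Int) auto
  thus ?thesis using assms(6) by auto
qed

lemma star_map_conj:
  assumes "norm V \<le> 1" shows "star_map (\<lambda>X. adj V * X * V)"
proof -
  have "norm (adj V * X * V) \<le> norm X" for X
  proof -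
    have "norm (adj V * X * V) \<le> norm (adj V) * norm X * norm V"
      by (meson mult_right_mono norm_ge_zero norm_mult_ineq order_trans)
    also have "\<dots> \<le> 1 * norm X * 1" using assms by (intro mult_mono) (auto simp: norm_adj)
    finally show ?thesis by simp
  qed
  thus ?thesis
    by (auto simp: star_map_def algebra_simps mult_scaleC_left mult_scaleC_right adj_mult adj_adj)
qed

text \<open>\<open>U * adj U = 1\<close> can be inserted between two factors, so this conjugation is
  multiplicative on all operators.\<close>

lemma conj_coisometry:
  assumes "U * adj U = (1 :: 'i cop)"
  shows "star_map (\<lambda>x. adj U * x * U)" "x \<in> mult_domain (\<lambda>x. adj U * x * U)"
proof -
  have "norm U \<le> 1" by (rule partial_isometry_norm_le) (simp add: assms)
  thus "star_map (\<lambda>x. adj U * x * U)" by (rule star_map_conj)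
  have "adj U * (x * y) * U = adj U * x * (U * adj U) * y * U" for x y
    by (simp only: assms mult_1_right mult.assoc)
  thus "x \<in> mult_domain (\<lambda>x. adj U * x * U)" by (simp add: mult_domain_def mult.assoc)
qed

text \<open>For a \<open>V\<close> that is not a coisometry, conjugation need not be multiplicative
  everywhere. It is so at \<open>X\<close> when \<open>X\<close> and \<open>adj X\<close> both map
  the range of \<open>V\<close> into itself, and this is what the first two hypotheses express,
  together with the compressed operator \<open>Y\<close>.\<close>

lemma conj_intertwine:
  assumes "X * V = V * Y" "adj X * V = V * adj Y" "adj V * V * Y = Y"
  shows "adj V * X * V = Y" "X \<in> mult_domain (\<lambda>X. adj V * X * V)"
proof -
  show 1: "adj V * X * V = Y" using assms by (simp add: mult.assoc)
  have 2: "adj V * X = Y * adj V" using arg_cong[OF assms(2), of adj] by (simp add: adj_mult adj_adj)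
  show "X \<in> mult_domain (\<lambda>X. adj V * X * V)"
  proof -
    have "adj V * (X * y) * V = Y * (adj V * y * V)" for y
      using 2 by (metis mult.assoc)
    moreover have "adj V * (y * X) * V = adj V * y * V * Y" for y
      using assms(1) by (metis mult.assoc)
    ultimately show ?thesis by (simp add: mult_domain_def 1)
  qed
qed

text \<open>\<open>\<alpha>\<close> and \<open>\<beta>\<close> are arbitrary outside the algebra, so
  they are not star maps in the above sense; continuity comes from the preservation of norms of
  differences. This is the uniqueness behind the descriptions \<open>gauge_action\<close> and
  \<open>stabilize\<close>.\<close>

lemma cstar_isomorphism_eqI:
  assumes "cstar_isomorphism (cstar_generated G) F \<alpha>" "cstar_isomorphism (cstar_generated G) F' \<beta>"
    and eq: "\<And>x. x \<in> G \<Longrightarrow> \<alpha> x = \<beta> x" and x: "x \<in> cstar_generated G"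
  shows "\<alpha> x = \<beta> x"
proof -
  let ?E = "cstar_generated G"
  note sub = star_subalgebra_cstar_generated[of G]
  have minus: "\<alpha> (u - v) = \<alpha> u - \<alpha> v" if "cstar_isomorphism ?E F \<alpha>" "u \<in> ?E" "v \<in> ?E" for \<alpha> F u v
    using that sub unfolding cstar_isomorphism_def
    by (metis add_uminus_conv_diff scaleC_minus_one sub_scaleC)
  have cont: "continuous_on ?E \<alpha>" if "cstar_isomorphism ?E F \<alpha>" for \<alpha> F
    unfolding continuous_on_iff
  proof (intro ballI allI impI)
    fix u and e :: real assume "u \<in> ?E" "e > 0"
    moreover have "dist (\<alpha> v) (\<alpha> u) = dist v u" if "v \<in> ?E" for v
      using minus[OF \<open>cstar_isomorphism ?E F \<alpha>\<close> that \<open>u \<in> ?E\<close>] that \<open>u \<in> ?E\<close>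
        star_subalgebra_diff[OF sub that \<open>u \<in> ?E\<close>] \<open>cstar_isomorphism ?E F \<alpha>\<close>
      unfolding cstar_isomorphism_def dist_norm by metis
    ultimately show "\<exists>d>0. \<forall>v\<in>?E. dist v u < d \<longrightarrow> dist (\<alpha> v) (\<alpha> u) < e" by metis
  qed
  have "closed {x \<in> ?E. \<alpha> x - \<beta> x = 0}"
    using continuous_closed_preimage[OF continuous_on_diff[OF cont[OF assms(1)] cont[OF assms(2)]], of "{0}"]
    by (simp add: vimage_def Int_def)
  hence "closed {x \<in> ?E. \<alpha> x = \<beta> x}" by simp
  moreover have "star_subalgebra {x \<in> ?E. \<alpha> x = \<beta> x}"
  proof -
    have "\<alpha> 0 = 0" "\<beta> 0 = 0"
      using assms(1,2) sub_zero[OF sub] minus by (metis diff_self)+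
    thus ?thesis using sub assms(1,2) by (auto simp: star_subalgebra_def cstar_isomorphism_def)
  qed
  ultimately have "?E \<subseteq> {x \<in> ?E. \<alpha> x = \<beta> x}"
    using eq cstar_generated_superset by (intro cstar_generated_minimal) auto
  thus ?thesis using x by auto
qed

text \<open>Mutually inverse contractive homomorphisms are isometric.\<close>

lemma star_map_isomorphism:
  assumes sm: "star_map \<Theta>1" "star_map \<Theta>2" and md: "E \<subseteq> mult_domain \<Theta>1"
    and im: "\<Theta>1 ` E \<subseteq> F" "\<Theta>2 ` F \<subseteq> E"
    and inv: "\<And>x. x \<in> E \<Longrightarrow> \<Theta>2 (\<Theta>1 x) = x" "\<And>y. y \<in> F \<Longrightarrow> \<Theta>1 (\<Theta>2 y) = y"
    and eq: "\<And>x. x \<in> E \<Longrightarrow> \<Phi> x = \<Theta>1 x" and sub: "star_subalgebra E"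
  shows "cstar_isomorphism E F \<Phi>"
proof -
  have "bij_betw \<Theta>1 E F"
    by (rule bij_betw_byWitness[where f' = \<Theta>2]) (use im inv in auto)
  hence "bij_betw \<Phi> E F" using bij_betw_cong[of E \<Phi> \<Theta>1] eq by auto
  moreover have "norm (\<Theta>1 x) = norm x" if "x \<in> E" for x
    using star_map_norm[OF sm(1), of x] star_map_norm[OF sm(2), of "\<Theta>1 x"] inv(1)[OF that] by simp
  ultimately show ?thesis
    using sub md eq sm(1)
    by (auto simp: cstar_isomorphism_def star_subalgebra_def mult_domainD star_map_add star_map_scaleC
        star_map_adj subset_iff)
qed

subsection \<open>Compression along an injection of index sets\<close>

text \<open>For an injection \<open>h\<close>, \<open>push h\<close> is the isometry that moves
  basis vectors along \<open>h\<close> and \<open>pull h\<close> is its adjoint. They relate two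
  different spaces and are therefore maps of vectors, not elements of \<open>cop\<close>.\<close>

definition pull :: "('j \<Rightarrow> 'i) \<Rightarrow> 'i ell2 \<Rightarrow> 'j ell2" where
  "pull h v = Abs_ell2 (\<lambda>j. coord v (h j))"

definition push :: "('j \<Rightarrow> 'i) \<Rightarrow> 'j ell2 \<Rightarrow> 'i ell2" where
  "push h w = Abs_ell2 (\<lambda>i. if i \<in> range h then coord w (inv_into UNIV h i) else 0)"

definition compress :: "('j \<Rightarrow> 'i) \<Rightarrow> 'i cop \<Rightarrow> 'j cop" where
  "compress h X = mk_cop (\<lambda>w. pull h (app X (push h w)))"

lemma
  fixes h :: "'j \<Rightarrow> 'i"
  assumes h: "inj h"
  shows coord_pull: "coord (pull h v) j = coord v (h j)" and norm_pull: "norm (pull h v) \<le> norm v"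
proof -
  have *: "(\<Sum>j\<in>F. (cmod (coord v (h j)))\<^sup>2) \<le> (norm v)\<^sup>2" if "finite F" for F
    using norm_ell2_finite_sum[of "h ` F" v] that h
    by (simp add: sum.reindex inj_on_subset)
  show "coord (pull h v) j = coord v (h j)"
    unfolding pull_def by (subst coord_Abs[OF norm_ell2_bound(1)[OF *]]) auto
  show "norm (pull h v) \<le> norm v"
    unfolding pull_def by (rule norm_ell2_bound(2)[OF *]) auto
qed

lemma
  fixes h :: "'j \<Rightarrow> 'i"
  assumes h: "inj h"
  shows coord_push: "coord (push h w) i = (if i \<in> range h then coord w (inv_into UNIV h i) else 0)"
    and norm_push: "norm (push h w) \<le> norm w"
proof -
  have *: "(\<Sum>i\<in>F. (cmod (if i \<in> range h then coord w (inv_into UNIV h i) else 0))\<^sup>2) \<le> (norm w)\<^sup>2" if "finite F" for F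
  proof -
    have "(\<Sum>i\<in>F. (cmod (if i \<in> range h then coord w (inv_into UNIV h i) else 0))\<^sup>2) =
        (\<Sum>i\<in>F \<inter> range h. (cmod (coord w (inv_into UNIV h i)))\<^sup>2)"
      using that by (intro sum.mono_neutral_cong_right) auto
    also have "\<dots> = (\<Sum>j\<in>h -` F. (cmod (coord w j))\<^sup>2)"
      by (rule sum.reindex_bij_witness[of _ h "inv_into UNIV h"]) (use h in auto)
    also have "\<dots> \<le> (norm w)\<^sup>2"
      using that h by (intro norm_ell2_finite_sum finite_vimageI)
    finally show ?thesis .
  qed
  show "coord (push h w) i = (if i \<in> range h then coord w (inv_into UNIV h i) else 0)"
    unfolding push_def by (subst coord_Abs[OF norm_ell2_bound(1)[OF *]]) auto
  show "norm (push h w) \<le> norm w"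
    unfolding push_def by (rule norm_ell2_bound(2)[OF *]) auto
qed

lemma push_ket: "inj h \<Longrightarrow> push h (ket j) = ket (h j)"
  by (rule ell2_eqI) (auto simp: coord_push coord_ket)

lemma
  assumes h: "inj h"
  shows mel_compress: "mel (compress h X) i j = mel X (h i) (h j)"
    and norm_compress: "norm (compress h X) \<le> norm X"
proof -
  have lin: "pull h (app X (push h (v + w))) = pull h (app X (push h v)) + pull h (app X (push h w))"
    "pull h (app X (push h (c *\<^sub>C v))) = c *\<^sub>C pull h (app X (push h v))" for v w c
  proof -
    have "push h (v + w) = push h v + push h w" "push h (c *\<^sub>C v) = c *\<^sub>C push h v"
      by (auto intro!: ell2_eqI simp: coord_push[OF h])
    thus "pull h (app X (push h (v + w))) = pull h (app X (push h v)) + pull h (app X (push h w))"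
      "pull h (app X (push h (c *\<^sub>C v))) = c *\<^sub>C pull h (app X (push h v))"
      by (auto intro!: ell2_eqI simp: coord_pull[OF h])
  qed
  have bd: "norm (pull h (app X (push h v))) \<le> norm v * norm X" for v
    using norm_pull[OF h, of "app X (push h v)"] norm_app[of X "push h v"]
      mult_left_mono[OF norm_push[OF h, of v], of "norm X"]
    by (simp add: mult.commute)
  show "mel (compress h X) i j = mel X (h i) (h j)"
    unfolding mel_def compress_def app_mk_cop[OF lin bd] by (simp add: coord_pull[OF h] push_ket[OF h])
  show "norm (compress h X) \<le> norm X"
    unfolding compress_def by (rule norm_mk_cop[OF lin bd]) simp
qed

lemma star_map_compress: "inj h \<Longrightarrow> star_map (compress h)"
  by (auto simp: star_map_def norm_compress mel_compress mel_add mel_scaleC mel_adj intro!: cop_eqI_mel)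

lemma compress_mult:
  assumes h: "inj h" and X: "\<And>i k. k \<notin> range h \<Longrightarrow> mel X (h i) k * mel Y k (h j) = 0"
  shows "mel (compress h (X * Y)) i j = mel (compress h X * compress h Y) i j"
proof -
  have "mel (X * Y) (h i) (h j) = (\<Sum>\<^sub>\<infinity>k\<in>range h. mel X (h i) k * mel Y k (h j))"
    unfolding mel_mult using X by (intro infsum_cong_neutral) auto
  also have "\<dots> = (\<Sum>\<^sub>\<infinity>k. mel X (h i) (h k) * mel Y (h k) (h j))"
    using h by (subst infsum_reindex) (auto simp: o_def)
  finally show ?thesis by (simp add: mel_compress[OF h] mel_mult)
qed

text \<open>The hypothesis says that the closed span of the basis vectors in \<open>range h\<close>
  reduces \<open>X\<close>.\<close>

lemma mult_domain_compress:
  assumes h: "inj h" and X: "\<And>i k. k \<notin> range h \<Longrightarrow> mel X (h i) k = 0 \<and> mel X k (h i) = 0"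
  shows "X \<in> mult_domain (compress h)"
  using X by (auto simp: mult_domain_def intro!: cop_eqI_mel compress_mult[OF h])

lemma mult_domain_compress_bij:
  assumes h: "bij h" shows "X \<in> mult_domain (compress h)"
  using h by (intro mult_domain_compress) (auto simp: bij_def)

lemma mel_block_diag:
  assumes "\<And>x. norm (T x) \<le> b"
  shows "mel (block_diag T) (x, i) (y, j) = (if x = y then mel (T x) i j else 0)"
proof -
  have "slice (ket (y, j)) x = (if x = y then ket j else 0)"
    by (rule ell2_eqI) (auto simp: coord_slice coord_ket)
  thus ?thesis unfolding mel_def coord_block_diag[OF assms]
    by (auto simp: linear_0[OF bounded_linear.linear[OF bounded_linear_app]])
qed

lemma star_map_block_diag:
  assumes "\<And>x. star_map (\<Theta> x)"
  shows "star_map (\<lambda>X. block_diag (\<lambda>x. \<Theta> x X))"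
proof -
  have b: "norm (\<Theta> x X) \<le> norm X" for x X by (rule star_map_norm[OF assms])
  note m = mel_block_diag[OF b]
  show ?thesis unfolding star_map_def
    apply (intro conjI allI)
       apply (rule cop_eqI_mel, clarsimp simp only: m mel_add split_paired_all,
        simp add: star_map_add[OF assms] mel_add)
      apply (rule cop_eqI_mel, clarsimp simp only: m mel_scaleC split_paired_all,
        simp add: star_map_scaleC[OF assms] mel_scaleC)
     apply (rule cop_eqI_mel, clarsimp simp only: m mel_adj split_paired_all,
        simp add: star_map_adj[OF assms] mel_adj)
    by (intro norm_block_diag b)
qed

lemma mult_domain_block_diag:
  assumes "\<And>x. star_map (\<Theta> x)" "\<And>x. X \<in> mult_domain (\<Theta> x)"
  shows "X \<in> mult_domain (\<lambda>X. block_diag (\<lambda>x. \<Theta> x X))"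
proof -
  have b: "norm (\<Theta> x X) \<le> norm X" for x X by (rule star_map_norm[OF assms(1)])
  show ?thesis
    unfolding mult_domain_def
    by (auto simp: block_diag_mult[OF b b] mult_domainD[OF assms(2)])
qed

subsection \<open>Tensor products\<close>

lemma tensor_vec_ket: "tensor_vec (ket i) (ket j) = ket (i, j)"
  by (rule ell2_eqI) (auto simp: coord_tensor_vec coord_ket split: if_splits)

lemma mel_tensor: "mel (S \<otimes>\<^sub>o T) (i, k) (j, l) = mel S i j * mel T k l"
  by (simp add: mel_def tensor_vec_ket[symmetric] app_tensor_op coord_tensor_vec)

lemma tensor_eqI: "(\<And>i j. app X (tensor_vec (ket i) (ket j)) = app Y (tensor_vec (ket i) (ket j))) \<Longrightarrow> X = Y"
  by (rule cop_eqI_ket) (auto simp: tensor_vec_ket)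

lemma tensor_mult: "(S \<otimes>\<^sub>o T) * (S' \<otimes>\<^sub>o T') = (S * S') \<otimes>\<^sub>o (T * T')"
  by (rule tensor_eqI) (simp add: app_tensor_op)

lemma tensor_adj: "adj (S \<otimes>\<^sub>o T) = adj S \<otimes>\<^sub>o adj T"
  by (rule cop_eqI_mel) (auto simp: mel_tensor mel_adj)

lemma tensor_one: "1 \<otimes>\<^sub>o 1 = 1"
  by (rule cop_eqI_mel) (auto simp: mel_tensor mel_one split: if_splits)

lemma tensor_add_left: "(S + S') \<otimes>\<^sub>o T = S \<otimes>\<^sub>o T + S' \<otimes>\<^sub>o T"
  and tensor_add_right: "S \<otimes>\<^sub>o (T + T') = S \<otimes>\<^sub>o T + S \<otimes>\<^sub>o T'"
  and tensor_scaleC_left: "(c *\<^sub>C S) \<otimes>\<^sub>o T = c *\<^sub>C (S \<otimes>\<^sub>o T)"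
  and tensor_scaleC_right: "S \<otimes>\<^sub>o (c *\<^sub>C T) = c *\<^sub>C (S \<otimes>\<^sub>o T)"
  and tensor_zero_left [simp]: "0 \<otimes>\<^sub>o T = 0" and tensor_zero_right [simp]: "S \<otimes>\<^sub>o 0 = 0"
  by (rule cop_eqI_mel, auto simp: mel_tensor mel_add mel_diff mel_scaleC algebra_simps)+

lemma tensor_sum_left: "(\<Sum>a\<in>I. f a) \<otimes>\<^sub>o T = (\<Sum>a\<in>I. f a \<otimes>\<^sub>o T)"
  by (induction I rule: infinite_finite_induct) (auto simp: tensor_add_left)

lemma tensor_sum_right: "S \<otimes>\<^sub>o (\<Sum>a\<in>I. f a) = (\<Sum>a\<in>I. S \<otimes>\<^sub>o f a)"
  by (induction I rule: infinite_finite_induct) (auto simp: tensor_add_right)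

lemma norm_tensor: "norm (S \<otimes>\<^sub>o T) \<le> norm S * norm T"
proof (rule norm_copI)
  fix v
  have "norm (app (S \<otimes>\<^sub>o T) v) \<le> norm (block_diag (\<lambda>_. S) :: ('b \<times> 'a) cop) * norm (app (block_diag (\<lambda>_. T)) v)"
    unfolding app_tensor_op_swap norm_swap by (metis norm_app norm_swap)
  also have "\<dots> \<le> norm S * (norm T * norm v)"
    by (intro mult_mono norm_block_diag order_refl order_trans[OF norm_app] mult_right_mono) auto
  finally show "norm (app (S \<otimes>\<^sub>o T) v) \<le> norm S * norm T * norm v" by (simp add: mult.assoc)
qed simp

lemma bounded_linear_tensor_right: "bounded_linear (\<lambda>T. S \<otimes>\<^sub>o T)"
  by (rule bounded_linear_intro[where K = "norm S"])
    (use norm_tensor[of S] in \<open>auto simp: tensor_add_right scaleR_eq_scaleC_cop tensor_scaleC_right mult.commute[of _ "norm S"]\<close>)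

lemma bounded_linear_tensor_left: "bounded_linear (\<lambda>S. S \<otimes>\<^sub>o T)"
  by (rule bounded_linear_intro[where K = "norm T"])
    (use norm_tensor in \<open>auto simp: tensor_add_left scaleR_eq_scaleC_cop tensor_scaleC_left\<close>)

subsection \<open>Matrix units and compact operators\<close>

definition munit :: "'i \<Rightarrow> 'i \<Rightarrow> 'i cop" where
  "munit i j = mk_cop (\<lambda>v. coord v j *\<^sub>C ket i)"

lemma app_munit: "app (munit i j) v = coord v j *\<^sub>C ket i"
  and norm_munit: "norm (munit i j) \<le> 1"
proof -
  have 1: "coord (v + w) j *\<^sub>C ket i = coord v j *\<^sub>C ket i + coord w j *\<^sub>C ket i"
    "coord (c *\<^sub>C v) j *\<^sub>C ket i = c *\<^sub>C coord v j *\<^sub>C ket i" for v w c and i :: 'a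
    by (auto intro!: ell2_eqI simp: algebra_simps)
  have 2: "norm (coord v j *\<^sub>C ket i) \<le> norm v * 1" for v and i :: 'a by (simp add: cmod_coord_le)
  show "app (munit i j) v = coord v j *\<^sub>C ket i" unfolding munit_def by (rule app_mk_cop[OF 1 2])
  show "norm (munit i j) \<le> 1" unfolding munit_def by (rule norm_mk_cop[OF 1 2]) simp
qed

lemma rank_one_proj_eq: "rank_one_proj = munit 0 0"
  by (simp add: rank_one_proj_def munit_def)

lemma mel_munit: "mel (munit i j) k l = (if k = i \<and> l = j then 1 else 0)"
  by (auto simp: mel_def app_munit coord_ket)

lemma munit_adj [simp]: "adj (munit i j) = munit j i"
  by (rule cop_eqI_mel) (auto simp: mel_adj mel_munit)

lemma app_munit_ket: "app (munit i j) (ket k) = (if k = j then ket i else 0)"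
  by (rule ell2_eqI) (auto simp: app_munit coord_ket)

lemma app_zero_right [simp]: "app X 0 = 0"
  by (rule linear_0[OF bounded_linear.linear[OF bounded_linear_app]])

lemma munit_mult: "munit i j * munit k l = (if j = k then munit i l else 0)"
  by (rule cop_eqI_ket) (auto simp: app_munit_ket)

lemma munit_sandwich: "munit i j * X * munit k l = mel X j k *\<^sub>C munit i l"
  by (rule cop_eqI_ket) (auto simp: app_munit app_munit_ket mel_def app_scaleC_cop intro!: ell2_eqI)

definition iso_op :: "('i \<Rightarrow> 'i) \<Rightarrow> 'i cop" where
  "iso_op \<sigma> = mk_cop (push \<sigma>)"

lemma app_iso_op: "inj \<sigma> \<Longrightarrow> app (iso_op \<sigma>) v = push \<sigma> v"
  unfolding iso_op_def
  by (rule app_mk_cop[where b = 1]) (auto intro!: ell2_eqI simp: coord_push norm_push)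

lemma app_iso_op_ket: "inj \<sigma> \<Longrightarrow> app (iso_op \<sigma>) (ket i) = ket (\<sigma> i)"
  by (simp add: app_iso_op push_ket)

lemma mel_iso_op: "inj \<sigma> \<Longrightarrow> mel (iso_op \<sigma>) i j = (if i = \<sigma> j then 1 else 0)"
  by (simp add: mel_def app_iso_op_ket coord_ket)

lemma app_adj_iso_op_ket:
  "inj \<sigma> \<Longrightarrow> app (adj (iso_op \<sigma>)) (ket i) = (if i \<in> range \<sigma> then ket (inv_into UNIV \<sigma> i) else 0)"
proof (rule ell2_eqI)
  fix k assume "inj \<sigma>"
  thus "coord (app (adj (iso_op \<sigma>)) (ket i)) k =
      coord (if i \<in> range \<sigma> then ket (inv_into UNIV \<sigma> i) else 0) k"
    unfolding mel_def[symmetric] by (auto simp: mel_adj mel_iso_op coord_ket inv_into_f_f)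
qed

lemma iso_op_adj_mult: "inj \<sigma> \<Longrightarrow> adj (iso_op \<sigma>) * iso_op \<sigma> = 1"
  by (rule cop_eqI_ket) (simp add: app_iso_op_ket app_adj_iso_op_ket inv_into_f_f)

lemma iso_op_orthogonal:
  "inj \<sigma> \<Longrightarrow> inj \<tau> \<Longrightarrow> range \<sigma> \<inter> range \<tau> = {} \<Longrightarrow> adj (iso_op \<sigma>) * iso_op \<tau> = 0"
  by (rule cop_eqI_ket) (auto simp: app_iso_op_ket app_adj_iso_op_ket)

lemma iso_op_munit: "inj \<sigma> \<Longrightarrow> iso_op \<sigma> * munit i j = munit (\<sigma> i) j"
  by (rule cop_eqI_ket) (auto simp: app_iso_op_ket app_munit_ket)

lemma munit_iso_op: "inj \<sigma> \<Longrightarrow> munit i j * adj (iso_op \<sigma>) = munit i (\<sigma> j)"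
  using iso_op_munit[of \<sigma> j i] by (metis adj_mult munit_adj)

lemma iso_op_range_proj:
  assumes "inj \<sigma>"
  shows "mel (iso_op \<sigma> * adj (iso_op \<sigma>)) i j = (if i = j \<and> i \<in> range \<sigma> then 1 else 0)"
  unfolding mel_def using assms by (auto simp: app_adj_iso_op_ket app_iso_op_ket coord_ket inv_into_f_f)

lemma sum_iso_op_range_proj:
  assumes "finite I" "\<And>c. c \<in> I \<Longrightarrow> inj (\<sigma> c)" "\<And>n. \<exists>!c. c \<in> I \<and> n \<in> range (\<sigma> c)"
  shows "(\<Sum>c\<in>I. iso_op (\<sigma> c) * adj (iso_op (\<sigma> c))) = 1"
proof (rule cop_eqI_mel)
  fix i j
  obtain c where c: "c \<in> I" "i \<in> range (\<sigma> c)" "\<And>d. d \<in> I \<Longrightarrow> i \<in> range (\<sigma> d) \<Longrightarrow> d = c"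
    using assms(3)[of i] by blast
  have "mel (\<Sum>c\<in>I. iso_op (\<sigma> c) * adj (iso_op (\<sigma> c))) i j =
      (\<Sum>d\<in>I. if d = c then (if i = j then 1 else 0) else 0)"
    unfolding mel_sum
  proof (intro sum.cong refl)
    fix d assume d: "d \<in> I"
    have "i \<in> range (\<sigma> d) \<longleftrightarrow> d = c" using c d by blast
    thus "mel (iso_op (\<sigma> d) * adj (iso_op (\<sigma> d))) i j = (if d = c then (if i = j then 1 else 0) else 0)"
      unfolding iso_op_range_proj[OF assms(2)[OF d]] by simp
  qed
  thus "mel (\<Sum>c\<in>I. iso_op (\<sigma> c) * adj (iso_op (\<sigma> c))) i j = mel 1 i j"
    using c(1) assms(1) by (simp add: mel_one)
qed

definition trunc :: "nat \<Rightarrow> nat cop" where "trunc n = (\<Sum>i<n. munit i i)"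

lemma trunc_adj [simp]: "adj (trunc n) = trunc n"
  by (simp add: trunc_def adj_sum)

lemma trunc_munit: "trunc n * munit i j = (if i < n then munit i j else 0)"
proof -
  have "trunc n * munit i j = (\<Sum>k<n. if k = i then munit i j else 0)"
    unfolding trunc_def sum_distrib_right by (intro sum.cong) (auto simp: munit_mult)
  thus ?thesis by simp
qed

lemma trunc_idem [simp]: "trunc n * trunc n = trunc n"
proof -
  have "trunc n * trunc n = (\<Sum>i<n. trunc n * munit i i)"
    by (subst (2) trunc_def) (simp add: sum_distrib_left)
  also have "\<dots> = trunc n" unfolding trunc_munit by (subst trunc_def) simp
  finally show ?thesis .
qed

lemma norm_trunc: "norm (trunc n) \<le> 1"
  by (rule partial_isometry_norm_le) simp

lemma trunc_tendsto: "(\<lambda>n. app (trunc n) v) \<longlonglongrightarrow> v"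
proof -
  have "app (trunc n) v = (\<Sum>i<n. coord v i *\<^sub>C ket i)" for n
    unfolding trunc_def by (induction n) (auto simp: app_munit)
  thus ?thesis using has_sum_imp_sums[OF has_sum_ket[of v]] by (simp add: sums_def)
qed

text \<open>\<open>trunc n\<close> is contractive and tends to 1 strongly, hence uniformly on
  totally bounded sets: a finite net in the image of the unit ball reduces the estimate to finitely
  many vectors.\<close>

lemma trunc_compact_tendsto:
  assumes "T \<in> compacts" shows "(\<lambda>n. trunc n * T) \<longlonglongrightarrow> T"
proof (rule LIMSEQ_I)
  fix r :: real assume r: "r > 0"
  define e where "e = r / 4"
  have e: "e > 0" "e + e + e < r" using r by (auto simp: e_def)
  obtain k where k: "finite k" "closure (app T ` cball 0 1) \<subseteq> (\<Union>x\<in>k. ball x e)"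
    using assms e(1) unfolding compacts_def compact_eq_totally_bounded by auto
  have "\<exists>n0. \<forall>n\<ge>n0. norm (app (trunc n) x - x) < e" for x
    using LIMSEQ_D[OF trunc_tendsto e(1)] .
  then obtain N where N: "\<And>x n. n \<ge> N x \<Longrightarrow> norm (app (trunc n) x - x) < e" by metis
  define M where "M = Max (insert 0 (N ` k))"
  have M: "N x \<le> M" if "x \<in> k" for x using that k(1) by (auto simp: M_def)
  have bd: "norm (app (trunc n * T - T) v) \<le> e + e + e" if n: "n \<ge> M" and v: "norm v \<le> 1" for n v
  proof -
    have "app T v \<in> closure (app T ` cball 0 1)"
      using v closure_subset[of "app T ` cball 0 1"] by auto
    then obtain x where x: "x \<in> k" "dist x (app T v) < e" using k(2) by auto
    have "app (trunc n * T - T) v = app (trunc n) (app T v - x) + (app (trunc n) x - x) + (x - app T v)"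
      using app_add[of "trunc n" "app T v - x" x] by simp
    also have "norm \<dots> \<le> norm (app (trunc n) (app T v - x)) + norm (app (trunc n) x - x) + norm (x - app T v)"
      by (intro norm_triangle_le add_mono order_refl norm_triangle_ineq)
    also have "norm (app (trunc n) (app T v - x)) \<le> 1 * norm (app T v - x)"
      by (intro order_trans[OF norm_app] mult_right_mono norm_trunc) simp
    also have "norm (app (trunc n) x - x) \<le> e" using N M x(1) n by (meson less_imp_le order_trans)
    finally show ?thesis using x(2) by (simp add: dist_norm norm_minus_commute)
  qed
  have "norm (trunc n * T - T) \<le> e + e + e" if n: "n \<ge> M" for n
  proof (rule norm_copI)
    fix v
    show "norm (app (trunc n * T - T) v) \<le> (e + e + e) * norm v"
    proof (cases "v = 0")
      case False
      have "norm (app (trunc n * T - T) (inverse (norm v) *\<^sub>R v)) \<le> e + e + e"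
        using False by (intro bd n) simp
      also have "app (trunc n * T - T) (inverse (norm v) *\<^sub>R v) = inverse (norm v) *\<^sub>R app (trunc n * T - T) v"
        by (rule linear_scale[OF bounded_linear.linear[OF bounded_linear_app]])
      finally have "inverse (norm v) * norm (app (trunc n * T - T) v) \<le> e + e + e" by (simp del: app_simps)
      thus ?thesis using False by (simp add: field_simps del: app_simps)
    qed simp
  qed (use e in simp)
  thus "\<exists>no. \<forall>n\<ge>no. norm (trunc n * T - T) < r" using e(2) by (intro exI[of _ M]) fastforce
qed

lemma munit_mult_norm: "norm (Y * munit i i) \<le> norm (app Y (ket i))"
proof (rule norm_copI)
  fix v
  have "norm (app (Y * munit i i) v) = cmod (coord v i) * norm (app Y (ket i))" by (simp add: app_munit)
  also have "\<dots> \<le> norm v * norm (app Y (ket i))" by (intro mult_right_mono cmod_coord_le) simp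
  finally show "norm (app (Y * munit i i) v) \<le> norm (app Y (ket i)) * norm v" by (simp add: mult.commute)
qed simp

lemma norm_adj_tendsto: "(f \<longlonglongrightarrow> l) \<Longrightarrow> (\<lambda>n. adj (f n)) \<longlonglongrightarrow> adj (l :: 'i cop)"
  unfolding tendsto_dist_iff[of f l] tendsto_dist_iff[of "\<lambda>n. adj (f n)" "adj l"]
  by (simp add: dist_norm norm_adj adj_diff[symmetric])

lemma trunc_row_tendsto: "(\<lambda>m. trunc n * T * trunc m) \<longlonglongrightarrow> trunc n * T"
proof -
  \<comment> \<open>Passing to the adjoint turns the finitely many rows into the vectors
    \<open>adj T (ket i)\<close>, to which the strong convergence of \<open>trunc m\<close>
    applies.\<close>
  have "(\<lambda>m. (trunc m * adj T - adj T) * munit i i) \<longlonglongrightarrow> 0" for i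
  proof (rule Lim_null_comparison)
    show "\<forall>\<^sub>F m in sequentially. norm ((trunc m * adj T - adj T) * munit i i) \<le>
        norm (app (trunc m) (app (adj T) (ket i)) - app (adj T) (ket i))"
      using munit_mult_norm[of "trunc _ * adj T - adj T" i] by (auto intro!: always_eventually)
    show "(\<lambda>m. norm (app (trunc m) (app (adj T) (ket i)) - app (adj T) (ket i))) \<longlonglongrightarrow> 0"
      using trunc_tendsto[of "app (adj T) (ket i)"] by (simp add: LIM_zero tendsto_norm_zero)
  qed
  hence "(\<lambda>m. \<Sum>i<n. (trunc m * adj T - adj T) * munit i i) \<longlonglongrightarrow> (\<Sum>i<n. 0)"
    by (intro tendsto_sum)
  hence "(\<lambda>m. trunc m * adj T * trunc n - adj T * trunc n) \<longlonglongrightarrow> 0"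
    by (simp only: trunc_def[of n] sum_distrib_left left_diff_distrib sum_subtractf sum.neutral_const)
  hence "(\<lambda>m. trunc m * adj T * trunc n) \<longlonglongrightarrow> adj T * trunc n" by (rule LIM_zero_cancel)
  from norm_adj_tendsto[OF this] show ?thesis by (simp add: adj_mult adj_adj mult.assoc)
qed

lemma trunc_sandwich: "trunc n * T * trunc m = (\<Sum>i<n. \<Sum>j<m. mel T i j *\<^sub>C munit i j)"
  by (subst sum.swap) (simp add: trunc_def sum_distrib_left sum_distrib_right munit_sandwich)

lemma closed_sum_mem:
  "0 \<in> Q \<Longrightarrow> (\<And>x y. x \<in> Q \<Longrightarrow> y \<in> Q \<Longrightarrow> x + y \<in> Q) \<Longrightarrow> (\<And>i. i \<in> I \<Longrightarrow> f i \<in> Q) \<Longrightarrow> (\<Sum>i\<in>I. f i) \<in> Q"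
  by (induction I rule: infinite_finite_induct) auto

text \<open>Finite matrices are dense, in two steps: compactness allows all but finitely many rows
  to be cut off, and the remaining rows are then truncated.\<close>

lemma compacts_induct:
  assumes "T \<in> compacts" "0 \<in> Q" "\<And>x y. x \<in> Q \<Longrightarrow> y \<in> Q \<Longrightarrow> x + y \<in> Q"
    and "\<And>c i j. c *\<^sub>C munit i j \<in> Q" "closed Q"
  shows "T \<in> Q"
proof -
  have "trunc n * T * trunc m \<in> Q" for n m
    unfolding trunc_sandwich by (intro closed_sum_mem assms)
  hence "trunc n * T \<in> Q" for n
    using closed_sequentially[OF assms(5) _ trunc_row_tendsto] by blast
  thus ?thesis using closed_sequentially[OF assms(5) _ trunc_compact_tendsto[OF assms(1)]] by blast
qed

lemma diagonal_compacts_induct: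
  assumes "T \<in> diagonal_compacts" "0 \<in> Q" "\<And>x y. x \<in> Q \<Longrightarrow> y \<in> Q \<Longrightarrow> x + y \<in> Q"
    and "\<And>c i. c *\<^sub>C munit i i \<in> Q" "closed Q"
  shows "T \<in> Q"
proof -
  have T: "T \<in> compacts" and d: "mel T i j = 0" if "i \<noteq> j" for i j
    using assms(1) that by (auto simp: diagonal_compacts_def mel_def)
  have "munit i i * T = mel T i i *\<^sub>C munit i i" for i
  proof (rule cop_eqI_ket, rule ell2_eqI)
    fix j k
    show "coord (app (munit i i * T) (ket j)) k = coord (app (mel T i i *\<^sub>C munit i i) (ket j)) k"
      using d[of i j] by (auto simp: app_munit app_munit_ket app_scaleC_cop coord_ket mel_def)
  qed
  hence "trunc n * T = (\<Sum>i<n. mel T i i *\<^sub>C munit i i)" for n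
    by (simp add: trunc_def sum_distrib_right)
  moreover have "(\<Sum>i<n. mel T i i *\<^sub>C munit i i) \<in> Q" for n by (intro closed_sum_mem assms)
  ultimately have "trunc n * T \<in> Q" for n by simp
  moreover have "T \<in> compacts" using assms(1) by (auto simp: diagonal_compacts_def)
  ultimately show ?thesis using closed_sequentially[OF assms(5) _ trunc_compact_tendsto] by blast
qed

lemma munit_compact: "munit i j \<in> compacts"
proof -
  have c: "compact ((\<lambda>c. c *\<^sub>C ket i) ` cball 0 1)"
  proof (rule compact_continuous_image)
    have "bounded_linear (\<lambda>c. c *\<^sub>C ket i)"
      by (rule bounded_linear_intro[where K = 1])
        (auto intro!: ell2_eqI simp: algebra_simps scaleR_conv_of_real)
    thus "continuous_on (cball 0 1) (\<lambda>c. c *\<^sub>C ket i)" by (rule linear_continuous_on)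
  qed simp
  have "app (munit i j) ` cball 0 1 \<subseteq> (\<lambda>c. c *\<^sub>C ket i) ` cball 0 1"
    by (auto simp: app_munit intro!: order_trans[OF cmod_coord_le] imageI)
  hence "closure (app (munit i j) ` cball 0 1) \<subseteq> (\<lambda>c. c *\<^sub>C ket i) ` cball 0 1"
    by (rule closure_minimal) (rule compact_imp_closed[OF c])
  hence "compact (closure (app (munit i j) ` cball 0 1))"
    using compact_Int_closed[OF c closed_closure, of "app (munit i j) ` cball 0 1"] by (simp add: Int_absorb1)
  thus ?thesis by (simp add: compacts_def)
qed

lemma munit_diagonal_compact: "munit i i \<in> diagonal_compacts"
  by (auto simp: diagonal_compacts_def munit_compact app_munit_ket coord_ket)

subsection \<open>Stabilization\<close>

lemma tensor_in_cstar_tensor: "S \<in> E \<Longrightarrow> T \<in> F \<Longrightarrow> S \<otimes>\<^sub>o T \<in> E \<otimes>\<^sub>* F"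
  unfolding cstar_tensor_def by (rule subsetD[OF closure_subset]) (auto intro: span_base)

lemma star_subalgebra_closure:
  assumes "star_subalgebra E" shows "star_subalgebra (closure (E :: 'i cop set))"
  unfolding star_subalgebra_def
proof (intro conjI ballI allI)
  show "0 \<in> closure E" using assms closure_subset[of E] by (auto simp: star_subalgebra_def)
next
  fix x y assume "x \<in> closure E" "y \<in> closure E"
  then obtain f g where "\<And>n. f n \<in> E" "f \<longlonglongrightarrow> x" "\<And>n. g n \<in> E" "g \<longlonglongrightarrow> y"
    unfolding closure_sequential by blast
  hence "\<And>n. f n + g n \<in> E" "\<And>n. f n * g n \<in> E" "(\<lambda>n. f n + g n) \<longlonglongrightarrow> x + y" "(\<lambda>n. f n * g n) \<longlonglongrightarrow> x * y"
    using assms by (auto simp: star_subalgebra_def intro: tendsto_add tendsto_mult)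
  hence *: "(\<forall>n. f n + g n \<in> E) \<and> (\<lambda>n. f n + g n) \<longlonglongrightarrow> x + y"
    "(\<forall>n. f n * g n \<in> E) \<and> (\<lambda>n. f n * g n) \<longlonglongrightarrow> x * y" by auto
  show "x + y \<in> closure E" unfolding closure_sequential using *(1) by (rule exI[of _ "\<lambda>n. f n + g n"])
  show "x * y \<in> closure E" unfolding closure_sequential using *(2) by (rule exI[of _ "\<lambda>n. f n * g n"])
next
  fix x assume "x \<in> closure E"
  then obtain f where f: "\<And>n. f n \<in> E" "f \<longlonglongrightarrow> x" unfolding closure_sequential by blast
  have "(\<forall>n. adj (f n) \<in> E) \<and> (\<lambda>n. adj (f n)) \<longlonglongrightarrow> adj x"
    using f assms norm_adj_tendsto by (auto simp: star_subalgebra_def)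
  thus "adj x \<in> closure E" unfolding closure_sequential by (rule exI[of _ "\<lambda>n. adj (f n)"])
  fix c
  have "bounded_linear (\<lambda>x :: 'i cop. c *\<^sub>C x)"
    by (rule bounded_linear_intro[where K = "cmod c"])
      (auto simp: scaleC_add_right scaleR_eq_scaleC_cop scaleC_scaleC mult.commute)
  hence "(\<forall>n. c *\<^sub>C f n \<in> E) \<and> (\<lambda>n. c *\<^sub>C f n) \<longlonglongrightarrow> c *\<^sub>C x"
    using f assms bounded_linear.tendsto by (auto simp: star_subalgebra_def)
  thus "c *\<^sub>C x \<in> closure E" unfolding closure_sequential by (rule exI[of _ "\<lambda>n. c *\<^sub>C f n"])
qed

lemma star_subalgebra_span:
  assumes "\<And>x y. x \<in> M \<Longrightarrow> y \<in> M \<Longrightarrow> x * y \<in> M" "\<And>x. x \<in> M \<Longrightarrow> adj x \<in> M"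
    and "\<And>c x. x \<in> M \<Longrightarrow> c *\<^sub>C x \<in> M"
  shows "star_subalgebra (span (M :: 'i cop set))"
proof -
  have m: "x * y \<in> span M" if "x \<in> span M" "y \<in> span M" for x y
  proof -
    have *: "x * y \<in> span M" if "x \<in> M" "y \<in> span M" for x y
      using that(2)
    proof (induction rule: span_induct_alt)
      case (step c z w)
      thus ?case using assms(1)[OF that(1)] by (auto simp: distrib_left intro: span_add span_scale span_base)
    qed (simp add: span_zero)
    show ?thesis using that(1)
    proof (induction x rule: span_induct_alt)
      case (step c z w)
      thus ?case using *[of z y] that(2) by (auto simp: distrib_right intro: span_add span_scale)
    qed (simp add: span_zero)
  qed
  have a: "adj x \<in> span M" if "x \<in> span M" for x using that
  proof (induction rule: span_induct_alt)
    case (step c z w)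
    have "adj (c *\<^sub>R z) = c *\<^sub>R adj z" by (simp add: scaleR_eq_scaleC_cop adj_scaleC)
    thus ?case using step assms(2) by (auto simp: adj_add intro: span_add span_scale span_base)
  qed (simp add: span_zero)
  have s: "d *\<^sub>C x \<in> span M" if "x \<in> span M" for x d using that
  proof (induction rule: span_induct_alt)
    case (step c z w)
    have "d *\<^sub>C (c *\<^sub>R z) = c *\<^sub>R d *\<^sub>C z"
      by (simp add: scaleR_eq_scaleC_cop scaleC_scaleC mult.commute)
    moreover have "c *\<^sub>R d *\<^sub>C z \<in> span M" using step(1) assms(3) by (intro span_scale span_base)
    ultimately show ?case using step(2) by (simp add: scaleC_add_right span_add)
  qed (simp add: span_zero)
  show ?thesis using m a s by (auto simp: star_subalgebra_def span_zero span_add)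
qed

text \<open>Stated for an abstract set \<open>U\<close> of units in order to serve both the matrix
  units of the compacts and the diagonal ones. The last hypothesis is an induction principle which
  says that \<open>U\<close> spans a dense subspace of \<open>K\<close>.\<close>

lemma tensor_generated_eq:
  fixes U :: "'j cop set" and K :: "'j cop set"
  assumes E: "star_subalgebra E" and U: "U \<subseteq> K"
    and Um: "\<And>u v. u \<in> U \<Longrightarrow> v \<in> U \<Longrightarrow> u * v \<in> U \<or> u * v = 0" and Ua: "\<And>u. u \<in> U \<Longrightarrow> adj u \<in> U"
    and K: "\<And>T Q. T \<in> K \<Longrightarrow> 0 \<in> Q \<Longrightarrow> (\<And>x y. x \<in> Q \<Longrightarrow> y \<in> Q \<Longrightarrow> x + y \<in> Q) \<Longrightarrow>
      (\<And>c u. u \<in> U \<Longrightarrow> c *\<^sub>C u \<in> Q) \<Longrightarrow> closed Q \<Longrightarrow> T \<in> Q"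
  shows "E \<otimes>\<^sub>* K = cstar_generated {x \<otimes>\<^sub>o u | x u. x \<in> E \<and> u \<in> U}" (is "_ = cstar_generated ?M")
proof
  let ?G = "cstar_generated ?M"
  note G = star_subalgebra_cstar_generated[of ?M]
  have M: "x \<otimes>\<^sub>o u \<in> ?G" if "x \<in> E" "u \<in> U" for x u
    using that cstar_generated_superset[of ?M] by blast
  have 1: "S \<otimes>\<^sub>o T \<in> ?G" if "S \<in> E" "T \<in> K" for S T
  proof -
    have "T \<in> (\<lambda>T. S \<otimes>\<^sub>o T) -` ?G"
    proof (rule K[OF that(2)])
      show "closed ((\<lambda>T. S \<otimes>\<^sub>o T) -` ?G)"
        by (rule continuous_closed_vimage)
          (auto intro: linear_continuous_at[OF bounded_linear_tensor_right])
    qed (use M that(1) E in \<open>auto simp: tensor_add_right tensor_scaleC_right sub_zero[OF G] sub_add[OF G] sub_scaleC[OF G]\<close>)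
    thus ?thesis by simp
  qed
  have "span {S \<otimes>\<^sub>o T | S T. S \<in> E \<and> T \<in> K} \<subseteq> ?G"
  proof (rule span_minimal)
    show "subspace ?G" using G by (auto simp: subspace_def star_subalgebra_def scaleR_eq_scaleC_cop)
  qed (use 1 in auto)
  thus "E \<otimes>\<^sub>* K \<subseteq> ?G" unfolding cstar_tensor_def by (rule closure_minimal) simp
next
  \<comment> \<open>Products of units may vanish, so 0 is added to make the set of elementary
    tensors closed under multiplication; the span stays the same.\<close>
  have s: "star_subalgebra (span (insert 0 ?M))"
  proof (rule star_subalgebra_span)
    show "x * y \<in> insert 0 ?M" if "x \<in> insert 0 ?M" "y \<in> insert 0 ?M" for x y
    proof (cases "x = 0 \<or> y = 0")
      case False
      then obtain a u b v where "x = a \<otimes>\<^sub>o u" "y = b \<otimes>\<^sub>o v" "a \<in> E" "b \<in> E" "u \<in> U" "v \<in> U"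
        using \<open>x \<in> insert 0 ?M\<close> \<open>y \<in> insert 0 ?M\<close> by blast
      thus ?thesis using Um[of u v] sub_mult[OF E] by (auto simp: tensor_mult)
    qed auto
    show "adj x \<in> insert 0 ?M" if "x \<in> insert 0 ?M" for x
      using that Ua sub_adj[OF E] by (auto 4 4 simp: tensor_adj)
    show "c *\<^sub>C x \<in> insert 0 ?M" if "x \<in> insert 0 ?M" for c x
    proof (cases "x = 0")
      case False
      then obtain a u where "x = a \<otimes>\<^sub>o u" "a \<in> E" "u \<in> U" using \<open>x \<in> insert 0 ?M\<close> by blast
      thus ?thesis using sub_scaleC[OF E, of a c] by (auto simp: tensor_scaleC_left[symmetric])
    qed simp
  qed
  have "?M \<subseteq> closure (span (insert 0 ?M))"
    by (rule order_trans[OF subset_insertI order_trans[OF span_superset closure_subset]])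
  hence "cstar_generated ?M \<subseteq> closure (span (insert 0 ?M))"
    by (rule cstar_generated_minimal[OF _ star_subalgebra_closure[OF s]]) simp
  also have "\<dots> \<subseteq> E \<otimes>\<^sub>* K"
    unfolding cstar_tensor_def span_insert_0 by (intro closure_mono span_mono) (use U in auto)
  finally show "cstar_generated ?M \<subseteq> E \<otimes>\<^sub>* K" .
qed

lemma tensor_compacts:
  "star_subalgebra E \<Longrightarrow> E \<otimes>\<^sub>* compacts = cstar_generated {x \<otimes>\<^sub>o u | x u. x \<in> E \<and> u \<in> {munit i j | i j. True}}"
proof (rule tensor_generated_eq)
  fix T and Q :: "nat cop set" assume T: "T \<in> compacts" and Q: "0 \<in> Q" "\<And>x y. x \<in> Q \<Longrightarrow> y \<in> Q \<Longrightarrow> x + y \<in> Q"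
    "\<And>c u. u \<in> {munit i j | i j. True} \<Longrightarrow> c *\<^sub>C u \<in> Q" "closed Q"
  show "T \<in> Q" by (rule compacts_induct[OF T Q(1,2) Q(3) Q(4)]) auto
next
  fix u v :: "nat cop" assume "u \<in> {munit i j | i j. True}" "v \<in> {munit i j | i j. True}"
  then obtain i j k l where "u = munit i j" "v = munit k l" by blast
  thus "u * v \<in> {munit i j | i j. True} \<or> u * v = 0" by (cases "j = k") (auto simp: munit_mult)
next
  fix u :: "nat cop" assume "u \<in> {munit i j | i j. True}"
  then obtain i j where "u = munit i j" by blast
  hence "adj u = munit j i" by simp
  thus "adj u \<in> {munit i j | i j. True}" by blast
qed (auto simp: munit_compact)

lemma tensor_diagonal_compacts:
  "star_subalgebra E \<Longrightarrow> E \<otimes>\<^sub>* diagonal_compacts = cstar_generated {x \<otimes>\<^sub>o u | x u. x \<in> E \<and> u \<in> range (\<lambda>i. munit i i)}"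
proof (rule tensor_generated_eq)
  fix T and Q :: "nat cop set" assume T: "T \<in> diagonal_compacts" and Q: "0 \<in> Q" "\<And>x y. x \<in> Q \<Longrightarrow> y \<in> Q \<Longrightarrow> x + y \<in> Q"
    "\<And>c u. u \<in> range (\<lambda>i. munit i i) \<Longrightarrow> c *\<^sub>C u \<in> Q" "closed Q"
  show "T \<in> Q" by (rule diagonal_compacts_induct[OF T Q(1,2) Q(3) Q(4)]) auto
qed (auto simp: munit_diagonal_compact munit_mult)

text \<open>Units are partial isometries, so \<open>(x * y) \<otimes> u\<close> is the product of
  \<open>x \<otimes> (u * adj u)\<close> and \<open>y \<otimes> u\<close>. Hence the elements
  \<open>x\<close> with all \<open>x \<otimes> u\<close> in the algebra on the right are closed
  under products.\<close>

lemma tensor_generators: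
  fixes V :: "'i cop set" and U :: "'j cop set"
  assumes U: "\<And>u. u \<in> U \<Longrightarrow> u * adj u \<in> U \<and> adj u \<in> U" "\<And>u. u \<in> U \<Longrightarrow> u * adj u * u = u"
  shows "cstar_generated {x \<otimes>\<^sub>o u | x u. x \<in> cstar_generated V \<and> u \<in> U} =
    cstar_generated {x \<otimes>\<^sub>o u | x u. x \<in> V \<and> u \<in> U}" (is "cstar_generated ?L = cstar_generated ?R")
proof
  let ?G = "cstar_generated ?R"
  note G = star_subalgebra_cstar_generated[of ?R]
  let ?E = "{x. \<forall>u\<in>U. x \<otimes>\<^sub>o u \<in> ?G}"
  have "cstar_generated V \<subseteq> ?E"
  proof (rule cstar_generated_minimal)
    show "V \<subseteq> ?E" using cstar_generated_superset[of ?R] by blast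
    have "?E = (\<Inter>u\<in>U. (\<lambda>x. x \<otimes>\<^sub>o u) -` ?G)" by auto
    moreover have "closed ((\<lambda>x. x \<otimes>\<^sub>o u) -` ?G)" for u
      by (rule continuous_closed_vimage)
        (auto intro: linear_continuous_at[OF bounded_linear_tensor_left])
    ultimately show "closed ?E" by auto
    have "(x * y) \<otimes>\<^sub>o u \<in> ?G" if "x \<in> ?E" "y \<in> ?E" "u \<in> U" for x y u
    proof -
      have 1: "(x * y) \<otimes>\<^sub>o u = (x \<otimes>\<^sub>o (u * adj u)) * (y \<otimes>\<^sub>o u)" using U that by (simp add: tensor_mult)
      have "x \<otimes>\<^sub>o (u * adj u) \<in> ?G" "y \<otimes>\<^sub>o u \<in> ?G" using U that by auto
      thus ?thesis unfolding 1 by (rule sub_mult[OF G])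
    qed
    moreover have "adj x \<otimes>\<^sub>o u \<in> ?G" if "x \<in> ?E" "u \<in> U" for x u
    proof -
      have "x \<otimes>\<^sub>o adj u \<in> ?G" using that U by auto
      hence "adj (x \<otimes>\<^sub>o adj u) \<in> ?G" by (rule sub_adj[OF G])
      thus ?thesis by (simp add: tensor_adj adj_adj)
    qed
    ultimately show "star_subalgebra ?E"
      using G by (auto simp: star_subalgebra_def tensor_add_left tensor_scaleC_left)
  qed
  thus "cstar_generated ?L \<subseteq> ?G" by (intro cstar_generated_minimal) auto
  have "?R \<subseteq> cstar_generated ?L"
    using cstar_generated_superset[of V] cstar_generated_superset[of ?L] by blast
  thus "?G \<subseteq> cstar_generated ?L" by (rule cstar_generated_minimal) auto
qed

lemma stabilization_generators:
  "cstar_generated V \<otimes>\<^sub>* compacts = cstar_generated {x \<otimes>\<^sub>o munit i j | x i j. x \<in> V}"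
proof -
  have *: "u * adj u \<in> {munit i j | i j. True} \<and> adj u \<in> {munit i j | i j. True} \<and> u * adj u * u = u"
    if u: "u \<in> {munit i j | i j. True}" for u :: "nat cop"
  proof -
    obtain i j where "u = munit i j" using u by blast
    hence "u * adj u = munit i i" "adj u = munit j i" "u * adj u * u = u" by (simp_all add: munit_mult)
    moreover have "munit k l \<in> {munit i j | i j. True}" for k l :: nat by blast
    ultimately show ?thesis by (simp only: simp_thms)
  qed
  have "{x \<otimes>\<^sub>o u | x u. x \<in> V \<and> u \<in> {munit i j | i j. True}} = {x \<otimes>\<^sub>o (munit i j :: nat cop) | x i j. x \<in> V}"
    by blast
  moreover have "cstar_generated {x \<otimes>\<^sub>o u | x u. x \<in> cstar_generated V \<and> u \<in> {munit i j | i j. True}} =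
    cstar_generated {x \<otimes>\<^sub>o u | x u. x \<in> V \<and> u \<in> {munit i j :: nat cop | i j. True}}"
    by (rule tensor_generators) (use * in blast)+
  ultimately show ?thesis
    by (simp only: tensor_compacts[OF star_subalgebra_cstar_generated])
qed

lemma diagonal_stabilization_generators:
  "cstar_generated V \<otimes>\<^sub>* diagonal_compacts = cstar_generated {x \<otimes>\<^sub>o munit i i | x i. x \<in> V}"
proof -
  have "{x \<otimes>\<^sub>o u | x u. x \<in> V \<and> u \<in> range (\<lambda>i. munit i i)} = {x \<otimes>\<^sub>o (munit i i :: nat cop) | x i. x \<in> V}"
    by blast
  moreover have "cstar_generated {x \<otimes>\<^sub>o u | x u. x \<in> cstar_generated V \<and> u \<in> range (\<lambda>i. munit i i)} =
    cstar_generated {x \<otimes>\<^sub>o u | x u. x \<in> V \<and> u \<in> range (\<lambda>i. munit i i :: nat cop)}"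
    by (rule tensor_generators) (auto simp: munit_mult)
  ultimately show ?thesis
    by (simp only: tensor_diagonal_compacts[OF star_subalgebra_cstar_generated])
qed

subsection \<open>Relations in Cuntz-Krieger families\<close>

text \<open>The form in which irreducibility is applied: a set of vertices that contains
  \<open>i\<close> and is closed under successors contains everything reachable from
  \<open>i\<close>.\<close>

lemma card_matrix_power_pos:
  fixes A :: "nat ^ 'n ^ 'n"
  assumes "(((\<lambda>X. A ** X) ^^ n) (mat 1)) $ i $ j > 0" "i \<in> Z"
    and "\<And>k l. k \<in> Z \<Longrightarrow> A $ k $ l > 0 \<Longrightarrow> l \<in> Z"
  shows "j \<in> Z"
  using assms(1,2)
proof (induction n arbitrary: i)
  case 0
  thus ?case by (auto simp: mat_def split: if_splits)
next
  case (Suc n)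
  have "(\<Sum>k\<in>UNIV. A $ i $ k * ((\<lambda>X. A ** X) ^^ n) (mat 1) $ k $ j) > 0"
    using Suc.prems(1) by (simp add: matrix_matrix_mult_def)
  hence "\<exists>k. A $ i $ k * ((\<lambda>X. A ** X) ^^ n) (mat 1) $ k $ j \<noteq> 0"
    by (metis (no_types, lifting) less_numeral_extra(3) sum.neutral)
  then obtain k where k: "A $ i $ k > 0" "((\<lambda>X. A ** X) ^^ n) (mat 1) $ k $ j > 0" by auto
  thus ?case using Suc.IH[OF k(2)] assms(3)[OF Suc.prems(2) k(1)] by auto
qed

lemma irreducible_row:
  assumes "irreducible_matrix A" shows "\<exists>j. A $ i $ j > 0"
proof (rule ccontr)
  assume c: "\<nexists>j. A $ i $ j > 0"
  obtain n where n: "n \<ge> 1" "(((\<lambda>X. A ** X) ^^ n) (mat 1)) $ i $ i > 0"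
    using assms unfolding irreducible_matrix_def by blast
  then obtain m where m: "n = Suc m" by (cases n) auto
  have "(\<Sum>k\<in>UNIV. A $ i $ k * ((\<lambda>X. A ** X) ^^ m) (mat 1) $ k $ i) > 0"
    using n(2) by (simp add: matrix_matrix_mult_def m)
  thus False using c by simp
qed

lemma irreducible_column:
  assumes "irreducible_matrix A" shows "\<exists>i. A $ i $ j > 0"
proof (rule ccontr)
  assume c: "\<nexists>i. A $ i $ j > 0"
  obtain n where n: "n \<ge> 1" "(((\<lambda>X. A ** X) ^^ n) (mat 1)) $ j $ j > 0"
    using assms unfolding irreducible_matrix_def by blast
  \<comment> \<open>Powers grow by a factor on the left, so a zero column of \<open>A\<close>
    remains zero in all of them.\<close>
  have "(((\<lambda>X. A ** X) ^^ Suc m) (mat 1)) $ i $ j = 0" for m i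
  proof (induction m arbitrary: i)
    case 0
    thus ?case using c by (simp add: matrix_mul_rid del: One_nat_def)
  next
    case (Suc m)
    have "((\<lambda>X. A ** X) ^^ Suc (Suc m)) (mat 1) $ i $ j =
        (\<Sum>k\<in>UNIV. A $ i $ k * ((\<lambda>X. A ** X) ^^ Suc m) (mat 1) $ k $ j)"
      by (simp add: matrix_matrix_mult_def)
    thus ?case using Suc by simp
  qed
  thus False using n by (metis One_nat_def Suc_le_D less_irrefl)
qed

lemma edge_exists: "A $ i $ j > 0 \<Longrightarrow> \<exists>a\<in>edges A. src a = i \<and> tgt a = j"
  by (rule bexI[of _ "(i, j, 0)"]) (auto simp: edges_def src_def tgt_def)

text \<open>Compressing the sum by \<open>p j\<close> shows that \<open>p j\<close> is
  \<open>p j\<close> plus the sum of the positive operators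
  \<open>adj (p i * p j) * (p i * p j)\<close> over the other \<open>i\<close>. A vanishing sum of
  positive operators has vanishing terms.\<close>

lemma sum_orthogonal_projections:
  fixes p :: "'a \<Rightarrow> 'i cop"
  assumes "finite I" "(\<Sum>i\<in>I. p i) = 1" "\<And>i. i \<in> I \<Longrightarrow> p i * p i = p i \<and> adj (p i) = p i"
    and "i \<in> I" "j \<in> I" "i \<noteq> j"
  shows "p i * p j = 0"
proof -
  have "p j = p j * (\<Sum>i\<in>I. p i) * p j" using assms(2,3,5) by simp
  also have "\<dots> = (\<Sum>i\<in>I. adj (p i * p j) * (p i * p j))"
    unfolding sum_distrib_left sum_distrib_right
    by (intro sum.cong refl) (use assms(3,5) in \<open>simp add: adj_mult mult.assoc\<close>, metis assms(3) mult.assoc)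
  also have "\<dots> = adj (p j * p j) * (p j * p j) + (\<Sum>i\<in>I - {j}. adj (p i * p j) * (p i * p j))"
    using assms(1,5) by (rule sum.remove)
  also have "adj (p j * p j) * (p j * p j) = p j" using assms(3,5) by simp
  finally have "(\<Sum>i\<in>I - {j}. adj (p i * p j) * (p i * p j)) = 0" by simp
  from sum_adj_mult_eq_0[OF _ this, of i] show ?thesis using assms by auto
qed

locale cuntz_krieger =
  fixes A :: "nat ^ 'n ^ 'n" and S :: "('n, 'n) edge \<Rightarrow> 'i cop"
  assumes family: "ck_family A S"
begin

definition vproj :: "'n \<Rightarrow> 'i cop" where
  "vproj v = (\<Sum>b | b \<in> edges A \<and> src b = v. S b * adj (S b))"

lemma partial_isometry: "a \<in> edges A \<Longrightarrow> S a * adj (S a) * S a = S a"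
  and sum_range_proj: "(\<Sum>b\<in>edges A. S b * adj (S b)) = 1"
  and source_proj: "a \<in> edges A \<Longrightarrow> adj (S a) * S a = vproj (tgt a)"
  using family by (auto simp: ck_family_def vproj_def)

lemma norm_gen: "a \<in> edges A \<Longrightarrow> norm (S a) \<le> 1"
  using partial_isometry partial_isometry_norm_le by blast

lemma range_proj_orthogonal:
  assumes "a \<in> edges A" "b \<in> edges A" "a \<noteq> b"
  shows "(S a * adj (S a)) * (S b * adj (S b)) = 0"
  by (rule sum_orthogonal_projections[OF finite_edges sum_range_proj _ assms])
    (auto simp: adj_mult adj_adj mult.assoc[symmetric] partial_isometry)

lemma adj_gen_mult:
  assumes "a \<in> edges A" "b \<in> edges A"
  shows "adj (S a) * S b = (if a = b then vproj (tgt a) else 0)"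
proof (cases "a = b")
  case False
  have "adj (S a) * S b = adj (S a * adj (S a) * S a) * (S b * adj (S b) * S b)"
    using assms by (simp add: partial_isometry)
  also have "\<dots> = adj (S a) * ((S a * adj (S a)) * (S b * adj (S b))) * S b"
    by (simp add: adj_mult adj_adj mult.assoc)
  finally show ?thesis using False assms by (simp add: range_proj_orthogonal)
qed (use assms source_proj in simp)

lemma vproj_gen:
  assumes "a \<in> edges A" shows "vproj v * S a = (if src a = v then S a else 0)"
proof -
  have "vproj v * S a = (\<Sum>b | b \<in> edges A \<and> src b = v. if b = a then S a else 0)"
    unfolding vproj_def sum_distrib_right
    by (intro sum.cong refl) (use assms adj_gen_mult partial_isometry source_proj in \<open>auto simp: mult.assoc\<close>)
  thus ?thesis using assms by (auto simp: sum.delta)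
qed

lemma adj_vproj [simp]: "adj (vproj v) = vproj v"
  by (simp add: vproj_def adj_sum adj_mult adj_adj)

lemma vproj_mult: "vproj v * vproj w = (if v = w then vproj v else 0)"
proof -
  have "vproj v * vproj w = (\<Sum>b | b \<in> edges A \<and> src b = w. if v = w then S b * adj (S b) else 0)"
    unfolding vproj_def[of w] sum_distrib_left
    by (intro sum.cong refl) (auto simp: mult.assoc[symmetric] vproj_gen)
  thus ?thesis by (auto simp: vproj_def)
qed

lemma vproj_idem [simp]: "vproj v * vproj v = vproj v" by (simp add: vproj_mult)

lemma adj_gen_vproj: "a \<in> edges A \<Longrightarrow> adj (S a) * vproj v = (if src a = v then adj (S a) else 0)"
  using arg_cong[OF vproj_gen, of a adj v] by (auto simp: adj_mult split: if_splits)

lemma gen_vproj: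
  assumes "a \<in> edges A" shows "S a * vproj v = (if tgt a = v then S a else 0)"
proof -
  have "S a * vproj v = S a * (adj (S a) * S a) * vproj v"
    using partial_isometry[OF assms] by (simp add: mult.assoc[symmetric])
  also have "\<dots> = S a * (vproj (tgt a) * vproj v)" using source_proj[OF assms] by (simp add: mult.assoc)
  also have "\<dots> = (if tgt a = v then S a else 0)"
    using partial_isometry[OF assms] source_proj[OF assms] by (auto simp: vproj_mult mult.assoc)
  finally show ?thesis .
qed

lemma vproj_adj_gen: "a \<in> edges A \<Longrightarrow> vproj v * adj (S a) = (if tgt a = v then adj (S a) else 0)"
  using arg_cong[OF gen_vproj, of a adj v] by (auto simp: adj_mult split: if_splits)

lemma sum_vproj: "(\<Sum>v\<in>UNIV. vproj v) = 1"
proof -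
  have "(\<Sum>v\<in>UNIV. vproj v) = (\<Sum>v\<in>UNIV. sum (\<lambda>b. S b * adj (S b)) {b \<in> edges A. src b = v})"
    by (simp add: vproj_def)
  also have "\<dots> = (\<Sum>b\<in>edges A. S b * adj (S b))" by (rule sum.group) auto
  finally show ?thesis by (simp add: sum_range_proj)
qed

text \<open>A vanishing vertex projection kills the generators that leave the vertex, and with them
  the projections at their ends. By irreducibility all vertex projections would vanish, but they sum
  to 1.\<close>

lemma vproj_nonzero:
  assumes "irreducible_matrix A" shows "vproj v \<noteq> 0"
proof
  assume v: "vproj v = 0"
  have step: "vproj l = 0" if z: "vproj k = 0" and e: "A $ k $ l > 0" for k l
  proof -
    obtain a where a: "a \<in> edges A" "src a = k" "tgt a = l" using edge_exists[OF e] by blast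
    have "S a = 0" using vproj_gen[OF a(1), of k] a(2) z by simp
    thus ?thesis using source_proj[OF a(1)] a(3) by simp
  qed
  have "vproj w = 0" for w
  proof -
    obtain n where "((\<lambda>X. A ** X) ^^ n) (mat 1) $ v $ w > 0"
      using assms unfolding irreducible_matrix_def by blast
    from card_matrix_power_pos[OF this, of "{v. vproj v = 0}"] show ?thesis using v step by auto
  qed
  thus False using sum_vproj by simp
qed

definition word :: "('n, 'n) edge list \<Rightarrow> 'i cop" where "word \<mu> = prod_list (map S \<mu>)"

definition wproj :: "('n, 'n) edge list \<Rightarrow> 'i cop" where "wproj \<mu> = word \<mu> * adj (word \<mu>)"

lemma word_simps [simp]: "word [] = 1" "word (a # \<mu>) = S a * word \<mu>" "word (\<mu> @ \<nu>) = word \<mu> * word \<nu>"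
  by (simp_all add: word_def)

end

lemma finite_paths_Cons:
  "a # \<mu> \<in> finite_paths A \<longleftrightarrow> a \<in> edges A \<and> (\<mu> = [] \<or> \<mu> \<in> finite_paths A \<and> tgt a = src (hd \<mu>))"
proof (cases \<mu>)
  case (Cons b \<nu>)
  have "(\<forall>k. Suc k < length (a # \<mu>) \<longrightarrow> tgt ((a # \<mu>) ! k) = src ((a # \<mu>) ! Suc k)) \<longleftrightarrow>
    tgt a = src b \<and> (\<forall>k. Suc k < length \<mu> \<longrightarrow> tgt (\<mu> ! k) = src (\<mu> ! Suc k))"
    (is "?L = ?R")
  proof
    assume L: ?L
    show ?R using L[rule_format, of 0] L[rule_format, of "Suc _"] by (auto simp: Cons)
  next
    assume R: ?R
    show ?L
    proof (intro allI impI)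
      fix k assume "Suc k < length (a # \<mu>)"
      thus "tgt ((a # \<mu>) ! k) = src ((a # \<mu>) ! Suc k)" using R by (cases k) (auto simp: Cons)
    qed
  qed
  thus ?thesis by (auto simp: finite_paths_def Cons)
qed (auto simp: finite_paths_def)

lemma finite_paths_edges: "\<mu> \<in> finite_paths A \<Longrightarrow> set \<mu> \<subseteq> edges A"
  and finite_paths_nonempty: "\<mu> \<in> finite_paths A \<Longrightarrow> \<mu> \<noteq> []"
  by (auto simp: finite_paths_def)

lemma finite_paths_append:
  assumes "\<mu> \<noteq> []" "\<nu> \<noteq> []"
  shows "\<mu> @ \<nu> \<in> finite_paths A \<longleftrightarrow> \<mu> \<in> finite_paths A \<and> \<nu> \<in> finite_paths A \<and> tgt (last \<mu>) = src (hd \<nu>)"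
  using assms(1)
proof (induction \<mu>)
  case (Cons a \<mu>)
  thus ?case using assms(2) by (cases "\<mu> = []") (auto simp: finite_paths_Cons)
qed simp

text \<open>Paths are nonempty, so \<open>paths A 0\<close> is empty; this is why levels are
  required to be at least 1 below.\<close>

definition paths :: "nat ^ 'n ^ 'n \<Rightarrow> nat \<Rightarrow> ('n, 'n) edge list set" where
  "paths A n = {\<mu> \<in> finite_paths A. length \<mu> = n}"

lemma finite_paths_finite [simp]: "finite (paths A n)"
proof (rule finite_subset)
  show "paths A n \<subseteq> {xs. set xs \<subseteq> edges A \<and> length xs = n}" by (auto simp: paths_def finite_paths_def)
qed (rule finite_lists_length_eq, simp)

lemma paths_1: "paths A 1 = (\<lambda>a. [a]) ` edges A"
proof -
  have "\<mu> \<in> paths A 1 \<longleftrightarrow> \<mu> \<in> (\<lambda>a. [a]) ` edges A" for \<mu>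
    by (cases \<mu>) (auto simp: paths_def finite_paths_Cons)
  thus ?thesis by blast
qed

lemma paths_Suc:
  assumes "n \<ge> 1"
  shows "paths A (Suc n) = (\<Union>\<mu>\<in>paths A n. (\<lambda>b. \<mu> @ [b]) ` {b \<in> edges A. src b = tgt (last \<mu>)})"
proof (intro equalityI subsetI)
  fix \<nu> assume "\<nu> \<in> paths A (Suc n)"
  hence \<nu>: "\<nu> \<in> finite_paths A" "length \<nu> = Suc n" by (auto simp: paths_def)
  then obtain \<mu> b where e: "\<nu> = \<mu> @ [b]" "length \<mu> = n" by (cases \<nu> rule: rev_cases) auto
  hence "\<mu> \<noteq> []" using assms by auto
  hence "\<mu> \<in> paths A n" "b \<in> edges A" "tgt (last \<mu>) = src b"
    using \<nu> e finite_paths_append[of \<mu> "[b]" A] by (auto simp: paths_def finite_paths_Cons)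
  thus "\<nu> \<in> (\<Union>\<mu>\<in>paths A n. (\<lambda>b. \<mu> @ [b]) ` {b \<in> edges A. src b = tgt (last \<mu>)})"
    unfolding e(1) by (intro UN_I[of \<mu>] image_eqI[of _ _ b]) auto
next
  fix \<nu> assume "\<nu> \<in> (\<Union>\<mu>\<in>paths A n. (\<lambda>b. \<mu> @ [b]) ` {b \<in> edges A. src b = tgt (last \<mu>)})"
  then obtain \<mu> b where e: "\<nu> = \<mu> @ [b]" "\<mu> \<in> paths A n" "b \<in> edges A" "src b = tgt (last \<mu>)" by auto
  moreover from e(2) have "\<mu> \<noteq> []" using assms by (auto simp: paths_def)
  ultimately show "\<nu> \<in> paths A (Suc n)"
    using finite_paths_append[of \<mu> "[b]" A] by (auto simp: paths_def finite_paths_Cons)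
qed

context cuntz_krieger begin

lemma word_last: "\<mu> \<in> finite_paths A \<Longrightarrow> word \<mu> * vproj (tgt (last \<mu>)) = word \<mu>"
proof (induction \<mu>)
  case (Cons a \<mu>)
  show ?case
  proof (cases "\<mu> = []")
    case False
    thus ?thesis using Cons by (simp add: finite_paths_Cons mult.assoc)
  qed (use Cons in \<open>simp add: finite_paths_Cons gen_vproj\<close>)
qed (simp add: finite_paths_def)

lemma hd_word: "\<mu> \<in> finite_paths A \<Longrightarrow> vproj v * word \<mu> = (if src (hd \<mu>) = v then word \<mu> else 0)"
  by (cases \<mu>) (auto simp: finite_paths_Cons finite_paths_def mult.assoc[symmetric] vproj_gen)

text \<open>Words of equal length cancel edge by edge, starting in the middle of the
  product.\<close>

lemma adj_word_mult:
  assumes "\<mu> \<in> finite_paths A" "\<nu> \<in> finite_paths A" "length \<mu> = length \<nu>"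
  shows "adj (word \<mu>) * word \<nu> = (if \<mu> = \<nu> then vproj (tgt (last \<mu>)) else 0)"
  using assms
proof (induction \<mu> arbitrary: \<nu>)
  case (Cons a \<mu>)
  then obtain b \<nu>' where \<nu>: "\<nu> = b # \<nu>'" by (cases \<nu>) auto
  have e: "a \<in> edges A" "b \<in> edges A" using Cons.prems by (auto simp: finite_paths_Cons \<nu>)
  have 1: "adj (word (a # \<mu>)) * word \<nu> = adj (word \<mu>) * (adj (S a) * S b) * word \<nu>'"
    by (simp add: \<nu> adj_mult mult.assoc)
  show ?case
  proof (cases "\<mu> = []")
    case True
    hence "\<nu>' = []" using Cons.prems \<nu> by auto
    thus ?thesis using 1 True e \<nu> by (simp add: adj_gen_mult)
  next
    case False
    hence p: "\<mu> \<in> finite_paths A" "tgt a = src (hd \<mu>)" "\<nu>' \<in> finite_paths A" "tgt b = src (hd \<nu>')"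
      using Cons.prems \<nu> by (auto simp: finite_paths_Cons)
    have "adj (word (a # \<mu>)) * word \<nu> = (if a = b then adj (word \<mu>) * word \<nu>' else 0)"
      unfolding 1 using e p by (auto simp: adj_gen_mult mult.assoc hd_word)
    thus ?thesis using Cons.IH[OF p(1) p(3)] Cons.prems(3) \<nu> False by auto
  qed
qed (simp add: finite_paths_def)

lemma word_partial_isometry: "\<mu> \<in> finite_paths A \<Longrightarrow> word \<mu> * adj (word \<mu>) * word \<mu> = word \<mu>"
  by (simp add: mult.assoc adj_word_mult word_last)

lemma wproj_idem: "\<mu> \<in> finite_paths A \<Longrightarrow> wproj \<mu> * wproj \<mu> = wproj \<mu>"
  unfolding wproj_def using word_partial_isometry by (simp add: mult.assoc[symmetric])

lemma adj_wproj [simp]: "adj (wproj \<mu>) = wproj \<mu>"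
  by (simp add: wproj_def adj_mult adj_adj)

lemma wproj_orthogonal:
  "\<mu> \<in> paths A n \<Longrightarrow> \<nu> \<in> paths A n \<Longrightarrow> \<mu> \<noteq> \<nu> \<Longrightarrow> wproj \<mu> * wproj \<nu> = 0"
  unfolding wproj_def using adj_word_mult[of \<mu> \<nu>]
  by (simp add: paths_def mult.assoc) (simp add: mult.assoc[symmetric])

lemma wproj_mult: "\<mu> \<in> paths A n \<Longrightarrow> \<nu> \<in> paths A n \<Longrightarrow> wproj \<mu> * wproj \<nu> = (if \<mu> = \<nu> then wproj \<mu> else 0)"
  using wproj_orthogonal wproj_idem by (auto simp: paths_def)

lemma wproj_split:
  assumes "\<mu> \<in> finite_paths A"
  shows "wproj \<mu> = (\<Sum>b | b \<in> edges A \<and> src b = tgt (last \<mu>). wproj (\<mu> @ [b]))"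
proof -
  have "(\<Sum>b | b \<in> edges A \<and> src b = tgt (last \<mu>). wproj (\<mu> @ [b])) = word \<mu> * vproj (tgt (last \<mu>)) * adj (word \<mu>)"
    by (simp add: wproj_def vproj_def sum_distrib_left sum_distrib_right adj_mult mult.assoc)
  thus ?thesis using word_last[OF assms] by (simp add: wproj_def)
qed

lemma sum_paths_Suc:
  assumes "n \<ge> 1"
  shows "(\<Sum>\<nu>\<in>paths A (Suc n). f \<nu>) = (\<Sum>\<mu>\<in>paths A n. \<Sum>b | b \<in> edges A \<and> src b = tgt (last \<mu>). f (\<mu> @ [b]))"
  unfolding paths_Suc[OF assms]
  by (subst sum.UNION_disjoint) (auto simp: sum.reindex inj_on_def)

lemma sum_wproj: "n \<ge> 1 \<Longrightarrow> (\<Sum>\<mu>\<in>paths A n. wproj \<mu>) = 1"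
proof (induction n rule: dec_induct)
  case base
  thus ?case using sum_range_proj unfolding paths_1 by (simp add: sum.reindex inj_on_def wproj_def)
next
  case (step n)
  have "(\<Sum>\<mu>\<in>paths A (Suc n). wproj \<mu>) = (\<Sum>\<mu>\<in>paths A n. wproj \<mu>)"
    using step(1) by (subst sum_paths_Suc) (auto intro!: sum.cong simp: wproj_split[symmetric] paths_def)
  thus ?case using step by simp
qed

lemma wproj_nonzero:
  assumes "irreducible_matrix A" "\<mu> \<in> finite_paths A" shows "wproj \<mu> \<noteq> 0"
proof
  assume "wproj \<mu> = 0"
  hence "adj (adj (word \<mu>)) * adj (word \<mu>) = 0" by (simp add: wproj_def adj_adj)
  hence "word \<mu> = 0" by (metis adj_mult_eq_0 adj_adj adj_zero)
  thus False using adj_word_mult[OF assms(2,2)] vproj_nonzero[OF assms(1)] by auto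
qed

end

subsection \<open>Existence of a Cuntz-Krieger family\<close>

lemma bij_countable_times_nat:
  assumes "countable X" "X \<noteq> {}"
  shows "bij_betw (to_nat_on (X \<times> (UNIV :: nat set))) (X \<times> UNIV) UNIV"
  using assms by (intro to_nat_on_infinite countable_SIGMA) (auto simp: finite_cartesian_product_iff)

text \<open>The basis is split into infinite sets, one for each edge. \<open>S a\<close> maps the
  span of the sets of all edges that start at the target of \<open>a\<close> onto the span of the
  set of \<open>a\<close>. Existence matters because the blocks of \<open>ck_gen\<close> with an
  improper index are filled with some family.\<close>

lemma ck_family_exists:
  fixes A :: "nat ^ 'n ^ 'n"
  assumes "\<And>i. \<exists>j. A $ i $ j > 0"
  shows "\<exists>S :: ('n, 'n) edge \<Rightarrow> nat cop. ck_family A S"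
proof -
  let ?E = "edges A"
  define g where "g = to_nat_on (?E \<times> (UNIV :: nat set))"
  have row: "\<exists>b\<in>?E. src b = v" for v using assms[of v] edge_exists by blast
  hence ne: "?E \<noteq> {}" by blast
  have g: "bij_betw g (?E \<times> UNIV) UNIV"
    unfolding g_def by (rule bij_countable_times_nat) (auto simp: ne countable_finite)
  define j where "j b n = g (b, n)" for b n
  have j: "inj (j b)" if "b \<in> ?E" for b
    using bij_betw_imp_inj_on[OF g] that by (auto simp: j_def inj_on_def)
  have jd: "b = c" if "j b m = j c n" "b \<in> ?E" "c \<in> ?E" for b c m n
    using inj_onD[OF bij_betw_imp_inj_on[OF g], of "(b, m)" "(c, n)"] that by (auto simp: j_def)
  have js: "\<exists>b\<in>?E. n \<in> range (j b)" for n
  proof -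
    have "n \<in> g ` (?E \<times> UNIV)" using g by (simp add: bij_betw_def)
    thus ?thesis by (auto simp: j_def)
  qed
  \<comment> \<open>\<open>R v\<close> is infinite because every vertex has an outgoing edge; its
    span will be the initial space of the generators that end at \<open>v\<close>.\<close>
  define R where "R v = (\<Union>b\<in>{b \<in> ?E. src b = v}. range (j b))" for v
  have inf: "infinite (R v)" for v
  proof -
    obtain b where "b \<in> ?E" "src b = v" using row by blast
    hence "range (j b) \<subseteq> R v" "infinite (range (j b))" using j by (auto simp: R_def finite_image_iff)
    thus ?thesis using infinite_super by blast
  qed
  define k where "k v = enumerate (R v)" for v
  have k: "inj (k v)" "range (k v) = R v" for v
    unfolding k_def using inf by (auto simp: range_enumerate strict_mono_enumerate strict_mono_imp_inj_on)
  define S where "S a = iso_op (j a) * adj (iso_op (k (tgt a)))" for a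
  have JJ: "adj (iso_op (j a)) * iso_op (j a) = 1" if "a \<in> ?E" for a
    using j[OF that] by (rule iso_op_adj_mult)
  have KK: "adj (iso_op (k v)) * iso_op (k v) = 1" for v
    using k(1) by (rule iso_op_adj_mult)
  have SS: "S a * adj (S a) = iso_op (j a) * adj (iso_op (j a))" for a
    unfolding S_def adj_mult adj_adj by (metis KK mult.assoc mult.right_neutral)
  have SS': "adj (S a) * S a = iso_op (k (tgt a)) * adj (iso_op (k (tgt a)))" if "a \<in> ?E" for a
    unfolding S_def adj_mult adj_adj by (metis JJ[OF that] mult.assoc mult.right_neutral)
  have "ck_family A S"
    unfolding ck_family_def
  proof (intro conjI ballI)
    fix a assume a: "a \<in> ?E"
    show "S a * adj (S a) * S a = S a"
      unfolding SS unfolding S_def by (metis JJ[OF a] mult.assoc mult.right_neutral)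
    show "adj (S a) * S a = (\<Sum>b | b \<in> ?E \<and> src b = tgt a. S b * adj (S b))"
    proof (rule cop_eqI_mel)
      fix m n
      show "mel (adj (S a) * S a) m n = mel (\<Sum>b | b \<in> ?E \<and> src b = tgt a. S b * adj (S b)) m n"
      proof (cases "m \<in> R (tgt a)")
        case True
        then obtain c where c: "c \<in> ?E" "src c = tgt a" "m \<in> range (j c)" by (auto simp: R_def)
        have "m \<in> range (j b) \<longleftrightarrow> b = c" if "b \<in> ?E" for b using c that jd by blast
        hence "mel (\<Sum>b | b \<in> ?E \<and> src b = tgt a. S b * adj (S b)) m n =
            (\<Sum>b | b \<in> ?E \<and> src b = tgt a. if b = c then (if m = n then 1 else 0) else 0)"
          unfolding mel_sum SS by (intro sum.cong refl) (auto simp: iso_op_range_proj[OF j])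
        thus ?thesis using c True by (simp add: SS'[OF a] iso_op_range_proj[OF k(1)] k(2))
      next
        case False
        hence "m \<notin> range (j b)" if "b \<in> ?E" "src b = tgt a" for b using that unfolding R_def by blast
        hence "mel (\<Sum>b | b \<in> ?E \<and> src b = tgt a. S b * adj (S b)) m n = 0"
          unfolding mel_sum SS by (intro sum.neutral) (auto simp: iso_op_range_proj[OF j])
        thus ?thesis using False by (simp add: SS'[OF a] iso_op_range_proj[OF k(1)] k(2))
      qed
    qed
  next
    have "\<exists>!b. b \<in> ?E \<and> n \<in> range (j b)" for n using js[of n] jd by blast
    thus "(\<Sum>b\<in>?E. S b * adj (S b)) = 1"
      unfolding SS by (intro sum_iso_op_range_proj j) auto
  qed
  thus ?thesis by blast
qed

lemma ck_gen_family: "irreducible_matrix A \<Longrightarrow> cuntz_krieger A (ck_gen A)"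
  using ck_family_exists[of A] irreducible_row[of A] ck_family_ck_gen by (auto simp: cuntz_krieger_def)

subsection \<open>Blockwise maps\<close>

lemma sum_single:
  assumes "finite I" "i \<in> I" "\<And>j. j \<in> I \<Longrightarrow> j \<noteq> i \<Longrightarrow> f j = (0 :: 'a :: comm_monoid_add)"
  shows "sum f I = f i"
  using assms by (subst sum.remove[of I i]) (auto intro: sum.neutral)

text \<open>The operators \<open>\<Theta> x X\<close> as diagonal blocks, with indices reassociated as those of
  \<open>\<O> \<otimes>\<^sub>* compacts\<close>.\<close>

definition blocks :: "('x \<Rightarrow> 'i cop \<Rightarrow> ('j \<times> 'k) cop) \<Rightarrow> 'i cop \<Rightarrow> (('x \<times> 'j) \<times> 'k) cop" where
  "blocks \<Theta> X = compress (\<lambda>((x, j), k). (x, (j, k))) (block_diag (\<lambda>x. \<Theta> x X))"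

lemma bij_assoc: "bij (\<lambda>((x, j), k). (x, (j, k)))"
  by (rule bijI') force+

lemma mel_blocks:
  assumes "\<And>x. star_map (\<Theta> x)"
  shows "mel (blocks \<Theta> X) ((x, j), k) ((y, l), m) = (if x = y then mel (\<Theta> x X) (j, k) (l, m) else 0)"
  unfolding blocks_def
  by (simp add: mel_compress[OF bij_is_inj[OF bij_assoc]] mel_block_diag[OF star_map_norm[OF assms]])

lemma star_map_blocks: "(\<And>x. star_map (\<Theta> x)) \<Longrightarrow> star_map (blocks \<Theta>)"
  using star_map_comp[OF star_map_block_diag star_map_compress[OF bij_is_inj[OF bij_assoc]], of \<Theta>]
  by (simp add: blocks_def[abs_def])

lemma mult_domain_blocks:
  "(\<And>x. star_map (\<Theta> x)) \<Longrightarrow> (\<And>x. X \<in> mult_domain (\<Theta> x)) \<Longrightarrow> X \<in> mult_domain (blocks \<Theta>)"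
  using mult_domain_comp[OF mult_domain_block_diag mult_domain_compress_bij[OF bij_assoc], of \<Theta> X]
  by (simp add: blocks_def[abs_def])

lemma ck_family_star_map:
  assumes "ck_family A S" "star_map \<Theta>" "\<And>a. a \<in> edges A \<Longrightarrow> S a \<in> mult_domain \<Theta>" "\<Theta> 1 = 1"
  shows "ck_family A (\<lambda>a. \<Theta> (S a))"
proof -
  note M = star_subalgebra_mult_domain[OF assms(2)]
  have m: "\<Theta> (S a) * adj (\<Theta> (S a)) = \<Theta> (S a * adj (S a))" "adj (\<Theta> (S a)) * \<Theta> (S a) = \<Theta> (adj (S a) * S a)"
    "\<Theta> (S a) * adj (\<Theta> (S a)) * \<Theta> (S a) = \<Theta> (S a * adj (S a) * S a)" if "a \<in> edges A" for a
    using assms(3)[OF that] by (simp_all add: mult_domainD star_map_adj[OF assms(2)])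
  have s: "(\<Sum>a\<in>F. \<Theta> (S a) * adj (\<Theta> (S a))) = \<Theta> (\<Sum>a\<in>F. S a * adj (S a))" if "F \<subseteq> edges A" for F
    unfolding star_map_sum[OF assms(2)] using that by (intro sum.cong refl m) blast
  have s': "(\<Sum>b | b \<in> edges A \<and> src b = v. \<Theta> (S b) * adj (\<Theta> (S b))) = \<Theta> (\<Sum>b | b \<in> edges A \<and> src b = v. S b * adj (S b))" for v
    by (rule s) blast
  show ?thesis
    unfolding ck_family_def
  proof (intro conjI ballI)
    have F: "\<And>a. a \<in> edges A \<Longrightarrow> S a * adj (S a) * S a = S a" "(\<Sum>b\<in>edges A. S b * adj (S b)) = 1"
      "\<And>a. a \<in> edges A \<Longrightarrow> adj (S a) * S a = (\<Sum>b | b \<in> edges A \<and> src b = tgt a. S b * adj (S b))"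
      using assms(1) unfolding ck_family_def by blast+
    show "\<Theta> (S a) * adj (\<Theta> (S a)) * \<Theta> (S a) = \<Theta> (S a)" if "a \<in> edges A" for a
      unfolding m(3)[OF that] F(1)[OF that] ..
    show "(\<Sum>b\<in>edges A. \<Theta> (S b) * adj (\<Theta> (S b))) = 1" unfolding s[OF order_refl] F(2) assms(4) ..
    show "adj (\<Theta> (S a)) * \<Theta> (S a) = (\<Sum>b | b \<in> edges A \<and> src b = tgt a. \<Theta> (S b) * adj (\<Theta> (S b)))"
      if "a \<in> edges A" for a unfolding m(2)[OF that] F(3)[OF that] s' ..
  qed
qed

text \<open>The family by which the generators \<open>ck_gen\<close> act in the block with index
  \<open>S\<close>.\<close>

definition ck_rep :: "nat ^ 'n ^ 'n \<Rightarrow> (('n, 'n) edge \<Rightarrow> nat cop) \<Rightarrow> ('n, 'n) edge \<Rightarrow> nat cop" where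
  "ck_rep A S = (if ck_family A S then S else (SOME S'. ck_family A S'))"

lemma ck_rep_family: "irreducible_matrix A \<Longrightarrow> cuntz_krieger A (ck_rep A S)"
  using ck_family_exists[of A] irreducible_row[of A] someI_ex[of "ck_family A"]
  by (auto simp: cuntz_krieger_def ck_rep_def)

lemma ck_rep_eq: "ck_family A S \<Longrightarrow> ck_rep A S = S"
  by (simp add: ck_rep_def)

lemma mel_ck_gen:
  assumes "irreducible_matrix A" "a \<in> edges A"
  shows "mel (ck_gen A a) (S, m) (S', n) = (if S = S' then mel (ck_rep A S a) m n else 0)"
proof -
  have "norm (ck_rep A S a) \<le> 1" for S
    using cuntz_krieger.norm_gen[OF ck_rep_family[OF assms(1)] assms(2)] .
  moreover have "ck_gen A a = block_diag (\<lambda>S. ck_rep A S a)" by (simp only: ck_gen_def ck_rep_def)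
  ultimately show ?thesis using mel_block_diag[of "\<lambda>S. ck_rep A S a" 1] by simp
qed

subsection \<open>The stable isomorphism attached to a factorization\<close>

lemma edge_splitting_facts:
  assumes "edge_splitting A C D \<kappa>" "a \<in> edges A"
  shows "fst (\<kappa> a) \<in> edges C" "snd (\<kappa> a) \<in> edges D" "tgt (fst (\<kappa> a)) = src (snd (\<kappa> a))"
    "src (fst (\<kappa> a)) = src a" "tgt (snd (\<kappa> a)) = tgt a"
    "the_inv_into (edges A) \<kappa> (fst (\<kappa> a), snd (\<kappa> a)) = a"
proof -
  have b: "bij_betw \<kappa> (edges A) {(c, d). c \<in> edges C \<and> d \<in> edges D \<and> tgt c = src d}"
    using assms(1) unfolding edge_splitting_def by (rule conjunct1)
  have "\<kappa> a \<in> {(c, d). c \<in> edges C \<and> d \<in> edges D \<and> tgt c = src d}"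
    by (rule bij_betw_apply[OF b assms(2)])
  thus "fst (\<kappa> a) \<in> edges C" "snd (\<kappa> a) \<in> edges D" "tgt (fst (\<kappa> a)) = src (snd (\<kappa> a))"
    by auto
  show "src (fst (\<kappa> a)) = src a" "tgt (snd (\<kappa> a)) = tgt a"
    using assms unfolding edge_splitting_def by blast+
  from the_inv_into_f_f[OF bij_betw_imp_inj_on[OF b] assms(2)]
  show "the_inv_into (edges A) \<kappa> (fst (\<kappa> a), snd (\<kappa> a)) = a" by simp
qed

lemma edge_splitting_inverse:
  assumes "edge_splitting A C D \<kappa>" "c \<in> edges C" "d \<in> edges D" "tgt c = src d"
  shows "the_inv_into (edges A) \<kappa> (c, d) \<in> edges A" "\<kappa> (the_inv_into (edges A) \<kappa> (c, d)) = (c, d)"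
    "src (the_inv_into (edges A) \<kappa> (c, d)) = src c" "tgt (the_inv_into (edges A) \<kappa> (c, d)) = tgt d"
proof -
  let ?a = "the_inv_into (edges A) \<kappa> (c, d)"
  have b: "bij_betw \<kappa> (edges A) {(c, d). c \<in> edges C \<and> d \<in> edges D \<and> tgt c = src d}"
    using assms(1) unfolding edge_splitting_def by (rule conjunct1)
  have m: "(c, d) \<in> {(c, d). c \<in> edges C \<and> d \<in> edges D \<and> tgt c = src d}" using assms by simp
  show 1: "?a \<in> edges A"
    using bij_betw_apply[OF bij_betw_the_inv_into[OF b] m] .
  show 2: "\<kappa> ?a = (c, d)"
    by (rule f_the_inv_into_f[OF bij_betw_imp_inj_on[OF b]]) (use m bij_betw_imp_surj_on[OF b] in simp)
  show "src ?a = src c" "tgt ?a = tgt d"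
    using edge_splitting_facts(4,5)[OF assms(1) 1] unfolding 2 by simp_all
qed

text \<open>\<open>leg C c\<close>, for the edges \<open>c\<close> of \<open>C\<close> ending at a given vertex, are isometries with
  orthogonal ranges summing up to the whole of \<open>\<ell>\<^sup>2(\<nat>)\<close>.\<close>

definition leg_index :: "nat ^ 'm ^ 'n \<Rightarrow> ('n, 'm) edge \<Rightarrow> nat \<Rightarrow> nat" where
  "leg_index C c n = to_nat_on ({c' \<in> edges C. tgt c' = tgt c} \<times> UNIV) (c, n)"

definition leg :: "nat ^ 'm ^ 'n \<Rightarrow> ('n, 'm) edge \<Rightarrow> nat cop" where
  "leg C c = iso_op (leg_index C c)"

lemma leg_index_bij:
  assumes "c \<in> edges C"
  shows "bij_betw (to_nat_on ({c' \<in> edges C. tgt c' = tgt c} \<times> (UNIV :: nat set)))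
    ({c' \<in> edges C. tgt c' = tgt c} \<times> UNIV) UNIV"
  by (rule bij_countable_times_nat) (use assms in \<open>blast intro: countable_finite finite_subset[OF _ finite_edges]\<close>)+

lemma leg_index_inj_iff:
  assumes "c \<in> edges C" "c' \<in> edges C" "tgt c = tgt c'"
  shows "leg_index C c m = leg_index C c' n \<longleftrightarrow> c = c' \<and> m = n"
  using inj_on_eq_iff[OF bij_betw_imp_inj_on[OF leg_index_bij[OF assms(1)]], of "(c, m)" "(c', n)"] assms
  by (simp add: leg_index_def)

lemma inj_leg_index: "c \<in> edges C \<Longrightarrow> inj (leg_index C c)"
  by (rule injI) (simp add: leg_index_inj_iff)

lemma leg_index_surj:
  assumes "c \<in> edges C"
  shows "\<exists>c'\<in>edges C. tgt c' = tgt c \<and> n \<in> range (leg_index C c')"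
proof -
  have "n \<in> to_nat_on ({c' \<in> edges C. tgt c' = tgt c} \<times> (UNIV :: nat set)) ` ({c' \<in> edges C. tgt c' = tgt c} \<times> UNIV)"
    using leg_index_bij[OF assms] by (simp add: bij_betw_def)
  then obtain c' m where c': "c' \<in> edges C" "tgt c' = tgt c"
    "n = to_nat_on ({c' \<in> edges C. tgt c' = tgt c} \<times> (UNIV :: nat set)) (c', m)" by blast
  hence "n = leg_index C c' m" by (simp add: leg_index_def)
  thus ?thesis using c' by blast
qed

lemma leg_adj_mult:
  assumes "c \<in> edges C" "c' \<in> edges C" "tgt c = tgt c'"
  shows "adj (leg C c) * leg C c' = (if c = c' then 1 else 0)"
proof (cases "c = c'")
  case False
  have "range (leg_index C c) \<inter> range (leg_index C c') = {}"
    using False assms by (auto simp: leg_index_inj_iff)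
  thus ?thesis using False assms by (simp add: leg_def iso_op_orthogonal inj_leg_index)
qed (use assms in \<open>simp add: leg_def iso_op_adj_mult inj_leg_index\<close>)

lemma leg_adj_mult_assoc:
  assumes "c \<in> edges C" "c' \<in> edges C" "tgt c = tgt c'"
  shows "adj (leg C c) * (leg C c' * X) = (if c = c' then X else 0)"
  using leg_adj_mult[OF assms] by (simp add: mult.assoc[symmetric])

lemma leg_sum:
  assumes "c\<^sub>0 \<in> edges C" "tgt c\<^sub>0 = v"
  shows "(\<Sum>c | c \<in> edges C \<and> tgt c = v. leg C c * adj (leg C c)) = 1"
  unfolding leg_def
proof (rule sum_iso_op_range_proj)
  fix n
  show "\<exists>!c. c \<in> {c. c \<in> edges C \<and> tgt c = v} \<and> n \<in> range (leg_index C c)"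
    using leg_index_surj[OF assms(1), of n] assms(2) leg_index_inj_iff[of _ C] by blast
qed (auto intro: inj_leg_index)

lemma leg_munit: "c \<in> edges C \<Longrightarrow> c' \<in> edges C \<Longrightarrow>
  leg C c * munit i j * adj (leg C c') = munit (leg_index C c i) (leg_index C c' j)"
  by (simp add: leg_def iso_op_munit munit_iso_op inj_leg_index)

text \<open>The factorizations of the matrices enter through the edge splittings. The assumptions
  are symmetric in \<open>A\<close> and \<open>B\<close>, so the inverse isomorphism can be obtained
  from an interpretation with exchanged roles.\<close>

locale factorization =
  fixes A :: "nat ^ 'n ^ 'n" and B :: "nat ^ 'm ^ 'm"
    and C :: "nat ^ 'm ^ 'n" and D :: "nat ^ 'n ^ 'm"
    and \<kappa>\<^sub>A :: "('n, 'n) edge \<Rightarrow> ('n, 'm) edge \<times> ('m, 'n) edge"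
    and \<kappa>\<^sub>B :: "('m, 'm) edge \<Rightarrow> ('m, 'n) edge \<times> ('n, 'm) edge"
  assumes irrA: "irreducible_matrix A" and irrB: "irreducible_matrix B"
    and splitA: "edge_splitting A C D \<kappa>\<^sub>A" and splitB: "edge_splitting B D C \<kappa>\<^sub>B"
begin

definition edgeA :: "('n, 'm) edge \<Rightarrow> ('m, 'n) edge \<Rightarrow> ('n, 'n) edge" where
  "edgeA c d = the_inv_into (edges A) \<kappa>\<^sub>A (c, d)"

definition edgeB :: "('m, 'n) edge \<Rightarrow> ('n, 'm) edge \<Rightarrow> ('m, 'm) edge" where
  "edgeB d c = the_inv_into (edges B) \<kappa>\<^sub>B (d, c)"

abbreviation cA :: "('n, 'n) edge \<Rightarrow> ('n, 'm) edge" where "cA a \<equiv> fst (\<kappa>\<^sub>A a)"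
abbreviation dA :: "('n, 'n) edge \<Rightarrow> ('m, 'n) edge" where "dA a \<equiv> snd (\<kappa>\<^sub>A a)"

abbreviation follow :: "'n \<Rightarrow> ('n, 'm) edge set" where
  "follow v \<equiv> {c. c \<in> edges C \<and> src c = v}"

lemmas A_facts = edge_splitting_facts[OF splitA]
lemmas B_facts = edge_splitting_facts[OF splitB]
lemmas edgeA_facts = edge_splitting_inverse[OF splitA, folded edgeA_def]
lemmas edgeB_facts = edge_splitting_inverse[OF splitB, folded edgeB_def]

lemma edgeA_cd: "a \<in> edges A \<Longrightarrow> edgeA (cA a) (dA a) = a"
  using A_facts(6) by (simp add: edgeA_def)

lemma edgeB_dc: "b \<in> edges B \<Longrightarrow> edgeB (fst (\<kappa>\<^sub>B b)) (snd (\<kappa>\<^sub>B b)) = b"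
  using B_facts(6) by (simp add: edgeB_def)

lemma edgeB_inj:
  assumes "d \<in> edges D" "c \<in> edges C" "tgt d = src c" "d' \<in> edges D" "c' \<in> edges C" "tgt d' = src c'"
  shows "edgeB d c = edgeB d' c' \<longleftrightarrow> d = d' \<and> c = c'"
proof
  assume e: "edgeB d c = edgeB d' c'"
  have 1: "\<kappa>\<^sub>B (edgeB d c) = (d, c)" using edgeB_facts(2)[OF assms(1) assms(2) assms(3)] .
  have 2: "\<kappa>\<^sub>B (edgeB d' c') = (d', c')" using edgeB_facts(2)[OF assms(4) assms(5) assms(6)] .
  have "(d, c) = (d', c')"
    using 1 2 unfolding e by (rule trans[OF sym])
  thus "d = d' \<and> c = c'" by simp
qed simp

lemma edgeB_mem: "a \<in> edges A \<Longrightarrow> c \<in> follow (tgt a) \<Longrightarrow> edgeB (dA a) c \<in> edges B"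
  and src_edgeB: "a \<in> edges A \<Longrightarrow> c \<in> follow (tgt a) \<Longrightarrow> src (edgeB (dA a) c) = tgt (cA a)"
  and tgt_edgeB: "a \<in> edges A \<Longrightarrow> c \<in> follow (tgt a) \<Longrightarrow> tgt (edgeB (dA a) c) = tgt c"
  using edgeB_facts[of "dA a" c] A_facts[of a] by auto

lemma edgeB_follow_inj: "a \<in> edges A \<Longrightarrow> c \<in> follow (tgt a) \<Longrightarrow> c' \<in> follow (tgt a) \<Longrightarrow>
    edgeB (dA a) c = edgeB (dA a) c' \<longleftrightarrow> c = c'"
  using edgeB_inj[of "dA a" c "dA a" c'] A_facts[of a] by auto

text \<open>\<open>B\<close> has no zero column, and an edge \<open>d c\<close> of \<open>B\<close>
  that ends at \<open>v\<close> contains an edge \<open>c\<close> of \<open>C\<close> that ends at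
  \<open>v\<close>. This provides the legs at \<open>v\<close>.\<close>

lemma C_column: "\<exists>c\<in>edges C. tgt c = v"
proof -
  obtain b where "b \<in> edges B" "tgt b = v"
    using irreducible_column[OF irrB, of v] edge_exists by blast
  thus ?thesis using B_facts by metis
qed

lemma leg_sum': "(\<Sum>c | c \<in> edges C \<and> tgt c = v. leg C c * adj (leg C c)) = 1"
proof -
  obtain c where "c \<in> edges C" "tgt c = v" using C_column by blast
  thus ?thesis by (rule leg_sum)
qed

lemma finite_follow [simp]: "finite (follow v)" by simp

end

text \<open>\<open>T\<close> will be the family in one block of the universal representation for
  \<open>B\<close>.\<close>

locale factorization_family = factorization A B C D \<kappa>\<^sub>A \<kappa>\<^sub>B + T: cuntz_krieger B T
  for A :: "nat ^ 'n ^ 'n" and B :: "nat ^ 'm ^ 'm" and C :: "nat ^ 'm ^ 'n" and D :: "nat ^ 'n ^ 'm"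
    and \<kappa>\<^sub>A \<kappa>\<^sub>B and T :: "('m, 'm) edge \<Rightarrow> 'i cop"
begin

text \<open>The formula of the isomorphism at \<open>k = 1\<close>, that is, what should be the
  image of \<open>S\<^sub>a \<otimes> 1\<close>. The lemmas up to \<open>ck_family_lift_gen\<close>
  verify the relations of \<open>A\<close> for these operators.\<close>

definition lift_gen :: "('n, 'n) edge \<Rightarrow> ('i \<times> nat) cop" where
  "lift_gen a = (\<Sum>c\<in>follow (tgt a). T (edgeB (dA a) c) \<otimes>\<^sub>o (leg C (cA a) * adj (leg C c)))"

lemma sum_edges_tgt:
  "(\<Sum>c\<in>edges C. T.vproj (tgt c) \<otimes>\<^sub>o (leg C c * adj (leg C c))) = 1"
proof -
  have "(\<Sum>c\<in>edges C. T.vproj (tgt c) \<otimes>\<^sub>o (leg C c * adj (leg C c))) =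
     (\<Sum>v\<in>UNIV. \<Sum>c\<in>{c \<in> edges C. tgt c = v}. T.vproj (tgt c) \<otimes>\<^sub>o (leg C c * adj (leg C c)))"
    by (rule sum.group[symmetric]) auto
  also have "\<dots> = (\<Sum>v\<in>UNIV. T.vproj v \<otimes>\<^sub>o 1)"
    by (intro sum.cong refl) (simp add: tensor_sum_right[symmetric] leg_sum')
  also have "\<dots> = 1" by (simp add: tensor_sum_left[symmetric] T.sum_vproj tensor_one)
  finally show ?thesis .
qed

lemma lift_gen_range_proj:
  assumes a: "a \<in> edges A"
  shows "lift_gen a * adj (lift_gen a) =
    (\<Sum>c\<in>follow (tgt a). (T (edgeB (dA a) c) * adj (T (edgeB (dA a) c))) \<otimes>\<^sub>o (leg C (cA a) * adj (leg C (cA a))))"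
proof -
  let ?b = "edgeB (dA a)"
  have "lift_gen a * adj (lift_gen a) = (\<Sum>c\<in>follow (tgt a). \<Sum>c'\<in>follow (tgt a).
      (T (?b c) * adj (T (?b c'))) \<otimes>\<^sub>o (leg C (cA a) * (adj (leg C c) * (leg C c' * adj (leg C (cA a))))))"
    by (simp add: lift_gen_def adj_sum tensor_adj adj_mult adj_adj sum_product tensor_mult mult.assoc)
  also have "\<dots> = (\<Sum>c\<in>follow (tgt a). (T (?b c) * adj (T (?b c))) \<otimes>\<^sub>o (leg C (cA a) * adj (leg C (cA a))))"
  proof (intro sum.cong refl)
    fix c assume c: "c \<in> follow (tgt a)"
    \<comment> \<open>A recurring reason for double sums to collapse: for a common target the legs
      of \<open>c\<close> and \<open>c'\<close> are orthogonal, and for different targets the two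
      factors from \<open>T\<close> annihilate each other because of their source
      projections.\<close>
    have "(T (?b c) * adj (T (?b c'))) \<otimes>\<^sub>o (leg C (cA a) * (adj (leg C c) * (leg C c' * adj (leg C (cA a))))) = 0"
      if c': "c' \<in> follow (tgt a)" "c' \<noteq> c" for c'
    proof (cases "tgt c = tgt c'")
      case False
      have "T (?b c) * adj (T (?b c')) = T (?b c) * T.vproj (tgt c) * adj (T (?b c'))"
        using a c by (simp add: T.gen_vproj edgeB_mem tgt_edgeB)
      also have "\<dots> = 0" using a c' False by (simp add: mult.assoc T.vproj_adj_gen edgeB_mem tgt_edgeB)
      finally show ?thesis by simp
    qed (use c c' in \<open>simp add: leg_adj_mult_assoc\<close>)
    from sum_single[OF finite_follow c this]
    show "(\<Sum>c'\<in>follow (tgt a).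
      (T (?b c) * adj (T (?b c'))) \<otimes>\<^sub>o (leg C (cA a) * (adj (leg C c) * (leg C c' * adj (leg C (cA a)))))) =
      (T (?b c) * adj (T (?b c))) \<otimes>\<^sub>o (leg C (cA a) * adj (leg C (cA a)))"
      using c by (simp add: leg_adj_mult_assoc)
  qed
  finally show ?thesis .
qed

lemma sum_lift_gen_range_proj:
  "(\<Sum>a | a \<in> edges A \<and> cA a = c. lift_gen a * adj (lift_gen a)) = T.vproj (tgt c) \<otimes>\<^sub>o (leg C c * adj (leg C c))"
  if c: "c \<in> edges C"
proof -
  have "(\<Sum>a | a \<in> edges A \<and> cA a = c. lift_gen a * adj (lift_gen a)) =
    (\<Sum>a | a \<in> edges A \<and> cA a = c. \<Sum>c'\<in>follow (tgt a).
      (T (edgeB (dA a) c') * adj (T (edgeB (dA a) c'))) \<otimes>\<^sub>o (leg C c * adj (leg C c)))"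
    by (intro sum.cong refl) (auto simp: lift_gen_range_proj)
  also have "\<dots> = (\<Sum>(a, c')\<in>Sigma {a. a \<in> edges A \<and> cA a = c} (\<lambda>a. follow (tgt a)).
      (T (edgeB (dA a) c') * adj (T (edgeB (dA a) c'))) \<otimes>\<^sub>o (leg C c * adj (leg C c)))"
    by (rule sum.Sigma) auto
  also have "\<dots> = (\<Sum>b | b \<in> edges B \<and> src b = tgt c. (T b * adj (T b)) \<otimes>\<^sub>o (leg C c * adj (leg C c)))"
  \<comment> \<open>For fixed \<open>c\<close>, the pairs of an edge \<open>a = c d\<close> and a
    following \<open>c'\<close> correspond to the edges \<open>d c'\<close> of \<open>B\<close> that
    start at the target of \<open>c\<close>.\<close>
  proof (rule sum.reindex_bij_witness[where j = "\<lambda>(a, c'). edgeB (dA a) c'"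
        and i = "\<lambda>b. (edgeA c (fst (\<kappa>\<^sub>B b)), snd (\<kappa>\<^sub>B b))"])
    fix p assume "p \<in> Sigma {a. a \<in> edges A \<and> cA a = c} (\<lambda>a. follow (tgt a))"
    then obtain a c' where p: "p = (a, c')" "a \<in> edges A" "cA a = c" "c' \<in> follow (tgt a)" by blast
    have k: "\<kappa>\<^sub>B (edgeB (dA a) c') = (dA a, c')" using edgeB_facts(2)[of "dA a" c'] A_facts[of a] p by auto
    show "(edgeA c (fst (\<kappa>\<^sub>B ((\<lambda>(a, c'). edgeB (dA a) c') p))), snd (\<kappa>\<^sub>B ((\<lambda>(a, c'). edgeB (dA a) c') p))) = p"
      using p k edgeA_cd[of a] by auto
    show "(\<lambda>(a, c'). edgeB (dA a) c') p \<in> {b. b \<in> edges B \<and> src b = tgt c}"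
      using p edgeB_mem[of a c'] src_edgeB[of a c'] by auto
    show "(T ((\<lambda>(a, c'). edgeB (dA a) c') p) * adj (T ((\<lambda>(a, c'). edgeB (dA a) c') p))) \<otimes>\<^sub>o (leg C c * adj (leg C c)) =
      (\<lambda>(a, c'). (T (edgeB (dA a) c') * adj (T (edgeB (dA a) c'))) \<otimes>\<^sub>o (leg C c * adj (leg C c))) p"
      by (simp add: p)
  next
    fix b assume "b \<in> {b. b \<in> edges B \<and> src b = tgt c}"
    hence b: "b \<in> edges B" "src b = tgt c" by auto
    note f = edgeA_facts[OF c B_facts(1)[OF b(1)]] B_facts[OF b(1)]
    show "(\<lambda>(a, c'). edgeB (dA a) c') (edgeA c (fst (\<kappa>\<^sub>B b)), snd (\<kappa>\<^sub>B b)) = b"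
      using f b edgeB_dc[of b] by auto
    show "(edgeA c (fst (\<kappa>\<^sub>B b)), snd (\<kappa>\<^sub>B b)) \<in> Sigma {a. a \<in> edges A \<and> cA a = c} (\<lambda>a. follow (tgt a))"
      using f b by auto
  qed
  also have "\<dots> = T.vproj (tgt c) \<otimes>\<^sub>o (leg C c * adj (leg C c))"
    by (simp add: T.vproj_def tensor_sum_left)
  finally show ?thesis .
qed

lemma lift_gen_source_proj:
  assumes a: "a \<in> edges A"
  shows "adj (lift_gen a) * lift_gen a = (\<Sum>c\<in>follow (tgt a). T.vproj (tgt c) \<otimes>\<^sub>o (leg C c * adj (leg C c)))"
proof -
  let ?b = "edgeB (dA a)"
  have "adj (lift_gen a) * lift_gen a = (\<Sum>c\<in>follow (tgt a). \<Sum>c'\<in>follow (tgt a).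
      (adj (T (?b c)) * T (?b c')) \<otimes>\<^sub>o (leg C c * (adj (leg C (cA a)) * (leg C (cA a) * adj (leg C c')))))"
    by (simp add: lift_gen_def adj_sum tensor_adj adj_mult adj_adj sum_product tensor_mult mult.assoc)
  also have "\<dots> = (\<Sum>c\<in>follow (tgt a). T.vproj (tgt c) \<otimes>\<^sub>o (leg C c * adj (leg C c)))"
  proof (intro sum.cong refl)
    fix c assume c: "c \<in> follow (tgt a)"
    have "(adj (T (?b c)) * T (?b c')) \<otimes>\<^sub>o (leg C c * (adj (leg C (cA a)) * (leg C (cA a) * adj (leg C c')))) = 0"
      if c': "c' \<in> follow (tgt a)" "c' \<noteq> c" for c'
      using edgeB_follow_inj[OF a c c'(1)] c' c
      by (simp add: T.adj_gen_mult edgeB_mem[OF a c] edgeB_mem[OF a c'(1)])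
    from sum_single[OF finite_follow c this]
    show "(\<Sum>c'\<in>follow (tgt a). (adj (T (?b c)) * T (?b c')) \<otimes>\<^sub>o
        (leg C c * (adj (leg C (cA a)) * (leg C (cA a) * adj (leg C c'))))) = T.vproj (tgt c) \<otimes>\<^sub>o (leg C c * adj (leg C c))"
      using c A_facts(1)[OF a] by (simp add: leg_adj_mult_assoc T.adj_gen_mult edgeB_mem[OF a c] tgt_edgeB[OF a c])
  qed
  finally show ?thesis .
qed

lemma lift_gen_partial_isometry:
  assumes a: "a \<in> edges A"
  shows "lift_gen a * adj (lift_gen a) * lift_gen a = lift_gen a"
proof -
  let ?b = "edgeB (dA a)"
  have "lift_gen a * adj (lift_gen a) * lift_gen a = (\<Sum>c\<in>follow (tgt a). \<Sum>c'\<in>follow (tgt a).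
      (T (?b c) * (adj (T (?b c)) * T (?b c'))) \<otimes>\<^sub>o (leg C (cA a) * (adj (leg C (cA a)) * (leg C (cA a) * adj (leg C c')))))"
    unfolding lift_gen_range_proj[OF a]
    by (simp add: lift_gen_def sum_product tensor_mult mult.assoc)
  also have "\<dots> = (\<Sum>c\<in>follow (tgt a). T (?b c) \<otimes>\<^sub>o (leg C (cA a) * adj (leg C c)))"
  proof (intro sum.cong refl)
    fix c assume c: "c \<in> follow (tgt a)"
    have "(T (?b c) * (adj (T (?b c)) * T (?b c'))) \<otimes>\<^sub>o (leg C (cA a) * (adj (leg C (cA a)) * (leg C (cA a) * adj (leg C c')))) = 0"
      if c': "c' \<in> follow (tgt a)" "c' \<noteq> c" for c'
      using edgeB_follow_inj[OF a c c'(1)] c' c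
      by (simp add: T.adj_gen_mult edgeB_mem[OF a c] edgeB_mem[OF a c'(1)])
    from sum_single[OF finite_follow c this]
    show "(\<Sum>c'\<in>follow (tgt a). (T (?b c) * (adj (T (?b c)) * T (?b c'))) \<otimes>\<^sub>o
        (leg C (cA a) * (adj (leg C (cA a)) * (leg C (cA a) * adj (leg C c'))))) = T (?b c) \<otimes>\<^sub>o (leg C (cA a) * adj (leg C c))"
      using c A_facts(1)[OF a] T.partial_isometry[OF edgeB_mem[OF a c]]
      by (simp add: leg_adj_mult_assoc mult.assoc)
  qed
  finally show ?thesis by (simp add: lift_gen_def)
qed

text \<open>The range projections of edges \<open>b\<close> are grouped by the first half of
  \<open>b\<close>. For the edges that start at the target of \<open>a\<close> these halves run
  through \<open>follow (tgt a)\<close>, as the sum in \<open>lift_gen_source_proj\<close>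
  does.\<close>

lemma ck_family_lift_gen: "ck_family A lift_gen"
  unfolding ck_family_def
proof (intro conjI ballI)
  fix a assume a: "a \<in> edges A"
  show "lift_gen a * adj (lift_gen a) * lift_gen a = lift_gen a"
    by (rule lift_gen_partial_isometry[OF a])
  have "(\<Sum>b | b \<in> edges A \<and> src b = tgt a. lift_gen b * adj (lift_gen b)) =
      (\<Sum>c\<in>follow (tgt a). \<Sum>b\<in>{b \<in> {b. b \<in> edges A \<and> src b = tgt a}. cA b = c}. lift_gen b * adj (lift_gen b))"
    by (rule sum.group[symmetric]) (auto simp: A_facts)
  also have "\<dots> = (\<Sum>c\<in>follow (tgt a). \<Sum>b | b \<in> edges A \<and> cA b = c. lift_gen b * adj (lift_gen b))"
  proof (intro sum.cong refl Collect_cong)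
    fix c b assume "c \<in> follow (tgt a)"
    thus "(b \<in> {b. b \<in> edges A \<and> src b = tgt a} \<and> cA b = c) = (b \<in> edges A \<and> cA b = c)"
      using A_facts(4)[of b] by auto
  qed
  finally show "adj (lift_gen a) * lift_gen a = (\<Sum>b | b \<in> edges A \<and> src b = tgt a. lift_gen b * adj (lift_gen b))"
    unfolding lift_gen_source_proj[OF a] by (simp add: sum_lift_gen_range_proj)
next
  have "(\<Sum>b\<in>edges A. lift_gen b * adj (lift_gen b)) =
      (\<Sum>c\<in>edges C. \<Sum>b\<in>{b \<in> edges A. cA b = c}. lift_gen b * adj (lift_gen b))"
    by (rule sum.group[symmetric]) (auto simp: A_facts)
  also have "\<dots> = (\<Sum>c\<in>edges C. T.vproj (tgt c) \<otimes>\<^sub>o (leg C c * adj (leg C c)))"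
    by (intro sum.cong refl) (simp add: sum_lift_gen_range_proj)
  finally show "(\<Sum>b\<in>edges A. lift_gen b * adj (lift_gen b)) = 1" by (simp add: sum_edges_tgt)
qed

text \<open>An isometry from \<open>H \<otimes> e\<^sub>0 \<otimes> \<ell>\<^sup>2\<close> onto a reducing subspace of \<open>H \<otimes> \<ell>\<^sup>2 \<otimes> \<ell>\<^sup>2\<close> that
  intertwines the amplification of the family \<open>lift_gen\<close> with the wanted isomorphism.\<close>

definition intertwiner :: "(('i \<times> nat) \<times> nat) cop" where
  "intertwiner = (\<Sum>c\<in>edges C. (T.vproj (tgt c) \<otimes>\<^sub>o (leg C c * munit 0 0)) \<otimes>\<^sub>o adj (leg C c))"

text \<open>The wanted value at \<open>S\<^sub>a \<otimes> k\<close>, with a rank one projection in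
  the middle factor to match the initial space of \<open>intertwiner\<close>.\<close>

definition image_gen :: "('n, 'n) edge \<Rightarrow> nat cop \<Rightarrow> (('i \<times> nat) \<times> nat) cop" where
  "image_gen a k = (\<Sum>c\<in>follow (tgt a).
    (T (edgeB (dA a) c) \<otimes>\<^sub>o munit 0 0) \<otimes>\<^sub>o (leg C (cA a) * k * adj (leg C c)))"

lemma intertwiner_isometry: "adj intertwiner * intertwiner = (1 \<otimes>\<^sub>o munit 0 0) \<otimes>\<^sub>o 1"
proof -
  have "adj intertwiner * intertwiner = (\<Sum>c\<in>edges C. \<Sum>c'\<in>edges C.
      ((T.vproj (tgt c) * T.vproj (tgt c')) \<otimes>\<^sub>o (munit 0 0 * (adj (leg C c) * (leg C c' * munit 0 0)))) \<otimes>\<^sub>o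
        (leg C c * adj (leg C c')))"
    by (simp add: intertwiner_def adj_sum tensor_adj adj_mult adj_adj sum_product tensor_mult mult.assoc)
  also have "\<dots> = (\<Sum>c\<in>edges C. (T.vproj (tgt c) \<otimes>\<^sub>o munit 0 0) \<otimes>\<^sub>o (leg C c * adj (leg C c)))"
  proof (intro sum.cong refl)
    fix c assume c: "c \<in> edges C"
    have "((T.vproj (tgt c) * T.vproj (tgt c')) \<otimes>\<^sub>o (munit 0 0 * (adj (leg C c) * (leg C c' * munit 0 0)))) \<otimes>\<^sub>o
        (leg C c * adj (leg C c')) = 0" if "c' \<in> edges C" "c' \<noteq> c" for c'
      using c that by (cases "tgt c = tgt c'") (simp_all add: T.vproj_mult leg_adj_mult_assoc)
    from sum_single[OF finite_edges c this]
    show "(\<Sum>c'\<in>edges C. ((T.vproj (tgt c) * T.vproj (tgt c')) \<otimes>\<^sub>o (munit 0 0 * (adj (leg C c) * (leg C c' * munit 0 0)))) \<otimes>\<^sub>o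
        (leg C c * adj (leg C c'))) = (T.vproj (tgt c) \<otimes>\<^sub>o munit 0 0) \<otimes>\<^sub>o (leg C c * adj (leg C c))"
      using c by (simp add: leg_adj_mult_assoc munit_mult)
  qed
  also have "\<dots> = (\<Sum>v\<in>UNIV. \<Sum>c\<in>{c \<in> edges C. tgt c = v}. (T.vproj (tgt c) \<otimes>\<^sub>o munit 0 0) \<otimes>\<^sub>o (leg C c * adj (leg C c)))"
    by (rule sum.group[symmetric]) auto
  also have "\<dots> = (\<Sum>v\<in>UNIV. (T.vproj v \<otimes>\<^sub>o munit 0 0) \<otimes>\<^sub>o 1)"
    by (intro sum.cong refl) (simp add: tensor_sum_right[symmetric] leg_sum')
  also have "\<dots> = (1 \<otimes>\<^sub>o munit 0 0) \<otimes>\<^sub>o 1" by (simp add: tensor_sum_left[symmetric] T.sum_vproj)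
  finally show ?thesis .
qed

lemma intertwiner_image_gen: "adj intertwiner * intertwiner * image_gen a k = image_gen a k"
  unfolding intertwiner_isometry image_gen_def sum_distrib_left
  by (simp add: tensor_mult munit_mult)

lemma norm_intertwiner: "norm intertwiner \<le> 1"
proof (rule partial_isometry_norm_le)
  have "intertwiner * adj intertwiner * intertwiner = intertwiner * ((1 \<otimes>\<^sub>o munit 0 0) \<otimes>\<^sub>o 1)"
    by (simp add: mult.assoc intertwiner_isometry)
  also have "\<dots> = intertwiner"
    unfolding intertwiner_def sum_distrib_right by (simp add: tensor_mult munit_mult mult.assoc)
  finally show "intertwiner * adj intertwiner * intertwiner = intertwiner" .
qed

text \<open>Both products reduce to the same single sum over \<open>follow (tgt a)\<close>. On the
  left the summand of \<open>intertwiner\<close> that survives is the one of \<open>c\<close>, on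
  the right it is the one of \<open>cA a\<close>.\<close>

lemma intertwine:
  assumes a: "a \<in> edges A"
  shows "(lift_gen a \<otimes>\<^sub>o k) * intertwiner = intertwiner * image_gen a k"
proof -
  let ?b = "edgeB (dA a)"
  have "(lift_gen a \<otimes>\<^sub>o k) * intertwiner = (\<Sum>c\<in>follow (tgt a). \<Sum>c'\<in>edges C.
      ((T (?b c) * T.vproj (tgt c')) \<otimes>\<^sub>o (leg C (cA a) * (adj (leg C c) * (leg C c' * munit 0 0)))) \<otimes>\<^sub>o (k * adj (leg C c')))"
    by (simp add: lift_gen_def intertwiner_def tensor_sum_left sum_product tensor_mult mult.assoc)
  also have "\<dots> = (\<Sum>c\<in>follow (tgt a). (T (?b c) \<otimes>\<^sub>o (leg C (cA a) * munit 0 0)) \<otimes>\<^sub>o (k * adj (leg C c)))"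
  proof (intro sum.cong refl)
    fix c assume c: "c \<in> follow (tgt a)"
    hence c1: "c \<in> edges C" by simp
    have "((T (?b c) * T.vproj (tgt c')) \<otimes>\<^sub>o (leg C (cA a) * (adj (leg C c) * (leg C c' * munit 0 0)))) \<otimes>\<^sub>o (k * adj (leg C c')) = 0"
      if "c' \<in> edges C" "c' \<noteq> c" for c'
      using c that edgeB_mem[OF a c] tgt_edgeB[OF a c]
      by (cases "tgt c = tgt c'") (simp_all add: T.gen_vproj leg_adj_mult_assoc)
    from sum_single[OF finite_edges c1 this]
    show "(\<Sum>c'\<in>edges C. ((T (?b c) * T.vproj (tgt c')) \<otimes>\<^sub>o (leg C (cA a) * (adj (leg C c) * (leg C c' * munit 0 0)))) \<otimes>\<^sub>o (k * adj (leg C c')))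
      = (T (?b c) \<otimes>\<^sub>o (leg C (cA a) * munit 0 0)) \<otimes>\<^sub>o (k * adj (leg C c))"
      using c1 edgeB_mem[OF a c] tgt_edgeB[OF a c] by (simp add: T.gen_vproj leg_adj_mult_assoc)
  qed
  also have "\<dots> = (\<Sum>c\<in>follow (tgt a). \<Sum>c'\<in>edges C. ((T.vproj (tgt c') * T (?b c)) \<otimes>\<^sub>o (leg C c' * munit 0 0)) \<otimes>\<^sub>o
      (adj (leg C c') * (leg C (cA a) * (k * adj (leg C c)))))"
  proof (intro sum.cong refl, rule sym)
    fix c assume c: "c \<in> follow (tgt a)"
    have "((T.vproj (tgt c') * T (?b c)) \<otimes>\<^sub>o (leg C c' * munit 0 0)) \<otimes>\<^sub>o
      (adj (leg C c') * (leg C (cA a) * (k * adj (leg C c)))) = 0" if "c' \<in> edges C" "c' \<noteq> cA a" for c'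
      using that A_facts(1)[OF a] edgeB_mem[OF a c] src_edgeB[OF a c]
      by (cases "tgt c' = tgt (cA a)") (simp_all add: T.vproj_gen leg_adj_mult_assoc)
    from sum_single[OF finite_edges A_facts(1)[OF a] this]
    show "(\<Sum>c'\<in>edges C. ((T.vproj (tgt c') * T (?b c)) \<otimes>\<^sub>o (leg C c' * munit 0 0)) \<otimes>\<^sub>o
      (adj (leg C c') * (leg C (cA a) * (k * adj (leg C c))))) = (T (?b c) \<otimes>\<^sub>o (leg C (cA a) * munit 0 0)) \<otimes>\<^sub>o (k * adj (leg C c))"
      using A_facts(1)[OF a] edgeB_mem[OF a c] src_edgeB[OF a c] by (simp add: T.vproj_gen leg_adj_mult_assoc)
  qed
  also have "\<dots> = intertwiner * image_gen a k"
    unfolding intertwiner_def image_gen_def sum_product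
    by (subst sum.swap) (simp add: tensor_mult mult.assoc munit_mult)
  finally show ?thesis .
qed

text \<open>Taking adjoints in \<open>intertwine\<close> would give a statement about
  \<open>adj intertwiner\<close> instead. The two lemmas together say that the range of
  \<open>intertwiner\<close> is invariant under the amplified generators and their adjoints, as
  \<open>conj_intertwine\<close> requires.\<close>

lemma intertwine_adj:
  assumes a: "a \<in> edges A"
  shows "adj (lift_gen a \<otimes>\<^sub>o k) * intertwiner = intertwiner * adj (image_gen a k)"
proof -
  let ?b = "edgeB (dA a)"
  have "adj (lift_gen a \<otimes>\<^sub>o k) * intertwiner = (\<Sum>c\<in>follow (tgt a). \<Sum>c'\<in>edges C.
      ((adj (T (?b c)) * T.vproj (tgt c')) \<otimes>\<^sub>o (leg C c * (adj (leg C (cA a)) * (leg C c' * munit 0 0)))) \<otimes>\<^sub>o (adj k * adj (leg C c')))"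
    by (simp add: lift_gen_def intertwiner_def adj_sum adj_mult adj_adj tensor_adj tensor_sum_left sum_product tensor_mult mult.assoc)
  also have "\<dots> = (\<Sum>c\<in>follow (tgt a). (adj (T (?b c)) \<otimes>\<^sub>o (leg C c * munit 0 0)) \<otimes>\<^sub>o (adj k * adj (leg C (cA a))))"
  proof (intro sum.cong refl)
    fix c assume c: "c \<in> follow (tgt a)"
    have "((adj (T (?b c)) * T.vproj (tgt c')) \<otimes>\<^sub>o (leg C c * (adj (leg C (cA a)) * (leg C c' * munit 0 0)))) \<otimes>\<^sub>o (adj k * adj (leg C c')) = 0"
      if "c' \<in> edges C" "c' \<noteq> cA a" for c'
      using c that A_facts(1)[OF a] edgeB_mem[OF a c] src_edgeB[OF a c]
      by (cases "tgt (cA a) = tgt c'") (simp_all add: T.adj_gen_vproj leg_adj_mult_assoc)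
    from sum_single[OF finite_edges A_facts(1)[OF a] this]
    show "(\<Sum>c'\<in>edges C. ((adj (T (?b c)) * T.vproj (tgt c')) \<otimes>\<^sub>o (leg C c * (adj (leg C (cA a)) * (leg C c' * munit 0 0)))) \<otimes>\<^sub>o (adj k * adj (leg C c')))
      = (adj (T (?b c)) \<otimes>\<^sub>o (leg C c * munit 0 0)) \<otimes>\<^sub>o (adj k * adj (leg C (cA a)))"
      using A_facts(1)[OF a] edgeB_mem[OF a c] src_edgeB[OF a c] by (simp add: T.adj_gen_vproj leg_adj_mult_assoc)
  qed
  also have "\<dots> = (\<Sum>c\<in>follow (tgt a). \<Sum>c'\<in>edges C. ((T.vproj (tgt c') * adj (T (?b c))) \<otimes>\<^sub>o (leg C c' * munit 0 0)) \<otimes>\<^sub>o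
      (adj (leg C c') * (leg C c * (adj k * adj (leg C (cA a))))))"
  proof (intro sum.cong refl, rule sym)
    fix c assume c: "c \<in> follow (tgt a)"
    hence c1: "c \<in> edges C" by simp
    have "((T.vproj (tgt c') * adj (T (?b c))) \<otimes>\<^sub>o (leg C c' * munit 0 0)) \<otimes>\<^sub>o
      (adj (leg C c') * (leg C c * (adj k * adj (leg C (cA a))))) = 0" if "c' \<in> edges C" "c' \<noteq> c" for c'
      using that c1 edgeB_mem[OF a c] tgt_edgeB[OF a c]
      by (cases "tgt c' = tgt c") (simp_all add: T.vproj_adj_gen leg_adj_mult_assoc)
    from sum_single[OF finite_edges c1 this]
    show "(\<Sum>c'\<in>edges C. ((T.vproj (tgt c') * adj (T (?b c))) \<otimes>\<^sub>o (leg C c' * munit 0 0)) \<otimes>\<^sub>o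
      (adj (leg C c') * (leg C c * (adj k * adj (leg C (cA a)))))) = (adj (T (?b c)) \<otimes>\<^sub>o (leg C c * munit 0 0)) \<otimes>\<^sub>o (adj k * adj (leg C (cA a)))"
      using c1 edgeB_mem[OF a c] tgt_edgeB[OF a c] by (simp add: T.vproj_adj_gen leg_adj_mult_assoc)
  qed
  also have "\<dots> = intertwiner * adj (image_gen a k)"
    unfolding intertwiner_def image_gen_def adj_sum sum_product
    by (subst sum.swap) (simp add: tensor_mult tensor_adj adj_mult adj_adj mult.assoc munit_mult)
  finally show ?thesis .
qed

end

section \<open>Generators of the stabilized algebras and of their diagonals\<close>

lemma ck_algebra_generator: "a \<in> edges A \<Longrightarrow> ck_gen A a \<in> \<O> A"
  unfolding ck_algebra_def using cstar_generated_superset by blast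

lemma star_subalgebra_ck_algebra [simp]: "star_subalgebra (\<O> A)" "closed (\<O> A)"
  by (simp_all add: ck_algebra_def)

lemma star_subalgebra_ck_diagonal [simp]: "star_subalgebra (\<D> A)" "closed (\<D> A)"
  by (simp_all add: ck_diagonal_def)

lemma ck_stable_generators:
  "\<O> A \<otimes>\<^sub>* compacts = cstar_generated {ck_gen A a \<otimes>\<^sub>o munit i j | a i j. a \<in> edges A}"
proof -
  have "{x \<otimes>\<^sub>o munit i j | x i j. x \<in> ck_gen A ` edges A} = {ck_gen A a \<otimes>\<^sub>o (munit i j :: nat cop) | a i j. a \<in> edges A}"
    by blast
  thus ?thesis unfolding ck_algebra_def stabilization_generators by simp
qed

lemma ck_stable_diagonal_generators:
  "\<D> A \<otimes>\<^sub>* diagonal_compacts = cstar_generated {ck_proj A \<mu> \<otimes>\<^sub>o munit i i | \<mu> i. \<mu> \<in> finite_paths A}"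
proof -
  have "{x \<otimes>\<^sub>o munit i i | x i. x \<in> ck_proj A ` finite_paths A} = {ck_proj A \<mu> \<otimes>\<^sub>o (munit i i :: nat cop) | \<mu> i. \<mu> \<in> finite_paths A}"
    by blast
  thus ?thesis unfolding ck_diagonal_def diagonal_stabilization_generators by simp
qed

lemma star_subalgebra_ck_stable [simp]:
  "star_subalgebra (\<O> A \<otimes>\<^sub>* compacts)" "closed (\<O> A \<otimes>\<^sub>* compacts)"
  "star_subalgebra (\<D> A \<otimes>\<^sub>* diagonal_compacts)" "closed (\<D> A \<otimes>\<^sub>* diagonal_compacts)"
  by (simp_all add: ck_stable_generators ck_stable_diagonal_generators)

lemma ck_tensor_mem: "x \<in> \<O> A \<Longrightarrow> x \<otimes>\<^sub>o munit i j \<in> \<O> A \<otimes>\<^sub>* compacts"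
  by (intro tensor_in_cstar_tensor munit_compact)

lemma diag_tensor_mem: "x \<in> \<D> A \<Longrightarrow> x \<otimes>\<^sub>o munit i i \<in> \<D> A \<otimes>\<^sub>* diagonal_compacts"
  by (intro tensor_in_cstar_tensor munit_diagonal_compact)

lemma block_index_inj: "inj g \<Longrightarrow> inj (\<lambda>(j, k). ((S, g j), k))"
  by (auto simp: inj_def)

text \<open>The substitute for the universal property: compression to the block \<open>S\<close>
  turns the generators into the family of that block. The bijection \<open>g\<close> recodes the
  index set of the block, so that families on other countable index sets can be reached.\<close>

lemma compress_block:
  fixes A :: "nat ^ 'n ^ 'n" and g :: "'j \<Rightarrow> nat" and T :: "'k cop"
  assumes "irreducible_matrix A" "a \<in> edges A" "bij g"
  shows "compress (\<lambda>(j, k). ((S, g j), k)) (ck_gen A a \<otimes>\<^sub>o T) = compress g (ck_rep A S a) \<otimes>\<^sub>o T"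
    and "ck_gen A a \<otimes>\<^sub>o T \<in> mult_domain (compress (\<lambda>(j, k). ((S, g j), k)))"
proof -
  note g = bij_is_inj[OF assms(3)]
  note h = block_index_inj[OF g, of S]
  show "compress (\<lambda>(j, k). ((S, g j), k)) (ck_gen A a \<otimes>\<^sub>o T) = compress g (ck_rep A S a) \<otimes>\<^sub>o T"
    by (rule cop_eqI_mel) (auto simp: mel_compress[OF h] mel_compress[OF g] mel_tensor mel_ck_gen[OF assms(1,2)])
  show "ck_gen A a \<otimes>\<^sub>o T \<in> mult_domain (compress (\<lambda>(j, k). ((S, g j), k)))"
  proof (rule mult_domain_compress[OF h])
    fix i :: "'j \<times> 'k" and p :: "'n ck_index \<times> 'k"
    obtain j k where i: "i = (j, k)" by fastforce
    obtain S' n l where p: "p = ((S', n), l)" by (metis surj_pair)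
    assume "p \<notin> range (\<lambda>(j, k). ((S, g j), k))"
    \<comment> \<open>\<open>g\<close> is onto, so an index outside the range must lie in a
      different block.\<close>
    hence "S' \<noteq> S" using surj_f_inv_f[OF bij_is_surj[OF assms(3)], of n] p
      by (auto simp: image_iff split_def) (metis fst_conv snd_conv)
    thus "mel (ck_gen A a \<otimes>\<^sub>o T) ((\<lambda>(j, k). ((S, g j), k)) i) p = 0 \<and> mel (ck_gen A a \<otimes>\<^sub>o T) p ((\<lambda>(j, k). ((S, g j), k)) i) = 0"
      by (simp add: i p mel_tensor mel_ck_gen[OF assms(1,2)])
  qed
qed

context factorization_family begin

lemma image_gen_compress:
  defines "h \<equiv> \<lambda>(i, k). ((i, 0 :: nat), k :: nat)"
  shows "compress h (image_gen a k) = (\<Sum>c\<in>follow (tgt a). T (edgeB (dA a) c) \<otimes>\<^sub>o (leg C (cA a) * k * adj (leg C c)))"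
    and "image_gen a k \<in> mult_domain (compress h)"
proof -
  have h: "inj h" unfolding h_def by (auto simp: inj_def)
  have h_eq: "h (i, k) = ((i, 0), k)" for i k by (simp add: h_def)
  have "compress h ((Y \<otimes>\<^sub>o munit 0 0) \<otimes>\<^sub>o Z) = Y \<otimes>\<^sub>o Z" for Y :: "'i cop" and Z
    by (rule cop_eqI_mel) (simp only: split_paired_all mel_compress[OF h] mel_tensor mel_munit h_eq, simp)
  thus "compress h (image_gen a k) = (\<Sum>c\<in>follow (tgt a). T (edgeB (dA a) c) \<otimes>\<^sub>o (leg C (cA a) * k * adj (leg C c)))"
    unfolding image_gen_def star_map_sum[OF star_map_compress[OF h]] by simp
  have "(Y \<otimes>\<^sub>o munit 0 0) \<otimes>\<^sub>o Z \<in> mult_domain (compress h)" for Y :: "'i cop" and Z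
  proof (rule mult_domain_compress[OF h])
    fix i :: "'i \<times> nat" and p :: "('i \<times> nat) \<times> nat"
    obtain j k where i: "i = (j, k)" by fastforce
    obtain x n l where p: "p = ((x, n), l)" by (metis surj_pair)
    assume "p \<notin> range h"
    hence "n \<noteq> 0" using p h_eq by (metis rangeI)
    thus "mel ((Y \<otimes>\<^sub>o munit 0 0) \<otimes>\<^sub>o Z) (h i) p = 0 \<and> mel ((Y \<otimes>\<^sub>o munit 0 0) \<otimes>\<^sub>o Z) p (h i) = 0"
      by (simp add: i p mel_tensor mel_munit h_eq)
  qed
  thus "image_gen a k \<in> mult_domain (compress h)"
    unfolding image_gen_def
    by (intro star_subalgebra_sum[OF star_subalgebra_mult_domain[OF star_map_compress[OF h]]])
qed

end

section \<open>The stable isomorphism and its values on generators\<close>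

context factorization begin

text \<open>The block of the isomorphism at a family \<open>T\<close> for \<open>B\<close> only depends on the block of its
  argument at the family \<open>lift_index T\<close> for \<open>A\<close>, which acts on \<open>\<ell>\<^sup>2(\<nat> \<times> \<nat>)\<close>, encoded as \<open>\<ell>\<^sup>2(\<nat>)\<close>.\<close>

definition lift_index :: "(('m, 'm) edge \<Rightarrow> nat cop) \<Rightarrow> ('n, 'n) edge \<Rightarrow> nat cop" where
  "lift_index T a = compress prod_decode (factorization_family.lift_gen B C \<kappa>\<^sub>A \<kappa>\<^sub>B (ck_rep B T) a)"

text \<open>From the inside out: compress to the block of the lifted family, decoding its index set
  into pairs; conjugate by the intertwiner; delete the middle factor, in which the images of the
  generators carry just a rank one projection.\<close>

definition stable_block :: "(('m, 'm) edge \<Rightarrow> nat cop) \<Rightarrow> ('n ck_index \<times> nat) cop \<Rightarrow> (nat \<times> nat) cop" where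
  "stable_block T X = compress (\<lambda>(i, k). ((i, 0), k))
    (adj (factorization_family.intertwiner B C (ck_rep B T)) *
     compress (\<lambda>(j, k). ((lift_index T, prod_encode j), k)) X *
     factorization_family.intertwiner B C (ck_rep B T))"

definition stable_iso :: "('n ck_index \<times> nat) cop \<Rightarrow> ('m ck_index \<times> nat) cop" where
  "stable_iso = blocks stable_block"

lemma ck_rep_factorization_family: "factorization_family A B C D \<kappa>\<^sub>A \<kappa>\<^sub>B (ck_rep B T)"
  using ck_rep_family[OF irrB] factorization_axioms by (simp add: factorization_family_def)

lemma ck_family_lift_index: "ck_family A (lift_index T)"
proof -
  interpret F: factorization_family A B C D \<kappa>\<^sub>A \<kappa>\<^sub>B "ck_rep B T" by (rule ck_rep_factorization_family)
  have "compress prod_decode (1 :: (nat \<times> nat) cop) = 1"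
    by (rule cop_eqI_mel) (simp add: mel_compress[OF bij_is_inj[OF bij_prod_decode]] mel_one prod_decode_eq)
  moreover have "F.lift_gen a \<in> mult_domain (compress prod_decode)" if "a \<in> edges A" for a
    by (rule mult_domain_compress_bij[OF bij_prod_decode])
  ultimately have "ck_family A (\<lambda>a. compress prod_decode (F.lift_gen a))"
    using ck_family_star_map[OF F.ck_family_lift_gen star_map_compress[OF bij_is_inj[OF bij_prod_decode]]] by blast
  thus ?thesis by (simp add: lift_index_def[abs_def])
qed

lemma lift_index_uncompress:
  "compress prod_encode (lift_index T a) = factorization_family.lift_gen B C \<kappa>\<^sub>A \<kappa>\<^sub>B (ck_rep B T) a"
  unfolding lift_index_def
  by (rule cop_eqI_mel)
    (simp add: mel_compress[OF bij_is_inj[OF bij_prod_decode]] mel_compress[OF bij_is_inj[OF bij_prod_encode]])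

lemma star_map_stable_block: "star_map (stable_block T)"
proof -
  interpret F: factorization_family A B C D \<kappa>\<^sub>A \<kappa>\<^sub>B "ck_rep B T" by (rule ck_rep_factorization_family)
  have "inj (\<lambda>(i :: nat, k :: nat). ((i, 0 :: nat), k))" by (auto simp: inj_def)
  thus ?thesis unfolding stable_block_def[abs_def]
    by (intro star_map_comp[OF star_map_comp[OF star_map_compress star_map_conj] star_map_compress]
        block_index_inj bij_is_inj[OF bij_prod_encode] F.norm_intertwiner)
qed

lemma stable_block_generator:
  assumes "a \<in> edges A"
  shows "stable_block T (ck_gen A a \<otimes>\<^sub>o k) =
      (\<Sum>c\<in>follow (tgt a). ck_rep B T (edgeB (dA a) c) \<otimes>\<^sub>o (leg C (cA a) * k * adj (leg C c)))"
    and "ck_gen A a \<otimes>\<^sub>o k \<in> mult_domain (stable_block T)"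
proof -
  interpret F: factorization_family A B C D \<kappa>\<^sub>A \<kappa>\<^sub>B "ck_rep B T" by (rule ck_rep_factorization_family)
  have 1: "compress (\<lambda>(j, k). ((lift_index T, prod_encode j), k)) (ck_gen A a \<otimes>\<^sub>o k) = F.lift_gen a \<otimes>\<^sub>o k"
    unfolding compress_block(1)[OF irrA assms bij_prod_encode]
    by (simp only: ck_rep_eq[OF ck_family_lift_index] lift_index_uncompress)
  note 2 = compress_block(2)[OF irrA assms bij_prod_encode, of k "lift_index T"]
  note 3 = conj_intertwine[OF F.intertwine[OF assms] F.intertwine_adj[OF assms] F.intertwiner_image_gen, of k]
  show "stable_block T (ck_gen A a \<otimes>\<^sub>o k) =
      (\<Sum>c\<in>follow (tgt a). ck_rep B T (edgeB (dA a) c) \<otimes>\<^sub>o (leg C (cA a) * k * adj (leg C c)))"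
    unfolding stable_block_def 1 3(1) F.image_gen_compress ..
  show "ck_gen A a \<otimes>\<^sub>o k \<in> mult_domain (stable_block T)"
    unfolding stable_block_def[abs_def]
    by (intro mult_domain_comp[OF mult_domain_comp[OF 2]]) (simp_all add: 1 3 F.image_gen_compress)
qed

lemma star_map_stable_iso: "star_map stable_iso"
  unfolding stable_iso_def by (intro star_map_blocks star_map_stable_block)

lemma stable_iso_generator:
  assumes a: "a \<in> edges A"
  shows "stable_iso (ck_gen A a \<otimes>\<^sub>o k) =
      (\<Sum>c\<in>follow (tgt a). ck_gen B (edgeB (dA a) c) \<otimes>\<^sub>o (leg C (cA a) * k * adj (leg C c)))"
proof (rule cop_eqI_mel)
  fix p q :: "'m ck_index \<times> nat"
  obtain T i k' where p: "p = ((T, i), k')" by (metis surj_pair)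
  obtain T' j l where q: "q = ((T', j), l)" by (metis surj_pair)
  show "mel (stable_iso (ck_gen A a \<otimes>\<^sub>o k)) p q =
      mel (\<Sum>c\<in>follow (tgt a). ck_gen B (edgeB (dA a) c) \<otimes>\<^sub>o (leg C (cA a) * k * adj (leg C c))) p q"
    unfolding p q stable_iso_def mel_blocks[OF star_map_stable_block] stable_block_generator(1)[OF a]
    by (simp add: mel_sum mel_tensor mel_ck_gen[OF irrB edgeB_mem[OF a]])
qed

lemma stable_iso_generator_mult_domain: "a \<in> edges A \<Longrightarrow> ck_gen A a \<otimes>\<^sub>o k \<in> mult_domain stable_iso"
  unfolding stable_iso_def by (intro mult_domain_blocks star_map_stable_block stable_block_generator(2))

lemma stable_iso_generator_munit:
  assumes a: "a \<in> edges A"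
  shows "stable_iso (ck_gen A a \<otimes>\<^sub>o munit i j) =
      (\<Sum>c\<in>follow (tgt a). ck_gen B (edgeB (dA a) c) \<otimes>\<^sub>o munit (leg_index C (cA a) i) (leg_index C c j))"
  unfolding stable_iso_generator[OF a]
  by (intro sum.cong refl) (use A_facts(1)[OF a] in \<open>simp add: leg_munit\<close>)

lemma stable_iso_subset:
  shows "\<O> A \<otimes>\<^sub>* compacts \<subseteq> mult_domain stable_iso" "stable_iso ` (\<O> A \<otimes>\<^sub>* compacts) \<subseteq> \<O> B \<otimes>\<^sub>* compacts"
proof -
  let ?G = "{ck_gen A a \<otimes>\<^sub>o munit i j | a i j. a \<in> edges A}"
  have 1: "?G \<subseteq> mult_domain stable_iso" using stable_iso_generator_mult_domain by blast
  have 2: "stable_iso ` ?G \<subseteq> \<O> B \<otimes>\<^sub>* compacts"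
  proof clarify
    fix a i j assume "a \<in> edges A"
    thus "stable_iso (ck_gen A a \<otimes>\<^sub>o munit i j) \<in> \<O> B \<otimes>\<^sub>* compacts"
      unfolding stable_iso_generator_munit[OF \<open>a \<in> edges A\<close>]
      by (intro star_subalgebra_sum star_subalgebra_ck_stable ck_tensor_mem ck_algebra_generator edgeB_mem)
  qed
  show "\<O> A \<otimes>\<^sub>* compacts \<subseteq> mult_domain stable_iso" "stable_iso ` (\<O> A \<otimes>\<^sub>* compacts) \<subseteq> \<O> B \<otimes>\<^sub>* compacts"
    unfolding ck_stable_generators[of A] by (intro star_map_generated_subset[OF star_map_stable_iso 1 2]; simp)+
qed

lemma stable_iso_mult:
  "x \<in> \<O> A \<otimes>\<^sub>* compacts \<Longrightarrow> stable_iso (x * y) = stable_iso x * stable_iso y"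
  "x \<in> \<O> A \<otimes>\<^sub>* compacts \<Longrightarrow> stable_iso (y * x) = stable_iso y * stable_iso x"
  using stable_iso_subset(1) mult_domainD by blast+

section \<open>Images of words and of the diagonal\<close>

fun shift_path :: "('n, 'n) edge list \<Rightarrow> ('n, 'm) edge \<Rightarrow> ('m, 'm) edge list" where
  "shift_path [] c = []"
| "shift_path [a] c = [edgeB (dA a) c]"
| "shift_path (a # a' # \<mu>) c = edgeB (dA a) (cA a') # shift_path (a' # \<mu>) c"

lemma length_shift_path [simp]: "length (shift_path \<mu> c) = length \<mu>"
  by (induction \<mu> c rule: shift_path.induct) auto

lemma shift_path_facts:
  assumes "\<mu> \<in> finite_paths A" "c \<in> follow (tgt (last \<mu>))"
  shows "shift_path \<mu> c \<in> finite_paths B" "src (hd (shift_path \<mu> c)) = tgt (cA (hd \<mu>))"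
    "tgt (last (shift_path \<mu> c)) = tgt c"
proof -
  have "shift_path \<mu> c \<in> finite_paths B \<and> src (hd (shift_path \<mu> c)) = tgt (cA (hd \<mu>)) \<and>
    tgt (last (shift_path \<mu> c)) = tgt c"
    using assms
  proof (induction \<mu> c rule: shift_path.induct)
    case (2 a c)
    thus ?case using edgeB_mem[of a c] src_edgeB[of a c] tgt_edgeB[of a c] by (simp add: finite_paths_Cons)
  next
    case (3 a a' \<mu> c)
    have a: "a \<in> edges A" "a' \<in> edges A" "tgt a = src a'" "a' # \<mu> \<in> finite_paths A"
      using 3(2) by (auto simp: finite_paths_Cons)
    have c: "cA a' \<in> follow (tgt a)" using A_facts(1,4)[OF a(2)] a(3) by simp
    have ne: "shift_path (a' # \<mu>) c \<noteq> []" using length_shift_path[of "a' # \<mu>" c] by (metis length_0_conv list.discI)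
    show ?case using 3(1)[OF a(4)] 3(3) edgeB_mem[OF a(1) c] src_edgeB[OF a(1) c] tgt_edgeB[OF a(1) c] ne
      by (simp add: finite_paths_Cons)
  qed (simp add: finite_paths_def)
  thus "shift_path \<mu> c \<in> finite_paths B" "src (hd (shift_path \<mu> c)) = tgt (cA (hd \<mu>))"
    "tgt (last (shift_path \<mu> c)) = tgt c" by auto
qed

lemma A_gen: "cuntz_krieger A (ck_gen A)" and B_gen: "cuntz_krieger B (ck_gen B)"
  using irrA irrB by (simp_all add: ck_gen_family)

end

sublocale factorization \<subseteq> GA: cuntz_krieger A "ck_gen A" by (rule A_gen)
sublocale factorization \<subseteq> GB: cuntz_krieger B "ck_gen B" by (rule B_gen)

lemma (in cuntz_krieger) word_mem:
  "star_subalgebra E \<Longrightarrow> (\<And>a. a \<in> edges A \<Longrightarrow> S a \<in> E) \<Longrightarrow> \<mu> \<in> finite_paths A \<Longrightarrow> word \<mu> \<in> E"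
proof (induction \<mu>)
  case (Cons a \<mu>)
  thus ?case by (cases "\<mu> = []") (simp_all add: finite_paths_Cons sub_mult)
qed (simp add: finite_paths_def)

context factorization begin

lemma wordA_mem: "\<mu> \<in> finite_paths A \<Longrightarrow> GA.word \<mu> \<in> \<O> A"
  by (rule GA.word_mem) (auto intro: ck_algebra_generator)

lemma wprojA_eq: "GA.wproj \<mu> = ck_proj A \<mu>" and wprojB_eq: "GB.wproj \<nu> = ck_proj B \<nu>"
  by (simp_all add: GA.wproj_def GA.word_def GB.wproj_def GB.word_def ck_proj_def)

lemma leg_index_eqD:
  "c \<in> edges C \<Longrightarrow> c' \<in> edges C \<Longrightarrow> tgt c = tgt c' \<Longrightarrow> leg_index C c m = leg_index C c' n \<Longrightarrow> c = c'"
  using leg_index_inj_iff by blast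

text \<open>In the product of the images of consecutive generators, either the inner matrix units or
  the vertex projections fail to match unless the free edge after \<open>dA a\<close> is the first
  half of the next generator. Only the free edge at the end of the word survives.\<close>

lemma stable_iso_word:
  assumes "\<mu> \<in> finite_paths A"
  shows "stable_iso (GA.word \<mu> \<otimes>\<^sub>o munit i j) =
    (\<Sum>c\<in>follow (tgt (last \<mu>)). GB.word (shift_path \<mu> c) \<otimes>\<^sub>o munit (leg_index C (cA (hd \<mu>)) i) (leg_index C c j))"
  using assms
proof (induction \<mu>)
  case (Cons a \<mu>)
  have a: "a \<in> edges A" using Cons.prems by (simp add: finite_paths_Cons)
  show ?case
  proof (cases \<mu>)
    case Nil
    thus ?thesis using stable_iso_generator_munit[OF a] by simp
  next
    case (Cons a' \<mu>')
    hence p: "\<mu> \<in> finite_paths A" "tgt a = src a'" "a' \<in> edges A"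
      using Cons.prems by (auto simp: finite_paths_Cons)
    have c0: "cA a' \<in> follow (tgt a)" using A_facts(1,4)[OF p(3)] p(2) by simp
    have hd: "hd \<mu> = a'" by (simp add: Cons)
    let ?l = "leg_index C"
    have "GA.word (a # \<mu>) \<otimes>\<^sub>o munit i j = (ck_gen A a \<otimes>\<^sub>o munit i i) * (GA.word \<mu> \<otimes>\<^sub>o munit i j)"
      by (simp add: tensor_mult munit_mult)
    hence "stable_iso (GA.word (a # \<mu>) \<otimes>\<^sub>o munit i j) =
        stable_iso (ck_gen A a \<otimes>\<^sub>o munit i i) * stable_iso (GA.word \<mu> \<otimes>\<^sub>o munit i j)"
      by (simp add: mult_domainD(1)[OF stable_iso_generator_mult_domain[OF a]])
    also have "\<dots> = (\<Sum>c\<in>follow (tgt a). \<Sum>c'\<in>follow (tgt (last \<mu>)).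
        (ck_gen B (edgeB (dA a) c) * GB.word (shift_path \<mu> c')) \<otimes>\<^sub>o
        (munit (?l (cA a) i) (?l c i) * munit (?l (cA a') i) (?l c' j)))"
      unfolding stable_iso_generator_munit[OF a] Cons.IH[OF p(1)] sum_product tensor_mult by (simp add: Cons)
    also have "\<dots> = (\<Sum>c'\<in>follow (tgt (last \<mu>)). \<Sum>c\<in>follow (tgt a).
        (ck_gen B (edgeB (dA a) c) * GB.word (shift_path \<mu> c')) \<otimes>\<^sub>o
        (munit (?l (cA a) i) (?l c i) * munit (?l (cA a') i) (?l c' j)))"
      by (rule sum.swap)
    also have "\<dots> = (\<Sum>c'\<in>follow (tgt (last \<mu>)).
        (ck_gen B (edgeB (dA a) (cA a')) * GB.word (shift_path \<mu> c')) \<otimes>\<^sub>o munit (?l (cA a) i) (?l c' j))"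
    proof (intro sum.cong refl)
      fix c' assume c': "c' \<in> follow (tgt (last \<mu>))"
      note sp = shift_path_facts[OF p(1) c']
      have "(ck_gen B (edgeB (dA a) c) * GB.word (shift_path \<mu> c')) \<otimes>\<^sub>o
        (munit (?l (cA a) i) (?l c i) * munit (?l (cA a') i) (?l c' j)) = 0"
        if c: "c \<in> follow (tgt a)" "c \<noteq> cA a'" for c
      proof (cases "tgt c = tgt (cA a')")
        case True
        hence "?l c i \<noteq> ?l (cA a') i" using leg_index_eqD[of c "cA a'" i i] c A_facts(1)[OF p(3)] by blast
        thus ?thesis by (simp add: munit_mult)
      next
        case False
        have "ck_gen B (edgeB (dA a) c) * GB.word (shift_path \<mu> c') =
            ck_gen B (edgeB (dA a) c) * GB.vproj (tgt c) * GB.word (shift_path \<mu> c')"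
          using edgeB_mem[OF a c(1)] tgt_edgeB[OF a c(1)] by (simp add: GB.gen_vproj)
        also have "\<dots> = 0" using False sp(2) by (simp add: mult.assoc GB.hd_word[OF sp(1)] hd)
        finally show ?thesis by simp
      qed
      from sum_single[OF finite_follow c0 this]
      show "(\<Sum>c\<in>follow (tgt a). (ck_gen B (edgeB (dA a) c) * GB.word (shift_path \<mu> c')) \<otimes>\<^sub>o
        (munit (?l (cA a) i) (?l c i) * munit (?l (cA a') i) (?l c' j))) =
        (ck_gen B (edgeB (dA a) (cA a')) * GB.word (shift_path \<mu> c')) \<otimes>\<^sub>o munit (?l (cA a) i) (?l c' j)"
        by (simp add: munit_mult)
    qed
    finally show ?thesis by (simp add: Cons)
  qed
qed (simp add: finite_paths_def)

lemma word_tensor_mem: "\<mu> \<in> finite_paths A \<Longrightarrow> GA.word \<mu> \<otimes>\<^sub>o munit i j \<in> \<O> A \<otimes>\<^sub>* compacts"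
  by (intro ck_tensor_mem wordA_mem)

lemma word_adj_word_eq_0:
  assumes "\<mu> \<in> finite_paths B" "\<nu> \<in> finite_paths B" "tgt (last \<mu>) \<noteq> tgt (last \<nu>)"
  shows "GB.word \<mu> * adj (GB.word \<nu>) = 0"
proof -
  have "GB.word \<mu> * adj (GB.word \<nu>) = GB.word \<mu> * GB.vproj (tgt (last \<mu>)) * adj (GB.word \<nu> * GB.vproj (tgt (last \<nu>)))"
    by (simp add: GB.word_last assms)
  also have "\<dots> = GB.word \<mu> * (GB.vproj (tgt (last \<mu>)) * GB.vproj (tgt (last \<nu>))) * adj (GB.word \<nu>)"
    by (simp add: adj_mult mult.assoc)
  finally show ?thesis using assms by (simp add: GB.vproj_mult)
qed

text \<open>The free edges at the ends of the two words must agree, for the same reason. With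
  \<open>\<mu> = \<nu>\<close> this shows that the diagonal is preserved, and with
  \<open>a # \<nu>\<close> for \<open>\<mu>\<close> it gives the elements on which the gauge actions
  are compared.\<close>

lemma stable_iso_word_adj:
  assumes "\<mu> \<in> finite_paths A" "\<nu> \<in> finite_paths A" "tgt (last \<mu>) = tgt (last \<nu>)"
  shows "stable_iso ((GA.word \<mu> * adj (GA.word \<nu>)) \<otimes>\<^sub>o munit i j) =
    (\<Sum>c\<in>follow (tgt (last \<mu>)). (GB.word (shift_path \<mu> c) * adj (GB.word (shift_path \<nu> c))) \<otimes>\<^sub>o
      munit (leg_index C (cA (hd \<mu>)) i) (leg_index C (cA (hd \<nu>)) j))"
proof -
  let ?l = "leg_index C"
  have "(GA.word \<mu> * adj (GA.word \<nu>)) \<otimes>\<^sub>o munit i j = (GA.word \<mu> \<otimes>\<^sub>o munit i i) * adj (GA.word \<nu> \<otimes>\<^sub>o munit j i)"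
    by (simp add: tensor_adj tensor_mult munit_mult)
  hence "stable_iso ((GA.word \<mu> * adj (GA.word \<nu>)) \<otimes>\<^sub>o munit i j) =
      stable_iso (GA.word \<mu> \<otimes>\<^sub>o munit i i) * adj (stable_iso (GA.word \<nu> \<otimes>\<^sub>o munit j i))"
    by (simp add: stable_iso_mult word_tensor_mem assms star_map_adj[OF star_map_stable_iso])
  also have "\<dots> = (\<Sum>c\<in>follow (tgt (last \<mu>)). \<Sum>c'\<in>follow (tgt (last \<mu>)).
      (GB.word (shift_path \<mu> c) * adj (GB.word (shift_path \<nu> c'))) \<otimes>\<^sub>o
      (munit (?l (cA (hd \<mu>)) i) (?l c i) * munit (?l c' i) (?l (cA (hd \<nu>)) j)))"
    unfolding stable_iso_word[OF assms(1)] stable_iso_word[OF assms(2)] adj_sum sum_product tensor_adj tensor_mult munit_adj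
    by (simp add: assms(3))
  also have "\<dots> = (\<Sum>c\<in>follow (tgt (last \<mu>)). (GB.word (shift_path \<mu> c) * adj (GB.word (shift_path \<nu> c))) \<otimes>\<^sub>o
      munit (?l (cA (hd \<mu>)) i) (?l (cA (hd \<nu>)) j))"
  proof (intro sum.cong refl)
    fix c assume c: "c \<in> follow (tgt (last \<mu>))"
    have "(GB.word (shift_path \<mu> c) * adj (GB.word (shift_path \<nu> c'))) \<otimes>\<^sub>o
      (munit (?l (cA (hd \<mu>)) i) (?l c i) * munit (?l c' i) (?l (cA (hd \<nu>)) j)) = 0"
      if c': "c' \<in> follow (tgt (last \<mu>))" "c' \<noteq> c" for c'
    proof (cases "tgt c = tgt c'")
      case True
      hence "?l c i \<noteq> ?l c' i" using leg_index_eqD[of c c' i i] c c' by blast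
      thus ?thesis by (simp add: munit_mult)
    next
      case False
      have c'': "c' \<in> follow (tgt (last \<nu>))" using c' assms(3) by simp
      have "GB.word (shift_path \<mu> c) * adj (GB.word (shift_path \<nu> c')) = 0"
        using False shift_path_facts[OF assms(1) c] shift_path_facts[OF assms(2) c'']
        by (intro word_adj_word_eq_0) simp_all
      thus ?thesis by simp
    qed
    from sum_single[OF finite_follow c this]
    show "(\<Sum>c'\<in>follow (tgt (last \<mu>)). (GB.word (shift_path \<mu> c) * adj (GB.word (shift_path \<nu> c'))) \<otimes>\<^sub>o
      (munit (?l (cA (hd \<mu>)) i) (?l c i) * munit (?l c' i) (?l (cA (hd \<nu>)) j))) =
      (GB.word (shift_path \<mu> c) * adj (GB.word (shift_path \<nu> c))) \<otimes>\<^sub>o munit (?l (cA (hd \<mu>)) i) (?l (cA (hd \<nu>)) j)"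
      by (simp add: munit_mult)
  qed
  finally show ?thesis .
qed

lemma stable_iso_wproj:
  assumes "\<mu> \<in> finite_paths A"
  shows "stable_iso (ck_proj A \<mu> \<otimes>\<^sub>o munit i i) = (\<Sum>c\<in>follow (tgt (last \<mu>)).
    ck_proj B (shift_path \<mu> c) \<otimes>\<^sub>o munit (leg_index C (cA (hd \<mu>)) i) (leg_index C (cA (hd \<mu>)) i))"
  using stable_iso_word_adj[OF assms assms refl]
  by (simp add: wprojA_eq[symmetric] wprojB_eq[symmetric] GA.wproj_def GB.wproj_def)

lemma ck_proj_mem: "\<mu> \<in> finite_paths A \<Longrightarrow> ck_proj A \<mu> \<in> \<O> A"
  unfolding wprojA_eq[symmetric] GA.wproj_def using wordA_mem sub_mult sub_adj star_subalgebra_ck_algebra by blast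

lemma stable_iso_diagonal: "stable_iso ` (\<D> A \<otimes>\<^sub>* diagonal_compacts) \<subseteq> \<D> B \<otimes>\<^sub>* diagonal_compacts"
proof -
  let ?G = "{ck_proj A \<mu> \<otimes>\<^sub>o munit i i | \<mu> i. \<mu> \<in> finite_paths A}"
  have 1: "?G \<subseteq> mult_domain stable_iso" using ck_tensor_mem[OF ck_proj_mem] stable_iso_subset(1) by blast
  have 2: "stable_iso ` ?G \<subseteq> \<D> B \<otimes>\<^sub>* diagonal_compacts"
  proof clarify
    fix \<mu> i assume \<mu>: "\<mu> \<in> finite_paths A"
    have "ck_proj B (shift_path \<mu> c) \<in> \<D> B" if "c \<in> follow (tgt (last \<mu>))" for c
      unfolding ck_diagonal_def using shift_path_facts(1)[OF \<mu> that] cstar_generated_superset by blast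
    thus "stable_iso (ck_proj A \<mu> \<otimes>\<^sub>o munit i i) \<in> \<D> B \<otimes>\<^sub>* diagonal_compacts"
      unfolding stable_iso_wproj[OF \<mu>]
      by (intro star_subalgebra_sum star_subalgebra_ck_stable diag_tensor_mem)
  qed
  show ?thesis
    unfolding ck_stable_diagonal_generators[of A]
    by (rule star_map_generated_subset(2)[OF star_map_stable_iso 1 2]) simp_all
qed

lemma swap: "factorization B A D C \<kappa>\<^sub>B \<kappa>\<^sub>A"
  using irrA irrB splitA splitB by unfold_locales

end

lemma adj_iso_op_munit:
  assumes "inj \<sigma>" "inj \<tau>"
  shows "adj (iso_op \<sigma>) * munit i j * iso_op \<tau> =
    (if i \<in> range \<sigma> \<and> j \<in> range \<tau> then munit (inv_into UNIV \<sigma> i) (inv_into UNIV \<tau> j) else 0)"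
proof -
  have 1: "adj (iso_op \<sigma>) * munit i j = (if i \<in> range \<sigma> then munit (inv_into UNIV \<sigma> i) j else 0)"
    if "inj \<sigma>" for i j and \<sigma> :: "'a \<Rightarrow> 'a"
    by (rule cop_eqI_ket) (auto simp: app_munit_ket app_adj_iso_op_ket that)
  have 2: "munit i j * iso_op \<tau> = (if j \<in> range \<tau> then munit i (inv_into UNIV \<tau> j) else 0)" for i j
    using arg_cong[OF 1[OF assms(2), of j i], of adj] by (auto simp: adj_mult adj_adj split: if_splits)
  show ?thesis using 2 by (simp add: 1[OF assms(1)])
qed

section \<open>The round trip from \<open>A\<close> to \<open>B\<close> and back\<close>

context factorization begin

interpretation sw: factorization B A D C \<kappa>\<^sub>B \<kappa>\<^sub>A by (rule swap)

text \<open>The composition of the maps for \<open>(C, D)\<close> and \<open>(D, C)\<close> is conjugation by \<open>cycle_unitary\<close> below.\<close>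

definition pair_index :: "('n, 'n) edge \<Rightarrow> nat \<Rightarrow> nat" where
  "pair_index a n = leg_index D (dA a) (leg_index C (cA a) n)"

lemma pair_index_inj_iff:
  assumes "a \<in> edges A" "a' \<in> edges A" "tgt a = tgt a'"
  shows "pair_index a m = pair_index a' n \<longleftrightarrow> a = a' \<and> m = n"
proof
  assume eq: "pair_index a m = pair_index a' n"
  have d: "dA a = dA a'" "leg_index C (cA a) m = leg_index C (cA a') n"
    using leg_index_inj_iff[OF A_facts(2)[OF assms(1)] A_facts(2)[OF assms(2)]] eq assms(3)
      A_facts(5)[OF assms(1)] A_facts(5)[OF assms(2)] by (auto simp: pair_index_def)
  have t: "tgt (cA a) = tgt (cA a')" using A_facts(3)[OF assms(1)] A_facts(3)[OF assms(2)] d(1) by simp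
  have c: "cA a = cA a'" "m = n"
    using leg_index_inj_iff[OF A_facts(1)[OF assms(1)] A_facts(1)[OF assms(2)] t] d(2) by auto
  have "edgeA (cA a) (dA a) = edgeA (cA a') (dA a')" unfolding c(1) d(1) ..
  hence "a = a'" unfolding edgeA_cd[OF assms(1)] edgeA_cd[OF assms(2)] .
  thus "a = a' \<and> m = n" using c(2) by simp
qed simp

lemma inj_pair_index: "a \<in> edges A \<Longrightarrow> inj (pair_index a)"
  by (rule injI) (simp add: pair_index_inj_iff)

text \<open>The legs of the edges of \<open>D\<close> that end at \<open>v\<close> fill \<nat>, and
  inside the leg of \<open>d\<close> the legs of the edges of \<open>C\<close> that end at the
  source of \<open>d\<close> fill everything again.\<close>

lemma pair_index_cover: "\<exists>a. a \<in> edges A \<and> tgt a = v \<and> n \<in> range (pair_index a)"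
proof -
  obtain d\<^sub>0 where "d\<^sub>0 \<in> edges D" "tgt d\<^sub>0 = v" using sw.C_column by blast
  then obtain d m where d: "d \<in> edges D" "tgt d = v" "n = leg_index D d m"
    using leg_index_surj[of d\<^sub>0 D n] by auto
  obtain c\<^sub>0 where "c\<^sub>0 \<in> edges C" "tgt c\<^sub>0 = src d" using C_column by blast
  then obtain c l where c: "c \<in> edges C" "tgt c = src d" "m = leg_index C c l"
    using leg_index_surj[of c\<^sub>0 C m] by auto
  note f = edgeA_facts[OF c(1) d(1) c(2)]
  have "n = pair_index (edgeA c d) l" using c d by (simp add: pair_index_def f(2))
  thus ?thesis using f(1,4) d(2) by blast
qed

definition cycle_unitary :: "('n ck_index \<times> nat) cop" where
  "cycle_unitary = (\<Sum>a\<in>edges A. ck_gen A a \<otimes>\<^sub>o adj (iso_op (pair_index a)))"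

lemma pair_op_adj_mult:
  assumes "a \<in> edges A" "a' \<in> edges A" "tgt a = tgt a'"
  shows "adj (iso_op (pair_index a)) * iso_op (pair_index a') = (if a = a' then 1 else 0)"
proof (cases "a = a'")
  case False
  hence "range (pair_index a) \<inter> range (pair_index a') = {}" by (auto simp: pair_index_inj_iff[OF assms])
  thus ?thesis using False assms by (simp add: iso_op_orthogonal inj_pair_index)
qed (use assms in \<open>simp add: iso_op_adj_mult inj_pair_index\<close>)

lemma cycle_unitary_adj_mult: "adj cycle_unitary * cycle_unitary = 1"
proof -
  let ?K = "\<lambda>a. iso_op (pair_index a)"
  have "adj cycle_unitary * cycle_unitary = (\<Sum>a\<in>edges A. \<Sum>a'\<in>edges A. (adj (ck_gen A a) * ck_gen A a') \<otimes>\<^sub>o (?K a * adj (?K a')))"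
    by (simp add: cycle_unitary_def adj_sum sum_product tensor_adj tensor_mult adj_adj)
  also have "\<dots> = (\<Sum>a\<in>edges A. GA.vproj (tgt a) \<otimes>\<^sub>o (?K a * adj (?K a)))"
  proof (intro sum.cong refl)
    fix a assume a: "a \<in> edges A"
    have z: "(adj (ck_gen A a) * ck_gen A a') \<otimes>\<^sub>o (?K a * adj (?K a')) = 0" if "a' \<in> edges A" "a' \<noteq> a" for a'
      using a that by (simp add: GA.adj_gen_mult)
    show "(\<Sum>a'\<in>edges A. (adj (ck_gen A a) * ck_gen A a') \<otimes>\<^sub>o (?K a * adj (?K a'))) = GA.vproj (tgt a) \<otimes>\<^sub>o (?K a * adj (?K a))"
      by (subst sum_single[OF finite_edges a], rule z, assumption+) (simp add: GA.adj_gen_mult a)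
  qed
  also have "\<dots> = (\<Sum>v\<in>UNIV. \<Sum>a\<in>{a \<in> edges A. tgt a = v}. GA.vproj (tgt a) \<otimes>\<^sub>o (?K a * adj (?K a)))"
    by (rule sum.group[symmetric]) simp_all
  also have "\<dots> = (\<Sum>v\<in>UNIV. GA.vproj v \<otimes>\<^sub>o 1)"
  proof (intro sum.cong refl)
    fix v
    have "(\<Sum>a | a \<in> edges A \<and> tgt a = v. ?K a * adj (?K a)) = 1"
    proof (rule sum_iso_op_range_proj)
      fix n
      show "\<exists>!a. a \<in> {a. a \<in> edges A \<and> tgt a = v} \<and> n \<in> range (pair_index a)"
        using pair_index_cover[of v n] pair_index_inj_iff by blast
    qed (simp_all add: inj_pair_index)
    thus "(\<Sum>a\<in>{a \<in> edges A. tgt a = v}. GA.vproj (tgt a) \<otimes>\<^sub>o (?K a * adj (?K a))) = GA.vproj v \<otimes>\<^sub>o 1"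
      by (simp add: tensor_sum_right[symmetric])
  qed
  also have "\<dots> = 1" by (simp add: tensor_sum_left[symmetric] GA.sum_vproj tensor_one)
  finally show ?thesis .
qed

lemma cycle_unitary_mult_adj: "cycle_unitary * adj cycle_unitary = 1"
proof -
  let ?K = "\<lambda>a. iso_op (pair_index a)"
  have "cycle_unitary * adj cycle_unitary = (\<Sum>a\<in>edges A. \<Sum>a'\<in>edges A. (ck_gen A a * adj (ck_gen A a')) \<otimes>\<^sub>o (adj (?K a) * ?K a'))"
    by (simp add: cycle_unitary_def adj_sum sum_product tensor_adj tensor_mult adj_adj)
  also have "\<dots> = (\<Sum>a\<in>edges A. (ck_gen A a * adj (ck_gen A a)) \<otimes>\<^sub>o 1)"
  proof (intro sum.cong refl)
    fix a assume a: "a \<in> edges A"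
    have z: "(ck_gen A a * adj (ck_gen A a')) \<otimes>\<^sub>o (adj (?K a) * ?K a') = 0" if a': "a' \<in> edges A" "a' \<noteq> a" for a'
    proof (cases "tgt a = tgt a'")
      case False
      have "ck_gen A a * adj (ck_gen A a') = ck_gen A a * GA.vproj (tgt a) * adj (ck_gen A a')"
        using a by (simp add: GA.gen_vproj)
      also have "\<dots> = 0" using a' False by (simp add: mult.assoc GA.vproj_adj_gen)
      finally show ?thesis by simp
    qed (use a a' in \<open>simp add: pair_op_adj_mult\<close>)
    show "(\<Sum>a'\<in>edges A. (ck_gen A a * adj (ck_gen A a')) \<otimes>\<^sub>o (adj (?K a) * ?K a')) = (ck_gen A a * adj (ck_gen A a)) \<otimes>\<^sub>o 1"
      by (subst sum_single[OF finite_edges a], rule z, assumption+) (simp add: pair_op_adj_mult a)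
  qed
  also have "\<dots> = 1" by (simp add: tensor_sum_left[symmetric] GA.sum_range_proj tensor_one)
  finally show ?thesis .
qed

text \<open>The left factor strips the generator down to a vertex projection, and the right factor
  supplies the edges \<open>a'\<close> that follow \<open>a\<close>. So conjugation shifts by one
  edge, just as two successive shifts by half an edge do.\<close>

lemma cycle_conj_generator:
  assumes a: "a \<in> edges A"
  shows "adj cycle_unitary * (ck_gen A a \<otimes>\<^sub>o munit i j) * cycle_unitary =
    (\<Sum>a' | a' \<in> edges A \<and> src a' = tgt a. ck_gen A a' \<otimes>\<^sub>o munit (pair_index a i) (pair_index a' j))"
proof -
  let ?K = "\<lambda>a. iso_op (pair_index a)"
  have "adj cycle_unitary * (ck_gen A a \<otimes>\<^sub>o munit i j) =
      (\<Sum>a'\<in>edges A. (adj (ck_gen A a') * ck_gen A a) \<otimes>\<^sub>o (?K a' * munit i j))"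
    by (simp add: cycle_unitary_def adj_sum sum_distrib_right tensor_adj tensor_mult adj_adj)
  also have "\<dots> = GA.vproj (tgt a) \<otimes>\<^sub>o munit (pair_index a i) j"
  proof -
    have z: "(adj (ck_gen A a') * ck_gen A a) \<otimes>\<^sub>o (?K a' * munit i j) = 0" if "a' \<in> edges A" "a' \<noteq> a" for a'
      using a that by (simp add: GA.adj_gen_mult)
    show ?thesis
      by (subst sum_single[OF finite_edges a], rule z, assumption+)
        (simp add: GA.adj_gen_mult iso_op_munit inj_pair_index a)
  qed
  finally have "adj cycle_unitary * (ck_gen A a \<otimes>\<^sub>o munit i j) * cycle_unitary =
      (\<Sum>a'\<in>edges A. (GA.vproj (tgt a) * ck_gen A a') \<otimes>\<^sub>o (munit (pair_index a i) j * adj (?K a')))"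
    by (simp add: cycle_unitary_def sum_distrib_left tensor_mult)
  also have "\<dots> = (\<Sum>a'\<in>edges A. if src a' = tgt a then ck_gen A a' \<otimes>\<^sub>o munit (pair_index a i) (pair_index a' j) else 0)"
    by (intro sum.cong refl) (simp add: GA.vproj_gen munit_iso_op inj_pair_index)
  also have "\<dots> = (\<Sum>a'\<in>edges A \<inter> {a'. src a' = tgt a}. ck_gen A a' \<otimes>\<^sub>o munit (pair_index a i) (pair_index a' j))"
    by (subst sum.inter_restrict) simp_all
  also have "edges A \<inter> {a'. src a' = tgt a} = {a'. a' \<in> edges A \<and> src a' = tgt a}" by blast
  finally show ?thesis .
qed

lemma stable_iso_roundtrip_generator:
  assumes a: "a \<in> edges A"
  shows "sw.stable_iso (stable_iso (ck_gen A a \<otimes>\<^sub>o munit i j)) =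
    (\<Sum>a' | a' \<in> edges A \<and> src a' = tgt a. ck_gen A a' \<otimes>\<^sub>o munit (pair_index a i) (pair_index a' j))"
proof -
  let ?f = "\<lambda>c d. ck_gen A (edgeA c d) \<otimes>\<^sub>o munit (pair_index a i) (leg_index D d (leg_index C c j))"
  have "sw.stable_iso (stable_iso (ck_gen A a \<otimes>\<^sub>o munit i j)) =
     (\<Sum>c\<in>follow (tgt a). sw.stable_iso (ck_gen B (edgeB (dA a) c) \<otimes>\<^sub>o munit (leg_index C (cA a) i) (leg_index C c j)))"
    unfolding stable_iso_generator_munit[OF a] star_map_sum[OF sw.star_map_stable_iso] ..
  also have "\<dots> = (\<Sum>c\<in>follow (tgt a). \<Sum>d\<in>sw.follow (tgt c). ?f c d)"
  proof (intro sum.cong refl)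
    fix c assume c: "c \<in> follow (tgt a)"
    have k: "\<kappa>\<^sub>B (edgeB (dA a) c) = (dA a, c)" using edgeB_facts(2)[of "dA a" c] A_facts[OF a] c by simp
    show "sw.stable_iso (ck_gen B (edgeB (dA a) c) \<otimes>\<^sub>o munit (leg_index C (cA a) i) (leg_index C c j)) =
        (\<Sum>d\<in>sw.follow (tgt c). ?f c d)"
      unfolding sw.stable_iso_generator_munit[OF edgeB_mem[OF a c]] tgt_edgeB[OF a c]
      by (simp add: k pair_index_def sw.edgeB_def edgeA_def)
  qed
  also have "\<dots> = (\<Sum>(c, d)\<in>Sigma (follow (tgt a)) (\<lambda>c. sw.follow (tgt c)). ?f c d)"
    by (rule sum.Sigma) simp_all
  also have "\<dots> = (\<Sum>a' | a' \<in> edges A \<and> src a' = tgt a. ck_gen A a' \<otimes>\<^sub>o munit (pair_index a i) (pair_index a' j))"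
  \<comment> \<open>An edge \<open>c\<close> after \<open>a\<close> followed by an edge
    \<open>d\<close> after \<open>c\<close> is the same as an edge \<open>a' = c d\<close> after
    \<open>a\<close>.\<close>
  proof (rule sum.reindex_bij_witness[where j = "\<lambda>(c, d). edgeA c d" and i = \<kappa>\<^sub>A])
    fix p assume "p \<in> Sigma (follow (tgt a)) (\<lambda>c. sw.follow (tgt c))"
    then obtain c d where p: "p = (c, d)" "c \<in> edges C" "src c = tgt a" "d \<in> edges D" "tgt c = src d" by auto
    note f = edgeA_facts[OF p(2,4,5)]
    show "\<kappa>\<^sub>A ((\<lambda>(c, d). edgeA c d) p) = p" using p f by simp
    show "(\<lambda>(c, d). edgeA c d) p \<in> {a'. a' \<in> edges A \<and> src a' = tgt a}" using p f by simp
    show "ck_gen A ((\<lambda>(c, d). edgeA c d) p) \<otimes>\<^sub>o munit (pair_index a i) (pair_index ((\<lambda>(c, d). edgeA c d) p) j) =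
        (\<lambda>(c, d). ?f c d) p" using p f by (simp add: pair_index_def)
  next
    fix a' assume "a' \<in> {a'. a' \<in> edges A \<and> src a' = tgt a}"
    hence a': "a' \<in> edges A" "src a' = tgt a" by simp_all
    show "(\<lambda>(c, d). edgeA c d) (\<kappa>\<^sub>A a') = a'" using edgeA_cd[OF a'(1)] by (simp add: split_def)
    have "(cA a', dA a') \<in> Sigma (follow (tgt a)) (\<lambda>c. sw.follow (tgt c))"
      using A_facts[OF a'(1)] a'(2) by (intro SigmaI CollectI conjI) simp_all
    thus "\<kappa>\<^sub>A a' \<in> Sigma (follow (tgt a)) (\<lambda>c. sw.follow (tgt c))" by (simp only: prod.collapse)
  qed
  finally show ?thesis .
qed

lemma stable_iso_roundtrip:
  assumes "x \<in> \<O> A \<otimes>\<^sub>* compacts"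
  shows "sw.stable_iso (stable_iso x) = adj cycle_unitary * x * cycle_unitary"
proof -
  let ?G = "{ck_gen A a \<otimes>\<^sub>o munit i j | a i j. a \<in> edges A}"
  have x: "x \<in> cstar_generated ?G" using assms by (simp add: ck_stable_generators)
  have "ck_gen A a \<otimes>\<^sub>o munit i j \<in> mult_domain (\<lambda>x. sw.stable_iso (stable_iso x))" if a: "a \<in> edges A" for a i j
  proof (rule mult_domain_comp[of _ stable_iso sw.stable_iso])
    show "ck_gen A a \<otimes>\<^sub>o munit i j \<in> mult_domain stable_iso" by (rule stable_iso_generator_mult_domain[OF a])
    have "stable_iso (ck_gen A a \<otimes>\<^sub>o munit i j) \<in> \<O> B \<otimes>\<^sub>* compacts"
      using stable_iso_subset(2) ck_tensor_mem[OF ck_algebra_generator[OF a]] by blast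
    thus "stable_iso (ck_gen A a \<otimes>\<^sub>o munit i j) \<in> mult_domain sw.stable_iso" using sw.stable_iso_subset(1) by blast
  qed
  hence 1: "?G \<subseteq> mult_domain (\<lambda>x. sw.stable_iso (stable_iso x))" by blast
  have 2: "sw.stable_iso (stable_iso y) = adj cycle_unitary * y * cycle_unitary" if y: "y \<in> ?G" for y
  proof -
    obtain a i j where "y = ck_gen A a \<otimes>\<^sub>o munit i j" "a \<in> edges A" using y by blast
    thus ?thesis by (simp only: stable_iso_roundtrip_generator cycle_conj_generator)
  qed
  note U = conj_coisometry[OF cycle_unitary_mult_adj]
  show ?thesis
    by (rule star_map_generated_eqI[OF star_map_comp[OF star_map_stable_iso sw.star_map_stable_iso] U(1) 1 _ 2 x])
      (intro subsetI U(2))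
qed

abbreviation uncycle :: "('n ck_index \<times> nat) cop \<Rightarrow> ('n ck_index \<times> nat) cop" where
  "uncycle x \<equiv> cycle_unitary * x * adj cycle_unitary"

lemma uncycle_star_map: "star_map uncycle" "x \<in> mult_domain uncycle"
  using conj_coisometry[of "adj cycle_unitary"] cycle_unitary_adj_mult
  by (simp_all add: adj_adj)

lemma uncycle_tensor: "uncycle (x \<otimes>\<^sub>o k) =
    (\<Sum>a\<in>edges A. \<Sum>a'\<in>edges A. (ck_gen A a * x * adj (ck_gen A a')) \<otimes>\<^sub>o (adj (iso_op (pair_index a)) * k * iso_op (pair_index a')))"
proof -
  have "cycle_unitary * (x \<otimes>\<^sub>o k) = (\<Sum>a\<in>edges A. (ck_gen A a * x) \<otimes>\<^sub>o (adj (iso_op (pair_index a)) * k))"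
    by (simp add: cycle_unitary_def sum_distrib_right tensor_mult)
  moreover have "adj cycle_unitary = (\<Sum>a\<in>edges A. adj (ck_gen A a) \<otimes>\<^sub>o iso_op (pair_index a))"
    by (simp add: cycle_unitary_def adj_sum tensor_adj adj_adj)
  ultimately show ?thesis by (simp only: sum_product tensor_mult)
qed

text \<open>The second components of \<open>cycle_unitary\<close> are not compact, so invariance is
  checked on generators, where these components turn a matrix unit into a matrix unit or 0.\<close>

lemma uncycle_subset: "uncycle ` (\<O> A \<otimes>\<^sub>* compacts) \<subseteq> \<O> A \<otimes>\<^sub>* compacts"
proof -
  let ?G = "{ck_gen A a \<otimes>\<^sub>o munit i j | a i j. a \<in> edges A}"
  have 1: "?G \<subseteq> mult_domain uncycle" using uncycle_star_map(2) by blast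
  have 2: "uncycle ` ?G \<subseteq> \<O> A \<otimes>\<^sub>* compacts"
  proof clarify
    fix b i j assume b: "b \<in> edges A"
    have "(ck_gen A a * ck_gen A b * adj (ck_gen A a')) \<otimes>\<^sub>o (adj (iso_op (pair_index a)) * munit i j * iso_op (pair_index a'))
        \<in> \<O> A \<otimes>\<^sub>* compacts" if a: "a \<in> edges A" "a' \<in> edges A" for a a'
    proof -
      have "ck_gen A a * ck_gen A b * adj (ck_gen A a') \<in> \<O> A"
        using a b by (intro sub_mult sub_adj star_subalgebra_ck_algebra ck_algebra_generator)
      thus ?thesis unfolding adj_iso_op_munit[OF inj_pair_index[OF a(1)] inj_pair_index[OF a(2)]]
        by (simp add: ck_tensor_mem sub_zero)
    qed
    thus "uncycle (ck_gen A b \<otimes>\<^sub>o munit i j) \<in> \<O> A \<otimes>\<^sub>* compacts"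
      unfolding uncycle_tensor by (intro star_subalgebra_sum star_subalgebra_ck_stable)
  qed
  have "uncycle ` cstar_generated ?G \<subseteq> \<O> A \<otimes>\<^sub>* compacts"
    by (rule star_map_generated_subset(2)[OF uncycle_star_map(1) 1 2]) simp_all
  thus ?thesis by (simp only: ck_stable_generators)
qed

text \<open>Only edges \<open>a\<close> and \<open>a'\<close> that end where \<open>\<mu>\<close>
  starts contribute. The ranges of their index maps are disjoint unless \<open>a = a'\<close>, so a
  diagonal matrix unit keeps just the terms with \<open>a = a'\<close>, and these contain the
  projections of the paths \<open>a # \<mu>\<close>.\<close>

lemma uncycle_diagonal: "uncycle ` (\<D> A \<otimes>\<^sub>* diagonal_compacts) \<subseteq> \<D> A \<otimes>\<^sub>* diagonal_compacts"
proof -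
  let ?G = "{ck_proj A \<mu> \<otimes>\<^sub>o munit i i | \<mu> i. \<mu> \<in> finite_paths A}"
  have 1: "?G \<subseteq> mult_domain uncycle" using uncycle_star_map(2) by blast
  have 2: "uncycle ` ?G \<subseteq> \<D> A \<otimes>\<^sub>* diagonal_compacts"
  proof clarify
    fix \<mu> i assume \<mu>: "\<mu> \<in> finite_paths A"
    have z: "ck_gen A a * ck_proj A \<mu> = 0" "ck_proj A \<mu> * adj (ck_gen A a) = 0"
      if a: "a \<in> edges A" "tgt a \<noteq> src (hd \<mu>)" for a
    proof -
      have "ck_gen A a * GA.word \<mu> = ck_gen A a * GA.vproj (tgt a) * GA.word \<mu>" using a by (simp add: GA.gen_vproj)
      also have "\<dots> = 0" using a by (simp add: mult.assoc GA.hd_word[OF \<mu>])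
      finally show 1: "ck_gen A a * ck_proj A \<mu> = 0"
        unfolding wprojA_eq[symmetric] GA.wproj_def by (simp add: mult.assoc[symmetric])
      show "ck_proj A \<mu> * adj (ck_gen A a) = 0"
        using arg_cong[OF 1, of adj] by (simp add: adj_mult wprojA_eq[symmetric])
    qed
    have "(ck_gen A a * ck_proj A \<mu> * adj (ck_gen A a')) \<otimes>\<^sub>o (adj (iso_op (pair_index a)) * munit i i * iso_op (pair_index a'))
        \<in> \<D> A \<otimes>\<^sub>* diagonal_compacts" if a: "a \<in> edges A" "a' \<in> edges A" for a a'
    proof (cases "tgt a = src (hd \<mu>) \<and> tgt a' = src (hd \<mu>)")
      case False
      hence "ck_gen A a * ck_proj A \<mu> * adj (ck_gen A a') = 0"
        using z(1)[OF a(1)] z(2)[OF a(2)] by (cases "tgt a = src (hd \<mu>)") (simp add: mult.assoc, simp)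
      thus ?thesis by (simp add: sub_zero)
    next
      case True
      note m = adj_iso_op_munit[OF inj_pair_index[OF a(1)] inj_pair_index[OF a(2)]]
      show ?thesis
      proof (cases "a = a'")
        case False
        have "\<not> (i \<in> range (pair_index a) \<and> i \<in> range (pair_index a'))"
          using pair_index_inj_iff[OF a] True False by auto
        thus ?thesis unfolding m by (simp only: if_False tensor_zero_right) (simp add: sub_zero)
      next
        case eq: True
        have "ck_gen A a * ck_proj A \<mu> * adj (ck_gen A a) = ck_proj A (a # \<mu>)"
          by (simp add: wprojA_eq[symmetric] GA.wproj_def adj_mult mult.assoc)
        moreover have "a # \<mu> \<in> finite_paths A" using True \<mu> a by (simp add: finite_paths_Cons)
        hence "ck_proj A (a # \<mu>) \<in> \<D> A" unfolding ck_diagonal_def using cstar_generated_superset by blast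
        ultimately show ?thesis
          unfolding eq[symmetric] adj_iso_op_munit[OF inj_pair_index[OF a(1)] inj_pair_index[OF a(1)]]
          by (simp add: diag_tensor_mem sub_zero)
      qed
    qed
    thus "uncycle (ck_proj A \<mu> \<otimes>\<^sub>o munit i i) \<in> \<D> A \<otimes>\<^sub>* diagonal_compacts"
      unfolding uncycle_tensor by (intro star_subalgebra_sum star_subalgebra_ck_stable)
  qed
  have "uncycle ` cstar_generated ?G \<subseteq> \<D> A \<otimes>\<^sub>* diagonal_compacts"
    by (rule star_map_generated_subset(2)[OF uncycle_star_map(1) 1 2]) simp_all
  thus ?thesis by (simp only: ck_stable_diagonal_generators)
qed

lemma diagonal_subset: "\<D> A \<otimes>\<^sub>* diagonal_compacts \<subseteq> \<O> A \<otimes>\<^sub>* compacts"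
  unfolding ck_stable_diagonal_generators
  by (rule cstar_generated_minimal) (use ck_tensor_mem[OF ck_proj_mem] in auto)

lemma stable_iso_roundtrip': "x \<in> \<O> A \<otimes>\<^sub>* compacts \<Longrightarrow> sw.stable_iso (stable_iso (uncycle x)) = x"
proof -
  assume "x \<in> \<O> A \<otimes>\<^sub>* compacts"
  hence "uncycle x \<in> \<O> A \<otimes>\<^sub>* compacts" using uncycle_subset by blast
  from stable_iso_roundtrip[OF this] have "sw.stable_iso (stable_iso (uncycle x)) =
    (adj cycle_unitary * cycle_unitary) * x * (adj cycle_unitary * cycle_unitary)" by (simp add: mult.assoc)
  thus ?thesis by (simp add: cycle_unitary_adj_mult)
qed

end

section \<open>Bijectivity on the stabilizations and on their diagonals\<close>

context factorization begin

interpretation sw: factorization B A D C \<kappa>\<^sub>B \<kappa>\<^sub>A by (rule swap)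

theorem stable_iso_isomorphism: "cstar_isomorphism (\<O> A \<otimes>\<^sub>* compacts) (\<O> B \<otimes>\<^sub>* compacts) stable_iso"
proof (rule star_map_isomorphism)
  let ?\<Theta> = "\<lambda>y. uncycle (sw.stable_iso y)"
  show "star_map stable_iso" "star_map ?\<Theta>"
    by (intro star_map_stable_iso star_map_comp[OF sw.star_map_stable_iso uncycle_star_map(1)])+
  show "\<O> A \<otimes>\<^sub>* compacts \<subseteq> mult_domain stable_iso" "stable_iso ` (\<O> A \<otimes>\<^sub>* compacts) \<subseteq> \<O> B \<otimes>\<^sub>* compacts"
    by (rule stable_iso_subset)+
  show "?\<Theta> ` (\<O> B \<otimes>\<^sub>* compacts) \<subseteq> \<O> A \<otimes>\<^sub>* compacts"
    using sw.stable_iso_subset(2) uncycle_subset by blast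
  show inv: "?\<Theta> (stable_iso x) = x" if "x \<in> \<O> A \<otimes>\<^sub>* compacts" for x
  proof -
    have "?\<Theta> (stable_iso x) = (cycle_unitary * adj cycle_unitary) * x * (cycle_unitary * adj cycle_unitary)"
      by (simp add: stable_iso_roundtrip[OF that] mult.assoc)
    thus ?thesis by (simp add: cycle_unitary_mult_adj)
  qed
  \<comment> \<open>The round trip that starts from \<open>B\<close> shows that \<open>y\<close> is
    a value of \<open>stable_iso\<close>; on such values the left inverse just established is also a
    right inverse.\<close>
  show "stable_iso (?\<Theta> y) = y" if y: "y \<in> \<O> B \<otimes>\<^sub>* compacts" for y
  proof -
    define x where "x = sw.stable_iso (sw.uncycle y)"
    have x: "x \<in> \<O> A \<otimes>\<^sub>* compacts" unfolding x_def using sw.uncycle_subset sw.stable_iso_subset(2) y by blast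
    have "stable_iso x = y" unfolding x_def using sw.stable_iso_roundtrip'[OF y] .
    thus ?thesis using inv[OF x] by metis
  qed
qed simp_all

theorem stable_iso_diagonal_eq: "stable_iso ` (\<D> A \<otimes>\<^sub>* diagonal_compacts) = \<D> B \<otimes>\<^sub>* diagonal_compacts"
proof
  show "\<D> B \<otimes>\<^sub>* diagonal_compacts \<subseteq> stable_iso ` (\<D> A \<otimes>\<^sub>* diagonal_compacts)"
  proof
    fix y assume y: "y \<in> \<D> B \<otimes>\<^sub>* diagonal_compacts"
    hence "sw.stable_iso (sw.uncycle y) \<in> \<D> A \<otimes>\<^sub>* diagonal_compacts"
      using sw.uncycle_diagonal sw.stable_iso_diagonal by blast
    moreover have "y = stable_iso (sw.stable_iso (sw.uncycle y))"
      using sw.stable_iso_roundtrip' y sw.diagonal_subset by fastforce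
    ultimately show "y \<in> stable_iso ` (\<D> A \<otimes>\<^sub>* diagonal_compacts)" by blast
  qed
qed (rule stable_iso_diagonal)

end

subsection \<open>Paths and locally constant functions\<close>

definition prefix :: "(nat \<Rightarrow> 'a) \<Rightarrow> nat \<Rightarrow> 'a list" where
  "prefix x n = map x [0..<n]"

lemma length_prefix [simp]: "length (prefix x n) = n" by (simp add: prefix_def)

lemma nth_prefix [simp]: "k < n \<Longrightarrow> prefix x n ! k = x k" by (simp add: prefix_def)

lemma prefix_eq_iff: "prefix x n = prefix y n \<longleftrightarrow> (\<forall>k<n. x k = y k)"
  by (auto simp: list_eq_iff_nth_eq)

lemma take_prefix: "n \<le> m \<Longrightarrow> take n (prefix x m) = prefix x n"
  by (rule nth_equalityI) simp_all

lemma prefix_mono: "prefix x m = prefix y m \<Longrightarrow> n \<le> m \<Longrightarrow> prefix x n = prefix y n"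
  by (simp add: prefix_eq_iff)

lemma prefix_paths:
  assumes "x \<in> path_space A" "n \<ge> 1" shows "prefix x n \<in> paths A n"
proof -
  have "set (prefix x n) \<subseteq> edges A" using assms by (auto simp: prefix_def path_space_def)
  moreover have "prefix x n \<noteq> []" using assms(2) by (metis length_prefix list.size(3) not_one_le_zero)
  ultimately show ?thesis using assms by (simp add: paths_def finite_paths_def path_space_def)
qed

lemma cylinder_eq: "cylinder A \<mu> = {x \<in> path_space A. prefix x (length \<mu>) = \<mu>}"
  by (auto simp: cylinder_def list_eq_iff_nth_eq)

lemma paths_take:
  assumes "\<nu> \<in> paths A m" "1 \<le> n" "n \<le> m" shows "take n \<nu> \<in> paths A n"
proof -
  have "take n \<nu> \<noteq> []" using assms by (auto simp: paths_def)
  moreover have "set (take n \<nu>) \<subseteq> edges A" using assms(1) set_take_subset[of n \<nu>] by (auto simp: paths_def finite_paths_def)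
  ultimately show ?thesis using assms by (auto simp: paths_def finite_paths_def)
qed

lemma cylinder_nonempty:
  fixes A :: "nat ^ 'n ^ 'n"
  assumes irr: "irreducible_matrix A" and \<mu>: "\<mu> \<in> finite_paths A"
  shows "\<exists>x. x \<in> cylinder A \<mu>"
proof -
  have "\<exists>b. b \<in> edges A \<and> src b = v" for v
    using irreducible_row[OF irr, of v] edge_exists by blast
  then obtain nxt :: "'n \<Rightarrow> ('n, 'n) edge" where nxt: "\<And>v. nxt v \<in> edges A \<and> src (nxt v) = v" by metis
  define f where "f a = nxt (tgt a)" for a :: "('n, 'n) edge"
  \<comment> \<open>Beyond the end of \<open>\<mu>\<close> the path continues with one chosen edge
    per vertex; the exponent is 1 at the first index after \<open>\<mu>\<close>.\<close>
  define x where "x n = (if n < length \<mu> then \<mu> ! n else (f ^^ (n + 1 - length \<mu>)) (last \<mu>))" for n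
  have ne: "\<mu> \<noteq> []" and e: "set \<mu> \<subseteq> edges A" using \<mu> by (auto simp: finite_paths_def)
  have step: "tgt (x n) = src (x (Suc n))" for n
  proof (cases "Suc n < length \<mu>")
    case True
    thus ?thesis using \<mu> by (simp add: x_def finite_paths_def)
  next
    case False
    have "x (Suc n) = f (x n)"
    proof (cases "n < length \<mu>")
      case True
      hence "n = length \<mu> - 1" "length \<mu> = Suc n" using False by auto
      thus ?thesis using ne by (simp add: x_def last_conv_nth)
    next
      case F: False
      hence "Suc n + 1 - length \<mu> = Suc (n + 1 - length \<mu>)" by simp
      thus ?thesis using F by (simp add: x_def)
    qed
    thus ?thesis using nxt by (simp add: f_def)
  qed
  have "x n \<in> edges A" for n
  proof (cases "n < length \<mu>")
    case True
    thus ?thesis using e by (auto simp: x_def)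
  next
    case False
    hence "n + 1 - length \<mu> = Suc (n - length \<mu>)" by simp
    thus ?thesis using False nxt by (simp add: x_def f_def)
  qed
  hence "x \<in> path_space A" using step by (auto simp: path_space_def)
  moreover have "prefix x (length \<mu>) = \<mu>" by (rule nth_equalityI) (simp_all add: x_def)
  ultimately show ?thesis by (auto simp: cylinder_eq)
qed

abbreviation sequence_topology :: "(nat \<Rightarrow> 'a) topology" where
  "sequence_topology \<equiv> product_topology (\<lambda>_. discrete_topology UNIV) UNIV"

lemma openin_sequence_topology:
  "openin sequence_topology T \<longleftrightarrow> (\<forall>x\<in>T. \<exists>n. \<forall>y. prefix y n = prefix x n \<longrightarrow> y \<in> T)"
proof
  assume T: "openin sequence_topology T"
  show "\<forall>x\<in>T. \<exists>n. \<forall>y. prefix y n = prefix x n \<longrightarrow> y \<in> T"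
  proof
    fix x assume "x \<in> T"
    from product_topology_open_contains_basis[OF T this]
    obtain U :: "nat \<Rightarrow> 'a set" where U: "x \<in> (\<Pi>\<^sub>E i\<in>UNIV. U i)" "finite {i. U i \<noteq> UNIV}" "(\<Pi>\<^sub>E i\<in>UNIV. U i) \<subseteq> T"
      by auto
    obtain n where n: "\<And>i. U i \<noteq> UNIV \<Longrightarrow> i < n" using U(2) finite_nat_set_iff_bounded by auto
    have "y \<in> T" if y: "prefix y n = prefix x n" for y
    proof -
      have "y i \<in> U i" for i
      proof (cases "i < n")
        case True
        thus ?thesis using U(1) y by (auto simp: prefix_eq_iff PiE_iff)
      qed (use n in auto)
      thus ?thesis using U(3) by (auto simp: PiE_iff)
    qed
    thus "\<exists>n. \<forall>y. prefix y n = prefix x n \<longrightarrow> y \<in> T" by blast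
  qed
next
  assume T: "\<forall>x\<in>T. \<exists>n. \<forall>y. prefix y n = prefix x n \<longrightarrow> y \<in> T"
  have cyl: "openin sequence_topology {y. prefix y n = prefix x n}" for x :: "nat \<Rightarrow> 'a" and n
  proof -
    have "openin sequence_topology (\<Pi>\<^sub>E k\<in>UNIV. if k < n then {x k} else UNIV)"
    proof (rule product_topology_basis)
      show "finite {i. (if i < n then {x i} else UNIV) \<noteq> topspace (discrete_topology UNIV)}"
        by (rule finite_subset[of _ "{..<n}"]) (auto split: if_splits)
    qed simp
    moreover have "(\<Pi>\<^sub>E k\<in>UNIV. if k < n then {x k} else UNIV) = {y. prefix y n = prefix x n}"
      by (auto simp: PiE_iff prefix_eq_iff split: if_splits)
    ultimately show ?thesis by simp
  qed
  have "\<exists>V. openin sequence_topology V \<and> x \<in> V \<and> V \<subseteq> T" if "x \<in> T" for x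
  proof -
    from T that obtain n where "\<forall>y. prefix y n = prefix x n \<longrightarrow> y \<in> T" by blast
    thus ?thesis using cyl[where x = x and n = n] by (intro exI[of _ "{y. prefix y n = prefix x n}"]) auto
  qed
  thus "openin sequence_topology T" by (subst openin_subopen) blast
qed

lemma compactin_path_space: "compactin sequence_topology (path_space A)"
proof (rule closed_compactin)
  show "compactin sequence_topology (\<Pi>\<^sub>E k\<in>UNIV. edges A)"
    by (simp add: compactin_PiE finite_imp_compactin)
  show "path_space A \<subseteq> (\<Pi>\<^sub>E k\<in>UNIV. edges A)" by (auto simp: path_space_def)
  have "openin sequence_topology (UNIV - path_space A)"
    unfolding openin_sequence_topology
  proof
    fix x assume "x \<in> UNIV - path_space A"
    then obtain n where n: "\<not> (x n \<in> edges A \<and> tgt (x n) = src (x (Suc n)))" by (auto simp: path_space_def)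
    hence "y \<in> UNIV - path_space A" if "prefix y (n + 2) = prefix x (n + 2)" for y
    proof -
      have "y n = x n" "y (Suc n) = x (Suc n)" using that by (auto simp: prefix_eq_iff)
      hence "\<not> (y n \<in> edges A \<and> tgt (y n) = src (y (Suc n)))" using n by simp
      thus ?thesis unfolding path_space_def by blast
    qed
    thus "\<exists>n. \<forall>y. prefix y n = prefix x n \<longrightarrow> y \<in> UNIV - path_space A" by blast
  qed
  thus "closedin sequence_topology (path_space A)" by (simp add: closedin_def)
qed

text \<open>A Lebesgue number argument. The points \<open>u\<close> and \<open>v\<close> are
  compared through a common centre \<open>x\<close>, so that \<open>R\<close> can be an estimate as
  well as an equality.\<close>

lemma path_space_uniform:
  assumes "\<And>x. x \<in> path_space A \<Longrightarrow> \<exists>n. \<forall>y\<in>path_space A. prefix y n = prefix x n \<longrightarrow> R x y"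
  shows "\<exists>N\<ge>1. \<forall>u\<in>path_space A. \<forall>v\<in>path_space A. prefix u N = prefix v N \<longrightarrow> (\<exists>x. R x u \<and> R x v)"
proof -
  obtain n where n: "\<And>x y. x \<in> path_space A \<Longrightarrow> y \<in> path_space A \<Longrightarrow> prefix y (n x) = prefix x (n x) \<Longrightarrow> R x y"
    using assms by metis
  define V where "V x = {y. prefix y (n x) = prefix x (n x)}" for x :: "nat \<Rightarrow> ('a, 'a) edge"
  have "openin sequence_topology (V x)" for x
    unfolding openin_sequence_topology V_def by (metis (mono_tags, lifting) mem_Collect_eq)
  hence "openin sequence_topology U" if "U \<in> V ` path_space A" for U
    using that by blast
  moreover have "path_space A \<subseteq> \<Union>(V ` path_space A)" by (auto simp: V_def)
  ultimately obtain \<F> where F: "finite \<F>" "\<F> \<subseteq> V ` path_space A" "path_space A \<subseteq> \<Union>\<F>"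
    using compactin_path_space[of A] unfolding compactin_def by meson
  obtain K where K: "finite K" "K \<subseteq> path_space A" "\<F> = V ` K"
    using finite_subset_image[OF F(1,2)] by auto
  define N where "N = Max (insert 1 (n ` K))"
  have N: "1 \<le> N" "\<And>x. x \<in> K \<Longrightarrow> n x \<le> N" using K(1) by (auto simp: N_def)
  have "\<exists>x. R x u \<and> R x v" if u: "u \<in> path_space A" and v: "v \<in> path_space A" and p: "prefix u N = prefix v N" for u v
  proof -
    obtain x where x: "x \<in> K" "u \<in> V x" using F(3) K(3) u by auto
    have "prefix v (n x) = prefix u (n x)" using prefix_mono[OF p N(2)[OF x(1)]] by simp
    hence "R x u" "R x v" using n[of x] x K(2) u v by (auto simp: V_def)
    thus ?thesis by blast
  qed
  thus ?thesis using N(1) by blast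
qed

lemma openin_path_topology:
  "openin (path_topology A) S \<longleftrightarrow> S \<subseteq> path_space A \<and>
    (\<forall>x\<in>S. \<exists>n. \<forall>y\<in>path_space A. prefix y n = prefix x n \<longrightarrow> y \<in> S)" (is "?L \<longleftrightarrow> ?R")
proof
  assume ?L
  then obtain T where T: "openin sequence_topology T" "S = T \<inter> path_space A"
    by (auto simp: path_topology_def openin_subtopology)
  thus ?R unfolding openin_sequence_topology by fastforce
next
  assume R: ?R
  define T where "T = {y. \<exists>x\<in>S. \<exists>n. prefix y n = prefix x n \<and> (\<forall>y\<in>path_space A. prefix y n = prefix x n \<longrightarrow> y \<in> S)}"
  have "openin sequence_topology T"
    unfolding openin_sequence_topology
  proof
    fix y assume "y \<in> T"
    then obtain x n where "x \<in> S" "prefix y n = prefix x n" "\<forall>y\<in>path_space A. prefix y n = prefix x n \<longrightarrow> y \<in> S"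
      by (auto simp: T_def)
    thus "\<exists>n. \<forall>z. prefix z n = prefix y n \<longrightarrow> z \<in> T" by (intro exI[of _ n]) (auto simp: T_def)
  qed
  moreover have "S = T \<inter> path_space A"
  proof (intro equalityI subsetI)
    fix x assume x: "x \<in> S"
    then obtain n where "\<forall>y\<in>path_space A. prefix y n = prefix x n \<longrightarrow> y \<in> S" using R by blast
    hence "x \<in> T" unfolding T_def using x by blast
    thus "x \<in> T \<inter> path_space A" using R x by blast
  next
    fix x assume "x \<in> T \<inter> path_space A"
    thus "x \<in> S" unfolding T_def by blast
  qed
  ultimately show ?L by (auto simp: path_topology_def openin_subtopology)
qed

lemma topspace_path_topology [simp]: "topspace (path_topology A) = path_space A"
  by (simp add: path_topology_def)

lemma C_int_locally_constant:
  assumes "f \<in> C_int A"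
  shows "\<exists>N\<ge>1. \<forall>u\<in>path_space A. \<forall>v\<in>path_space A. prefix u N = prefix v N \<longrightarrow> f u = f v"
proof -
  have c: "continuous_map (path_topology A) (discrete_topology UNIV) f" using assms by (simp add: C_int_def)
  have "\<exists>n. \<forall>y\<in>path_space A. prefix y n = prefix x n \<longrightarrow> f y = f x" if x: "x \<in> path_space A" for x
  proof -
    have "openin (path_topology A) {y \<in> path_space A. f y \<in> {f x}}"
      using openin_continuous_map_preimage[OF c, of "{f x}"] by simp
    thus ?thesis using x unfolding openin_path_topology by blast
  qed
  from path_space_uniform[of A "\<lambda>x y. f y = f x", OF this] show ?thesis by metis
qed

text \<open>From here on, continuity on the path space is used as uniform continuity with respect to
  prefixes.\<close>

lemma C_complex_iff:
  "g \<in> C_complex A \<longleftrightarrow> g \<in> extensional (path_space A) \<and>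
    (\<forall>e>0. \<exists>N\<ge>1. \<forall>u\<in>path_space A. \<forall>v\<in>path_space A. prefix u N = prefix v N \<longrightarrow> cmod (g u - g v) < e)"
    (is "?L \<longleftrightarrow> ?R")
proof
  assume L: ?L
  hence c: "continuous_map (path_topology A) euclidean g" by (simp add: C_complex_def)
  have "\<exists>N\<ge>1. \<forall>u\<in>path_space A. \<forall>v\<in>path_space A. prefix u N = prefix v N \<longrightarrow> cmod (g u - g v) < e"
    if e: "e > 0" for e
  proof -
    have "\<exists>n. \<forall>y\<in>path_space A. prefix y n = prefix x n \<longrightarrow> dist (g x) (g y) < e / 2" if x: "x \<in> path_space A" for x
    proof -
      have "openin (path_topology A) {y \<in> path_space A. g y \<in> ball (g x) (e / 2)}"
        using openin_continuous_map_preimage[OF c, of "ball (g x) (e / 2)"] by simp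
      thus ?thesis using x e unfolding openin_path_topology by fastforce
    qed
    from path_space_uniform[of A "\<lambda>x y. dist (g x) (g y) < e / 2", OF this]
    obtain N where N: "N \<ge> 1" "\<And>u v. u \<in> path_space A \<Longrightarrow> v \<in> path_space A \<Longrightarrow> prefix u N = prefix v N \<Longrightarrow>
      \<exists>x. dist (g x) (g u) < e / 2 \<and> dist (g x) (g v) < e / 2" by blast
    have "cmod (g u - g v) < e" if "u \<in> path_space A" "v \<in> path_space A" "prefix u N = prefix v N" for u v
      using N(2)[OF that] dist_triangle_half_r[of _ "g u" e "g v"] by (auto simp: dist_norm)
    thus ?thesis using N(1) by blast
  qed
  thus ?R using L by (simp add: C_complex_def)
next
  assume R: ?R
  have "openin (path_topology A) {x \<in> path_space A. g x \<in> U}" if U: "open U" for U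
    unfolding openin_path_topology
  proof (intro conjI ballI)
    fix x assume x: "x \<in> {x \<in> path_space A. g x \<in> U}"
    then obtain e where e: "e > 0" "ball (g x) e \<subseteq> U" using U open_contains_ball by blast
    obtain N where N: "\<forall>u\<in>path_space A. \<forall>v\<in>path_space A. prefix u N = prefix v N \<longrightarrow> cmod (g u - g v) < e"
      using R e(1) by blast
    have "g y \<in> U" if "y \<in> path_space A" "prefix y N = prefix x N" for y
    proof -
      have "cmod (g x - g y) < e" using N x that by auto
      hence "g y \<in> ball (g x) e" by (simp add: dist_norm)
      thus ?thesis using e(2) by blast
    qed
    thus "\<exists>n. \<forall>y\<in>path_space A. prefix y n = prefix x n \<longrightarrow> y \<in> {x \<in> path_space A. g x \<in> U}" by blast
  qed blast
  thus ?L using R by (simp add: C_complex_def continuous_map)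
qed

lemma C_complex_locally_constant:
  assumes "\<And>u v. u \<in> path_space A \<Longrightarrow> v \<in> path_space A \<Longrightarrow> prefix u N = prefix v N \<Longrightarrow> g u = g v"
  shows "(\<lambda>x\<in>path_space A. g x) \<in> C_complex A"
proof -
  have "\<exists>M\<ge>1. \<forall>u\<in>path_space A. \<forall>v\<in>path_space A. prefix u M = prefix v M \<longrightarrow> cmod (g u - g v) < e" if "e > 0" for e
  proof (intro exI[of _ "Suc N"] conjI ballI impI)
    fix u v assume "u \<in> path_space A" "v \<in> path_space A" "prefix u (Suc N) = prefix v (Suc N)"
    thus "cmod (g u - g v) < e" using assms[of u v] prefix_mono[of u "Suc N" v N] that by simp
  qed simp
  thus ?thesis unfolding C_complex_iff by simp
qed

subsection \<open>The diagonal subalgebra\<close>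

context cuntz_krieger begin

text \<open>The diagonal operator of a step function: one that depends on the first \<open>n\<close>
  edges and has the value \<open>F \<mu>\<close> on the cylinder of \<open>\<mu>\<close>.\<close>

definition simple :: "nat \<Rightarrow> (('n, 'n) edge list \<Rightarrow> complex) \<Rightarrow> 'i cop" where
  "simple n F = (\<Sum>\<mu>\<in>paths A n. F \<mu> *\<^sub>C wproj \<mu>)"

lemma simple_cong: "(\<And>\<mu>. \<mu> \<in> paths A n \<Longrightarrow> F \<mu> = G \<mu>) \<Longrightarrow> simple n F = simple n G"
  unfolding simple_def by (intro sum.cong) auto

lemma simple_add: "simple n (\<lambda>\<mu>. F \<mu> + G \<mu>) = simple n F + simple n G"
  by (simp add: simple_def scaleC_add_left sum.distrib)

lemma simple_scaleC: "simple n (\<lambda>\<mu>. c * F \<mu>) = c *\<^sub>C simple n F"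
  by (simp add: simple_def scaleC_sum_right scaleC_scaleC)

lemma simple_diff: "simple n (\<lambda>\<mu>. F \<mu> - G \<mu>) = simple n F - simple n G"
proof -
  have "simple n (\<lambda>\<mu>. F \<mu> - G \<mu>) = simple n (\<lambda>\<mu>. F \<mu> + (-1) * G \<mu>)" by simp
  thus ?thesis by (simp only: simple_add simple_scaleC scaleC_minus_one add_uminus_conv_diff)
qed

lemma simple_adj: "simple n (\<lambda>\<mu>. cnj (F \<mu>)) = adj (simple n F)"
  by (simp add: simple_def adj_sum adj_scaleC)

lemma simple_one: "n \<ge> 1 \<Longrightarrow> simple n (\<lambda>_. 1) = 1"
  by (simp add: simple_def scaleC_one sum_wproj)

lemma wproj_simple: "\<mu> \<in> paths A n \<Longrightarrow> wproj \<mu> * simple n F = F \<mu> *\<^sub>C wproj \<mu>"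
  unfolding simple_def sum_distrib_left
  by (subst sum_single[of _ \<mu>]) (simp_all add: mult_scaleC_right wproj_mult)

lemma simple_mult: "simple n (\<lambda>\<mu>. F \<mu> * G \<mu>) = simple n F * simple n G"
proof -
  have "simple n F * simple n G = (\<Sum>\<mu>\<in>paths A n. F \<mu> *\<^sub>C (wproj \<mu> * simple n G))"
    by (simp add: simple_def[of n F] sum_distrib_right mult_scaleC_left)
  also have "\<dots> = simple n (\<lambda>\<mu>. F \<mu> * G \<mu>)"
    unfolding simple_def[of n "\<lambda>\<mu>. F \<mu> * G \<mu>"] by (intro sum.cong) (auto simp: wproj_simple scaleC_scaleC)
  finally show ?thesis by simp
qed

lemma simple_refine:
  assumes "1 \<le> n" "n \<le> m" shows "simple n F = simple m (\<lambda>\<nu>. F (take n \<nu>))"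
  using assms(2)
proof (induction m rule: dec_induct)
  case base
  show ?case by (rule simple_cong) (simp add: paths_def)
next
  case (step m)
  have "simple (Suc m) (\<lambda>\<nu>. F (take n \<nu>)) = (\<Sum>\<mu>\<in>paths A m. \<Sum>b | b \<in> edges A \<and> src b = tgt (last \<mu>).
      F (take n (\<mu> @ [b])) *\<^sub>C wproj (\<mu> @ [b]))"
    unfolding simple_def using step(1) assms(1) by (intro sum_paths_Suc) simp
  also have "\<dots> = (\<Sum>\<mu>\<in>paths A m. F (take n \<mu>) *\<^sub>C wproj \<mu>)"
  proof (rule sum.cong)
    fix \<mu> assume \<mu>: "\<mu> \<in> paths A m"
    hence "wproj \<mu> = (\<Sum>b | b \<in> edges A \<and> src b = tgt (last \<mu>). wproj (\<mu> @ [b]))"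
      by (intro wproj_split) (simp add: paths_def)
    moreover have "take n (\<mu> @ [b]) = take n \<mu>" for b using \<mu> step(1) by (simp add: paths_def)
    ultimately show "(\<Sum>b | b \<in> edges A \<and> src b = tgt (last \<mu>). F (take n (\<mu> @ [b])) *\<^sub>C wproj (\<mu> @ [b])) = F (take n \<mu>) *\<^sub>C wproj \<mu>"
      by (simp add: scaleC_sum_right)
  qed simp
  finally show ?case using step.IH by (simp add: simple_def)
qed

text \<open>The projections of level \<open>n\<close> are orthogonal with sum 1, so the components
  of a vector are scaled separately and the squared norms of the results add up.\<close>

lemma norm_simple_le:
  assumes F: "\<And>\<mu>. \<mu> \<in> paths A n \<Longrightarrow> cmod (F \<mu>) \<le> M" and M: "0 \<le> M" and n: "n \<ge> 1"
  shows "norm (simple n F) \<le> M"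
proof (rule norm_copI[OF M])
  fix v
  have sq: "(norm w)\<^sup>2 = Re (cinner w w)" for w :: "'i ell2"
    by (simp add: power2_norm_eq_inner inner_ell2_def)
  have lin: "cinner (app (simple n G) v) v = (\<Sum>\<mu>\<in>paths A n. cnj (G \<mu>) * cinner (app (wproj \<mu>) v) v)" for G
  proof -
    have "cinner (app (\<Sum>\<mu>\<in>P. G \<mu> *\<^sub>C wproj \<mu>) v) v = (\<Sum>\<mu>\<in>P. cnj (G \<mu>) * cinner (app (wproj \<mu>) v) v)"
      if "finite P" for P
      using that
    proof induction
      case empty
      have "cinner 0 v = 0" by (simp add: cinner_def)
      thus ?case by simp
    qed (simp add: app_scaleC_cop cinner_add_left cinner_scaleC_left)
    thus ?thesis by (simp add: simple_def)
  qed
  have pos: "cinner (app (wproj \<mu>) v) v = of_real ((norm (app (wproj \<mu>) v))\<^sup>2)" if "\<mu> \<in> paths A n" for \<mu>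
  proof -
    have "wproj \<mu> = adj (wproj \<mu>) * wproj \<mu>" using that by (simp add: wproj_idem paths_def)
    hence "cinner (app (wproj \<mu>) v) v = cinner (app (adj (wproj \<mu>) * wproj \<mu>) v) v" by simp
    also have "\<dots> = cinner (app (wproj \<mu>) v) (app (wproj \<mu>) v)"
      using cinner_app_adj[of "wproj \<mu>" "app (wproj \<mu>) v" v] by (simp del: adj_wproj)
    finally show ?thesis by (simp add: cinner_self norm_ell2_sq)
  qed
  have "(norm (app (simple n F) v))\<^sup>2 = Re (cinner (app (adj (simple n F) * simple n F) v) v)"
    by (simp add: sq cinner_app_adj)
  also have "adj (simple n F) * simple n F = simple n (\<lambda>\<mu>. of_real ((cmod (F \<mu>))\<^sup>2))"
    by (simp add: simple_adj[symmetric] simple_mult[symmetric] complex_norm_square mult.commute flip: of_real_power)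
  also have "Re (cinner (app (simple n (\<lambda>\<mu>. of_real ((cmod (F \<mu>))\<^sup>2))) v) v) =
      (\<Sum>\<mu>\<in>paths A n. (cmod (F \<mu>))\<^sup>2 * (norm (app (wproj \<mu>) v))\<^sup>2)"
    unfolding lin by (simp add: pos flip: of_real_power of_real_mult)
  also have "\<dots> \<le> (\<Sum>\<mu>\<in>paths A n. M\<^sup>2 * (norm (app (wproj \<mu>) v))\<^sup>2)"
    by (intro sum_mono mult_right_mono power_mono F) simp_all
  also have "\<dots> = M\<^sup>2 * Re (cinner (app (simple n (\<lambda>_. 1)) v) v)"
    unfolding lin by (simp add: pos sum_distrib_left)
  also have "\<dots> = (M * norm v)\<^sup>2" by (simp add: simple_one[OF n] sq[symmetric] power_mult_distrib)
  finally show "norm (app (simple n F) v) \<le> M * norm v" using M by (auto intro: power2_le_imp_le)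
qed

text \<open>Multiplication by the projection of \<open>\<mu>\<close>, which is nonzero by
  irreducibility, isolates the value at \<open>\<mu>\<close>.\<close>

lemma norm_simple_ge:
  assumes "irreducible_matrix A" "\<mu> \<in> paths A n"
  shows "cmod (F \<mu>) \<le> norm (simple n F)"
proof -
  have \<mu>: "\<mu> \<in> finite_paths A" using assms(2) by (simp add: paths_def)
  have "cmod (F \<mu>) * norm (wproj \<mu>) = norm (wproj \<mu> * simple n F)"
    using assms(2) by (simp add: wproj_simple)
  also have "\<dots> = norm (simple n F * wproj \<mu>)"
    using assms(2) unfolding wproj_simple[OF assms(2)] unfolding simple_def sum_distrib_right
    by (subst sum_single[of _ \<mu>]) (simp_all add: mult_scaleC_left wproj_mult)
  also have "\<dots> \<le> norm (simple n F) * norm (wproj \<mu>)" by (rule norm_mult_ineq)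
  finally show ?thesis using wproj_nonzero[OF assms(1) \<mu>] by simp
qed

lemma simple_mem:
  assumes "star_subalgebra E" "\<And>\<mu>. \<mu> \<in> finite_paths A \<Longrightarrow> wproj \<mu> \<in> E"
  shows "simple n F \<in> E"
  unfolding simple_def using assms by (intro star_subalgebra_sum) (auto simp: paths_def sub_scaleC)

end

lemma C_complex_bounded:
  assumes "g \<in> C_complex A" shows "\<exists>M\<ge>1. \<forall>x\<in>path_space A. cmod (g x) \<le> M"
proof -
  obtain N where N: "N \<ge> 1" "\<forall>u\<in>path_space A. \<forall>v\<in>path_space A. prefix u N = prefix v N \<longrightarrow> cmod (g u - g v) < 1"
    using assms unfolding C_complex_iff by (meson zero_less_one)
  let ?pt = "\<lambda>\<mu>. SOME x. x \<in> path_space A \<and> prefix x N = \<mu>"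
  \<comment> \<open>Finitely many sampled values, plus 1 for the oscillation on a cylinder; the
    inserted 0 ensures that \<open>M \<ge> 1\<close>.\<close>
  define M where "M = Max (insert 0 ((\<lambda>\<mu>. cmod (g (?pt \<mu>))) ` paths A N)) + 1"
  have M: "cmod (g x) \<le> M" if x: "x \<in> path_space A" for x
  proof -
    define p where "p = ?pt (prefix x N)"
    have p: "p \<in> path_space A \<and> prefix p N = prefix x N"
      unfolding p_def by (rule someI[of _ x]) (simp add: x)
    hence "cmod (g x - g p) < 1" using N(2) x by auto
    moreover have "cmod (g p) \<le> M - 1" unfolding M_def p_def using prefix_paths[OF x N(1)] by (simp add: Max_ge)
    ultimately show ?thesis using norm_triangle_sub[of "g x" "g p"] by linarith
  qed
  have "M \<ge> 1" by (simp add: M_def)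
  thus ?thesis using M by blast
qed

lemma C_complex_osc:
  assumes "g \<in> C_complex A" "e > 0"
  obtains N where "N \<ge> 1" "\<And>n u v. n \<ge> N \<Longrightarrow> u \<in> path_space A \<Longrightarrow> v \<in> path_space A \<Longrightarrow> prefix u n = prefix v n \<Longrightarrow> cmod (g u - g v) < e"
proof -
  from assms obtain N where "N \<ge> 1" "\<forall>u\<in>path_space A. \<forall>v\<in>path_space A. prefix u N = prefix v N \<longrightarrow> cmod (g u - g v) < e"
    unfolding C_complex_iff by blast
  thus ?thesis using prefix_mono by (intro that[of N]) blast+
qed

lemma C_complex_I:
  assumes "\<And>e. e > 0 \<Longrightarrow> \<exists>N. \<forall>u\<in>path_space A. \<forall>v\<in>path_space A. prefix u N = prefix v N \<longrightarrow> cmod (g u - g v) < e"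
  shows "(\<lambda>x\<in>path_space A. g x) \<in> C_complex A"
proof -
  have "\<exists>M\<ge>1. \<forall>u\<in>path_space A. \<forall>v\<in>path_space A. prefix u M = prefix v M \<longrightarrow> cmod (g u - g v) < e" if e: "e > 0" for e
  proof -
    obtain N where N: "\<forall>u\<in>path_space A. \<forall>v\<in>path_space A. prefix u N = prefix v N \<longrightarrow> cmod (g u - g v) < e"
      using assms[OF e] by blast
    have "cmod (g u - g v) < e" if "u \<in> path_space A" "v \<in> path_space A" "prefix u (Suc N) = prefix v (Suc N)" for u v
      using N that prefix_mono[OF that(3), of N] by simp
    thus ?thesis by (intro exI[of _ "Suc N"]) simp
  qed
  thus ?thesis unfolding C_complex_iff by simp
qed

lemma C_complex_add: "g \<in> C_complex A \<Longrightarrow> h \<in> C_complex A \<Longrightarrow> (\<lambda>x\<in>path_space A. g x + h x) \<in> C_complex A"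
proof (rule C_complex_I)
  fix e :: real assume gh: "g \<in> C_complex A" "h \<in> C_complex A" and e: "e > 0"
  obtain N where N: "\<And>n u v. n \<ge> N \<Longrightarrow> u \<in> path_space A \<Longrightarrow> v \<in> path_space A \<Longrightarrow> prefix u n = prefix v n \<Longrightarrow> cmod (g u - g v) < e / 2"
    using C_complex_osc[OF gh(1) half_gt_zero[OF e]] by metis
  obtain K where K: "\<And>n u v. n \<ge> K \<Longrightarrow> u \<in> path_space A \<Longrightarrow> v \<in> path_space A \<Longrightarrow> prefix u n = prefix v n \<Longrightarrow> cmod (h u - h v) < e / 2"
    using C_complex_osc[OF gh(2) half_gt_zero[OF e]] by metis
  have "cmod (g u + h u - (g v + h v)) < e"
    if "u \<in> path_space A" "v \<in> path_space A" "prefix u (max N K) = prefix v (max N K)" for u v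
  proof -
    have "cmod (g u - g v) < e / 2" "cmod (h u - h v) < e / 2"
      using N[of "max N K"] K[of "max N K"] that by simp_all
    moreover have "g u + h u - (g v + h v) = (g u - g v) + (h u - h v)" by simp
    ultimately show ?thesis using norm_triangle_ineq[of "g u - g v" "h u - h v"] by (simp only:)
  qed
  thus "\<exists>N. \<forall>u\<in>path_space A. \<forall>v\<in>path_space A. prefix u N = prefix v N \<longrightarrow> cmod (g u + h u - (g v + h v)) < e"
    by blast
qed

lemma C_complex_mult: "g \<in> C_complex A \<Longrightarrow> h \<in> C_complex A \<Longrightarrow> (\<lambda>x\<in>path_space A. g x * h x) \<in> C_complex A"
proof (rule C_complex_I)
  fix e :: real assume gh: "g \<in> C_complex A" "h \<in> C_complex A" and e: "e > 0"
  obtain M where M: "M \<ge> 1" "\<And>x. x \<in> path_space A \<Longrightarrow> cmod (g x) \<le> M" using C_complex_bounded[OF gh(1)] by blast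
  obtain L where L: "L \<ge> 1" "\<And>x. x \<in> path_space A \<Longrightarrow> cmod (h x) \<le> L" using C_complex_bounded[OF gh(2)] by blast
  have e': "e / (2 * L) > 0" "e / (2 * M) > 0" using e M(1) L(1) by simp_all
  obtain N where N: "\<And>n u v. n \<ge> N \<Longrightarrow> u \<in> path_space A \<Longrightarrow> v \<in> path_space A \<Longrightarrow> prefix u n = prefix v n \<Longrightarrow> cmod (g u - g v) < e / (2 * L)"
    using C_complex_osc[OF gh(1) e'(1)] by metis
  obtain K where K: "\<And>n u v. n \<ge> K \<Longrightarrow> u \<in> path_space A \<Longrightarrow> v \<in> path_space A \<Longrightarrow> prefix u n = prefix v n \<Longrightarrow> cmod (h u - h v) < e / (2 * M)"
    using C_complex_osc[OF gh(2) e'(2)] by metis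
  have "cmod (g u * h u - g v * h v) < e"
    if uv: "u \<in> path_space A" "v \<in> path_space A" "prefix u (max N K) = prefix v (max N K)" for u v
  proof -
    have "g u * h u - g v * h v = g u * (h u - h v) + (g u - g v) * h v" by (simp add: algebra_simps)
    hence "cmod (g u * h u - g v * h v) \<le> cmod (g u) * cmod (h u - h v) + cmod (g u - g v) * cmod (h v)"
      using norm_triangle_ineq[of "g u * (h u - h v)" "(g u - g v) * h v"] by (simp only: norm_mult)
    also have "\<dots> \<le> M * cmod (h u - h v) + cmod (g u - g v) * L"
      using M(2)[OF uv(1)] L(2)[OF uv(2)] by (intro add_mono mult_right_mono mult_left_mono) simp_all
    also have "\<dots> < M * (e / (2 * M)) + e / (2 * L) * L"
      using N[of "max N K"] K[of "max N K"] uv M(1) L(1)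
      by (intro add_strict_mono mult_strict_left_mono mult_strict_right_mono) simp_all
    also have "\<dots> = e" using M(1) L(1) by simp
    finally show ?thesis .
  qed
  thus "\<exists>N. \<forall>u\<in>path_space A. \<forall>v\<in>path_space A. prefix u N = prefix v N \<longrightarrow> cmod (g u * h u - g v * h v) < e"
    by blast
qed

lemma C_complex_const: "(\<lambda>x\<in>path_space A. c) \<in> C_complex A"
  by (rule C_complex_locally_constant[where N = 0]) simp

lemma C_complex_scale: "g \<in> C_complex A \<Longrightarrow> (\<lambda>x\<in>path_space A. c * g x) \<in> C_complex A"
proof -
  assume "g \<in> C_complex A"
  from C_complex_mult[OF C_complex_const this, of c] show ?thesis
    by (rule arg_cong[where f = "\<lambda>h. h \<in> C_complex A", THEN iffD1, rotated]) (auto simp: restrict_def)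
qed

lemma C_complex_cnj: "g \<in> C_complex A \<Longrightarrow> (\<lambda>x\<in>path_space A. cnj (g x)) \<in> C_complex A"
proof (rule C_complex_I)
  fix e :: real assume g: "g \<in> C_complex A" and e: "e > 0"
  obtain N where N: "\<And>n u v. n \<ge> N \<Longrightarrow> u \<in> path_space A \<Longrightarrow> v \<in> path_space A \<Longrightarrow> prefix u n = prefix v n \<Longrightarrow> cmod (g u - g v) < e"
    using C_complex_osc[OF g e] by metis
  have "cmod (cnj z - cnj w) = cmod (z - w)" for z w by (metis complex_cnj_diff complex_mod_cnj)
  thus "\<exists>N. \<forall>u\<in>path_space A. \<forall>v\<in>path_space A. prefix u N = prefix v N \<longrightarrow> cmod (cnj (g u) - cnj (g v)) < e"
    using N[of N] by (intro exI[of _ N]) simp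
qed

section \<open>The isomorphism from continuous functions onto the diagonal\<close>

locale irreducible_graph =
  fixes A :: "nat ^ 'n ^ 'n"
  assumes irr: "irreducible_matrix A"

sublocale irreducible_graph \<subseteq> cuntz_krieger A "ck_gen A"
  by (rule ck_gen_family[OF irr])

context irreducible_graph begin

lemma wproj_eq: "wproj \<mu> = ck_proj A \<mu>"
  by (simp add: wproj_def word_def ck_proj_def)

lemma wproj_diagonal: "\<mu> \<in> finite_paths A \<Longrightarrow> wproj \<mu> \<in> \<D> A"
  unfolding wproj_eq ck_diagonal_def using cstar_generated_superset by blast

lemma simple_diagonal: "simple n F \<in> \<D> A"
  by (rule simple_mem) (simp_all add: wproj_diagonal)

definition pt :: "('n, 'n) edge list \<Rightarrow> nat \<Rightarrow> ('n, 'n) edge" where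
  "pt \<mu> = (SOME x. x \<in> cylinder A \<mu>)"

lemma pt: "\<mu> \<in> finite_paths A \<Longrightarrow> pt \<mu> \<in> path_space A \<and> prefix (pt \<mu>) (length \<mu>) = \<mu>"
  using someI_ex[OF cylinder_nonempty[OF irr]] unfolding pt_def cylinder_eq by blast

lemma pt_paths: "\<mu> \<in> paths A n \<Longrightarrow> pt \<mu> \<in> path_space A" "\<mu> \<in> paths A n \<Longrightarrow> prefix (pt \<mu>) n = \<mu>"
  using pt by (auto simp: paths_def)

text \<open>As for Riemann sums, \<open>g\<close> is replaced by the step function that takes its
  value at one chosen point of each cylinder of length \<open>n\<close>.\<close>

definition sample :: "((nat \<Rightarrow> ('n, 'n) edge) \<Rightarrow> complex) \<Rightarrow> nat \<Rightarrow> 'n ck_index cop" where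
  "sample g n = simple n (\<lambda>\<mu>. g (pt \<mu>))"

text \<open>Level \<open>N\<close> is refined to level \<open>m\<close>, where the two step
  functions are compared cylinder by cylinder.\<close>

lemma sample_diff_le:
  assumes "1 \<le> N" "N \<le> m" "0 \<le> e"
    and osc: "\<And>u v. u \<in> path_space A \<Longrightarrow> v \<in> path_space A \<Longrightarrow> prefix u N = prefix v N \<Longrightarrow> cmod (g u - g v) \<le> e"
  shows "norm (sample g m - sample g N) \<le> e"
proof -
  have "sample g m - sample g N = simple m (\<lambda>\<nu>. g (pt \<nu>) - g (pt (take N \<nu>)))"
    by (simp add: sample_def simple_refine[OF assms(1,2)] simple_diff)
  also have "norm \<dots> \<le> e"
  proof (rule norm_simple_le)
    fix \<nu> assume \<nu>: "\<nu> \<in> paths A m"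
    have t: "take N \<nu> \<in> paths A N" by (rule paths_take[OF \<nu> assms(1,2)])
    have "prefix (pt \<nu>) N = take N (prefix (pt \<nu>) m)" using assms(2) by (simp add: take_prefix)
    also have "\<dots> = prefix (pt (take N \<nu>)) N" using pt_paths(2)[OF \<nu>] pt_paths(2)[OF t] by simp
    finally show "cmod (g (pt \<nu>) - g (pt (take N \<nu>))) \<le> e"
      using osc pt_paths(1)[OF \<nu>] pt_paths(1)[OF t] by blast
  qed (use assms in simp_all)
  finally show ?thesis .
qed

definition theta :: "((nat \<Rightarrow> ('n, 'n) edge) \<Rightarrow> complex) \<Rightarrow> 'n ck_index cop" where
  "theta g = lim (sample g)"

lemma sample_tendsto:
  assumes g: "g \<in> C_complex A" shows "sample g \<longlonglongrightarrow> theta g"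
proof -
  have "Cauchy (sample g)"
  proof (rule CauchyI)
    fix e :: real assume e: "e > 0"
    obtain N where N: "N \<ge> 1" "\<And>n u v. n \<ge> N \<Longrightarrow> u \<in> path_space A \<Longrightarrow> v \<in> path_space A \<Longrightarrow> prefix u n = prefix v n \<Longrightarrow> cmod (g u - g v) < e / 3"
      using C_complex_osc[OF g, of "e / 3"] e by auto
    have le: "norm (sample g m - sample g N) \<le> e / 3" if "m \<ge> N" for m
      using N(2)[OF order_refl] e by (intro sample_diff_le[OF N(1) that]) (auto intro: less_imp_le)
    have "norm (sample g m - sample g n) < e" if "m \<ge> N" "n \<ge> N" for m n
    proof -
      have "sample g m - sample g n = (sample g m - sample g N) - (sample g n - sample g N)" by simp
      also have "norm \<dots> \<le> norm (sample g m - sample g N) + norm (sample g n - sample g N)" by (rule norm_triangle_ineq4)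
      finally show ?thesis using le[OF that(1)] le[OF that(2)] e by linarith
    qed
    thus "\<exists>M. \<forall>m\<ge>M. \<forall>n\<ge>M. norm (sample g m - sample g n) < e" by blast
  qed
  thus ?thesis unfolding theta_def by (simp add: Cauchy_convergent_iff convergent_LIMSEQ_iff)
qed

lemma thetaI: "g \<in> C_complex A \<Longrightarrow> sample g \<longlonglongrightarrow> T \<Longrightarrow> theta g = T"
  using sample_tendsto LIMSEQ_unique by blast

lemma theta_level:
  assumes N: "N \<ge> 1"
    and g: "\<And>u v. u \<in> path_space A \<Longrightarrow> v \<in> path_space A \<Longrightarrow> prefix u N = prefix v N \<Longrightarrow> g u = g v"
  shows "theta (\<lambda>x\<in>path_space A. g x) = simple N (\<lambda>\<mu>. g (pt \<mu>))"
proof -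
  let ?g = "\<lambda>x\<in>path_space A. g x"
  have osc: "cmod (?g u - ?g v) \<le> 0"
    if "u \<in> path_space A" "v \<in> path_space A" "prefix u N = prefix v N" for u v
    using g[OF that] that(1,2) by simp
  have "sample ?g m - sample ?g N = 0" if "m \<ge> N" for m
  proof -
    have "norm (sample ?g m - sample ?g N) \<le> 0" by (rule sample_diff_le[OF N that order_refl]) (rule osc)
    thus ?thesis by simp
  qed
  hence "\<forall>\<^sub>F m in sequentially. sample ?g m = sample ?g N"
    unfolding eventually_sequentially by (metis eq_iff_diff_eq_0)
  hence "theta ?g = sample ?g N"
    by (intro thetaI C_complex_locally_constant[of A N] g tendsto_eventually)
  also have "\<dots> = simple N (\<lambda>\<mu>. g (pt \<mu>))"
    unfolding sample_def by (rule simple_cong) (simp add: pt_paths)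
  finally show ?thesis .
qed

lemma sample_restrict: "sample (\<lambda>x\<in>path_space A. g x) n = sample g n"
  unfolding sample_def by (rule simple_cong) (simp add: pt_paths)

lemma theta_hom:
  assumes "g \<in> C_complex A" "h \<in> C_complex A"
  shows "theta (\<lambda>x\<in>path_space A. g x + h x) = theta g + theta h"
    and "theta (\<lambda>x\<in>path_space A. g x * h x) = theta g * theta h"
    and "theta (\<lambda>x\<in>path_space A. cnj (g x)) = adj (theta g)"
    and "theta (\<lambda>x\<in>path_space A. c * g x) = c *\<^sub>C theta g"
proof -
  note t = sample_tendsto[OF assms(1)] sample_tendsto[OF assms(2)]
  have c: "bounded_linear (\<lambda>x :: 'n ck_index cop. c *\<^sub>C x)"
    by (rule bounded_linear_intro[where K = "cmod c"])
      (auto simp: scaleC_add_right scaleR_eq_scaleC_cop scaleC_scaleC mult.commute)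
  show "theta (\<lambda>x\<in>path_space A. g x + h x) = theta g + theta h"
    using tendsto_add[OF t] by (intro thetaI C_complex_add assms) (simp add: sample_restrict[abs_def] sample_def simple_add)
  show "theta (\<lambda>x\<in>path_space A. g x * h x) = theta g * theta h"
    using tendsto_mult[OF t] by (intro thetaI C_complex_mult assms) (simp add: sample_restrict[abs_def] sample_def simple_mult)
  show "theta (\<lambda>x\<in>path_space A. cnj (g x)) = adj (theta g)"
    using norm_adj_tendsto[OF t(1)] by (intro thetaI C_complex_cnj assms) (simp add: sample_restrict[abs_def] sample_def simple_adj)
  show "theta (\<lambda>x\<in>path_space A. c * g x) = c *\<^sub>C theta g"
    using bounded_linear.tendsto[OF c t(1)] by (intro thetaI C_complex_scale assms) (simp add: sample_restrict[abs_def] sample_def simple_scaleC)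
qed

lemma theta_norm_le:
  assumes "g \<in> C_complex A" "\<And>x. x \<in> path_space A \<Longrightarrow> cmod (g x) \<le> M" "0 \<le> M"
  shows "norm (theta g) \<le> M"
proof (rule LIMSEQ_le_const2[OF tendsto_norm[OF sample_tendsto[OF assms(1)]]])
  have "norm (sample g n) \<le> M" if "n \<ge> 1" for n
    unfolding sample_def using assms pt_paths that by (intro norm_simple_le) auto
  thus "\<exists>N. \<forall>n\<ge>N. norm (sample g n) \<le> M" by blast
qed

lemma theta_norm_ge:
  assumes g: "g \<in> C_complex A" and x: "x \<in> path_space A"
  shows "cmod (g x) \<le> norm (theta g)"
proof (rule field_le_epsilon)
  fix e :: real assume e: "e > 0"
  obtain N where N: "N \<ge> 1" "\<And>n u v. n \<ge> N \<Longrightarrow> u \<in> path_space A \<Longrightarrow> v \<in> path_space A \<Longrightarrow> prefix u n = prefix v n \<Longrightarrow> cmod (g u - g v) < e"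
    using C_complex_osc[OF g e] by metis
  show "cmod (g x) \<le> norm (theta g) + e"
  proof (rule LIMSEQ_le_const)
    show "(\<lambda>n. norm (sample g n) + e) \<longlonglongrightarrow> norm (theta g) + e"
      by (intro tendsto_intros sample_tendsto g)
    have "cmod (g x) \<le> norm (sample g n) + e" if n: "n \<ge> N" for n
    proof -
      have p: "prefix x n \<in> paths A n" using prefix_paths[OF x] n N(1) by simp
      have "cmod (g (pt (prefix x n))) \<le> norm (sample g n)"
        unfolding sample_def by (rule norm_simple_ge[OF irr p, where F = "\<lambda>\<mu>. g (pt \<mu>)"])
      moreover have "cmod (g x - g (pt (prefix x n))) < e"
        using N(2)[OF n x pt_paths(1)[OF p]] pt_paths(2)[OF p] by simp
      ultimately show ?thesis using norm_triangle_sub[of "g x" "g (pt (prefix x n))"] by linarith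
    qed
    thus "\<exists>N. \<forall>n\<ge>N. cmod (g x) \<le> norm (sample g n) + e" by blast
  qed
qed

lemma path_space_nonempty: "path_space A \<noteq> {}"
proof -
  obtain a where "a \<in> edges A" using irreducible_row[OF irr] edge_exists by blast
  hence "[a] \<in> finite_paths A" by (simp add: finite_paths_Cons)
  thus ?thesis using pt by blast
qed

lemma theta_norm:
  assumes g: "g \<in> C_complex A" shows "norm (theta g) = (SUP x\<in>path_space A. cmod (g x))"
proof (rule antisym)
  obtain M where "\<forall>x\<in>path_space A. cmod (g x) \<le> M" using C_complex_bounded[OF g] by blast
  hence bdd: "bdd_above ((\<lambda>x. cmod (g x)) ` path_space A)" by (auto intro: bdd_aboveI2)
  have le: "cmod (g x) \<le> (SUP x\<in>path_space A. cmod (g x))" if "x \<in> path_space A" for x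
    by (rule cSUP_upper[OF that bdd])
  obtain x where "x \<in> path_space A" using path_space_nonempty by blast
  hence "0 \<le> (SUP x\<in>path_space A. cmod (g x))" using le norm_ge_zero order_trans by blast
  thus "norm (theta g) \<le> (SUP x\<in>path_space A. cmod (g x))" by (intro theta_norm_le[OF g] le)
  show "(SUP x\<in>path_space A. cmod (g x)) \<le> norm (theta g)"
    by (rule cSUP_least[OF path_space_nonempty theta_norm_ge[OF g]])
qed

lemma theta_diff:
  assumes "g \<in> C_complex A" "h \<in> C_complex A"
  shows "(\<lambda>x\<in>path_space A. g x - h x) \<in> C_complex A" "theta (\<lambda>x\<in>path_space A. g x - h x) = theta g - theta h"
proof -
  have e: "(\<lambda>x\<in>path_space A. g x + (\<lambda>x\<in>path_space A. (-1) * h x) x) = (\<lambda>x\<in>path_space A. g x - h x)"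
    by (auto simp: restrict_def)
  show "(\<lambda>x\<in>path_space A. g x - h x) \<in> C_complex A"
    using C_complex_add[OF assms(1) C_complex_scale[OF assms(2), of "-1"]] unfolding e .
  show "theta (\<lambda>x\<in>path_space A. g x - h x) = theta g - theta h"
    using theta_hom(1)[OF assms(1) C_complex_scale[OF assms(2), of "-1"]] theta_hom(4)[OF assms(2) assms(2), of "-1"]
    unfolding e by (simp add: scaleC_minus_one)
qed

lemma indicator_cylinder:
  assumes \<mu>: "\<mu> \<in> finite_paths A"
  shows "(\<lambda>x\<in>path_space A. indicator (cylinder A \<mu>) x) \<in> C_complex A"
    and "theta (\<lambda>x\<in>path_space A. indicator (cylinder A \<mu>) x) = wproj \<mu>"
proof -
  have n: "length \<mu> \<ge> 1" using \<mu> by (cases \<mu>) (auto simp: finite_paths_def)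
  have c: "indicator (cylinder A \<mu>) u = (indicator (cylinder A \<mu>) v :: complex)"
    if "u \<in> path_space A" "v \<in> path_space A" "prefix u (length \<mu>) = prefix v (length \<mu>)" for u v
    using that by (simp add: indicator_def cylinder_eq)
  show "(\<lambda>x\<in>path_space A. indicator (cylinder A \<mu>) x) \<in> C_complex A"
    by (rule C_complex_locally_constant[where N = "length \<mu>"]) (rule c)
  have "theta (\<lambda>x\<in>path_space A. indicator (cylinder A \<mu>) x) = simple (length \<mu>) (\<lambda>\<nu>. indicator (cylinder A \<mu>) (pt \<nu>))"
    using n c by (rule theta_level)
  also have "\<dots> = (\<Sum>\<nu>\<in>paths A (length \<mu>). if \<nu> = \<mu> then wproj \<mu> else 0)"
    unfolding simple_def by (intro sum.cong) (auto simp: indicator_def cylinder_eq pt_paths scaleC_one)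
  finally show "theta (\<lambda>x\<in>path_space A. indicator (cylinder A \<mu>) x) = wproj \<mu>"
    using \<mu> by (simp add: sum.delta[OF finite_paths_finite]) (simp add: paths_def)
qed

text \<open>\<open>theta\<close> preserves distances, so a convergent sequence of values comes from
  a uniformly Cauchy sequence of functions. With a closed range, \<open>theta\<close> reaches the
  whole generated algebra \<open>\<D> A\<close>.\<close>

lemma theta_closed_range: "closed (theta ` C_complex A)"
  unfolding closed_sequential_limits
proof (intro allI impI)
  fix T :: "nat \<Rightarrow> 'n ck_index cop" and L
  assume "(\<forall>n. T n \<in> theta ` C_complex A) \<and> T \<longlonglongrightarrow> L"
  hence T: "\<And>n. T n \<in> theta ` C_complex A" "T \<longlonglongrightarrow> L" by auto
  have "\<exists>g. \<forall>n. g n \<in> C_complex A \<and> T n = theta (g n)" using T(1) by (intro choice) blast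
  then obtain g where g: "\<And>n. g n \<in> C_complex A" "\<And>n. T n = theta (g n)" by blast
  have le: "cmod (g m x - g n x) \<le> norm (T m - T n)" if "x \<in> path_space A" for m n x
    using theta_norm_ge[OF theta_diff(1)[OF g(1) g(1)] that, of m n] that by (simp add: theta_diff(2)[OF g(1) g(1)] g(2))
  have T': "\<exists>K. \<forall>m\<ge>K. \<forall>n\<ge>K. norm (T m - T n) < e" if "e > 0" for e
    using LIMSEQ_imp_Cauchy[OF T(2)] that by (simp add: Cauchy_iff)
  have "Cauchy (\<lambda>n. g n x)" if "x \<in> path_space A" for x
    using T' le[OF that] by (intro CauchyI) (meson le_less_trans)
  hence "\<exists>l. (\<lambda>n. g n x) \<longlonglongrightarrow> l" if "x \<in> path_space A" for x
    using that by (simp add: Cauchy_convergent_iff convergent_def)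
  then obtain G where G: "\<And>x. x \<in> path_space A \<Longrightarrow> (\<lambda>n. g n x) \<longlonglongrightarrow> G x" by metis
  have unif: "\<exists>K. \<forall>n\<ge>K. \<forall>x\<in>path_space A. cmod (g n x - G x) \<le> e" if e: "e > 0" for e
  proof -
    obtain K where K: "\<forall>m\<ge>K. \<forall>n\<ge>K. norm (T m - T n) < e" using T'[OF e] by blast
    have "cmod (g n x - G x) \<le> e" if n: "n \<ge> K" and x: "x \<in> path_space A" for n x
    proof (rule LIMSEQ_le_const2)
      show "(\<lambda>m. cmod (g n x - g m x)) \<longlonglongrightarrow> cmod (g n x - G x)" by (intro tendsto_intros G x)
      show "\<exists>N. \<forall>m\<ge>N. cmod (g n x - g m x) \<le> e"
        using K n le[OF x, of n] by (intro exI[of _ K]) (meson le_less_trans less_imp_le)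
    qed
    thus ?thesis by blast
  qed
  let ?G = "\<lambda>x\<in>path_space A. G x"
  have GC: "?G \<in> C_complex A"
  proof (rule C_complex_I)
    fix e :: real assume e: "e > 0"
    obtain K where K: "\<And>x. x \<in> path_space A \<Longrightarrow> cmod (g K x - G x) \<le> e / 4" using unif[of "e / 4"] e by auto
    obtain N where N: "N \<ge> 1" "\<And>n u v. n \<ge> N \<Longrightarrow> u \<in> path_space A \<Longrightarrow> v \<in> path_space A \<Longrightarrow> prefix u n = prefix v n \<Longrightarrow> cmod (g K u - g K v) < e / 4"
      using C_complex_osc[OF g(1), of "e / 4" K] e by auto
    have "cmod (G u - G v) < e" if "u \<in> path_space A" "v \<in> path_space A" "prefix u N = prefix v N" for u v
    proof -
      have "G u - G v = (g K u - g K v) - (g K u - G u) + (g K v - G v)" by simp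
      also have "cmod \<dots> \<le> cmod (g K u - g K v) + cmod (g K u - G u) + cmod (g K v - G v)"
        by (intro norm_triangle_le add_mono norm_triangle_ineq4 order_refl)
      finally show ?thesis using K[OF that(1)] K[OF that(2)] N(2)[OF order_refl that] e by linarith
    qed
    thus "\<exists>N. \<forall>u\<in>path_space A. \<forall>v\<in>path_space A. prefix u N = prefix v N \<longrightarrow> cmod (G u - G v) < e" by blast
  qed
  have "T \<longlonglongrightarrow> theta ?G"
  proof (rule LIMSEQ_I)
    fix e :: real assume e: "e > 0"
    obtain K where K: "\<forall>n\<ge>K. \<forall>x\<in>path_space A. cmod (g n x - G x) \<le> e / 2" using unif[of "e / 2"] e by auto
    have "norm (T n - theta ?G) \<le> e / 2" if "n \<ge> K" for n
      unfolding g(2) theta_diff(2)[OF g(1) GC, symmetric]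
      using K that e by (intro theta_norm_le theta_diff(1) g(1) GC) simp_all
    thus "\<exists>no. \<forall>n\<ge>no. norm (T n - theta ?G) < e" using e by (intro exI[of _ K]) fastforce
  qed
  hence "L = theta ?G" using T(2) LIMSEQ_unique by blast
  thus "L \<in> theta ` C_complex A" using GC by blast
qed

lemma theta_range: "theta ` C_complex A = \<D> A"
proof
  have "theta g \<in> \<D> A" if "g \<in> C_complex A" for g
  proof (rule closed_sequentially[OF star_subalgebra_ck_diagonal(2) _ sample_tendsto[OF that]])
    show "sample g n \<in> \<D> A" for n unfolding sample_def by (rule simple_diagonal)
  qed
  thus "theta ` C_complex A \<subseteq> \<D> A" by blast
  have "star_subalgebra (theta ` C_complex A)"
    unfolding star_subalgebra_def
  proof (intro conjI ballI allI)
    show "0 \<in> theta ` C_complex A"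
      using C_complex_const[where A = A and c = 0] theta_norm_le[OF C_complex_const[where A = A and c = 0], of 0] by (intro image_eqI[of _ _ "\<lambda>x\<in>path_space A. 0"]) simp_all
  next
    fix x y assume "x \<in> theta ` C_complex A" "y \<in> theta ` C_complex A"
    then obtain g h where gh: "g \<in> C_complex A" "h \<in> C_complex A" "x = theta g" "y = theta h" by blast
    show "x + y \<in> theta ` C_complex A" "x * y \<in> theta ` C_complex A"
      unfolding gh(3,4) theta_hom(1)[OF gh(1,2), symmetric] theta_hom(2)[OF gh(1,2), symmetric]
      by (intro imageI C_complex_add C_complex_mult gh)+
  next
    fix x c assume "x \<in> theta ` C_complex A"
    then obtain g where g: "g \<in> C_complex A" "x = theta g" by blast
    show "adj x \<in> theta ` C_complex A" "c *\<^sub>C x \<in> theta ` C_complex A"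
      unfolding g(2) theta_hom(3)[OF g(1) g(1), symmetric] theta_hom(4)[OF g(1) g(1), symmetric]
      by (intro imageI C_complex_cnj C_complex_scale g)+
  qed
  moreover have "ck_proj A ` finite_paths A \<subseteq> theta ` C_complex A"
  proof
    fix p assume "p \<in> ck_proj A ` finite_paths A"
    then obtain \<mu> where "\<mu> \<in> finite_paths A" "p = wproj \<mu>" by (auto simp: wproj_eq)
    thus "p \<in> theta ` C_complex A" using indicator_cylinder[of \<mu>] by (metis imageI)
  qed
  ultimately show "\<D> A \<subseteq> theta ` C_complex A"
    unfolding ck_diagonal_def using theta_closed_range by (intro cstar_generated_minimal)
qed

lemma theta_inj: "inj_on theta (C_complex A)"
proof (rule inj_onI)
  fix g h assume gh: "g \<in> C_complex A" "h \<in> C_complex A" "theta g = theta h"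
  have "g x = h x" if "x \<in> path_space A" for x
    using theta_norm_ge[OF theta_diff(1)[OF gh(1,2)] that] theta_diff(2)[OF gh(1,2)] gh(3) that by simp
  thus "g = h" using gh(1,2) by (auto simp: C_complex_def intro: extensionalityI)
qed

end

section \<open>Uniqueness of the diagonal isomorphism and the unitaries of integer functions\<close>

context irreducible_graph begin

text \<open>For uniqueness, linearity and the values on indicators of cylinders determine
  \<open>\<theta>\<close> on step functions. The norm clause then makes \<open>\<theta> g\<close>
  the limit of the step functions of \<open>g\<close>, which is \<open>theta g\<close>.\<close>

lemma diagonal_iso_eq: "diagonal_iso A = restrict theta (C_complex A)"
  unfolding diagonal_iso_def
proof (rule the_equality, goal_cases)
  case 1
  show ?case
  proof (intro conjI ballI allI)
    show "bij_betw (restrict theta (C_complex A)) (C_complex A) (\<D> A)"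
      using theta_inj theta_range by (simp add: bij_betw_def)
  qed (simp_all add: C_complex_add C_complex_mult C_complex_cnj C_complex_scale theta_hom theta_norm
      indicator_cylinder wproj_eq[symmetric])
next
  case (2 \<theta>)
  note ext = 2[THEN conjunct1]
  have add: "\<theta> (\<lambda>x\<in>path_space A. g x + h x) = \<theta> g + \<theta> h" if "g \<in> C_complex A" "h \<in> C_complex A" for g h
    using 2 that by blast
  have nrm: "norm (\<theta> g) = (SUP x\<in>path_space A. cmod (g x))" if "g \<in> C_complex A" for g
    using 2 that by blast
  have scale: "\<theta> (\<lambda>x\<in>path_space A. c * g x) = c *\<^sub>C \<theta> g" if "g \<in> C_complex A" for g c
    using 2 that by blast
  have cyl: "\<theta> (\<lambda>x\<in>path_space A. indicator (cylinder A \<mu>) x) = wproj \<mu>" if "\<mu> \<in> finite_paths A" for \<mu>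
    using 2 that unfolding wproj_eq by blast
  have step: "(\<lambda>x\<in>path_space A. \<Sum>\<mu>\<in>P. F \<mu> * indicator (cylinder A \<mu>) x) \<in> C_complex A \<and>
      \<theta> (\<lambda>x\<in>path_space A. \<Sum>\<mu>\<in>P. F \<mu> * indicator (cylinder A \<mu>) x) = (\<Sum>\<mu>\<in>P. F \<mu> *\<^sub>C wproj \<mu>)"
    if "finite P" "P \<subseteq> finite_paths A" for P and F :: "('n, 'n) edge list \<Rightarrow> complex"
    using that
  proof (induction P)
    case empty
    show ?case using scale[OF C_complex_const[of 0], of 0] C_complex_const[where A = A and c = 0]
      by (simp add: restrict_def)
  next
    case (insert \<mu> P)
    let ?g = "\<lambda>x\<in>path_space A. \<Sum>\<mu>\<in>P. F \<mu> * indicator (cylinder A \<mu>) x"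
    let ?i = "\<lambda>x\<in>path_space A. indicator (cylinder A \<mu>) x :: complex"
    let ?h = "\<lambda>x\<in>path_space A. F \<mu> * ?i x"
    have \<mu>: "\<mu> \<in> finite_paths A" and P: "P \<subseteq> finite_paths A" using insert.prems by auto
    have h: "?h \<in> C_complex A" by (rule C_complex_scale[OF indicator_cylinder(1)[OF \<mu>]])
    have "(\<lambda>x\<in>path_space A. ?h x + ?g x) = (\<lambda>x\<in>path_space A. \<Sum>\<mu>\<in>insert \<mu> P. F \<mu> * indicator (cylinder A \<mu>) x)"
      by (intro restrict_ext) (simp only: restrict_apply' sum.insert[OF insert.hyps(1,2)])
    moreover have "\<theta> (\<lambda>x\<in>path_space A. ?h x + ?g x) = F \<mu> *\<^sub>C wproj \<mu> + (\<Sum>\<mu>\<in>P. F \<mu> *\<^sub>C wproj \<mu>)"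
      using add[OF h insert.IH[OF P, THEN conjunct1]] scale[OF indicator_cylinder(1)[OF \<mu>], of "F \<mu>"] cyl[OF \<mu>]
        insert.IH[OF P, THEN conjunct2] by (simp only:)
    ultimately show ?case
      using C_complex_add[OF h insert.IH[OF P, THEN conjunct1]] insert.hyps by (simp only: sum.insert simp_thms)
  qed
  have eq: "\<theta> g = theta g" if g: "g \<in> C_complex A" for g
  proof -
    have "sample g \<longlonglongrightarrow> \<theta> g"
    proof (rule LIMSEQ_I)
      fix e :: real assume e: "e > 0"
      obtain N where N: "N \<ge> 1" "\<And>n u v. n \<ge> N \<Longrightarrow> u \<in> path_space A \<Longrightarrow> v \<in> path_space A \<Longrightarrow> prefix u n = prefix v n \<Longrightarrow> cmod (g u - g v) < e / 2"
        using C_complex_osc[OF g half_gt_zero[OF e]] by metis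
      have "norm (sample g n - \<theta> g) \<le> e / 2" if n: "n \<ge> N" for n
      proof -
        let ?s = "\<lambda>x\<in>path_space A. \<Sum>\<mu>\<in>paths A n. g (pt \<mu>) * indicator (cylinder A \<mu>) x"
        have P: "paths A n \<subseteq> finite_paths A" by (auto simp: paths_def)
        note s = step[OF finite_paths_finite P, of "\<lambda>\<mu>. g (pt \<mu>)"]
        have sx: "?s x = g (pt (prefix x n))" if x: "x \<in> path_space A" for x
        proof -
          have p: "prefix x n \<in> paths A n" using prefix_paths[OF x] N(1) n by simp
          have "indicator (cylinder A \<mu>) x = (if \<mu> = prefix x n then 1 else (0 :: complex))" if "\<mu> \<in> paths A n" for \<mu>
            using that x by (auto simp: indicator_def cylinder_eq paths_def)
          hence "g (pt \<mu>) * indicator (cylinder A \<mu>) x = (if \<mu> = prefix x n then g (pt (prefix x n)) else 0)"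
            if "\<mu> \<in> paths A n" for \<mu> using that by simp
          hence "?s x = (\<Sum>\<mu>\<in>paths A n. if \<mu> = prefix x n then g (pt (prefix x n)) else 0)"
            unfolding restrict_apply'[OF x] by (intro sum.cong refl)
          thus ?thesis using p by (simp add: sum.delta[OF finite_paths_finite])
        qed
        \<comment> \<open>The description provides sums and scalar multiples but no differences,
          hence the summand \<open>(-1) * g x\<close>.\<close>
        let ?d = "\<lambda>x\<in>path_space A. ?s x + (\<lambda>x\<in>path_space A. (-1) * g x) x"
        note d = add[OF s[THEN conjunct1] C_complex_scale[OF g, of "-1"]]
          C_complex_add[OF s[THEN conjunct1] C_complex_scale[OF g, of "-1"]]
        have "\<theta> ?d = sample g n - \<theta> g"
          unfolding d(1) s[THEN conjunct2] scale[OF g] sample_def simple_def by (simp add: scaleC_minus_one)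
        hence "norm (sample g n - \<theta> g) = (SUP x\<in>path_space A. cmod (?d x))" using nrm[OF d(2)] by simp
        also have "\<dots> \<le> e / 2"
        proof (rule cSUP_least[OF path_space_nonempty])
          fix x assume x: "x \<in> path_space A"
          have p: "prefix x n \<in> paths A n" using prefix_paths[OF x] N(1) n by simp
          have "?d x = g (pt (prefix x n)) - g x" using x sx[OF x] by simp
          thus "cmod (?d x) \<le> e / 2" using N(2)[OF n pt_paths(1)[OF p] x pt_paths(2)[OF p]] by simp
        qed
        finally show ?thesis .
      qed
      thus "\<exists>no. \<forall>n\<ge>no. norm (sample g n - \<theta> g) < e" using e by (intro exI[of _ N]) fastforce
    qed
    thus ?thesis using thetaI[OF g] by simp
  qed
  show "\<theta> = restrict theta (C_complex A)"
  proof (rule extensionalityI[OF ext])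
    show "\<theta> x = restrict theta (C_complex A) x" if "x \<in> C_complex A" for x using eq[OF that] that by simp
  qed simp
qed

definition phase :: "real \<Rightarrow> int \<Rightarrow> complex" where
  "phase t k = exp (2 * of_real pi * \<i> * of_real t * of_int k)"

definition level :: "((nat \<Rightarrow> ('n, 'n) edge) \<Rightarrow> int) \<Rightarrow> nat \<Rightarrow> bool" where
  "level f N \<longleftrightarrow> N \<ge> 1 \<and> (\<forall>u\<in>path_space A. \<forall>v\<in>path_space A. prefix u N = prefix v N \<longrightarrow> f u = f v)"

lemma U_fun_eq:
  assumes "level f N" shows "U_fun A f t = simple N (\<lambda>\<mu>. phase t (f (pt \<mu>)))"
proof -
  let ?g = "\<lambda>x. exp (2 * of_real pi * \<i> * of_real t * of_int (f x))"
  have c: "?g u = ?g v" if "u \<in> path_space A" "v \<in> path_space A" "prefix u N = prefix v N" for u v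
  proof -
    have "f u = f v" using assms that unfolding level_def by blast
    thus ?thesis by (simp only:)
  qed
  have N: "N \<ge> 1" using assms by (simp add: level_def)
  have "(\<lambda>x\<in>path_space A. ?g x) \<in> C_complex A"
    by (rule C_complex_locally_constant[where N = N]) (rule c)
  hence "U_fun A f t = theta (\<lambda>x\<in>path_space A. ?g x)"
    unfolding U_fun_def diagonal_iso_eq by (rule restrict_apply')
  also have "\<dots> = simple N (\<lambda>\<mu>. ?g (pt \<mu>))" by (rule theta_level[OF N c])
  finally show ?thesis by (simp add: phase_def)
qed

lemma phase_add: "phase (s + t) k = phase s k * phase t k"
  by (simp add: phase_def exp_add[symmetric] algebra_simps)

lemma phase_0 [simp]: "phase 0 k = 1" by (simp add: phase_def)

lemma phase_1 [simp]: "phase 1 k = 1"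
  using exp_integer_2pi[of "of_int k"] by (simp add: phase_def mult_ac)

lemma phase_cnj: "cnj (phase t k) = phase (- t) k"
  by (simp add: phase_def exp_cnj)

context
  fixes f N assumes lev: "level f N"
begin

lemma N_pos: "N \<ge> 1" using lev by (simp add: level_def)

lemma U_fun_add: "U_fun A f (s + t) = U_fun A f s * U_fun A f t"
  by (simp add: U_fun_eq[OF lev] simple_mult[symmetric] phase_add)

lemma U_fun_0: "U_fun A f 0 = 1" and U_fun_1: "U_fun A f 1 = 1"
  using simple_one[OF N_pos] by (simp_all add: U_fun_eq[OF lev])

lemma U_fun_adj: "adj (U_fun A f t) = U_fun A f (- t)"
  by (simp add: U_fun_eq[OF lev] simple_adj[symmetric] phase_cnj)

lemma U_fun_inverse: "U_fun A f (- t) * U_fun A f t = 1" "U_fun A f t * U_fun A f (- t) = 1"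
  using U_fun_add[of "- t" t] U_fun_add[of t "- t"] by (simp_all add: U_fun_0)

lemma U_fun_diagonal: "U_fun A f t \<in> \<D> A"
  by (simp add: U_fun_eq[OF lev] simple_diagonal)

lemma U_fun_continuous: "continuous_on UNIV (\<lambda>t. U_fun A f (- t))"
proof -
  have "continuous_on UNIV (\<lambda>t. phase (- t) k *\<^sub>C wproj \<mu>)" for k \<mu>
  proof -
    have b: "bounded_linear (\<lambda>c. c *\<^sub>C wproj \<mu>)"
      by (rule bounded_linear_intro[where K = "norm (wproj \<mu>)"])
        (auto simp: scaleC_add_left scaleR_eq_scaleC_cop scaleC_scaleC scaleR_conv_of_real)
    have c: "continuous_on UNIV (\<lambda>t. phase (- t) k)" unfolding phase_def by (intro continuous_intros)
    show ?thesis by (rule bounded_linear.continuous_on[OF b c])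
  qed
  thus ?thesis unfolding U_fun_eq[OF lev] simple_def by (intro continuous_on_sum)
qed

lemma U_fun_wproj: "\<mu> \<in> paths A N \<Longrightarrow> U_fun A f t * wproj \<mu> = phase t (f (pt \<mu>)) *\<^sub>C wproj \<mu>"
  unfolding U_fun_eq[OF lev] simple_def sum_distrib_right
  by (subst sum_single[of _ \<mu>]) (simp_all add: mult_scaleC_left wproj_mult)

end

lemma wproj_simple_delta:
  "\<mu> \<in> finite_paths A \<Longrightarrow> wproj \<mu> = simple (length \<mu>) (\<lambda>\<nu>. if \<nu> = \<mu> then 1 else 0)"
  unfolding simple_def
  by (subst sum_single[OF finite_paths_finite, of \<mu>]) (simp_all add: scaleC_one, simp add: paths_def)

lemma simple_commute:
  assumes "n \<ge> 1" "m \<ge> 1" shows "simple n F * simple m G = simple m G * simple n F"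
proof -
  have "simple n F * simple m G = simple (max n m) (\<lambda>\<nu>. F (take n \<nu>) * G (take m \<nu>))"
    using simple_refine[OF assms(1), of "max n m" F] simple_refine[OF assms(2), of "max n m" G]
    by (simp add: simple_mult)
  moreover have "simple m G * simple n F = simple (max n m) (\<lambda>\<nu>. G (take m \<nu>) * F (take n \<nu>))"
    using simple_refine[OF assms(1), of "max n m" F] simple_refine[OF assms(2), of "max n m" G]
    by (simp add: simple_mult)
  ultimately show ?thesis by (simp add: mult.commute)
qed

text \<open>Both factors come from step functions, and these commute after refinement to a common
  level.\<close>

lemma U_fun_commute:
  assumes "level f N" "\<mu> \<in> finite_paths A"
  shows "U_fun A f t * wproj \<mu> = wproj \<mu> * U_fun A f t"
proof -
  have "length \<mu> \<ge> 1" using assms(2) by (cases \<mu>) (auto simp: finite_paths_def)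
  thus ?thesis
    unfolding U_fun_eq[OF assms(1)] wproj_simple_delta[OF assms(2)]
    by (intro simple_commute N_pos[OF assms(1)])
qed

end

subsection \<open>Block diagonal operators and generalized gauge actions\<close>

definition block_diagonal :: "('x \<times> 'i) cop set" where
  "block_diagonal = {X. \<forall>x y i j. x \<noteq> y \<longrightarrow> mel X (x, i) (y, j) = 0}"

lemma block_diagonalI: "(\<And>x y i j. x \<noteq> y \<Longrightarrow> mel X (x, i) (y, j) = 0) \<Longrightarrow> X \<in> block_diagonal"
  by (simp add: block_diagonal_def)

lemma block_diagonalD: "X \<in> block_diagonal \<Longrightarrow> x \<noteq> y \<Longrightarrow> mel X (x, i) (y, j) = 0"
  by (simp add: block_diagonal_def)

lemma star_subalgebra_block_diagonal: "star_subalgebra block_diagonal"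
  unfolding star_subalgebra_def
proof (intro conjI ballI allI)
  fix X Y :: "('x \<times> 'i) cop" assume XY: "X \<in> block_diagonal" "Y \<in> block_diagonal"
  show "X * Y \<in> block_diagonal"
  proof (rule block_diagonalI)
    fix x y :: 'x and i j :: 'i assume "x \<noteq> y"
    have "mel X (x, i) k * mel Y k (y, j) = 0" for k
    proof (cases k)
      case (Pair z l)
      thus ?thesis using XY \<open>x \<noteq> y\<close> by (cases "x = z") (simp_all add: block_diagonalD)
    qed
    thus "mel (X * Y) (x, i) (y, j) = 0" unfolding mel_mult by (intro infsum_0)
  qed
qed (auto intro!: block_diagonalI simp: mel_add mel_adj mel_scaleC block_diagonalD)

lemma bounded_linear_mel: "bounded_linear (\<lambda>X. mel X i j)"
  by (rule bounded_linear_intro[where K = 1]) (auto simp: mel_add mel_scaleR cmod_mel_le scaleR_conv_of_real[where 'a = complex])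

lemma closed_block_diagonal: "closed block_diagonal"
proof -
  have "closed {X :: ('x \<times> 'i) cop. mel X p q = 0}" for p q
    by (intro closed_Collect_eq linear_continuous_on bounded_linear_mel continuous_on_const)
  thus ?thesis unfolding block_diagonal_def by (intro closed_Collect_all closed_Collect_imp) simp_all
qed

lemma ck_algebra_block_diagonal: "irreducible_matrix A \<Longrightarrow> \<O> A \<subseteq> block_diagonal"
  unfolding ck_algebra_def
  by (intro cstar_generated_minimal star_subalgebra_block_diagonal closed_block_diagonal)
    (auto simp: block_diagonal_def mel_ck_gen)

lemma block_diagonal_compress:
  fixes X :: "('x \<times> 'i) cop" and T :: "'k cop"
  assumes "X \<in> block_diagonal"
  shows "X \<in> mult_domain (compress (Pair x))"
    and "X \<otimes>\<^sub>o T \<in> mult_domain (compress (\<lambda>(i, k). ((x, i), k)))"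
proof -
  have z: "mel X (y, i) (z, j) = 0" if "y \<noteq> z" for y z i j using block_diagonalD[OF assms that] .
  have h: "inj (Pair x)" "inj (\<lambda>(i, k). ((x, i), k))" by (auto simp: inj_def)
  show "X \<in> mult_domain (compress (Pair x))"
  proof (rule mult_domain_compress[OF h(1)])
    fix i and k :: "'x \<times> 'i" assume "k \<notin> range (Pair x)"
    then obtain y j where "k = (y, j)" "y \<noteq> x" by (cases k) auto
    thus "mel X (x, i) k = 0 \<and> mel X k (x, i) = 0" using z by auto
  qed
  show "X \<otimes>\<^sub>o T \<in> mult_domain (compress (\<lambda>(i, k). ((x, i), k)))"
  proof (rule mult_domain_compress[OF h(2)])
    fix p :: "'i \<times> 'k" and q :: "('x \<times> 'i) \<times> 'k" assume "q \<notin> range (\<lambda>(i, k). ((x, i), k))"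
    moreover obtain y j l where q: "q = ((y, j), l)" by (metis surj_pair)
    moreover obtain i k where p: "p = (i, k)" by fastforce
    ultimately have "y \<noteq> x" by force
    thus "mel (X \<otimes>\<^sub>o T) ((\<lambda>(i, k). ((x, i), k)) p) q = 0 \<and> mel (X \<otimes>\<^sub>o T) q ((\<lambda>(i, k). ((x, i), k)) p) = 0"
      using z by (simp add: p q mel_tensor)
  qed
qed

text \<open>The block of the result at \<open>x\<close> is the block of the argument at
  \<open>F x\<close>. On block diagonal operators this is multiplicative for any map
  \<open>F\<close> of the indices.\<close>

definition reindex :: "('x \<Rightarrow> 'y) \<Rightarrow> ('y \<times> 'i) cop \<Rightarrow> ('x \<times> 'i) cop" where
  "reindex F X = block_diag (\<lambda>x. compress (Pair (F x)) X)"

definition reindex_stable :: "('x \<Rightarrow> 'y) \<Rightarrow> (('y \<times> 'i) \<times> 'k) cop \<Rightarrow> (('x \<times> 'i) \<times> 'k) cop" where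
  "reindex_stable F = blocks (\<lambda>x. compress (\<lambda>(i, k). ((F x, i), k)))"

lemma inj_Pairs: "inj (Pair x)" "inj (\<lambda>(i, k). ((x, i), k))" by (auto simp: inj_def)

lemma star_map_reindex: "star_map (reindex F)"
  unfolding reindex_def[abs_def] by (intro star_map_block_diag star_map_compress inj_Pairs)

lemma star_map_reindex_stable: "star_map (reindex_stable F)"
  unfolding reindex_stable_def by (intro star_map_blocks star_map_compress inj_Pairs)

lemma mel_reindex: "mel (reindex F X) (x, i) (y, j) = (if x = y then mel X (F x, i) (F x, j) else 0)"
  unfolding reindex_def
  by (simp add: mel_block_diag[OF star_map_norm[OF star_map_compress[OF inj_Pairs(1)]]] mel_compress[OF inj_Pairs(1)])

lemma reindex_mult_domain: "X \<in> block_diagonal \<Longrightarrow> X \<in> mult_domain (reindex F)"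
  unfolding reindex_def[abs_def] by (intro mult_domain_block_diag star_map_compress inj_Pairs block_diagonal_compress)

lemma reindex_stable_mult_domain: "X \<in> block_diagonal \<Longrightarrow> X \<otimes>\<^sub>o T \<in> mult_domain (reindex_stable F)"
  unfolding reindex_stable_def by (intro mult_domain_blocks star_map_compress inj_Pairs block_diagonal_compress)

lemma reindex_stable_tensor: "reindex_stable F (X \<otimes>\<^sub>o T) = reindex F X \<otimes>\<^sub>o T"
  unfolding reindex_stable_def
  by (rule cop_eqI_mel)
    (simp only: split_paired_all mel_blocks[OF star_map_compress[OF inj_Pairs(2)]] mel_tensor mel_reindex
      mel_compress[OF inj_Pairs(2)], simp add: mel_tensor)

text \<open>Multiplication by \<open>x \<otimes> 1\<close> is linear and bounded and maps the
  elementary tensors among themselves, so it preserves their closed span.\<close>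

lemma multiplier_mult:
  assumes "star_subalgebra E" "x \<in> E" "Y \<in> E \<otimes>\<^sub>* K"
  shows "(x \<otimes>\<^sub>o 1) * Y \<in> E \<otimes>\<^sub>* K" "Y * (x \<otimes>\<^sub>o 1) \<in> E \<otimes>\<^sub>* K"
proof -
  let ?M = "{S \<otimes>\<^sub>o T | S T. S \<in> E \<and> T \<in> K}"
  have *: "L Y \<in> E \<otimes>\<^sub>* K" if L: "bounded_linear L" and m: "\<And>S T. S \<in> E \<Longrightarrow> T \<in> K \<Longrightarrow> L (S \<otimes>\<^sub>o T) \<in> ?M" for L
  proof -
    have "L ` span ?M \<subseteq> span ?M"
      unfolding linear_span_image[OF bounded_linear.linear[OF L], symmetric] using m by (intro span_mono) blast
    hence "L ` closure (span ?M) \<subseteq> closure (span ?M)"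
      using closure_bounded_linear_image_subset[OF L, of "span ?M"] closure_mono by blast
    thus ?thesis using assms(3) unfolding cstar_tensor_def by blast
  qed
  show "(x \<otimes>\<^sub>o 1) * Y \<in> E \<otimes>\<^sub>* K"
  proof (rule *[OF bounded_linear_mult_right])
    fix S T assume "S \<in> E" "T \<in> K"
    hence "(x * S) \<otimes>\<^sub>o T \<in> ?M" using sub_mult[OF assms(1,2)] by blast
    thus "(x \<otimes>\<^sub>o 1) * (S \<otimes>\<^sub>o T) \<in> ?M" by (simp only: tensor_mult mult_1_left)
  qed
  show "Y * (x \<otimes>\<^sub>o 1) \<in> E \<otimes>\<^sub>* K"
  proof (rule *[OF bounded_linear_mult_left])
    fix S T assume "S \<in> E" "T \<in> K"
    hence "(S * x) \<otimes>\<^sub>o T \<in> ?M" using sub_mult[OF assms(1) _ assms(2)] by blast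
    thus "(S \<otimes>\<^sub>o T) * (x \<otimes>\<^sub>o 1) \<in> ?M" by (simp only: tensor_mult mult_1_right)
  qed
qed

section \<open>Generalized gauge actions and their stabilizations\<close>

context irreducible_graph begin

text \<open>The gauge automorphism sends the generators to those of another family in every block, so
  it permutes the blocks of the universal representation according to \<open>twist_index\<close>.\<close>

definition twist_index :: "((nat \<Rightarrow> ('n, 'n) edge) \<Rightarrow> int) \<Rightarrow> real \<Rightarrow>
    (('n, 'n) edge \<Rightarrow> nat cop) \<Rightarrow> ('n, 'n) edge \<Rightarrow> nat cop" where
  "twist_index f t S a = compress (Pair S) (U_fun A f t * ck_gen A a)"

abbreviation gauge_map :: "((nat \<Rightarrow> ('n, 'n) edge) \<Rightarrow> int) \<Rightarrow> real \<Rightarrow> 'n ck_index cop \<Rightarrow> 'n ck_index cop" where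
  "gauge_map f t \<equiv> reindex (twist_index f t)"

abbreviation gauge_map_stable :: "((nat \<Rightarrow> ('n, 'n) edge) \<Rightarrow> int) \<Rightarrow> real \<Rightarrow>
    ('n ck_index \<times> nat) cop \<Rightarrow> ('n ck_index \<times> nat) cop" where
  "gauge_map_stable f t \<equiv> reindex_stable (twist_index f t)"

lemma diagonal_subset_algebra: "\<D> A \<subseteq> \<O> A"
  unfolding ck_diagonal_def
proof (rule cstar_generated_minimal)
  show "ck_proj A ` finite_paths A \<subseteq> \<O> A"
  proof
    fix p assume "p \<in> ck_proj A ` finite_paths A"
    then obtain \<mu> where "\<mu> \<in> finite_paths A" "p = wproj \<mu>" by (auto simp: wproj_eq)
    moreover have "word \<mu> \<in> \<O> A" if "\<mu> \<in> finite_paths A" for \<mu>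
      using that by (intro word_mem star_subalgebra_ck_algebra ck_algebra_generator)
    ultimately show "p \<in> \<O> A" by (simp add: wproj_def sub_mult sub_adj)
  qed
qed simp_all

lemma gauge_mult_domain: "x \<in> \<O> A \<Longrightarrow> x \<in> mult_domain (gauge_map f t)"
  using ck_algebra_block_diagonal[OF irr] by (intro reindex_mult_domain) blast

context
  fixes f N assumes lev: "level f N"
begin

lemma gauge_generator_mem: "a \<in> edges A \<Longrightarrow> U_fun A f t * ck_gen A a \<in> \<O> A"
  using U_fun_diagonal[OF lev] diagonal_subset_algebra
  by (intro sub_mult star_subalgebra_ck_algebra ck_algebra_generator) blast

text \<open>\<open>U_fun A f t\<close> is a unitary that commutes with the range projections of the
  generators, so multiplying the generators by it from the left changes neither their range nor
  their source projections.\<close>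

lemma twisted_family: "ck_family A (\<lambda>a. U_fun A f t * ck_gen A a)"
proof -
  let ?U = "U_fun A f t"
  have U: "adj ?U * ?U = 1" "?U * adj ?U = 1" using U_fun_inverse[OF lev] by (simp_all add: U_fun_adj[OF lev])
  have p: "?U * (ck_gen A a * (adj (ck_gen A a) * adj ?U)) = ck_gen A a * adj (ck_gen A a)" if "a \<in> edges A" for a
  proof -
    have "[a] \<in> finite_paths A" using that by (simp add: finite_paths_Cons)
    hence "?U * wproj [a] * adj ?U = wproj [a] * (?U * adj ?U)" by (simp add: U_fun_commute[OF lev] mult.assoc)
    thus ?thesis by (simp add: U wproj_def mult.assoc)
  qed
  have q: "(?U * ck_gen A a) * adj (?U * ck_gen A a) = ck_gen A a * adj (ck_gen A a)" if "a \<in> edges A" for a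
    using p[OF that] by (simp add: adj_mult mult.assoc)
  have r: "adj (?U * ck_gen A a) * (?U * ck_gen A a) = adj (ck_gen A a) * ck_gen A a" for a
  proof -
    have "adj (?U * ck_gen A a) * (?U * ck_gen A a) = adj (ck_gen A a) * (adj ?U * ?U) * ck_gen A a"
      by (simp only: adj_mult mult.assoc)
    thus ?thesis by (simp add: U)
  qed
  show ?thesis unfolding ck_family_def
  proof (intro conjI ballI)
    fix a assume a: "a \<in> edges A"
    have "(?U * ck_gen A a) * adj (?U * ck_gen A a) * (?U * ck_gen A a) =
        (?U * ck_gen A a) * (adj (?U * ck_gen A a) * (?U * ck_gen A a))" by (simp only: mult.assoc)
    also have "\<dots> = ?U * (ck_gen A a * adj (ck_gen A a) * ck_gen A a)" by (simp only: r mult.assoc)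
    finally show "(?U * ck_gen A a) * adj (?U * ck_gen A a) * (?U * ck_gen A a) = ?U * ck_gen A a"
      by (simp only: partial_isometry[OF a])
    have "(\<Sum>b | b \<in> edges A \<and> src b = tgt a. (?U * ck_gen A b) * adj (?U * ck_gen A b)) = vproj (tgt a)"
      unfolding vproj_def by (intro sum.cong refl q) simp
    thus "adj (?U * ck_gen A a) * (?U * ck_gen A a) =
        (\<Sum>b | b \<in> edges A \<and> src b = tgt a. (?U * ck_gen A b) * adj (?U * ck_gen A b))"
      by (simp only: r source_proj[OF a])
  next
    have "(\<Sum>b\<in>edges A. (?U * ck_gen A b) * adj (?U * ck_gen A b)) = (\<Sum>b\<in>edges A. ck_gen A b * adj (ck_gen A b))"
      by (intro sum.cong refl q)
    thus "(\<Sum>b\<in>edges A. (?U * ck_gen A b) * adj (?U * ck_gen A b)) = 1" by (simp only: sum_range_proj)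
  qed
qed

lemma twist_index_family: "ck_family A (twist_index f t S)"
proof -
  have one: "compress (Pair S) (1 :: 'n ck_index cop) = 1"
    by (rule cop_eqI_mel) (simp add: mel_compress[OF inj_Pairs(1)] mel_one)
  have m: "U_fun A f t * ck_gen A a \<in> mult_domain (compress (Pair S))" if "a \<in> edges A" for a
    by (rule block_diagonal_compress(1)[OF subsetD[OF ck_algebra_block_diagonal[OF irr] gauge_generator_mem[OF that]]])
  from ck_family_star_map[OF twisted_family star_map_compress[OF inj_Pairs(1)] m one]
  show ?thesis by (simp add: twist_index_def[abs_def])
qed

text \<open>In the block \<open>S\<close> the result is the generator's block at
  \<open>twist_index f t S\<close>. This index is a family, so that block is the family itself,
  which by definition is the compression of the twisted generators to \<open>S\<close>.\<close>

lemma gauge_map_generator: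
  assumes a: "a \<in> edges A" shows "gauge_map f t (ck_gen A a) = U_fun A f t * ck_gen A a"
proof (rule cop_eqI_mel)
  fix p q :: "'n ck_index"
  obtain S i where p: "p = (S, i)" by fastforce
  obtain S' j where q: "q = (S', j)" by fastforce
  have "U_fun A f t * ck_gen A a \<in> block_diagonal"
    using gauge_generator_mem[OF a] ck_algebra_block_diagonal[OF irr] by blast
  from block_diagonalD[OF this, of S S' i j]
  show "mel (gauge_map f t (ck_gen A a)) p q = mel (U_fun A f t * ck_gen A a) p q"
    unfolding p q mel_reindex mel_ck_gen[OF irr a] ck_rep_eq[OF twist_index_family]
    by (simp add: twist_index_def mel_compress[OF inj_Pairs(1)])
qed

text \<open>By induction the projection of \<open>a # \<mu>\<close> is conjugated by
  \<open>U_fun A f t\<close>, and the two commute. Consequently the gauge map fixes the diagonal,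
  from which its group law follows.\<close>

lemma gauge_map_wproj: "\<mu> \<in> finite_paths A \<Longrightarrow> gauge_map f t (wproj \<mu>) = wproj \<mu>"
proof (induction \<mu>)
  case (Cons a \<mu>)
  let ?U = "U_fun A f t"
  have a: "a \<in> edges A" using Cons.prems by (simp add: finite_paths_Cons)
  have U: "?U * adj ?U = 1" using U_fun_inverse[OF lev] by (simp add: U_fun_adj[OF lev])
  note m = mult_domainD[OF gauge_mult_domain[OF ck_algebra_generator[OF a]]]
  have w: "wproj (a # \<mu>) = ck_gen A a * wproj \<mu> * adj (ck_gen A a)"
    by (simp add: wproj_def adj_mult mult.assoc)
  have ma: "adj (ck_gen A a) \<in> mult_domain (gauge_map f t)"
    using gauge_mult_domain ck_algebra_generator[OF a] sub_adj[OF star_subalgebra_ck_algebra(1)] by blast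
  have one: "gauge_map f t 1 = 1"
    by (rule cop_eqI_mel) (simp only: split_paired_all mel_reindex mel_one prod.inject, simp)
  \<comment> \<open>For \<open>\<mu> = []\<close> the inner factor is the unit, to which the
    induction hypothesis does not apply because paths are nonempty.\<close>
  have fx: "gauge_map f t (wproj \<mu>) = wproj \<mu>"
  proof (cases "\<mu> = []")
    case True
    thus ?thesis by (simp add: wproj_def one)
  next
    case False
    thus ?thesis using Cons by (simp add: finite_paths_Cons)
  qed
  have "gauge_map f t (wproj (a # \<mu>)) = ?U * wproj (a # \<mu>) * adj ?U"
    unfolding w by (simp add: m mult_domainD[OF ma] star_map_adj[OF star_map_reindex] gauge_map_generator[OF a] fx
        adj_mult mult.assoc)
  also have "\<dots> = wproj (a # \<mu>)" by (simp add: U_fun_commute[OF lev Cons.prems] mult.assoc U)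
  finally show ?case .
qed (simp add: finite_paths_def)

lemma gauge_map_diagonal:
  assumes "x \<in> \<D> A" shows "gauge_map f t x = x"
proof -
  have m: "ck_proj A ` finite_paths A \<subseteq> mult_domain (gauge_map f t)"
    by (intro image_subsetI gauge_mult_domain subsetD[OF diagonal_subset_algebra])
      (simp only: wproj_eq[symmetric] wproj_diagonal)
  have e: "gauge_map f t y = y" if "y \<in> ck_proj A ` finite_paths A" for y
    using that gauge_map_wproj by (auto simp: wproj_eq)
  have i: "star_map (\<lambda>x :: 'n ck_index cop. x)" "y \<in> mult_domain (\<lambda>x :: 'n ck_index cop. x)" for y
    by (simp_all add: star_map_def mult_domain_def)
  show ?thesis
    by (rule star_map_generated_eqI[OF star_map_reindex i(1) m _ e assms[unfolded ck_diagonal_def]])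
      (intro subsetI i(2))
qed

end

text \<open>The map for \<open>s\<close> fixes the diagonal unitary for \<open>t\<close>, so the
  phases add up. With \<open>s = - t\<close> this makes the gauge maps invertible.\<close>

lemma level_phase:
  assumes "level f N" "a \<in> edges A"
  shows "gauge_map f s (U_fun A f t * ck_gen A a) = U_fun A f (s + t) * ck_gen A a"
proof -
  have "U_fun A f t \<in> \<O> A" using U_fun_diagonal[OF assms(1)] diagonal_subset_algebra by blast
  hence "gauge_map f s (U_fun A f t * ck_gen A a) = U_fun A f t * (U_fun A f s * ck_gen A a)"
    by (simp add: mult_domainD gauge_mult_domain gauge_map_diagonal[OF assms(1) U_fun_diagonal[OF assms(1)]]
        gauge_map_generator[OF assms])
  thus ?thesis using U_fun_add[OF assms(1), of t s] by (simp add: mult.assoc add.commute)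
qed

context
  fixes f N assumes lev: "level f N"
begin

lemma gauge_map_algebra: "gauge_map f t ` \<O> A \<subseteq> \<O> A"
  unfolding ck_algebra_def[of A]
proof (rule star_map_generated_subset(2)[OF star_map_reindex])
  show "ck_gen A ` edges A \<subseteq> mult_domain (gauge_map f t)"
    by (intro image_subsetI gauge_mult_domain ck_algebra_generator)
  show "gauge_map f t ` ck_gen A ` edges A \<subseteq> cstar_generated (ck_gen A ` edges A)"
    using gauge_map_generator[OF lev] gauge_generator_mem[OF lev] by (auto simp: ck_algebra_def)
qed simp_all

lemma gauge_map_inverse: "x \<in> \<O> A \<Longrightarrow> gauge_map f (- t) (gauge_map f t x) = x"
proof -
  assume x: "x \<in> \<O> A"
  let ?\<Theta> = "\<lambda>x. gauge_map f (- t) (gauge_map f t x)"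
  have m: "ck_gen A ` edges A \<subseteq> mult_domain ?\<Theta>"
  proof (rule image_subsetI)
    fix a assume a: "a \<in> edges A"
    have "gauge_map f t (ck_gen A a) \<in> \<O> A"
      by (rule subsetD[OF gauge_map_algebra imageI[OF ck_algebra_generator[OF a]]])
    thus "ck_gen A a \<in> mult_domain ?\<Theta>"
      by (rule mult_domain_comp[OF gauge_mult_domain[OF ck_algebra_generator[OF a]] gauge_mult_domain])
  qed
  have e: "?\<Theta> y = y" if "y \<in> ck_gen A ` edges A" for y
    using that by (auto simp: gauge_map_generator[OF lev] level_phase[OF lev] U_fun_0[OF lev])
  have i: "star_map (\<lambda>x :: 'n ck_index cop. x)" "y \<in> mult_domain (\<lambda>x :: 'n ck_index cop. x)" for y
    by (simp_all add: star_map_def mult_domain_def)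
  show ?thesis
    by (rule star_map_generated_eqI[OF star_map_comp[OF star_map_reindex star_map_reindex] i(1) m _ e])
      (use i(2) x in \<open>auto simp: ck_algebra_def\<close>)
qed

lemma gauge_map_isomorphism:
  assumes "\<And>x. x \<in> \<O> A \<Longrightarrow> \<alpha> x = gauge_map f t x" shows "cstar_isomorphism (\<O> A) (\<O> A) \<alpha>"
proof (rule star_map_isomorphism[OF star_map_reindex star_map_reindex])
  show "gauge_map f (- t) (gauge_map f t x) = x" if "x \<in> \<O> A" for x using gauge_map_inverse[OF that] .
  show "gauge_map f t (gauge_map f (- t) x) = x" if "x \<in> \<O> A" for x using gauge_map_inverse[OF that, of "- t"] by simp
  show "gauge_map f t ` \<O> A \<subseteq> \<O> A" "gauge_map f (- t) ` \<O> A \<subseteq> \<O> A" by (rule gauge_map_algebra)+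
qed (simp_all add: assms gauge_mult_domain subsetI)

text \<open>Replaces the described automorphism by the restriction of an explicit map of all
  operators, to which the arguments with multiplicative domains apply.\<close>

lemma gauge_action_eq: "\<rho> A f t = restrict (gauge_map f t) (\<O> A)"
  unfolding gauge_action_def
proof (rule the_equality)
  have iso: "cstar_isomorphism (\<O> A) (\<O> A) (restrict (gauge_map f t) (\<O> A))"
    by (rule gauge_map_isomorphism) simp
  show "restrict (gauge_map f t) (\<O> A) \<in> extensional (\<O> A) \<and> cstar_isomorphism (\<O> A) (\<O> A) (restrict (gauge_map f t) (\<O> A)) \<and>
    (\<forall>a\<in>edges A. restrict (gauge_map f t) (\<O> A) (ck_gen A a) = U_fun A f t * ck_gen A a)"
    using iso by (simp add: ck_algebra_generator gauge_map_generator[OF lev])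
  fix \<alpha> assume \<alpha>: "\<alpha> \<in> extensional (\<O> A) \<and> cstar_isomorphism (\<O> A) (\<O> A) \<alpha> \<and>
    (\<forall>a\<in>edges A. \<alpha> (ck_gen A a) = U_fun A f t * ck_gen A a)"
  have "\<alpha> y = restrict (gauge_map f t) (\<O> A) y" if "y \<in> ck_gen A ` edges A" for y
    using that \<alpha> by (auto simp: ck_algebra_generator gauge_map_generator[OF lev])
  hence "\<alpha> x = restrict (gauge_map f t) (\<O> A) x" if "x \<in> \<O> A" for x
    using cstar_isomorphism_eqI[of "ck_gen A ` edges A" "\<O> A" \<alpha> "\<O> A" "restrict (gauge_map f t) (\<O> A)" x] \<alpha> iso that
    unfolding ck_algebra_def[of A] by blast
  thus "\<alpha> = restrict (gauge_map f t) (\<O> A)" using \<alpha> by (intro extensionalityI[of _ "\<O> A"]) simp_all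
qed

lemma gauge_map_stable_generator:
  "a \<in> edges A \<Longrightarrow> gauge_map_stable f t (ck_gen A a \<otimes>\<^sub>o k) = (U_fun A f t * ck_gen A a) \<otimes>\<^sub>o k"
  by (simp add: reindex_stable_tensor gauge_map_generator[OF lev])

lemma gauge_stable_mult_domain: "x \<in> \<O> A \<Longrightarrow> x \<otimes>\<^sub>o k \<in> mult_domain (gauge_map_stable f t)"
  using ck_algebra_block_diagonal[OF irr] by (intro reindex_stable_mult_domain) blast

lemma gauge_map_stable_subset:
  shows "\<O> A \<otimes>\<^sub>* compacts \<subseteq> mult_domain (gauge_map_stable f t)"
    and "gauge_map_stable f t ` (\<O> A \<otimes>\<^sub>* compacts) \<subseteq> \<O> A \<otimes>\<^sub>* compacts"
proof -
  let ?G = "{ck_gen A a \<otimes>\<^sub>o munit i j | a i j. a \<in> edges A}"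
  have 1: "?G \<subseteq> mult_domain (gauge_map_stable f t)" using gauge_stable_mult_domain ck_algebra_generator by blast
  have 2: "gauge_map_stable f t ` ?G \<subseteq> \<O> A \<otimes>\<^sub>* compacts"
  proof clarify
    fix a i j assume "a \<in> edges A"
    thus "gauge_map_stable f t (ck_gen A a \<otimes>\<^sub>o munit i j) \<in> \<O> A \<otimes>\<^sub>* compacts"
      by (simp add: gauge_map_stable_generator ck_tensor_mem gauge_generator_mem[OF lev])
  qed
  show "\<O> A \<otimes>\<^sub>* compacts \<subseteq> mult_domain (gauge_map_stable f t)"
    "gauge_map_stable f t ` (\<O> A \<otimes>\<^sub>* compacts) \<subseteq> \<O> A \<otimes>\<^sub>* compacts"
    using star_map_generated_subset[OF star_map_reindex_stable 1 2 star_subalgebra_ck_stable(1,2)]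
    by (simp_all only: ck_stable_generators[symmetric])
qed

lemma gauge_map_stable_inverse:
  assumes "x \<in> \<O> A \<otimes>\<^sub>* compacts" shows "gauge_map_stable f (- t) (gauge_map_stable f t x) = x"
proof -
  let ?\<Theta> = "\<lambda>x. gauge_map_stable f (- t) (gauge_map_stable f t x)"
  let ?G = "{ck_gen A a \<otimes>\<^sub>o munit i j | a i j. a \<in> edges A}"
  have x: "x \<in> cstar_generated ?G" using assms by (simp add: ck_stable_generators)
  have "y \<in> mult_domain ?\<Theta>" if "y \<in> \<O> A \<otimes>\<^sub>* compacts" for y
    by (rule mult_domain_comp[OF subsetD[OF gauge_map_stable_subset(1) that]
          subsetD[OF gauge_map_stable_subset(1) subsetD[OF gauge_map_stable_subset(2) imageI[OF that]]]])
  hence m: "?G \<subseteq> mult_domain ?\<Theta>" using ck_tensor_mem[OF ck_algebra_generator] by blast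
  have e: "?\<Theta> y = y" if y: "y \<in> ?G" for y
  proof -
    obtain a i j where a: "y = ck_gen A a \<otimes>\<^sub>o munit i j" "a \<in> edges A" using y by blast
    show ?thesis
      by (simp add: a reindex_stable_tensor gauge_map_inverse ck_algebra_generator)
  qed
  have i: "star_map (\<lambda>x :: ('n ck_index \<times> nat) cop. x)" "y \<in> mult_domain (\<lambda>x :: ('n ck_index \<times> nat) cop. x)" for y
    by (simp_all add: star_map_def mult_domain_def)
  show ?thesis
    by (rule star_map_generated_eqI[OF star_map_comp[OF star_map_reindex_stable star_map_reindex_stable] i(1) m _ e x])
      (intro subsetI i(2))
qed

lemma stabilize_gauge_action:
  "stabilize (\<O> A) (\<rho> A f t) = restrict (gauge_map_stable f t) (\<O> A \<otimes>\<^sub>* compacts)"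
  unfolding stabilize_def
proof (rule the_equality)
  let ?E = "\<O> A \<otimes>\<^sub>* compacts"
  let ?G = "{ck_gen A a \<otimes>\<^sub>o munit i j | a i j. a \<in> edges A}"
  let ?\<beta> = "restrict (gauge_map_stable f t) ?E"
  have iso: "cstar_isomorphism ?E ?E ?\<beta>"
  proof (rule star_map_isomorphism[OF star_map_reindex_stable star_map_reindex_stable])
    show "gauge_map_stable f (- t) (gauge_map_stable f t x) = x" if "x \<in> ?E" for x
      using gauge_map_stable_inverse[OF that] .
    show "gauge_map_stable f t (gauge_map_stable f (- t) x) = x" if "x \<in> ?E" for x
      using gauge_map_stable_inverse[OF that, of "- t"] by simp
    show "?E \<subseteq> mult_domain (gauge_map_stable f t)" by (rule gauge_map_stable_subset)
    show "gauge_map_stable f t ` ?E \<subseteq> ?E" "gauge_map_stable f (- t) ` ?E \<subseteq> ?E" by (rule gauge_map_stable_subset)+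
  qed simp_all
  show "?\<beta> \<in> extensional ?E \<and> cstar_isomorphism ?E ?E ?\<beta> \<and>
    (\<forall>S\<in>\<O> A. \<forall>T\<in>compacts. ?\<beta> (S \<otimes>\<^sub>o T) = \<rho> A f t S \<otimes>\<^sub>o T)"
    using iso by (simp add: tensor_in_cstar_tensor reindex_stable_tensor gauge_action_eq)
  fix \<beta> assume \<beta>: "\<beta> \<in> extensional ?E \<and> cstar_isomorphism ?E ?E \<beta> \<and>
    (\<forall>S\<in>\<O> A. \<forall>T\<in>compacts. \<beta> (S \<otimes>\<^sub>o T) = \<rho> A f t S \<otimes>\<^sub>o T)"
  have eq: "\<beta> y = ?\<beta> y" if y: "y \<in> ?G" for y
  proof -
    obtain a i j where a: "y = ck_gen A a \<otimes>\<^sub>o munit i j" "a \<in> edges A" using y by blast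
    have "\<beta> y = \<rho> A f t (ck_gen A a) \<otimes>\<^sub>o munit i j"
      unfolding a(1) using \<beta> ck_algebra_generator[OF a(2)] munit_compact by blast
    also have "\<dots> = ?\<beta> y"
      using a by (simp add: ck_tensor_mem ck_algebra_generator reindex_stable_tensor gauge_action_eq)
    finally show ?thesis .
  qed
  have E: "?E = cstar_generated ?G" by (rule ck_stable_generators)
  have "\<beta> x = ?\<beta> x" if "x \<in> ?E" for x
    using cstar_isomorphism_eqI[of ?G ?E \<beta> ?E ?\<beta> x, OF _ _ eq] \<beta> iso that unfolding E[symmetric] by blast
  thus "\<beta> = ?\<beta>" using \<beta> by (intro extensionalityI[of _ ?E]) simp_all
qed

text \<open>As \<open>f\<close> is locally constant at some level, the unitaries are combinations of
  finitely many fixed projections, and the representation is even norm continuous.\<close>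

lemma circle_unitary_rep_U:
  "circle_unitary_rep (\<D> A \<otimes>\<^sub>* diagonal_compacts) (\<lambda>t. U_fun A f (- t) \<otimes>\<^sub>o 1)"
  unfolding circle_unitary_rep_def
proof (intro conjI allI ballI)
  fix s t
  show "U_fun A f (- t) \<otimes>\<^sub>o 1 \<in> multipliers (\<D> A \<otimes>\<^sub>* diagonal_compacts)"
    unfolding multipliers_def using multiplier_mult[OF star_subalgebra_ck_diagonal(1) U_fun_diagonal[OF lev]] by blast
  show "adj (U_fun A f (- t) \<otimes>\<^sub>o 1) * (U_fun A f (- t) \<otimes>\<^sub>o 1) = 1"
    "U_fun A f (- t) \<otimes>\<^sub>o 1 * adj (U_fun A f (- t) \<otimes>\<^sub>o 1) = 1"
    by (simp_all add: tensor_adj tensor_mult U_fun_adj[OF lev] U_fun_inverse[OF lev] tensor_one)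
  show "U_fun A f (- (s + t)) \<otimes>\<^sub>o 1 = (U_fun A f (- s) \<otimes>\<^sub>o 1) * (U_fun A f (- t) \<otimes>\<^sub>o 1)"
    using U_fun_add[OF lev, of "- s" "- t"] by (simp add: tensor_mult)
next
  have "U_fun A f (- 1) = U_fun A f (- 1) * U_fun A f 1" by (simp add: U_fun_1[OF lev])
  thus "U_fun A f (- 1) \<otimes>\<^sub>o 1 = 1" by (simp add: U_fun_inverse[OF lev] tensor_one)
next
  fix X :: "('n ck_index \<times> nat) cop"
  have "continuous_on UNIV (\<lambda>t. U_fun A f (- t) \<otimes>\<^sub>o (1 :: nat cop))"
    using bounded_linear.continuous_on[OF bounded_linear_tensor_left U_fun_continuous[OF lev]] .
  thus "continuous_on UNIV (\<lambda>t. (U_fun A f (- t) \<otimes>\<^sub>o 1) * X)"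
    by (intro continuous_on_mult continuous_on_const)
qed

end

lemma C_int_level: "f \<in> C_int A \<Longrightarrow> \<exists>N. level f N"
  using C_int_locally_constant unfolding level_def by blast

end

sublocale factorization \<subseteq> IA: irreducible_graph A by (rule irreducible_graph.intro[OF irrA])
sublocale factorization \<subseteq> IB: irreducible_graph B by (rule irreducible_graph.intro[OF irrB])

section \<open>Equivariance of the stable isomorphism\<close>

context factorization begin

lemma shift_path_Cons: "\<mu> \<noteq> [] \<Longrightarrow> shift_path (a # \<mu>) c = edgeB (dA a) (cA (hd \<mu>)) # shift_path \<mu> c"
  by (cases \<mu>) simp_all

lemma nth_shift_path: "k < length \<mu> \<Longrightarrow>
  shift_path \<mu> c ! k = edgeB (dA (\<mu> ! k)) (if Suc k < length \<mu> then cA (\<mu> ! Suc k) else c)"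
proof (induction \<mu> c arbitrary: k rule: shift_path.induct)
  case (3 a a' \<mu> c)
  thus ?case by (cases k) simp_all
qed simp_all

lemma kappa_nth_shift_path:
  assumes \<mu>: "\<mu> \<in> finite_paths A" and c: "c \<in> follow (tgt (last \<mu>))" and k: "k < length \<mu>"
  shows "\<kappa>\<^sub>B (shift_path \<mu> c ! k) = (dA (\<mu> ! k), if Suc k < length \<mu> then cA (\<mu> ! Suc k) else c)"
proof -
  have e: "\<mu> ! l \<in> edges A" if "l < length \<mu>" for l using finite_paths_edges[OF \<mu>] that by auto
  define c' where "c' = (if Suc k < length \<mu> then cA (\<mu> ! Suc k) else c)"
  have "c' \<in> edges C \<and> tgt (dA (\<mu> ! k)) = src c'"
  proof (cases "Suc k < length \<mu>")
    case True
    have "tgt (\<mu> ! k) = src (\<mu> ! Suc k)" using \<mu> True by (simp add: finite_paths_def)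
    thus ?thesis using True A_facts(5)[OF e[OF k]] A_facts(1,4)[OF e[OF True]] by (simp add: c'_def)
  next
    case False
    hence "last \<mu> = \<mu> ! k" using k by (metis Suc_lessI diff_Suc_1 last_conv_nth length_0_conv not_less_zero)
    thus ?thesis using False A_facts(5)[OF e[OF k]] c by (simp add: c'_def)
  qed
  thus ?thesis unfolding nth_shift_path[OF k] c'_def[symmetric]
    using edgeB_facts(2)[OF A_facts(2)[OF e[OF k]]] by blast
qed

definition shift_point :: "(nat \<Rightarrow> ('m, 'm) edge) \<Rightarrow> nat \<Rightarrow> ('n, 'n) edge" where
  "shift_point y n = edgeA (snd (\<kappa>\<^sub>B (y n))) (fst (\<kappa>\<^sub>B (y (Suc n))))"

lemma shift_map_eq: "shift_map A \<kappa>\<^sub>A \<kappa>\<^sub>B f y = f (shift_point y)"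
  by (simp add: shift_map_def shift_point_def[abs_def] edgeA_def)

lemma shift_point_path_space:
  assumes "y \<in> path_space B" shows "shift_point y \<in> path_space A"
proof -
  have y: "y n \<in> edges B" "tgt (y n) = src (y (Suc n))" for n using assms by (auto simp: path_space_def)
  have comp: "tgt (snd (\<kappa>\<^sub>B (y n))) = src (fst (\<kappa>\<^sub>B (y (Suc n))))" for n
    using B_facts(5)[OF y(1)[of n]] B_facts(4)[OF y(1)[of "Suc n"]] y(2)[of n] by (simp only:)
  note f = edgeA_facts[OF B_facts(2)[OF y(1)] B_facts(1)[OF y(1)] comp]
  show ?thesis
    unfolding path_space_def shift_point_def
    using f(1) f(3,4) B_facts(3)[OF y(1)] by simp
qed

lemma shift_point_prefix: "prefix u (Suc N) = prefix v (Suc N) \<Longrightarrow> prefix (shift_point u) N = prefix (shift_point v) N"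
  by (simp add: prefix_eq_iff shift_point_def)

text \<open>Every edge of \<open>shift_point y\<close> is composed of halves of two consecutive
  edges of \<open>y\<close>, so one more edge of \<open>y\<close> has to be known.\<close>

lemma level_shift_map:
  assumes "IA.level f N" shows "IB.level (shift_map A \<kappa>\<^sub>A \<kappa>\<^sub>B f) (Suc N)"
proof -
  have "f (shift_point u) = f (shift_point v)"
    if u: "u \<in> path_space B" and v: "v \<in> path_space B" and p: "prefix u (Suc N) = prefix v (Suc N)" for u v
    using assms shift_point_path_space[OF u] shift_point_path_space[OF v] shift_point_prefix[OF p]
    unfolding IA.level_def by blast
  thus ?thesis unfolding IB.level_def shift_map_eq by (intro conjI ballI impI) (simp, blast)
qed

text \<open>For a path \<open>\<mu> = c_1 d_1 ... c_N d_N\<close> the shifted path of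
  \<open>a # \<mu>\<close> reads \<open>d c_1, d_1 c_2, ..., d_N c\<close>, where \<open>d\<close>
  is the second half of \<open>a\<close>. Dropping \<open>d\<close> and regrouping gives back
  \<open>\<mu>\<close>.\<close>

lemma shift_point_sample:
  assumes "a # \<mu> \<in> finite_paths A" "\<mu> \<in> paths A N" "c \<in> follow (tgt (last \<mu>))" "N \<ge> 1"
  shows "prefix (shift_point (IB.pt (shift_path (a # \<mu>) c))) N = \<mu>"
proof -
  let ?r = "shift_path (a # \<mu>) c"
  have len: "length \<mu> = N" "\<mu> \<noteq> []" using assms(2,4) by (auto simp: paths_def)
  have c: "c \<in> follow (tgt (last (a # \<mu>)))" using assms(3) len(2) by simp
  have r: "?r \<in> finite_paths B" by (rule shift_path_facts(1)[OF assms(1) c])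
  have nth: "IB.pt ?r k = ?r ! k" if "k < Suc N" for k
    using IB.pt[OF r] that len(1) by (metis length_shift_path length_Cons nth_prefix)
  show ?thesis
  proof (rule nth_equalityI)
    fix n assume "n < length (prefix (shift_point (IB.pt ?r)) N)"
    hence n: "n < N" by simp
    have k: "\<kappa>\<^sub>B (?r ! n) = (dA ((a # \<mu>) ! n), cA (\<mu> ! n))"
      "fst (\<kappa>\<^sub>B (?r ! Suc n)) = dA (\<mu> ! n)"
      using kappa_nth_shift_path[OF assms(1) c, of n] kappa_nth_shift_path[OF assms(1) c, of "Suc n"] n len(1)
      by simp_all
    have "\<mu> ! n \<in> edges A" using n len(1) assms(2) by (auto simp: paths_def finite_paths_def)
    hence "shift_point (IB.pt ?r) n = \<mu> ! n"
      using n unfolding shift_point_def by (simp only: nth less_SucI Suc_less_eq k snd_conv edgeA_cd)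
    thus "prefix (shift_point (IB.pt ?r)) N ! n = \<mu> ! n" using n by simp
  qed (simp add: len)
qed

text \<open>With \<open>\<eta> = b # \<nu>\<close> the operator is the generator of \<open>b\<close>
  times the projection of \<open>\<nu>\<close>, which equals the projection of \<open>\<eta>\<close>
  times the generator of \<open>b\<close>. The gauge map fixes the projection of
  \<open>\<nu>\<close> and multiplies the generator by the unitary of the shifted function. As
  \<open>\<eta>\<close> has length \<open>N + 1\<close>, this unitary is a scalar on the projection
  of \<open>\<eta>\<close>, and \<open>shift_point_sample\<close> computes the scalar.\<close>

lemma gauge_word:
  assumes f: "IA.level f N" and a\<mu>: "a # \<mu> \<in> finite_paths A" and \<mu>: "\<mu> \<in> paths A N" and c: "c \<in> follow (tgt (last \<mu>))"
  shows "IB.gauge_map (shift_map A \<kappa>\<^sub>A \<kappa>\<^sub>B f) t (GB.word (shift_path (a # \<mu>) c) * adj (GB.word (shift_path \<mu> c))) =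
    IA.phase t (f (IA.pt \<mu>)) *\<^sub>C (GB.word (shift_path (a # \<mu>) c) * adj (GB.word (shift_path \<mu> c)))"
proof -
  let ?h = "shift_map A \<kappa>\<^sub>A \<kappa>\<^sub>B f"
  have N: "N \<ge> 1" using f by (simp add: IA.level_def)
  have ne: "\<mu> \<noteq> []" "\<mu> \<in> finite_paths A" using \<mu> N by (auto simp: paths_def)
  note lev = level_shift_map[OF f]
  define \<eta> where "\<eta> = shift_path (a # \<mu>) c"
  define \<nu> where "\<nu> = shift_path \<mu> c"
  define b where "b = edgeB (dA a) (cA (hd \<mu>))"
  have \<eta>: "\<eta> = b # \<nu>" by (simp add: \<eta>_def \<nu>_def b_def shift_path_Cons[OF ne(1)])
  have c': "c \<in> follow (tgt (last (a # \<mu>)))" using c ne by simp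
  have p: "\<eta> \<in> finite_paths B" "\<nu> \<in> finite_paths B"
    unfolding \<eta>_def \<nu>_def by (rule shift_path_facts(1)[OF a\<mu> c'], rule shift_path_facts(1)[OF ne(2) c])
  have b: "b \<in> edges B" "tgt b = src (hd \<nu>)" using p(1) finite_paths_nonempty[OF p(2)] unfolding \<eta> by (simp_all add: finite_paths_Cons)
  have w: "GB.word \<eta> * adj (GB.word \<nu>) = ck_gen B b * GB.wproj \<nu>" by (simp add: \<eta> GB.wproj_def mult.assoc)
  have "GB.wproj \<eta> * ck_gen B b = ck_gen B b * GB.wproj \<nu> * (adj (ck_gen B b) * ck_gen B b)"
    by (simp add: \<eta> GB.wproj_def adj_mult mult.assoc)
  also have "\<dots> = ck_gen B b * GB.word \<nu> * adj (GB.vproj (tgt b) * GB.word \<nu>)"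
    by (simp add: GB.source_proj[OF b(1)] GB.wproj_def adj_mult mult.assoc)
  also have "\<dots> = ck_gen B b * GB.wproj \<nu>" by (simp add: GB.hd_word[OF p(2)] b(2) GB.wproj_def mult.assoc)
  finally have comm: "GB.wproj \<eta> * ck_gen B b = ck_gen B b * GB.wproj \<nu>" .
  have len: "\<eta> \<in> paths B (Suc N)" using p(1) \<mu> by (simp add: paths_def \<eta>_def)
  have pre: "prefix (shift_point (IB.pt \<eta>)) N = prefix (IA.pt \<mu>) N"
    using shift_point_sample[OF a\<mu> \<mu> c N] IA.pt_paths(2)[OF \<mu>] by (simp add: \<eta>_def)
  have "IB.pt \<eta> \<in> path_space B" using IB.pt[OF p(1)] by simp
  hence fp: "f (shift_point (IB.pt \<eta>)) = f (IA.pt \<mu>)"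
    using f pre shift_point_path_space IA.pt_paths(1)[OF \<mu>] unfolding IA.level_def by blast
  have "IB.gauge_map ?h t (ck_gen B b * GB.wproj \<nu>) = U_fun B ?h t * (ck_gen B b * GB.wproj \<nu>)"
    by (simp add: mult_domainD(1)[OF IB.gauge_mult_domain[OF ck_algebra_generator[OF b(1)]]]
        IB.gauge_map_generator[OF lev b(1)] IB.gauge_map_wproj[OF lev p(2)] mult.assoc)
  also have "\<dots> = U_fun B ?h t * GB.wproj \<eta> * ck_gen B b" by (simp add: comm[symmetric] mult.assoc)
  also have "\<dots> = IB.phase t (?h (IB.pt \<eta>)) *\<^sub>C (GB.wproj \<eta> * ck_gen B b)"
    by (simp add: IB.U_fun_wproj[OF lev len] mult_scaleC_left)
  also have "\<dots> = IA.phase t (f (IA.pt \<mu>)) *\<^sub>C (ck_gen B b * GB.wproj \<nu>)"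
    by (simp add: comm shift_map_eq fp IA.phase_def IB.phase_def)
  finally show ?thesis unfolding \<eta>_def[symmetric] \<nu>_def[symmetric] w .
qed

text \<open>\<open>stable_iso_word_adj\<close> for the paths \<open>a # \<mu>\<close> and
  \<open>\<mu>\<close> writes the image as a sum of eigenvectors of the gauge map that all have the
  same eigenvalue.\<close>

lemma gauge_stable_iso_path:
  assumes f: "IA.level f N" and a: "a \<in> edges A" and \<mu>: "\<mu> \<in> paths A N"
  shows "IB.gauge_map_stable (shift_map A \<kappa>\<^sub>A \<kappa>\<^sub>B f) t (stable_iso ((ck_gen A a * GA.wproj \<mu>) \<otimes>\<^sub>o munit i j)) =
    IA.phase t (f (IA.pt \<mu>)) *\<^sub>C stable_iso ((ck_gen A a * GA.wproj \<mu>) \<otimes>\<^sub>o munit i j)"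
proof (cases "tgt a = src (hd \<mu>)")
  \<comment> \<open>If \<open>a # \<mu>\<close> is not a path, both sides vanish.\<close>
  case False
  have "ck_gen A a * GA.wproj \<mu> = ck_gen A a * GA.vproj (tgt a) * GA.word \<mu> * adj (GA.word \<mu>)"
    using a by (simp add: GA.gen_vproj GA.wproj_def mult.assoc)
  also have "\<dots> = ck_gen A a * (GA.vproj (tgt a) * GA.word \<mu>) * adj (GA.word \<mu>)" by (simp only: mult.assoc)
  also have "\<dots> = 0" using \<mu> False by (simp add: GA.hd_word paths_def)
  finally show ?thesis by (simp add: star_map_zero[OF star_map_stable_iso] star_map_zero[OF star_map_reindex_stable])
next
  case True
  have p: "\<mu> \<in> finite_paths A" "\<mu> \<noteq> []" using \<mu> finite_paths_nonempty by (auto simp: paths_def)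
  have a\<mu>: "a # \<mu> \<in> finite_paths A" using True a p by (simp add: finite_paths_Cons)
  have l: "last (a # \<mu>) = last \<mu>" using p by simp
  have "stable_iso ((ck_gen A a * GA.wproj \<mu>) \<otimes>\<^sub>o munit i j) = stable_iso ((GA.word (a # \<mu>) * adj (GA.word \<mu>)) \<otimes>\<^sub>o munit i j)"
    by (simp add: GA.wproj_def mult.assoc)
  also have "\<dots> = (\<Sum>c\<in>follow (tgt (last \<mu>)). (GB.word (shift_path (a # \<mu>) c) * adj (GB.word (shift_path \<mu> c))) \<otimes>\<^sub>o
      munit (leg_index C (cA a) i) (leg_index C (cA (hd \<mu>)) j))"
    using stable_iso_word_adj[OF a\<mu> p(1), of i j] l by (simp only: list.sel)
  finally have e: "stable_iso ((ck_gen A a * GA.wproj \<mu>) \<otimes>\<^sub>o munit i j) = \<dots>" .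
  show ?thesis
    unfolding e star_map_sum[OF star_map_reindex_stable] reindex_stable_tensor scaleC_sum_right tensor_scaleC_left[symmetric]
  proof (rule sum.cong[OF refl])
    fix c assume c: "c \<in> follow (tgt (last \<mu>))"
    show "IB.gauge_map (shift_map A \<kappa>\<^sub>A \<kappa>\<^sub>B f) t (GB.word (shift_path (a # \<mu>) c) * adj (GB.word (shift_path \<mu> c))) \<otimes>\<^sub>o
        munit (leg_index C (cA a) i) (leg_index C (cA (hd \<mu>)) j) =
      (IA.phase t (f (IA.pt \<mu>)) *\<^sub>C (GB.word (shift_path (a # \<mu>) c) * adj (GB.word (shift_path \<mu> c)))) \<otimes>\<^sub>o
        munit (leg_index C (cA a) i) (leg_index C (cA (hd \<mu>)) j)"
      by (simp only: gauge_word[OF f a\<mu> \<mu> c])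
  qed
qed

text \<open>Conjugation by \<open>U_fun A f (- t)\<close> moves the phase from the left of a
  generator to its right, so that \<open>f\<close> is read on the path that follows
  \<open>a\<close>. This is also where the shifted function reads \<open>f\<close> on the image
  side. Splitting by the projections of level \<open>N\<close> reduces the claim to
  \<open>gauge_stable_iso_path\<close>.\<close>

theorem stable_iso_gauge:
  assumes f: "IA.level f N" and x: "x \<in> \<O> A \<otimes>\<^sub>* compacts"
  shows "stable_iso (Ad (U_fun A f (- t) \<otimes>\<^sub>o 1) (stabilize (\<O> A) (\<rho> A f t) x)) =
    stabilize (\<O> B) (\<rho> B (shift_map A \<kappa>\<^sub>A \<kappa>\<^sub>B f) t) (stable_iso x)"
proof -
  let ?h = "shift_map A \<kappa>\<^sub>A \<kappa>\<^sub>B f"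
  let ?u = "U_fun A f (- t) \<otimes>\<^sub>o (1 :: nat cop)"
  let ?G = "{ck_gen A a \<otimes>\<^sub>o (munit i j :: nat cop) | a i j. a \<in> edges A}"
  note lev = level_shift_map[OF f]
  have u: "adj ?u * adj (adj ?u) = 1"
    by (simp add: tensor_adj tensor_mult adj_adj IA.U_fun_adj[OF f] IA.U_fun_inverse[OF f] tensor_one)
  note cu = conj_coisometry[OF u]
  let ?L = "\<lambda>x. stable_iso (adj (adj ?u) * IA.gauge_map_stable f t x * adj ?u)"
  let ?R = "\<lambda>x. IB.gauge_map_stable ?h t (stable_iso x)"
  have gen: "adj (adj ?u) * IA.gauge_map_stable f t (ck_gen A a \<otimes>\<^sub>o munit i j) * adj ?u = (ck_gen A a * U_fun A f t) \<otimes>\<^sub>o munit i j"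
    if a: "a \<in> edges A" for a i j
  proof -
    have "U_fun A f (- t) * (U_fun A f t * ck_gen A a) = ck_gen A a"
      by (simp add: IA.U_fun_inverse[OF f] mult.assoc[symmetric])
    thus ?thesis by (simp add: adj_adj IA.gauge_map_stable_generator[OF f a] tensor_mult tensor_adj IA.U_fun_adj[OF f])
  qed
  have smL: "star_map ?L"
    by (rule star_map_comp[OF star_map_comp[OF star_map_reindex_stable cu(1)] star_map_stable_iso])
  have smR: "star_map ?R" by (rule star_map_comp[OF star_map_stable_iso star_map_reindex_stable])
  have mL: "?G \<subseteq> mult_domain ?L"
  proof
    fix y assume "y \<in> ?G"
    then obtain a i j where y: "y = ck_gen A a \<otimes>\<^sub>o munit i j" and a: "a \<in> edges A" by blast
    have "ck_gen A a * U_fun A f t \<in> \<O> A"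
      by (rule sub_mult[OF star_subalgebra_ck_algebra(1) ck_algebra_generator[OF a]
          subsetD[OF IA.diagonal_subset_algebra IA.U_fun_diagonal[OF f]]])
    hence 1: "adj (adj ?u) * IA.gauge_map_stable f t y * adj ?u \<in> mult_domain stable_iso"
      unfolding y gen[OF a] using ck_tensor_mem stable_iso_subset(1) by blast
    have 2: "y \<in> mult_domain (IA.gauge_map_stable f t)"
      unfolding y by (rule IA.gauge_stable_mult_domain[OF f ck_algebra_generator[OF a]])
    show "y \<in> mult_domain ?L" by (rule mult_domain_comp[OF mult_domain_comp[OF 2 cu(2)] 1])
  qed
  have mR: "?G \<subseteq> mult_domain ?R"
  proof
    fix y assume "y \<in> ?G"
    then obtain a i j where y: "y = ck_gen A a \<otimes>\<^sub>o munit i j" and a: "a \<in> edges A" by blast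
    have 1: "y \<in> \<O> A \<otimes>\<^sub>* compacts" unfolding y by (rule ck_tensor_mem[OF ck_algebra_generator[OF a]])
    show "y \<in> mult_domain ?R"
      by (rule mult_domain_comp[OF subsetD[OF stable_iso_subset(1) 1]
          subsetD[OF IB.gauge_map_stable_subset(1)[OF lev] subsetD[OF stable_iso_subset(2) imageI[OF 1]]]])
  qed
  have eq: "?L y = ?R y" if y: "y \<in> ?G" for y
  proof -
    obtain a i j where y: "y = ck_gen A a \<otimes>\<^sub>o munit i j" and a: "a \<in> edges A" using y by blast
    let ?X = "\<lambda>\<mu>. stable_iso ((ck_gen A a * GA.wproj \<mu>) \<otimes>\<^sub>o munit i j)"
    have "?L y = stable_iso ((ck_gen A a * U_fun A f t) \<otimes>\<^sub>o munit i j)" unfolding y gen[OF a] ..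
    also have "\<dots> = (\<Sum>\<mu>\<in>paths A N. IA.phase t (f (IA.pt \<mu>)) *\<^sub>C ?X \<mu>)"
      by (simp add: IA.U_fun_eq[OF f] GA.simple_def sum_distrib_left tensor_sum_left star_map_sum[OF star_map_stable_iso]
          mult_scaleC_right tensor_scaleC_left star_map_scaleC[OF star_map_stable_iso])
    also have "\<dots> = (\<Sum>\<mu>\<in>paths A N. IB.gauge_map_stable ?h t (?X \<mu>))"
      by (intro sum.cong refl gauge_stable_iso_path[OF f a, symmetric])
    also have "\<dots> = IB.gauge_map_stable ?h t (stable_iso ((ck_gen A a * (\<Sum>\<mu>\<in>paths A N. GA.wproj \<mu>)) \<otimes>\<^sub>o munit i j))"
      by (simp add: star_map_sum[OF star_map_reindex_stable] star_map_sum[OF star_map_stable_iso] sum_distrib_left tensor_sum_left)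
    also have "\<dots> = ?R y" using GA.sum_wproj[OF IA.N_pos[OF f]] by (simp add: y)
    finally show ?thesis .
  qed
  have xG: "x \<in> cstar_generated ?G" using x by (simp only: ck_stable_generators)
  have "?L x = ?R x" by (rule star_map_generated_eqI[OF smL smR mL mR eq xG])
  moreover have "stable_iso x \<in> \<O> B \<otimes>\<^sub>* compacts" using stable_iso_subset(2) x by blast
  ultimately show ?thesis
    using x by (simp add: Ad_def adj_adj IA.stabilize_gauge_action[OF f] IB.stabilize_gauge_action[OF lev])
qed

end

subsection \<open>Finitely supported matrices\<close>

text \<open>As a type of their own, finitely supported matrices become an instance of
  \<open>star_algebra\<close>, and calculations with products and adjoints are plain algebra.
  \<open>Minf_eq\<close>, \<open>minf_projs_eq\<close> and \<open>murray_von_neumann_ent\<close>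
  translate back.\<close>

typedef (overloaded) 'a fmat = "{P :: nat \<Rightarrow> nat \<Rightarrow> 'a :: zero. finite {(i, j). P i j \<noteq> 0}}"
  morphisms ent Abs_fmat
  by (rule exI[of _ "\<lambda>_ _. 0"]) simp

lemma fmat_eqI: "(\<And>i j. ent P i j = ent Q i j) \<Longrightarrow> P = Q"
  by (simp add: ent_inject[symmetric] fun_eq_iff)

definition fbound :: "'a :: zero fmat \<Rightarrow> nat \<Rightarrow> bool" where
  "fbound P N \<longleftrightarrow> (\<forall>i j. ent P i j \<noteq> 0 \<longrightarrow> i < N \<and> j < N)"

lemma fbound_exists: "\<exists>N. fbound P N"
proof -
  have f: "finite {(i, j). ent P i j \<noteq> 0}" using ent[of P] by simp
  obtain M N where "\<forall>i \<in> fst ` {(i, j). ent P i j \<noteq> 0}. i < M" "\<forall>i \<in> snd ` {(i, j). ent P i j \<noteq> 0}. i < N"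
    using f finite_nat_set_iff_bounded by (metis finite_imageI)
  hence "fbound P (max M N)" unfolding fbound_def by force
  thus ?thesis ..
qed

lemma fbound_mono: "fbound P M \<Longrightarrow> M \<le> N \<Longrightarrow> fbound P N"
  unfolding fbound_def by (meson order_less_le_trans)

lemma fbound_common:
  obtains N where "fbound P N" "fbound Q N" "fbound R N"
proof -
  obtain a b c where "fbound P a" "fbound Q b" "fbound R c" using fbound_exists by metis
  hence "fbound P (a + b + c)" "fbound Q (a + b + c)" "fbound R (a + b + c)"
    by (auto intro: fbound_mono)
  thus thesis by (rule that)
qed

lemma ent_Abs_fmat:
  assumes "\<And>i j. P i j \<noteq> 0 \<Longrightarrow> i < (N :: nat) \<and> j < N" shows "ent (Abs_fmat P) = P"
proof -
  have "{(i, j). P i j \<noteq> 0} \<subseteq> {..<N} \<times> {..<N}" using assms by auto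
  hence "finite {(i, j). P i j \<noteq> 0}" by (rule finite_subset) simp
  thus ?thesis by (simp add: Abs_fmat_inverse)
qed

text \<open>\<open>minf_mult\<close> sums over a set that depends on the matrix and the row. A bound
  on the support replaces it by a fixed interval, over which sums can be exchanged.\<close>

lemma minf_mult_eq:
  assumes "fbound P N" shows "minf_mult (ent P) Q i j = (\<Sum>k<N. ent P i k * Q k j)"
  unfolding minf_mult_def
  by (rule sum.mono_neutral_left) (use assms in \<open>auto simp: fbound_def\<close>)

instantiation fmat :: (star_algebra) star_algebra
begin
definition "0 = Abs_fmat (\<lambda>_ _. 0 :: 'a)"
definition "P + Q = Abs_fmat (\<lambda>i j. ent P i j + ent Q i j :: 'a)"
definition "- P = Abs_fmat (\<lambda>i j. - ent P i j :: 'a)"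
definition "P - Q = Abs_fmat (\<lambda>i j. ent P i j - ent Q i j :: 'a)"
definition "P * Q = (Abs_fmat (minf_mult (ent P) (ent Q)) :: 'a fmat)"
definition "c *\<^sub>C P = Abs_fmat (\<lambda>i j. c *\<^sub>C ent P i j :: 'a)"
definition "adj P = (Abs_fmat (minf_adj (ent P)) :: 'a fmat)"

lemma ent_simps:
  fixes P Q :: "'a fmat"
  shows "ent 0 i j = (0 :: 'a)" "ent (P + Q) i j = ent P i j + ent Q i j" "ent (- P) i j = - ent P i j"
    "ent (P - Q) i j = ent P i j - ent Q i j" "ent (c *\<^sub>C P) i j = c *\<^sub>C ent P i j"
    "ent (adj P) i j = adj (ent P j i)"
proof -
  obtain N where N: "fbound P N" "fbound Q N" using fbound_common[of P Q] by metis
  hence z: "ent P i j \<noteq> 0 \<Longrightarrow> i < N \<and> j < N" "ent Q i j \<noteq> 0 \<Longrightarrow> i < N \<and> j < N" for i j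
    by (auto simp: fbound_def)
  note A = ent_Abs_fmat[of _ N, THEN fun_cong, THEN fun_cong]
  show "ent 0 i j = (0 :: 'a)" by (simp add: zero_fmat_def Abs_fmat_inverse)
  show "ent (P + Q) i j = ent P i j + ent Q i j" unfolding plus_fmat_def
    by (rule A) (metis z add_0)
  show "ent (P - Q) i j = ent P i j - ent Q i j" unfolding minus_fmat_def
    by (rule A) (metis z right_minus_eq)
  show "ent (- P) i j = - ent P i j" unfolding uminus_fmat_def
    by (rule A) (metis z(1) neg_0_equal_iff_equal)
  show "ent (c *\<^sub>C P) i j = c *\<^sub>C ent P i j" unfolding scaleC_fmat_def
    by (rule A) (metis z(1) scaleC_zero_right)
  show "ent (adj P) i j = adj (ent P j i)" unfolding adj_fmat_def minf_adj_def
    by (rule A) (metis z(1) adj_zero)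
qed

lemma ent_mult: "ent (P * Q) = minf_mult (ent P) (ent Q)" for P Q :: "'a fmat"
proof -
  obtain N where N: "fbound P N" "fbound Q N" using fbound_common[of P Q] by metis
  show ?thesis unfolding times_fmat_def
  proof (rule ent_Abs_fmat)
    fix i j assume "minf_mult (ent P) (ent Q) i j \<noteq> 0"
    hence "(\<Sum>k<N. ent P i k * ent Q k j) \<noteq> 0" by (simp add: minf_mult_eq[OF N(1)])
    then obtain k where "ent P i k * ent Q k j \<noteq> 0" by (meson sum.not_neutral_contains_not_neutral)
    hence "ent P i k \<noteq> 0" "ent Q k j \<noteq> 0" by auto
    thus "i < N \<and> j < N" using N by (auto simp: fbound_def)
  qed
qed

lemma ent_mult_sum: "fbound P N \<Longrightarrow> ent (P * Q) i j = (\<Sum>k<N. ent P i k * ent Q k j)" for P Q :: "'a fmat"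
  by (simp add: ent_mult minf_mult_eq)

instance
proof
  fix P Q R :: "'a fmat" and c d
  obtain N where N: "fbound P N" "fbound Q N" "fbound R N" by (rule fbound_common)
  have N': "fbound (P + Q) N" using N unfolding fbound_def ent_simps by (metis add_0)
  have N'': "fbound (adj Q) N" using N unfolding fbound_def ent_simps by (metis adj_zero)
  have N3: "fbound (P * Q) N" unfolding fbound_def
  proof (intro allI impI)
    fix i j assume "ent (P * Q) i j \<noteq> 0"
    hence "(\<Sum>k<N. ent P i k * ent Q k j) \<noteq> 0" by (simp add: ent_mult_sum[OF N(1)])
    then obtain k where "ent P i k * ent Q k j \<noteq> 0" by (meson sum.not_neutral_contains_not_neutral)
    hence "ent P i k \<noteq> 0" "ent Q k j \<noteq> 0" by auto
    thus "i < N \<and> j < N" using N by (auto simp: fbound_def)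
  qed
  have N4: "fbound (c *\<^sub>C P) N" using N unfolding fbound_def ent_simps by (metis scaleC_zero_right)
  show "P * Q * R = P * (Q * R)"
  proof (rule fmat_eqI)
    fix i j
    have "ent (P * Q * R) i j = (\<Sum>k<N. \<Sum>l<N. ent P i l * ent Q l k * ent R k j)"
      by (simp add: ent_mult_sum[OF N3] ent_mult_sum[OF N(1)] sum_distrib_right)
    also have "\<dots> = (\<Sum>l<N. \<Sum>k<N. ent P i l * ent Q l k * ent R k j)" by (rule sum.swap)
    also have "\<dots> = ent (P * (Q * R)) i j"
      by (simp add: ent_mult_sum[OF N(1)] ent_mult_sum[OF N(2)] sum_distrib_left mult.assoc)
    finally show "ent (P * Q * R) i j = ent (P * (Q * R)) i j" .
  qed
  show "(P + Q) * R = P * R + Q * R"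
    by (rule fmat_eqI)
      (simp add: ent_mult_sum[OF N'] ent_mult_sum[OF N(1)] ent_mult_sum[OF N(2)] ent_simps distrib_right sum.distrib)
  show "P * (Q + R) = P * Q + P * R"
    by (rule fmat_eqI) (simp add: ent_mult_sum[OF N(1)] ent_simps distrib_left sum.distrib)
  show "adj (P * Q) = adj Q * adj P"
    by (rule fmat_eqI) (simp add: ent_mult_sum[OF N(1)] ent_mult_sum[OF N''] ent_simps adj_sum adj_mult)
  show "c *\<^sub>C P * Q = c *\<^sub>C (P * Q)" "P * c *\<^sub>C Q = c *\<^sub>C (P * Q)"
    by (rule fmat_eqI, simp add: ent_mult_sum[OF N4] ent_mult_sum[OF N(1)] ent_simps scaleC_sum_right
        mult_scaleC_left mult_scaleC_right)+
qed (rule fmat_eqI, simp add: ent_simps algebra_simps scaleC_add_right scaleC_add_left scaleC_scaleC scaleC_one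
    adj_adj adj_add adj_scaleC)+
end

lemma ent_adj: "ent (adj P) = minf_adj (ent P)"
  by (simp add: fun_eq_iff minf_adj_def ent_simps)

lemma ent_sum: "ent (\<Sum>k\<in>K. P k) i j = (\<Sum>k\<in>K. ent (P k :: 'a :: star_algebra fmat) i j)"
  by (induction K rule: infinite_finite_induct) (simp_all add: ent_simps)

definition fsingle :: "nat \<Rightarrow> nat \<Rightarrow> 'a :: star_algebra \<Rightarrow> 'a fmat" where
  "fsingle i j x = Abs_fmat (\<lambda>k l. if k = i \<and> l = j then x else 0)"

lemma ent_fsingle: "ent (fsingle i j x) k l = (if k = i \<and> l = j then x else 0)"
  unfolding fsingle_def by (subst ent_Abs_fmat[of _ "Suc (i + j)"]) (auto split: if_splits)

lemma fsingle_zero [simp]: "fsingle i j 0 = 0" by (rule fmat_eqI) (simp add: ent_fsingle ent_simps)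

lemma fsingle_add: "fsingle i j (x + y) = fsingle i j x + fsingle i j y" by (rule fmat_eqI) (simp add: ent_fsingle ent_simps)

lemma adj_fsingle: "adj (fsingle i j x) = fsingle j i (adj x)" by (rule fmat_eqI) (simp add: ent_fsingle ent_simps)

lemma fsingle_mult: "fsingle i j x * fsingle k l y = (if j = k then fsingle i l (x * y) else 0)"
proof (rule fmat_eqI)
  fix a b
  have f: "fbound (fsingle i j x) (Suc (i + j))" by (simp add: fbound_def ent_fsingle)
  have "ent (fsingle i j x * fsingle k l y) a b = (\<Sum>m\<in>{j}. ent (fsingle i j x) a m * ent (fsingle k l y) m b)"
    unfolding ent_mult_sum[OF f] by (rule sum.mono_neutral_right) (auto simp: ent_fsingle)
  thus "ent (fsingle i j x * fsingle k l y) a b = ent (if j = k then fsingle i l (x * y) else 0) a b"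
    by (simp add: ent_fsingle ent_simps)
qed

text \<open>Reduces identities that are additive in a matrix to matrices with a single
  entry.\<close>

lemma fmat_induct:
  assumes "p 0" "\<And>P Q. p P \<Longrightarrow> p Q \<Longrightarrow> p (P + Q)" "\<And>i j x. p (fsingle i j x)"
  shows "p P"
proof -
  obtain N where N: "fbound P N" using fbound_exists by blast
  have s: "p (\<Sum>k<n. F k)" if "\<And>k. p (F k)" for F :: "nat \<Rightarrow> 'a fmat" and n
    by (induction n) (simp_all add: assms that)
  have e: "ent P k l = (\<Sum>i<N. \<Sum>j<N. if k = i \<and> l = j then ent P i j else 0)" for k l
  proof -
    have "(\<Sum>i<N. \<Sum>j<N. if k = i \<and> l = j then ent P i j else 0) =
        (\<Sum>i<N. if k = i then (\<Sum>j<N. if l = j then ent P i j else 0) else 0)"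
      by (rule sum.cong) simp_all
    also have "\<dots> = (if k < N \<and> l < N then ent P k l else 0)" by simp
    finally show ?thesis using N by (auto simp: fbound_def)
  qed
  have P: "P = (\<Sum>i<N. \<Sum>j<N. fsingle i j (ent P i j))"
    by (rule fmat_eqI) (unfold ent_sum ent_fsingle, rule e)
  show ?thesis by (subst P, intro s assms(3))
qed

text \<open>The matrix with entry \<open>ent P i j\<close> at \<open>(h i, g j)\<close>; the orthogonal sum \<open>\<oplus>\<^sub>m\<close> and its
  rearrangements are sums of such matrices.\<close>

definition relab :: "(nat \<Rightarrow> nat) \<Rightarrow> (nat \<Rightarrow> nat) \<Rightarrow> 'a :: star_algebra fmat \<Rightarrow> 'a fmat" where
  "relab h g P = Abs_fmat (\<lambda>i j. if i \<in> range h \<and> j \<in> range g then ent P (inv_into UNIV h i) (inv_into UNIV g j) else 0)"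

lemma ent_relab:
  assumes "inj h" "inj g"
  shows "ent (relab h g P) i j = (if i \<in> range h \<and> j \<in> range g then ent P (inv_into UNIV h i) (inv_into UNIV g j) else 0)"
proof -
  obtain N where N: "fbound P N" using fbound_exists by blast
  have b: "h n < Suc (\<Sum>k<N. h k + g k) \<and> g m < Suc (\<Sum>k<N. h k + g k)" if "n < N" "m < N" for n m
    using member_le_sum[of n "{..<N}" "\<lambda>k. h k + g k"] member_le_sum[of m "{..<N}" "\<lambda>k. h k + g k"] that by simp
  have b': "h n < Suc (\<Sum>k<N. h k + g k) \<and> g m < Suc (\<Sum>k<N. h k + g k)" if "ent P n m \<noteq> 0" for n m
    using N b that unfolding fbound_def by blast
  let ?R = "\<lambda>i j. if i \<in> range h \<and> j \<in> range g then ent P (inv_into UNIV h i) (inv_into UNIV g j) else 0"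
  have "i < Suc (\<Sum>k<N. h k + g k) \<and> j < Suc (\<Sum>k<N. h k + g k)" if "?R i j \<noteq> 0" for i j
    using that b'[of "inv_into UNIV h i" "inv_into UNIV g j"] by (simp add: f_inv_into_f split: if_splits)
  from ent_Abs_fmat[of ?R, OF this] show ?thesis unfolding relab_def by simp
qed

lemma relab_zero [simp]: "inj h \<Longrightarrow> inj g \<Longrightarrow> relab h g 0 = 0"
  by (rule fmat_eqI) (simp add: ent_relab ent_simps)

lemma relab_add: "inj h \<Longrightarrow> inj g \<Longrightarrow> relab h g (P + Q) = relab h g P + relab h g Q"
  by (rule fmat_eqI) (simp add: ent_relab ent_simps)

lemma relab_fsingle:
  assumes "inj h" "inj g" shows "relab h g (fsingle i j x) = fsingle (h i) (g j) x"
proof (rule fmat_eqI)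
  fix k l
  have 1: "k \<in> range h \<and> inv_into UNIV h k = i \<longleftrightarrow> k = h i" using assms(1) by (auto simp: inv_into_f_f f_inv_into_f)
  have 2: "l \<in> range g \<and> inv_into UNIV g l = j \<longleftrightarrow> l = g j" using assms(2) by (auto simp: inv_into_f_f f_inv_into_f)
  show "ent (relab h g (fsingle i j x)) k l = ent (fsingle (h i) (g j) x) k l"
    unfolding ent_relab[OF assms] ent_fsingle using 1 2 by metis
qed

lemma relab_id: "relab (\<lambda>n. n) (\<lambda>n. n) P = P"
  by (rule fmat_eqI) (simp add: ent_relab inv_into_f_f[of "\<lambda>n. n", simplified])

lemma relab_adj: "inj h \<Longrightarrow> inj g \<Longrightarrow> adj (relab h g P) = relab g h (adj P)"
  by (induction P rule: fmat_induct) (simp_all add: relab_add adj_add relab_fsingle adj_fsingle)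

lemma relab_mult:
  assumes "inj h" "inj g" "inj k" shows "relab h g P * relab g k Q = relab h k (P * Q)"
proof (induction P rule: fmat_induct)
  case (3 i j x)
  show ?case
    by (induction Q rule: fmat_induct)
      (use assms in \<open>simp_all add: relab_add relab_fsingle distrib_left fsingle_mult inj_eq\<close>)
qed (use assms in \<open>simp_all add: relab_add distrib_right\<close>)

lemma relab_mult_disjoint:
  assumes "inj h" "inj g" "inj g'" "inj k" "\<And>n m. g n \<noteq> g' m" shows "relab h g P * relab g' k Q = 0"
proof (induction P rule: fmat_induct)
  case (3 i j x)
  show ?case
    by (induction Q rule: fmat_induct)
      (use assms in \<open>simp_all add: relab_add relab_fsingle distrib_left fsingle_mult\<close>)
qed (use assms in \<open>simp_all add: relab_add distrib_right\<close>)

lemma relab_relab: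
  assumes "inj h" "inj g" "inj h'" "inj g'"
  shows "relab h g (relab h' g' P) = relab (\<lambda>n. h (h' n)) (\<lambda>n. g (g' n)) P"
proof -
  have "inj (\<lambda>n. h (h' n))" "inj (\<lambda>n. g (g' n))"
    using inj_compose[OF assms(1,3)] inj_compose[OF assms(2,4)] by (simp_all add: comp_def)
  thus ?thesis by (induction P rule: fmat_induct) (use assms in \<open>simp_all add: relab_add relab_fsingle\<close>)
qed

definition oplus :: "'a :: star_algebra fmat \<Rightarrow> 'a fmat \<Rightarrow> 'a fmat" (infixr "\<oplus>\<^sub>f" 65) where
  "P \<oplus>\<^sub>f Q = relab (\<lambda>n. 2 * n) (\<lambda>n. 2 * n) P + relab (\<lambda>n. 2 * n + 1) (\<lambda>n. 2 * n + 1) Q"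

lemma inj_double: "inj (\<lambda>n :: nat. 2 * n)" "inj (\<lambda>n :: nat. 2 * n + 1)" by (simp_all add: inj_on_def)

lemma ent_oplus: "ent (P \<oplus>\<^sub>f Q) = ent P \<oplus>\<^sub>m ent Q"
proof -
  have e: "i \<in> range (\<lambda>n :: nat. 2 * n) \<longleftrightarrow> even i" for i :: nat by (auto elim: evenE)
  have o: "i \<in> range (\<lambda>n :: nat. 2 * n + 1) \<longleftrightarrow> odd i" for i :: nat by (auto elim: oddE)
  have ie: "inv_into UNIV (\<lambda>n. 2 * n) i = i div 2" if "even i" for i :: nat
    using that by (metis evenE inv_into_f_f[OF inj_double(1)] UNIV_I nonzero_mult_div_cancel_left zero_neq_numeral)
  have io: "inv_into UNIV (\<lambda>n. 2 * n + 1) i = i div 2" if "odd i" for i :: nat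
    using inv_into_f_f[OF inj_double(2), of "i div 2"] that by simp
  show ?thesis
    unfolding fun_eq_iff minf_oplus_def oplus_def ent_simps ent_relab[OF inj_double(1) inj_double(1)]
      ent_relab[OF inj_double(2) inj_double(2)] e o
    by (auto simp: ie io[simplified])
qed

definition fmap :: "('a \<Rightarrow> 'b) \<Rightarrow> 'a :: star_algebra fmat \<Rightarrow> 'b :: star_algebra fmat" where
  "fmap \<phi> P = Abs_fmat (\<lambda>i j. \<phi> (ent P i j))"

lemma ent_fmap:
  assumes "\<phi> 0 = 0" shows "ent (fmap \<phi> P) i j = \<phi> (ent P i j)"
proof -
  obtain N where N: "fbound P N" using fbound_exists by blast
  have "i < N \<and> j < N" if "\<phi> (ent P i j) \<noteq> 0" for i j
    using N that assms unfolding fbound_def by metis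
  from ent_Abs_fmat[of "\<lambda>i j. \<phi> (ent P i j)", OF this] show ?thesis unfolding fmap_def by simp
qed

lemma fmap_fsingle: "\<phi> 0 = 0 \<Longrightarrow> fmap \<phi> (fsingle i j x) = fsingle i j (\<phi> x)"
  by (rule fmat_eqI) (simp add: ent_fmap ent_fsingle)

lemma fmap_oplus: "\<phi> 0 = 0 \<Longrightarrow> fmap \<phi> (P \<oplus>\<^sub>f Q) = fmap \<phi> P \<oplus>\<^sub>f fmap \<phi> Q"
  by (rule fmat_eqI) (simp add: ent_fmap ent_oplus minf_oplus_def)

subsection \<open>Murray-von Neumann equivalence\<close>

lemma even_neq_odd: "2 * n \<noteq> 2 * m + 1" "2 * n + 1 \<noteq> 2 * m" for n m :: nat
  by presburger+

definition FM :: "'a :: zero set \<Rightarrow> 'a fmat set" where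
  "FM R = {P. \<forall>i j. ent P i j \<in> R}"

definition projs :: "'a :: star_algebra set \<Rightarrow> 'a fmat set" where
  "projs R = {P \<in> FM R. P * P = P \<and> adj P = P}"

definition mvn :: "'a :: star_algebra set \<Rightarrow> 'a fmat \<Rightarrow> 'a fmat \<Rightarrow> bool" where
  "mvn R P Q \<longleftrightarrow> (\<exists>V\<in>FM R. adj V * V = P \<and> V * adj V = Q)"

lemma ent_eq_iff: "ent P = ent Q \<longleftrightarrow> P = Q" by (rule ent_inject)

lemma Minf_eq: "Minf R = ent ` FM R" for R :: "'a :: star_algebra set"
proof (intro equalityI subsetI)
  fix P assume "P \<in> Minf R"
  hence "ent (Abs_fmat P) = P" "\<forall>i j. P i j \<in> R" by (simp_all add: Minf_def Abs_fmat_inverse)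
  thus "P \<in> ent ` FM R" unfolding FM_def by (intro image_eqI[of _ _ "Abs_fmat P"]) simp_all
next
  fix P assume "P \<in> ent ` FM R"
  thus "P \<in> Minf R" using ent by (auto simp: Minf_def FM_def)
qed

lemma minf_projs_eq: "minf_projs R = ent ` projs R"
  unfolding minf_projs_def projs_def Minf_eq by (auto simp: ent_mult[symmetric] ent_adj[symmetric] ent_eq_iff)

lemma murray_von_neumann_ent: "murray_von_neumann R (ent P) (ent Q) \<longleftrightarrow> mvn R P Q"
  unfolding murray_von_neumann_def mvn_def Minf_eq by (auto simp: ent_mult[symmetric] ent_adj[symmetric] ent_eq_iff)

locale matrix_star_algebra =
  fixes R :: "'a :: star_algebra set"
  assumes star_subalgebra: "star_subalgebra R"
begin

lemma zero_mem: "0 \<in> R" using star_subalgebra by (rule sub_zero)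

lemma FM_zero: "0 \<in> FM R" by (simp add: FM_def ent_simps zero_mem)

lemma FM_add: "P \<in> FM R \<Longrightarrow> Q \<in> FM R \<Longrightarrow> P + Q \<in> FM R"
  using star_subalgebra by (simp add: FM_def ent_simps sub_add)

lemma FM_adj: "P \<in> FM R \<Longrightarrow> adj P \<in> FM R"
  using star_subalgebra by (simp add: FM_def ent_simps sub_adj)

lemma FM_mult: "P \<in> FM R \<Longrightarrow> Q \<in> FM R \<Longrightarrow> P * Q \<in> FM R"
  unfolding FM_def
proof safe
  fix i j assume "\<forall>i j. ent P i j \<in> R" "\<forall>i j. ent Q i j \<in> R"
  thus "ent (P * Q) i j \<in> R"
    unfolding ent_mult minf_mult_def using star_subalgebra by (simp add: star_subalgebra_sum sub_mult)
qed

lemma FM_fsingle: "x \<in> R \<Longrightarrow> fsingle i j x \<in> FM R" by (simp add: FM_def ent_fsingle zero_mem)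

lemma FM_relab: "inj h \<Longrightarrow> inj g \<Longrightarrow> P \<in> FM R \<Longrightarrow> relab h g P \<in> FM R"
  by (simp add: FM_def ent_relab zero_mem)

lemma FM_sum: "(\<And>k. k \<in> K \<Longrightarrow> P k \<in> FM R) \<Longrightarrow> sum P K \<in> FM R"
  by (induction K rule: infinite_finite_induct) (simp_all add: FM_zero FM_add)

lemma projs_zero: "0 \<in> projs R" by (simp add: projs_def FM_zero)

lemma projs_oplus:
  assumes "P \<in> projs R" "Q \<in> projs R" shows "P \<oplus>\<^sub>f Q \<in> projs R"
proof -
  note d = relab_mult_disjoint[OF inj_double(1,1,2,2) even_neq_odd(1)] relab_mult_disjoint[OF inj_double(2,2,1,1) even_neq_odd(2)]
  show ?thesis using assms
    unfolding projs_def oplus_def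
    by (simp only: mem_Collect_eq FM_add FM_relab inj_double distrib_left distrib_right relab_mult d relab_adj adj_add
        add_0_left add_0_right)
qed

lemma mvn_sym: "mvn R P Q \<Longrightarrow> mvn R Q P"
  unfolding mvn_def
proof (elim bexE conjE)
  fix V assume "V \<in> FM R" "adj V * V = P" "V * adj V = Q"
  thus "\<exists>V\<in>FM R. adj V * V = Q \<and> V * adj V = P" by (intro bexI[of _ "adj V"]) (simp_all add: adj_adj FM_adj)
qed

text \<open>In a general star algebra \<open>adj V * V = P\<close> does not imply
  \<open>V * P = V\<close>. Replacing \<open>V\<close> by \<open>V * P\<close> achieves it without
  changing the two projections.\<close>

lemma mvnE:
  assumes "mvn R P Q" "P \<in> projs R" "Q \<in> projs R"
  obtains V where "V \<in> FM R" "adj V * V = P" "V * adj V = Q" "V * P = V" "Q * V = V"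
proof -
  obtain V where V: "V \<in> FM R" "adj V * V = P" "V * adj V = Q" using assms(1) unfolding mvn_def by blast
  have P: "P * P = P" "adj P = P" "P \<in> FM R" and Q: "Q * Q = Q" using assms by (simp_all add: projs_def)
  show thesis
  proof (rule that[of "V * P"])
    show "V * P \<in> FM R" by (rule FM_mult[OF V(1) P(3)])
    have "adj (V * P) * (V * P) = P * (adj V * V) * P" by (simp only: adj_mult P mult.assoc)
    thus "adj (V * P) * (V * P) = P" by (simp only: V(2) P)
    have "V * P * adj (V * P) = V * (P * P) * adj V" by (simp only: adj_mult P(2) mult.assoc)
    also have "\<dots> = V * adj V * (V * adj V)" unfolding P(1) by (simp only: V(2)[symmetric] mult.assoc)
    finally show "V * P * adj (V * P) = Q" by (simp only: V(3) Q)
    show "V * P * P = V * P" by (simp only: mult.assoc P)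
    have "Q * (V * P) = V * (adj V * V) * P" by (simp only: V(3)[symmetric] mult.assoc)
    thus "Q * (V * P) = V * P" by (simp only: V(2) mult.assoc P)
  qed
qed

lemma mvn_refl: "P \<in> projs R \<Longrightarrow> mvn R P P"
  unfolding mvn_def projs_def by (intro bexI[of _ P]) simp_all

lemma mvn_trans:
  assumes "mvn R P Q" "mvn R Q T" "P \<in> projs R" "Q \<in> projs R" "T \<in> projs R"
  shows "mvn R P T"
proof -
  obtain V where V: "V \<in> FM R" "adj V * V = P" "V * adj V = Q" "V * P = V" "Q * V = V"
    using mvnE[OF assms(1,3,4)] by metis
  obtain W where W: "W \<in> FM R" "adj W * W = Q" "W * adj W = T" "W * Q = W" "T * W = W"
    using mvnE[OF assms(2,4,5)] by metis
  have "adj (W * V) * (W * V) = adj V * ((adj W * W) * V)" by (simp only: adj_mult mult.assoc)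
  hence 1: "adj (W * V) * (W * V) = P" by (simp only: W(2) V(5) V(2))
  have "W * V * adj (W * V) = W * (V * adj V) * adj W" by (simp only: adj_mult mult.assoc)
  hence 2: "W * V * adj (W * V) = T" by (simp only: V(3) W(4) W(3))
  show ?thesis unfolding mvn_def using 1 2 FM_mult[OF W(1) V(1)] by blast
qed

text \<open>Equivalences placed at disjoint sets of indices add up: rows are placed along
  \<open>g\<close> and columns along \<open>h\<close>. Compatibility, commutativity, associativity
  and the neutral element of \<open>\<oplus>\<^sub>f\<close> are all obtained from this.\<close>

lemma mvn_relab_sum:
  assumes K: "finite K"
    and h: "\<And>k. k \<in> K \<Longrightarrow> inj (h k)" "\<And>k l n m. k \<in> K \<Longrightarrow> l \<in> K \<Longrightarrow> k \<noteq> l \<Longrightarrow> h k n \<noteq> h l m"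
    and g: "\<And>k. k \<in> K \<Longrightarrow> inj (g k)" "\<And>k l n m. k \<in> K \<Longrightarrow> l \<in> K \<Longrightarrow> k \<noteq> l \<Longrightarrow> g k n \<noteq> g l m"
    and m: "\<And>k. k \<in> K \<Longrightarrow> mvn R (P k) (Q k)"
  shows "mvn R (\<Sum>k\<in>K. relab (h k) (h k) (P k)) (\<Sum>k\<in>K. relab (g k) (g k) (Q k))"
proof -
  obtain V where V: "\<And>k. k \<in> K \<Longrightarrow> V k \<in> FM R \<and> adj (V k) * V k = P k \<and> V k * adj (V k) = Q k"
    using m unfolding mvn_def Bex_def by metis
  define W where "W = (\<Sum>k\<in>K. relab (g k) (h k) (V k))"
  have aW: "adj W = (\<Sum>k\<in>K. relab (h k) (g k) (adj (V k)))"
    unfolding W_def adj_sum by (rule sum.cong[OF refl]) (simp add: relab_adj h g)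
  have "W \<in> FM R" unfolding W_def by (rule FM_sum) (simp add: FM_relab h g V)
  moreover have "adj W * W = (\<Sum>k\<in>K. relab (h k) (h k) (P k))"
  proof -
    have "adj W * W = (\<Sum>k\<in>K. \<Sum>l\<in>K. relab (h k) (g k) (adj (V k)) * relab (g l) (h l) (V l))"
      unfolding aW unfolding W_def sum_product ..
    also have "\<dots> = (\<Sum>k\<in>K. \<Sum>l\<in>K. if l = k then relab (h k) (h k) (P k) else 0)"
    proof (intro sum.cong refl)
      fix k l assume k: "k \<in> K" and l: "l \<in> K"
      show "relab (h k) (g k) (adj (V k)) * relab (g l) (h l) (V l) = (if l = k then relab (h k) (h k) (P k) else 0)"
      proof (cases "l = k")
        case True
        thus ?thesis using V[OF k] by (simp add: relab_mult[OF h(1)[OF k] g(1)[OF k] h(1)[OF k]])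
      next
        case False
        hence "relab (h k) (g k) (adj (V k)) * relab (g l) (h l) (V l) = 0"
          by (intro relab_mult_disjoint h(1) g k l) simp
        thus ?thesis using False by simp
      qed
    qed
    finally show ?thesis using K by simp
  qed
  moreover have "W * adj W = (\<Sum>k\<in>K. relab (g k) (g k) (Q k))"
  proof -
    have "W * adj W = (\<Sum>k\<in>K. \<Sum>l\<in>K. relab (g k) (h k) (V k) * relab (h l) (g l) (adj (V l)))"
      unfolding aW unfolding W_def sum_product ..
    also have "\<dots> = (\<Sum>k\<in>K. \<Sum>l\<in>K. if l = k then relab (g k) (g k) (Q k) else 0)"
    proof (intro sum.cong refl)
      fix k l assume k: "k \<in> K" and l: "l \<in> K"
      show "relab (g k) (h k) (V k) * relab (h l) (g l) (adj (V l)) = (if l = k then relab (g k) (g k) (Q k) else 0)"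
      proof (cases "l = k")
        case True
        thus ?thesis using V[OF k] by (simp add: relab_mult[OF g(1)[OF k] h(1)[OF k] g(1)[OF k]])
      next
        case False
        hence "relab (g k) (h k) (V k) * relab (h l) (g l) (adj (V l)) = 0"
          by (intro relab_mult_disjoint h g(1) k l) simp
        thus ?thesis using False by simp
      qed
    qed
    finally show ?thesis using K by simp
  qed
  ultimately show ?thesis unfolding mvn_def by blast
qed

lemma mvn_relab2:
  assumes "inj h1" "inj h2" "\<And>n m. h1 n \<noteq> h2 m" "inj g1" "inj g2" "\<And>n m. g1 n \<noteq> g2 m"
    and "mvn R P1 Q1" "mvn R P2 Q2"
  shows "mvn R (relab h1 h1 P1 + relab h2 h2 P2) (relab g1 g1 Q1 + relab g2 g2 Q2)"
proof -
  have "mvn R (\<Sum>k\<in>UNIV. relab (if k then h1 else h2) (if k then h1 else h2) (if k then P1 else P2))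
      (\<Sum>k\<in>UNIV. relab (if k then g1 else g2) (if k then g1 else g2) (if k then Q1 else Q2))"
  proof (rule mvn_relab_sum)
    fix k l :: bool and n m :: nat
    show "inj (if k then h1 else h2)" "inj (if k then g1 else g2)" using assms by simp_all
    show "mvn R (if k then P1 else P2) (if k then Q1 else Q2)" using assms by simp
    assume "k \<noteq> l"
    thus "(if k then h1 else h2) n \<noteq> (if l then h1 else h2) m" "(if k then g1 else g2) n \<noteq> (if l then g1 else g2) m"
      using assms(3)[of n m] assms(3)[of m n] assms(6)[of n m] assms(6)[of m n]
      by (cases k; cases l; simp)+
  qed simp
  thus ?thesis by (simp add: UNIV_bool add.commute)
qed

lemma mvn_oplus: "mvn R P P' \<Longrightarrow> mvn R Q Q' \<Longrightarrow> mvn R (P \<oplus>\<^sub>f Q) (P' \<oplus>\<^sub>f Q')"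
  unfolding oplus_def by (rule mvn_relab2[OF inj_double even_neq_odd(1) inj_double even_neq_odd(1)])

lemma mvn_oplus_commute: "P \<in> projs R \<Longrightarrow> Q \<in> projs R \<Longrightarrow> mvn R (P \<oplus>\<^sub>f Q) (Q \<oplus>\<^sub>f P)"
  unfolding oplus_def add.commute[of "relab _ _ Q"]
  by (rule mvn_relab2[OF inj_double even_neq_odd(1) inj_double(2,1) even_neq_odd(2) mvn_refl mvn_refl])

lemma mvn_oplus_zero: "P \<in> projs R \<Longrightarrow> mvn R (P \<oplus>\<^sub>f 0) P"
proof -
  assume "P \<in> projs R"
  hence "mvn R (relab (\<lambda>n. 2 * n) (\<lambda>n. 2 * n) P + relab (\<lambda>n. 2 * n + 1) (\<lambda>n. 2 * n + 1) 0)
     (\<Sum>k\<in>{()}. relab (\<lambda>n. n) (\<lambda>n. n) P)"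
    using mvn_relab_sum[of "{()}" "\<lambda>_ n. 2 * n" "\<lambda>_ n. n" "\<lambda>_. P" "\<lambda>_. P"] mvn_refl inj_double
    by (simp add: inj_on_def)
  thus ?thesis by (simp add: oplus_def relab_id)
qed

lemma mvn_oplus_assoc:
  assumes "P \<in> projs R" "Q \<in> projs R" "T \<in> projs R"
  shows "mvn R ((P \<oplus>\<^sub>f Q) \<oplus>\<^sub>f T) (P \<oplus>\<^sub>f (Q \<oplus>\<^sub>f T))"
proof -
  \<comment> \<open>Positions of \<open>P\<close>, \<open>Q\<close> and \<open>T\<close> in the two
    bracketings: \<open>4n\<close>, \<open>4n+2\<close>, \<open>2n+1\<close> for \<open>h\<close>
    and \<open>2n\<close>, \<open>4n+1\<close>, \<open>4n+3\<close> for \<open>g\<close>.\<close>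
  define h :: "nat \<Rightarrow> nat \<Rightarrow> nat" where "h k n = (if k = 0 then 2 * (2 * n) else if k = 1 then 2 * (2 * n + 1) else 2 * n + 1)" for k n
  define g :: "nat \<Rightarrow> nat \<Rightarrow> nat" where "g k n = (if k = 0 then 2 * n else if k = 1 then 2 * (2 * n) + 1 else 2 * (2 * n + 1) + 1)" for k n
  define F where "F k = (if k = 0 then P else if k = 1 then Q else T)" for k :: nat
  have "mvn R (\<Sum>k\<in>{0, 1, 2}. relab (h k) (h k) (F k)) (\<Sum>k\<in>{0, 1, 2}. relab (g k) (g k) (F k))"
  proof (rule mvn_relab_sum)
    fix k l :: nat assume k: "k \<in> {0, 1, 2}"
    show "inj (h k)" "inj (g k)" by (auto simp: inj_on_def h_def g_def)
    show "mvn R (F k) (F k)" using assms by (auto simp: F_def intro: mvn_refl)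
    fix n m assume l: "l \<in> {0, 1, 2}" "k \<noteq> l"
    from k l show "h k n \<noteq> h l m" unfolding h_def by (elim insertE emptyE; simp; presburger)
    from k l show "g k n \<noteq> g l m" unfolding g_def by (elim insertE emptyE; simp; presburger)
  qed simp
  thus ?thesis
    by (simp add: oplus_def relab_add inj_double[simplified] relab_relab h_def[abs_def] g_def[abs_def] F_def add.assoc)
qed

definition mvcl :: "'a fmat \<Rightarrow> 'a fmat set" where
  "mvcl P = {Q \<in> projs R. mvn R P Q}"

text \<open>With the classes packaged as a commutative monoid, \<open>m_ac\<close> performs
  rearrangements that would otherwise be chains of equivalences. The product picks representatives;
  \<open>mvcl_oplus\<close> shows that the choice does not matter.\<close>

definition mvmon :: "'a fmat set monoid" where
  "mvmon = \<lparr>carrier = mvcl ` projs R,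
    mult = (\<lambda>X Y. mvcl ((SOME P. P \<in> projs R \<and> mvcl P = X) \<oplus>\<^sub>f (SOME P. P \<in> projs R \<and> mvcl P = Y))),
    one = mvcl 0\<rparr>"

lemma mvcl_eq_iff: "P \<in> projs R \<Longrightarrow> Q \<in> projs R \<Longrightarrow> mvcl P = mvcl Q \<longleftrightarrow> mvn R P Q"
  unfolding mvcl_def using mvn_refl mvn_trans mvn_sym by blast

lemma mvcl_carrier: "P \<in> projs R \<Longrightarrow> mvcl P \<in> carrier mvmon" by (simp add: mvmon_def)

lemma mvcl_oplus:
  assumes P: "P \<in> projs R" and Q: "Q \<in> projs R"
  shows "mvcl (P \<oplus>\<^sub>f Q) = mvcl P \<otimes>\<^bsub>mvmon\<^esub> mvcl Q"
proof -
  let ?s = "\<lambda>P. SOME P'. P' \<in> projs R \<and> mvcl P' = mvcl P"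
  have s: "?s P \<in> projs R \<and> mvcl (?s P) = mvcl P" if "P \<in> projs R" for P
    by (rule someI[of "\<lambda>P'. P' \<in> projs R \<and> mvcl P' = mvcl P" P]) (simp add: that)
  have "mvn R (P \<oplus>\<^sub>f Q) (?s P \<oplus>\<^sub>f ?s Q)"
    using s[OF P] s[OF Q] P Q by (intro mvn_oplus) (simp_all add: mvcl_eq_iff[symmetric])
  hence "mvcl (P \<oplus>\<^sub>f Q) = mvcl (?s P \<oplus>\<^sub>f ?s Q)"
    using s[OF P] s[OF Q] P Q by (simp add: mvcl_eq_iff projs_oplus)
  thus ?thesis by (simp add: mvmon_def)
qed

lemma mvcl_zero: "mvcl 0 = \<one>\<^bsub>mvmon\<^esub>" by (simp add: mvmon_def)

lemma comm_monoid_mvmon: "comm_monoid mvmon"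
proof -
  have c: "\<exists>P\<in>projs R. x = mvcl P" if "x \<in> carrier mvmon" for x using that by (auto simp: mvmon_def)
  show ?thesis
  proof (rule comm_monoidI)
    fix x y assume "x \<in> carrier mvmon" "y \<in> carrier mvmon"
    then obtain P Q where "P \<in> projs R" "Q \<in> projs R" "x = mvcl P" "y = mvcl Q" using c by metis
    thus "x \<otimes>\<^bsub>mvmon\<^esub> y \<in> carrier mvmon" "x \<otimes>\<^bsub>mvmon\<^esub> y = y \<otimes>\<^bsub>mvmon\<^esub> x"
      by (simp_all add: mvcl_oplus[symmetric] mvcl_carrier projs_oplus mvcl_eq_iff mvn_oplus_commute)
  next
    fix x y z assume "x \<in> carrier mvmon" "y \<in> carrier mvmon" "z \<in> carrier mvmon"
    then obtain P Q T where "P \<in> projs R" "Q \<in> projs R" "T \<in> projs R" "x = mvcl P" "y = mvcl Q" "z = mvcl T"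
      using c by metis
    thus "x \<otimes>\<^bsub>mvmon\<^esub> y \<otimes>\<^bsub>mvmon\<^esub> z = x \<otimes>\<^bsub>mvmon\<^esub> (y \<otimes>\<^bsub>mvmon\<^esub> z)"
      by (simp add: mvcl_oplus[symmetric] projs_oplus mvcl_eq_iff mvn_oplus_assoc)
  next
    show "\<one>\<^bsub>mvmon\<^esub> \<in> carrier mvmon" by (simp add: mvcl_zero[symmetric] mvcl_carrier projs_zero)
  next
    fix x assume "x \<in> carrier mvmon"
    then obtain P where P: "P \<in> projs R" "x = mvcl P" using c by metis
    have "mvn R (0 \<oplus>\<^sub>f P) P"
      by (rule mvn_trans[OF mvn_oplus_commute mvn_oplus_zero]) (simp_all add: P projs_zero projs_oplus)
    thus "\<one>\<^bsub>mvmon\<^esub> \<otimes>\<^bsub>mvmon\<^esub> x = x"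
      using P by (simp add: mvcl_zero[symmetric] mvcl_oplus[symmetric] mvcl_eq_iff projs_oplus projs_zero)
  qed
qed

end

subsection \<open>\<open>K\<^sub>0\<close>\<close>

lemma UN_const: "A \<noteq> {} \<Longrightarrow> (\<And>x. x \<in> A \<Longrightarrow> f x = c) \<Longrightarrow> (\<Union>x\<in>A. f x) = c"
  by auto

text \<open>The formal difference \<open>[P] - [Q]\<close>.\<close>

definition kc :: "'a :: star_algebra set \<Rightarrow> 'a fmat \<Rightarrow> 'a fmat \<Rightarrow> 'a proj_pair set" where
  "kc R P Q = K00_rel R `` {(ent P, ent Q)}"

text \<open>A diagonal matrix up to the positions of its entries, which are those produced by nested
  orthogonal sums.\<close>

primrec dg :: "'a :: star_algebra list \<Rightarrow> 'a fmat" where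
  "dg [] = 0"
| "dg (x # xs) = fsingle 0 0 x \<oplus>\<^sub>f dg xs"

lemma fmap_dg: "\<phi> 0 = 0 \<Longrightarrow> fmap \<phi> (dg xs) = dg (map \<phi> xs)"
proof (induction xs)
  case Nil
  show ?case by (rule fmat_eqI) (simp add: ent_fmap Nil ent_simps)
qed (simp add: fmap_oplus fmap_fsingle)

lemma oplus_zero_zero: "0 \<oplus>\<^sub>f 0 = (0 :: 'a :: star_algebra fmat)"
  by (simp add: oplus_def inj_double[simplified])

context matrix_star_algebra begin

definition proj :: "'a \<Rightarrow> bool" where "proj x \<longleftrightarrow> x \<in> R \<and> x * x = x \<and> adj x = x"

lemma K00_rel_iff:
  assumes "P \<in> projs R" "Q \<in> projs R" "P' \<in> projs R" "Q' \<in> projs R"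
  shows "((ent P, ent Q), (ent P', ent Q')) \<in> K00_rel R \<longleftrightarrow>
    (\<exists>S\<in>projs R. mvcl P \<otimes>\<^bsub>mvmon\<^esub> (mvcl Q' \<otimes>\<^bsub>mvmon\<^esub> mvcl S) = mvcl P' \<otimes>\<^bsub>mvmon\<^esub> (mvcl Q \<otimes>\<^bsub>mvmon\<^esub> mvcl S))"
proof -
  have "((ent P, ent Q), (ent P', ent Q')) \<in> K00_rel R \<longleftrightarrow>
      (\<exists>S\<in>projs R. mvn R (P \<oplus>\<^sub>f Q' \<oplus>\<^sub>f S) (P' \<oplus>\<^sub>f Q \<oplus>\<^sub>f S))"
    unfolding K00_rel_def minf_projs_eq
    using assms by (simp add: ent_oplus[symmetric] murray_von_neumann_ent)
  also have "\<dots> \<longleftrightarrow> (\<exists>S\<in>projs R. mvcl P \<otimes>\<^bsub>mvmon\<^esub> (mvcl Q' \<otimes>\<^bsub>mvmon\<^esub> mvcl S) = mvcl P' \<otimes>\<^bsub>mvmon\<^esub> (mvcl Q \<otimes>\<^bsub>mvmon\<^esub> mvcl S))"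
    by (rule bex_cong[OF refl]) (simp add: assms mvcl_eq_iff[symmetric] mvcl_oplus projs_oplus)
  finally show ?thesis .
qed

lemma K00_rel_subset: "K00_rel R \<subseteq> (minf_projs R \<times> minf_projs R) \<times> (minf_projs R \<times> minf_projs R)"
  by (auto simp: K00_rel_def)

lemma K00_rel_refl: "P \<in> projs R \<Longrightarrow> Q \<in> projs R \<Longrightarrow> ((ent P, ent Q), (ent P, ent Q)) \<in> K00_rel R"
  by (subst K00_rel_iff) (use projs_zero in blast)+

lemma K00_rel_sym:
  assumes "P \<in> projs R" "Q \<in> projs R" "P' \<in> projs R" "Q' \<in> projs R"
    and "((ent P, ent Q), (ent P', ent Q')) \<in> K00_rel R"
  shows "((ent P', ent Q'), (ent P, ent Q)) \<in> K00_rel R"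
  using assms(5) unfolding K00_rel_iff[OF assms(1-4)] K00_rel_iff[OF assms(3,4,1,2)] by metis

lemma K00_rel_trans:
  assumes P: "P \<in> projs R" "Q \<in> projs R" "P' \<in> projs R" "Q' \<in> projs R" "P'' \<in> projs R" "Q'' \<in> projs R"
    and 1: "((ent P, ent Q), (ent P', ent Q')) \<in> K00_rel R" and 2: "((ent P', ent Q'), (ent P'', ent Q'')) \<in> K00_rel R"
  shows "((ent P, ent Q), (ent P'', ent Q'')) \<in> K00_rel R"
proof -
  interpret M: comm_monoid mvmon by (rule comm_monoid_mvmon)
  obtain S where S: "S \<in> projs R"
    "mvcl P \<otimes>\<^bsub>mvmon\<^esub> (mvcl Q' \<otimes>\<^bsub>mvmon\<^esub> mvcl S) = mvcl P' \<otimes>\<^bsub>mvmon\<^esub> (mvcl Q \<otimes>\<^bsub>mvmon\<^esub> mvcl S)"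
    using 1 unfolding K00_rel_iff[OF P(1-4)] by blast
  obtain T where T: "T \<in> projs R"
    "mvcl P' \<otimes>\<^bsub>mvmon\<^esub> (mvcl Q'' \<otimes>\<^bsub>mvmon\<^esub> mvcl T) = mvcl P'' \<otimes>\<^bsub>mvmon\<^esub> (mvcl Q' \<otimes>\<^bsub>mvmon\<^esub> mvcl T)"
    using 2 unfolding K00_rel_iff[OF P(3-6)] by blast
  \<comment> \<open>The usual stabilizing summand for transitivity of a Grothendieck relation: the
    two given ones together with the middle pair \<open>P'\<close>, \<open>Q'\<close>.\<close>
  define U where "U = (Q' \<oplus>\<^sub>f S) \<oplus>\<^sub>f (P' \<oplus>\<^sub>f T)"
  have U: "U \<in> projs R" unfolding U_def by (intro projs_oplus P S T)
  note c = mvcl_carrier[OF P(1)] mvcl_carrier[OF P(2)] mvcl_carrier[OF P(3)] mvcl_carrier[OF P(4)]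
    mvcl_carrier[OF P(5)] mvcl_carrier[OF P(6)] mvcl_carrier[OF S(1)] mvcl_carrier[OF T(1)]
  have mU: "mvcl U = (mvcl Q' \<otimes>\<^bsub>mvmon\<^esub> mvcl S) \<otimes>\<^bsub>mvmon\<^esub> (mvcl P' \<otimes>\<^bsub>mvmon\<^esub> mvcl T)"
    unfolding U_def by (simp add: mvcl_oplus projs_oplus P S(1) T(1))
  have "mvcl P \<otimes>\<^bsub>mvmon\<^esub> (mvcl Q'' \<otimes>\<^bsub>mvmon\<^esub> mvcl U) =
      (mvcl P \<otimes>\<^bsub>mvmon\<^esub> (mvcl Q' \<otimes>\<^bsub>mvmon\<^esub> mvcl S)) \<otimes>\<^bsub>mvmon\<^esub> (mvcl P' \<otimes>\<^bsub>mvmon\<^esub> (mvcl Q'' \<otimes>\<^bsub>mvmon\<^esub> mvcl T))"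
    unfolding mU using c by (simp add: M.m_ac)
  also have "\<dots> = mvcl P'' \<otimes>\<^bsub>mvmon\<^esub> (mvcl Q \<otimes>\<^bsub>mvmon\<^esub> mvcl U)"
    unfolding S(2) T(2) mU using c by (simp add: M.m_ac)
  finally show ?thesis unfolding K00_rel_iff[OF P(1,2,5,6)] using U by blast
qed

lemma kc_member:
  assumes "z \<in> kc R P Q"
  obtains P' Q' where "P' \<in> projs R" "Q' \<in> projs R" "z = (ent P', ent Q')"
    "((ent P, ent Q), (ent P', ent Q')) \<in> K00_rel R"
proof -
  have z: "((ent P, ent Q), z) \<in> K00_rel R" using assms by (simp add: kc_def)
  hence "z \<in> minf_projs R \<times> minf_projs R" using K00_rel_subset by blast
  then obtain P' Q' where P: "P' \<in> projs R" "Q' \<in> projs R" "z = (ent P', ent Q')"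
    unfolding minf_projs_eq by blast
  show thesis using that[OF P] z P(3) by blast
qed

lemma kc_eq_iff:
  assumes "P \<in> projs R" "Q \<in> projs R" "P' \<in> projs R" "Q' \<in> projs R"
  shows "kc R P Q = kc R P' Q' \<longleftrightarrow> ((ent P, ent Q), (ent P', ent Q')) \<in> K00_rel R"
proof
  assume "kc R P Q = kc R P' Q'"
  moreover have "(ent P', ent Q') \<in> kc R P' Q'" unfolding kc_def using K00_rel_refl assms by simp
  ultimately have "(ent P', ent Q') \<in> kc R P Q" by (simp only:)
  thus "((ent P, ent Q), (ent P', ent Q')) \<in> K00_rel R" unfolding kc_def by simp
next
  have sub: "kc R P' Q' \<subseteq> kc R P Q"
    if P: "P \<in> projs R" "Q \<in> projs R" "P' \<in> projs R" "Q' \<in> projs R" and r: "((ent P, ent Q), (ent P', ent Q')) \<in> K00_rel R"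
    for P Q P' Q'
  proof
    fix z assume "z \<in> kc R P' Q'"
    then obtain P'' Q'' where z: "P'' \<in> projs R" "Q'' \<in> projs R" "z = (ent P'', ent Q'')"
      "((ent P', ent Q'), (ent P'', ent Q'')) \<in> K00_rel R" by (rule kc_member)
    show "z \<in> kc R P Q" unfolding kc_def z(3) using K00_rel_trans[OF P z(1,2) r z(4)] by simp
  qed
  assume r: "((ent P, ent Q), (ent P', ent Q')) \<in> K00_rel R"
  show "kc R P Q = kc R P' Q'"
    using sub[OF assms r] sub[OF assms(3,4,1,2) K00_rel_sym[OF assms r]] by blast
qed

lemma kc_self: "P \<in> projs R \<Longrightarrow> Q \<in> projs R \<Longrightarrow> (ent P, ent Q) \<in> kc R P Q"
  unfolding kc_def using K00_rel_refl by simp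

lemma kc_eqI:
  assumes "P \<in> projs R" "Q \<in> projs R" "P' \<in> projs R" "Q' \<in> projs R"
    and "mvcl P \<otimes>\<^bsub>mvmon\<^esub> mvcl Q' = mvcl P' \<otimes>\<^bsub>mvmon\<^esub> mvcl Q"
  shows "kc R P Q = kc R P' Q'"
proof -
  interpret M: comm_monoid mvmon by (rule comm_monoid_mvmon)
  show ?thesis
    unfolding kc_eq_iff[OF assms(1-4)] K00_rel_iff[OF assms(1-4)]
    using assms(5) by (intro bexI[of _ 0] projs_zero) (simp add: mvcl_zero mvcl_carrier assms(1-4))
qed

lemma kc_mvn:
  assumes "P \<in> projs R" "Q \<in> projs R" "P' \<in> projs R" "Q' \<in> projs R" "mvn R P P'" "mvn R Q Q'"
  shows "kc R P Q = kc R P' Q'"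
  using assms by (intro kc_eqI) (simp_all add: mvcl_eq_iff[symmetric])

lemma kc_oplus_cong:
  assumes P: "P \<in> projs R" "Q \<in> projs R" "P1 \<in> projs R" "Q1 \<in> projs R"
    and P': "P' \<in> projs R" "Q' \<in> projs R" "P1' \<in> projs R" "Q1' \<in> projs R"
    and r: "((ent P, ent Q), (ent P1, ent Q1)) \<in> K00_rel R" and r': "((ent P', ent Q'), (ent P1', ent Q1')) \<in> K00_rel R"
  shows "kc R (P1 \<oplus>\<^sub>f P1') (Q1 \<oplus>\<^sub>f Q1') = kc R (P \<oplus>\<^sub>f P') (Q \<oplus>\<^sub>f Q')"
proof -
  interpret M: comm_monoid mvmon by (rule comm_monoid_mvmon)
  obtain S where S: "S \<in> projs R"
    "mvcl P \<otimes>\<^bsub>mvmon\<^esub> (mvcl Q1 \<otimes>\<^bsub>mvmon\<^esub> mvcl S) = mvcl P1 \<otimes>\<^bsub>mvmon\<^esub> (mvcl Q \<otimes>\<^bsub>mvmon\<^esub> mvcl S)"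
    using r unfolding K00_rel_iff[OF P] by blast
  obtain T where T: "T \<in> projs R"
    "mvcl P' \<otimes>\<^bsub>mvmon\<^esub> (mvcl Q1' \<otimes>\<^bsub>mvmon\<^esub> mvcl T) = mvcl P1' \<otimes>\<^bsub>mvmon\<^esub> (mvcl Q' \<otimes>\<^bsub>mvmon\<^esub> mvcl T)"
    using r' unfolding K00_rel_iff[OF P'] by blast
  note c = mvcl_carrier[OF P(1)] mvcl_carrier[OF P(2)] mvcl_carrier[OF P(3)] mvcl_carrier[OF P(4)]
    mvcl_carrier[OF P'(1)] mvcl_carrier[OF P'(2)] mvcl_carrier[OF P'(3)] mvcl_carrier[OF P'(4)]
    mvcl_carrier[OF S(1)] mvcl_carrier[OF T(1)]
  have "mvcl (P1 \<oplus>\<^sub>f P1') \<otimes>\<^bsub>mvmon\<^esub> (mvcl (Q \<oplus>\<^sub>f Q') \<otimes>\<^bsub>mvmon\<^esub> mvcl (S \<oplus>\<^sub>f T)) =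
      (mvcl P1 \<otimes>\<^bsub>mvmon\<^esub> (mvcl Q \<otimes>\<^bsub>mvmon\<^esub> mvcl S)) \<otimes>\<^bsub>mvmon\<^esub> (mvcl P1' \<otimes>\<^bsub>mvmon\<^esub> (mvcl Q' \<otimes>\<^bsub>mvmon\<^esub> mvcl T))"
    using c by (simp add: mvcl_oplus P P' S(1) T(1) M.m_ac)
  also have "\<dots> = mvcl (P \<oplus>\<^sub>f P') \<otimes>\<^bsub>mvmon\<^esub> (mvcl (Q1 \<oplus>\<^sub>f Q1') \<otimes>\<^bsub>mvmon\<^esub> mvcl (S \<oplus>\<^sub>f T))"
    unfolding S(2)[symmetric] T(2)[symmetric] using c by (simp add: mvcl_oplus P P' S(1) T(1) M.m_ac)
  finally show ?thesis
    using projs_oplus[OF S(1) T(1)]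
    unfolding kc_eq_iff[OF projs_oplus projs_oplus projs_oplus projs_oplus, OF P(3) P'(3) P(4) P'(4) P(1) P'(1) P(2) P'(2)]
      K00_rel_iff[OF projs_oplus projs_oplus projs_oplus projs_oplus, OF P(3) P'(3) P(4) P'(4) P(1) P'(1) P(2) P'(2)]
    by blast
qed

lemma kc_mult:
  assumes P: "P \<in> projs R" "Q \<in> projs R" and P': "P' \<in> projs R" "Q' \<in> projs R"
  shows "kc R P Q \<otimes>\<^bsub>K00 R\<^esub> kc R P' Q' = kc R (P \<oplus>\<^sub>f P') (Q \<oplus>\<^sub>f Q')"
proof -
  have "(case z of (p, q) \<Rightarrow> case z' of (p', q') \<Rightarrow> K00_rel R `` {(p \<oplus>\<^sub>m p', q \<oplus>\<^sub>m q')}) = kc R (P \<oplus>\<^sub>f P') (Q \<oplus>\<^sub>f Q')"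
    if z: "z \<in> kc R P Q" and z': "z' \<in> kc R P' Q'" for z z'
  proof -
    obtain P1 Q1 where 1: "P1 \<in> projs R" "Q1 \<in> projs R" "z = (ent P1, ent Q1)"
      "((ent P, ent Q), (ent P1, ent Q1)) \<in> K00_rel R" using z by (rule kc_member)
    obtain P2 Q2 where 2: "P2 \<in> projs R" "Q2 \<in> projs R" "z' = (ent P2, ent Q2)"
      "((ent P', ent Q'), (ent P2, ent Q2)) \<in> K00_rel R" using z' by (rule kc_member)
    show ?thesis
      using kc_oplus_cong[OF P 1(1,2) P' 2(1,2) 1(4) 2(4)] by (simp add: 1(3) 2(3) ent_oplus[symmetric] kc_def)
  qed
  hence "(\<Union>z\<in>kc R P Q. \<Union>z'\<in>kc R P' Q'. case z of (p, q) \<Rightarrow> case z' of (p', q') \<Rightarrow> K00_rel R `` {(p \<oplus>\<^sub>m p', q \<oplus>\<^sub>m q')}) =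
      kc R (P \<oplus>\<^sub>f P') (Q \<oplus>\<^sub>f Q')"
    using kc_self[OF P] kc_self[OF P'] by (intro UN_const) blast+
  thus ?thesis by (simp add: K00_def case_prod_unfold)
qed

lemma kc_carrier: "P \<in> projs R \<Longrightarrow> Q \<in> projs R \<Longrightarrow> kc R P Q \<in> carrier (K00 R)"
  unfolding K00_def kc_def minf_projs_eq by (simp add: quotientI)

lemma kc_one: "\<one>\<^bsub>K00 R\<^esub> = kc R 0 0"
proof -
  have "ent (0 :: 'a fmat) = (\<lambda>_ _. 0)" by (simp add: fun_eq_iff ent_simps)
  thus ?thesis by (simp add: K00_def kc_def)
qed

lemma single_projs: "proj x \<Longrightarrow> fsingle 0 0 x \<in> projs R"
  by (simp add: projs_def proj_def FM_fsingle fsingle_mult adj_fsingle)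

lemma dg_projs: "(\<And>x. x \<in> set xs \<Longrightarrow> proj x) \<Longrightarrow> dg xs \<in> projs R"
  by (induction xs) (simp_all add: projs_zero projs_oplus single_projs)

lemma single_mvn: "v \<in> R \<Longrightarrow> mvn R (fsingle 0 0 (adj v * v)) (fsingle 0 0 (v * adj v))"
  unfolding mvn_def by (intro bexI[of _ "fsingle 0 0 v"]) (simp_all add: fsingle_mult adj_fsingle FM_fsingle)

lemma single_oplus: "fsingle 0 0 x \<oplus>\<^sub>f fsingle 0 0 y = fsingle 0 0 x + fsingle 1 1 y"
  by (simp add: oplus_def relab_fsingle inj_double[simplified])

lemma single_add_mvn:
  assumes "proj x" "proj y" "x * y = 0"
  shows "mvn R (fsingle 0 0 (x + y)) (fsingle 0 0 x \<oplus>\<^sub>f fsingle 0 0 y)"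
proof -
  have x: "x * x = x" "adj x = x" "y * y = y" "adj y = y" "x \<in> R" "y \<in> R" using assms by (auto simp: proj_def)
  have yx: "y * x = 0" using arg_cong[OF assms(3), of adj] x by (simp add: adj_mult)
  \<comment> \<open>A column with the entries \<open>x\<close> and \<open>y\<close>:
    \<open>adj V * V\<close> is their sum, and \<open>V * adj V\<close> is diagonal because
    \<open>x\<close> and \<open>y\<close> are orthogonal.\<close>
  define V where "V = fsingle 0 0 x + fsingle 1 0 y"
  have "adj V * V = fsingle 0 0 (x + y)"
    by (simp add: V_def adj_add adj_fsingle x distrib_left distrib_right fsingle_mult fsingle_add)
  moreover have "V * adj V = fsingle 0 0 x \<oplus>\<^sub>f fsingle 0 0 y"
    by (simp add: V_def adj_add adj_fsingle x distrib_left distrib_right fsingle_mult assms(3) yx single_oplus)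
  moreover have "V \<in> FM R" unfolding V_def by (intro FM_add FM_fsingle x)
  ultimately show ?thesis unfolding mvn_def by blast
qed

lemma mvcl_dg_append:
  assumes "\<And>x. x \<in> set xs \<Longrightarrow> proj x" "\<And>x. x \<in> set ys \<Longrightarrow> proj x"
  shows "mvcl (dg (xs @ ys)) = mvcl (dg xs) \<otimes>\<^bsub>mvmon\<^esub> mvcl (dg ys)"
proof -
  interpret M: comm_monoid mvmon by (rule comm_monoid_mvmon)
  show ?thesis using assms(1)
  proof (induction xs)
    case Nil
    show ?case using dg_projs[OF assms(2)] by (simp add: mvcl_zero mvcl_carrier)
  next
    case (Cons x xs)
    have p: "fsingle 0 0 x \<in> projs R" "dg xs \<in> projs R" "dg ys \<in> projs R" "dg (xs @ ys) \<in> projs R"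
      using Cons(2) assms(2) by (auto intro!: single_projs dg_projs)
    show ?case using Cons p by (simp add: mvcl_oplus mvcl_carrier M.m_assoc)
  qed
qed

lemma mvcl_dg_sum:
  assumes "distinct cs" "\<And>c. c \<in> set cs \<Longrightarrow> proj (f c)"
    and "\<And>c d. c \<in> set cs \<Longrightarrow> d \<in> set cs \<Longrightarrow> c \<noteq> d \<Longrightarrow> f c * f d = 0"
  shows "proj (\<Sum>c\<in>set cs. f c) \<and> mvcl (fsingle 0 0 (\<Sum>c\<in>set cs. f c)) = mvcl (dg (map f cs))"
  using assms
proof (induction cs)
  case Nil
  show ?case by (simp add: proj_def zero_mem)
next
  case (Cons c cs)
  let ?s = "\<Sum>c\<in>set cs. f c"
  have IH: "proj ?s" "mvcl (fsingle 0 0 ?s) = mvcl (dg (map f cs))" using Cons by (simp_all del: fsingle_zero)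
  have c: "proj (f c)" using Cons.prems(2) by simp
  have z0: "f c * ?s = 0"
    unfolding sum_distrib_left using Cons.prems(1,3) by (intro sum.neutral) auto
  have z1: "?s * f c = 0"
    using arg_cong[OF z0, of adj] IH(1) c by (simp add: adj_mult proj_def)
  have s: "(\<Sum>c\<in>set (c # cs). f c) = f c + ?s" using Cons.prems(1) by simp
  have p: "proj (f c + ?s)"
    using IH(1) c star_subalgebra by (simp add: proj_def distrib_left distrib_right z0 z1 adj_add sub_add)
  have d: "dg (map f cs) \<in> projs R" by (rule dg_projs) (use Cons.prems(2) in auto)
  have "mvcl (fsingle 0 0 (f c + ?s)) = mvcl (fsingle 0 0 (f c) \<oplus>\<^sub>f fsingle 0 0 ?s)"
    using single_add_mvn[OF c IH(1) z0] by (simp add: mvcl_eq_iff single_projs p projs_oplus c IH(1))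
  also have "\<dots> = mvcl (dg (map f (c # cs)))"
    by (simp add: mvcl_oplus single_projs c IH d)
  finally show ?case unfolding s using p by blast
qed

text \<open>Diagonal entries may be refined: each \<open>f a\<close> can be exchanged for a whole
  list \<open>g a\<close> of projections with the same class.\<close>

lemma mvcl_dg_concat:
  assumes "\<And>a. a \<in> set L \<Longrightarrow> proj (f a) \<and> (\<forall>x\<in>set (g a). proj x) \<and> mvcl (fsingle 0 0 (f a)) = mvcl (dg (g a))"
  shows "mvcl (dg (map f L)) = mvcl (dg (concat (map g L)))"
  using assms
proof (induction L)
  case (Cons a L)
  have q: "proj (f b)" "x \<in> set (g b) \<Longrightarrow> proj x" if "b = a \<or> b \<in> set L" for b x
    using Cons(2)[of b] that by auto
  have p: "dg (map f L) \<in> projs R" "dg (g a) \<in> projs R" "dg (concat (map g L)) \<in> projs R" "fsingle 0 0 (f a) \<in> projs R"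
    by (rule dg_projs, use q in force)+ (rule single_projs, use q in force)
  have "mvcl (dg (g a @ concat (map g L))) = mvcl (dg (g a)) \<otimes>\<^bsub>mvmon\<^esub> mvcl (dg (concat (map g L)))"
    by (rule mvcl_dg_append) (use q in force)+
  moreover have "mvcl (dg (map f L)) = mvcl (dg (concat (map g L)))"
    by (rule Cons(1), rule Cons(2)) simp
  moreover have "mvcl (fsingle 0 0 (f a)) = mvcl (dg (g a))" using Cons(2)[of a] by simp
  ultimately show ?case using p by (simp add: mvcl_oplus)
qed simp

end

text \<open>\<open>\<phi>\<close> is constrained on \<open>R\<close> only, because maps such as
  \<open>stable_iso\<close> are known to be multiplicative on their algebra but not on all
  operators.\<close>

locale matrix_star_hom = R: matrix_star_algebra R + R': matrix_star_algebra R'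
  for R :: "'a :: star_algebra set" and R' :: "'b :: star_algebra set" +
  fixes \<phi> :: "'a \<Rightarrow> 'b"
  assumes image: "x \<in> R \<Longrightarrow> \<phi> x \<in> R'"
    and add: "x \<in> R \<Longrightarrow> y \<in> R \<Longrightarrow> \<phi> (x + y) = \<phi> x + \<phi> y"
    and mult: "x \<in> R \<Longrightarrow> y \<in> R \<Longrightarrow> \<phi> (x * y) = \<phi> x * \<phi> y"
    and adj: "x \<in> R \<Longrightarrow> \<phi> (adj x) = adj (\<phi> x)"
begin

lemma zero: "\<phi> 0 = 0" using add[OF R.zero_mem R.zero_mem] by simp

lemma sum: "(\<And>k. k \<in> K \<Longrightarrow> f k \<in> R) \<Longrightarrow> \<phi> (\<Sum>k\<in>K. f k) = (\<Sum>k\<in>K. \<phi> (f k))"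
proof (induction K rule: infinite_finite_induct)
  case (insert k K)
  have "(\<Sum>k\<in>K. f k) \<in> R" using R.star_subalgebra insert.prems by (simp add: star_subalgebra_sum)
  thus ?case using insert by (simp add: add)
qed (simp_all add: zero)

lemma fmap_FM: "P \<in> FM R \<Longrightarrow> fmap \<phi> P \<in> FM R'"
  by (simp add: FM_def ent_fmap[of \<phi>, OF zero] image)

lemma fmap_mult:
  assumes "P \<in> FM R" "Q \<in> FM R" shows "fmap \<phi> (P * Q) = fmap \<phi> P * fmap \<phi> Q"
proof (rule fmat_eqI)
  fix i j
  obtain N where N: "fbound P N" using fbound_exists by blast
  have N': "fbound (fmap \<phi> P) N" using N unfolding fbound_def ent_fmap[of \<phi>, OF zero] by (metis zero)
  have m: "ent P i k * ent Q k j \<in> R" for k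
    using assms R.star_subalgebra by (simp add: FM_def sub_mult)
  show "ent (fmap \<phi> (P * Q)) i j = ent (fmap \<phi> P * fmap \<phi> Q) i j"
    using assms by (simp add: ent_fmap[of \<phi>, OF zero] ent_mult_sum[OF N] ent_mult_sum[OF N'] sum m mult FM_def)
qed

lemma fmap_adj: "P \<in> FM R \<Longrightarrow> fmap \<phi> (adj P) = adj (fmap \<phi> P)"
  by (rule fmat_eqI) (simp add: ent_fmap[of \<phi>, OF zero] ent_simps adj FM_def)

lemma fmap_projs: "P \<in> projs R \<Longrightarrow> fmap \<phi> P \<in> projs R'"
  by (simp add: projs_def fmap_FM fmap_mult[symmetric] fmap_adj[symmetric])

lemma fmap_mvn: "mvn R P Q \<Longrightarrow> mvn R' (fmap \<phi> P) (fmap \<phi> Q)"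
  unfolding mvn_def
proof (elim bexE conjE)
  fix V assume V: "V \<in> FM R" "adj V * V = P" "V * adj V = Q"
  show "\<exists>V\<in>FM R'. adj V * V = fmap \<phi> P \<and> V * adj V = fmap \<phi> Q"
    using V fmap_FM[OF V(1)] R.FM_adj[OF V(1)]
    by (intro bexI[of _ "fmap \<phi> V"]) (simp_all add: fmap_mult[symmetric] fmap_adj[symmetric])
qed

lemma fmap_rel:
  assumes P: "P \<in> projs R" "Q \<in> projs R" "P' \<in> projs R" "Q' \<in> projs R"
    and r: "((ent P, ent Q), (ent P', ent Q')) \<in> K00_rel R"
  shows "((ent (fmap \<phi> P), ent (fmap \<phi> Q)), (ent (fmap \<phi> P'), ent (fmap \<phi> Q'))) \<in> K00_rel R'"
proof -
  note P' = fmap_projs[OF P(1)] fmap_projs[OF P(2)] fmap_projs[OF P(3)] fmap_projs[OF P(4)]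
  obtain S where S: "S \<in> projs R" "mvn R (P \<oplus>\<^sub>f Q' \<oplus>\<^sub>f S) (P' \<oplus>\<^sub>f Q \<oplus>\<^sub>f S)"
    using r unfolding R.K00_rel_iff[OF P] by (auto simp: R.mvcl_oplus[symmetric] R.projs_oplus P R.mvcl_eq_iff)
  show ?thesis
    unfolding R'.K00_rel_iff[OF P']
    using fmap_mvn[OF S(2)] fmap_projs[OF S(1)]
    by (intro bexI[of _ "fmap \<phi> S"])
      (simp_all add: R'.mvcl_oplus[symmetric] R'.projs_oplus P' R'.mvcl_eq_iff fmap_oplus[of \<phi>, OF zero])
qed

lemma K00_map_kc:
  assumes P: "P \<in> projs R" "Q \<in> projs R"
  shows "K00_map R' \<phi> (kc R P Q) = kc R' (fmap \<phi> P) (fmap \<phi> Q)"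
  unfolding K00_map_def
proof (rule UN_const)
  show "kc R P Q \<noteq> {}" using R.kc_self[OF P] by blast
  fix z assume "z \<in> kc R P Q"
  then obtain P' Q' where z: "P' \<in> projs R" "Q' \<in> projs R" "z = (ent P', ent Q')"
    "((ent P, ent Q), (ent P', ent Q')) \<in> K00_rel R" by (rule R.kc_member)
  have e: "(\<lambda>i j. \<phi> (ent P i j)) = ent (fmap \<phi> P)" for P
    by (simp add: fun_eq_iff ent_fmap[of \<phi>, OF zero])
  have "kc R' (fmap \<phi> P) (fmap \<phi> Q) = kc R' (fmap \<phi> P') (fmap \<phi> Q')"
    using fmap_rel[OF P z(1,2,4)] by (simp add: R'.kc_eq_iff fmap_projs P z(1,2))
  thus "(case z of (P, Q) \<Rightarrow> K00_rel R' `` {(\<lambda>i j. \<phi> (P i j), \<lambda>i j. \<phi> (Q i j))}) = kc R' (fmap \<phi> P) (fmap \<phi> Q)"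
    by (simp add: z(3) e kc_def)
qed

end

subsection \<open>Absorbing the compacts by isometries\<close>

text \<open>For isometries \<open>s i\<close> with orthogonal ranges, conjugation by the coisometry \<open>column_op s\<close> maps
  \<open>T \<otimes>\<^sub>o munit i j\<close> to \<open>(s i * T * adj (s j)) \<otimes>\<^sub>o munit 0 0\<close>.\<close>

definition column_op :: "(nat \<Rightarrow> 'x cop) \<Rightarrow> ('x \<times> nat) cop" where
  "column_op s = mk_cop (\<lambda>v. Abs_ell2 (\<lambda>(x, i). coord (app (adj (s i)) (slice (swap_ell2 v) 0)) x))"

context
  fixes s :: "nat \<Rightarrow> 'x cop"
  assumes s: "\<And>i j. adj (s i) * s j = (if i = j then 1 else 0)"
begin

text \<open>\<open>Q\<close> is a projection, and the left hand side is the inner product of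
  \<open>w\<close> and \<open>Q w\<close>. The estimate makes \<open>column_op s\<close>
  bounded.\<close>

lemma bessel:
  assumes "finite G" shows "(\<Sum>i\<in>G. (norm (app (adj (s i)) w))\<^sup>2) \<le> (norm w)\<^sup>2"
proof -
  define Q where "Q = (\<Sum>i\<in>G. s i * adj (s i))"
  have Qs: "Q * s j = (if j \<in> G then s j else 0)" for j
  proof -
    have "Q * s j = (\<Sum>i\<in>G. if i = j then s j else 0)"
      unfolding Q_def sum_distrib_right by (rule sum.cong[OF refl]) (simp add: mult.assoc s)
    thus ?thesis using assms by simp
  qed
  have aQ: "adj Q = Q" by (simp add: Q_def adj_sum adj_mult adj_adj)
  have QQ: "Q * Q = Q"
  proof -
    have "Q * Q = (\<Sum>i\<in>G. Q * s i * adj (s i))" by (subst (2) Q_def) (simp add: sum_distrib_left mult.assoc)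
    also have "\<dots> = Q" unfolding Q_def[symmetric] by (subst (2) Q_def, rule sum.cong[OF refl]) (simp add: Qs)
    finally show ?thesis .
  qed
  have n: "norm Q \<le> 1" by (rule partial_isometry_norm_le) (simp add: aQ QQ)
  have sq: "(norm x)\<^sup>2 = Re (cinner x x)" for x :: "'x ell2"
    by (simp add: power2_norm_eq_inner inner_ell2_def)
  have a0: "cinner w 0 = 0" by (simp add: cinner_def)
  have "cinner w (app Q w) = (\<Sum>i\<in>G. cinner w (app (s i * adj (s i)) w))"
    unfolding Q_def using assms by (induction G rule: finite_induct) (simp_all add: cinner_add_right a0)
  also have "\<dots> = (\<Sum>i\<in>G. cinner (app (adj (s i)) w) (app (adj (s i)) w))"
    by (rule sum.cong[OF refl]) (simp add: cinner_app_adj)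
  finally have "(\<Sum>i\<in>G. (norm (app (adj (s i)) w))\<^sup>2) = Re (cinner w (app Q w))"
    by (simp only: sq Re_sum)
  also have "\<dots> \<le> norm w * norm (app Q w)"
    using norm_cinner complex_Re_le_cmod order_trans by blast
  also have "\<dots> \<le> norm w * (1 * norm w)"
    using n by (intro mult_left_mono order_trans[OF norm_app] mult_right_mono) simp_all
  finally show ?thesis by (simp add: power2_eq_square)
qed

lemma mel_column_op: "mel (column_op s) (x, i) (y, l) = (if l = 0 then mel (adj (s i)) x y else 0)"
proof -
  define w where "w v = slice (swap_ell2 v) 0" for v :: "('x \<times> nat) ell2"
  define g where "g v = (\<lambda>(x, i). coord (app (adj (s i)) (w v)) x)" for v
  have cw: "coord (w v) y = coord v (y, 0)" for v y by (simp add: w_def coord_slice coord_swap)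
  have w_add: "w (v + v') = w v + w v'" and w_scale: "w (c *\<^sub>C v) = c *\<^sub>C w v" for v v' c
    by (rule ell2_eqI; simp add: cw)+
  have wn: "(norm (w v))\<^sup>2 \<le> (norm v)\<^sup>2" for v
    using sum_norm_slice[of "{0}" "swap_ell2 v"] by (simp add: w_def norm_swap)
  have fin: "(\<Sum>p\<in>F. (cmod (g v p))\<^sup>2) \<le> (norm v)\<^sup>2" if F: "finite F" for F v
  proof -
    have "(\<Sum>p\<in>F. (cmod (g v p))\<^sup>2) \<le> (\<Sum>p\<in>fst ` F \<times> snd ` F. (cmod (g v p))\<^sup>2)"
      using F by (intro sum_mono2) force+
    also have "\<dots> = (\<Sum>i\<in>snd ` F. \<Sum>x\<in>fst ` F. (cmod (coord (app (adj (s i)) (w v)) x))\<^sup>2)"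
      by (subst sum.swap) (simp add: sum.cartesian_product g_def case_prod_unfold)
    also have "\<dots> \<le> (\<Sum>i\<in>snd ` F. (norm (app (adj (s i)) (w v)))\<^sup>2)"
      using F by (intro sum_mono norm_ell2_finite_sum) simp
    also have "\<dots> \<le> (norm (w v))\<^sup>2" using F by (intro bessel) simp
    also note wn
    finally show ?thesis .
  qed
  have sq: "sq_summable (g v)" for v by (rule norm_ell2_bound(1)[OF fin]) simp_all
  have bd: "norm (Abs_ell2 (g v)) \<le> norm v * 1" for v using norm_ell2_bound(2)[OF fin, of v] by simp
  have lin: "Abs_ell2 (g (v + v')) = Abs_ell2 (g v) + Abs_ell2 (g v')"
    "Abs_ell2 (g (c *\<^sub>C v)) = c *\<^sub>C Abs_ell2 (g v)" for v v' c
    by (rule ell2_eqI; simp add: coord_Abs sq; simp add: g_def w_add w_scale case_prod_unfold)+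
  have a: "app (column_op s) v = Abs_ell2 (g v)" for v
    unfolding column_op_def w_def[symmetric] g_def[symmetric] by (rule app_mk_cop[OF lin bd])
  have wk: "w (ket (y, l)) = (if l = 0 then ket y else 0)"
    by (rule ell2_eqI) (auto simp: cw coord_ket)
  show ?thesis unfolding mel_def a coord_Abs[OF sq] unfolding g_def wk by simp
qed

lemma column_op_coisometry: "column_op s * adj (column_op s) = 1"
proof (rule cop_eqI_mel)
  fix p q :: "'x \<times> nat"
  obtain x i y j where pq: "p = (x, i)" "q = (y, j)" by (metis surj_pair)
  have "mel (column_op s * adj (column_op s)) p q =
      (\<Sum>\<^sub>\<infinity>r. mel (column_op s) (x, i) r * cnj (mel (column_op s) (y, j) r))"
    by (simp add: mel_mult mel_adj pq)
  also have "\<dots> = (\<Sum>\<^sub>\<infinity>r\<in>range (\<lambda>z. (z, 0)). mel (column_op s) (x, i) r * cnj (mel (column_op s) (y, j) r))"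
    by (rule infsum_cong_neutral) (auto simp: mel_column_op image_iff)
  also have "\<dots> = (\<Sum>\<^sub>\<infinity>z. mel (adj (s i)) x z * mel (s j) z y)"
    by (subst infsum_reindex) (auto simp: inj_on_def o_def mel_column_op mel_adj)
  also have "\<dots> = mel (adj (s i) * s j) x y" by (simp add: mel_mult)
  also have "\<dots> = mel 1 p q" by (simp add: s pq mel_one)
  finally show "mel (column_op s * adj (column_op s)) p q = mel 1 p q" .
qed

lemma tensor_column_op: "(1 \<otimes>\<^sub>o munit 0 i) * column_op s = adj (s i) \<otimes>\<^sub>o munit 0 0"
proof (rule cop_eqI_mel)
  fix p q :: "'x \<times> nat"
  obtain x k y l where pq: "p = (x, k)" "q = (y, l)" by (metis surj_pair)
  have "mel ((1 \<otimes>\<^sub>o munit 0 i) * column_op s) p q = (\<Sum>\<^sub>\<infinity>r. mel (1 \<otimes>\<^sub>o munit 0 i) (x, k) r * mel (column_op s) r (y, l))"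
    by (simp add: mel_mult pq)
  also have "\<dots> = (\<Sum>\<^sub>\<infinity>r\<in>{(x, i)}. mel (1 \<otimes>\<^sub>o munit 0 i) (x, k) r * mel (column_op s) r (y, l))"
    by (rule infsum_cong_neutral) (auto simp: mel_tensor mel_munit mel_one split: if_splits)
  also have "\<dots> = (if k = 0 then mel (column_op s) (x, i) (y, l) else 0)"
    by (simp add: mel_tensor mel_munit mel_one)
  also have "\<dots> = mel (adj (s i) \<otimes>\<^sub>o munit 0 0) p q" by (simp add: pq mel_tensor mel_munit mel_column_op)
  finally show "mel ((1 \<otimes>\<^sub>o munit 0 i) * column_op s) p q = mel (adj (s i) \<otimes>\<^sub>o munit 0 0) p q" .
qed

definition absorb :: "('x \<times> nat) cop \<Rightarrow> 'x cop" where
  "absorb X = compress (\<lambda>x. (x, 0)) (adj (column_op s) * X * column_op s)"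

lemma inj_Pair0: "inj (\<lambda>x. (x, 0 :: nat))" by (simp add: inj_on_def)

lemma star_map_absorb: "star_map absorb"
  unfolding absorb_def[abs_def]
  by (rule star_map_comp[OF conj_coisometry(1)[OF column_op_coisometry] star_map_compress[OF inj_Pair0]])

text \<open>Conjugation by a coisometry is multiplicative. Its values live in the corner at index 0,
  since the other columns of \<open>column_op s\<close> vanish, and the compression extracts this
  corner.\<close>

lemma mult_domain_absorb: "X \<in> mult_domain absorb"
proof -
  have z: "mel (Y * column_op s) p (y, l) = 0" if "l \<noteq> 0" for Y p y l
  proof -
    have "mel (column_op s) r (y, l) = 0" for r using that by (cases r) (simp add: mel_column_op)
    thus ?thesis by (simp add: mel_mult)
  qed
  have z': "mel (adj (column_op s) * Y) (y, l) p = 0" if "l \<noteq> 0" for Y p y l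
    using z[OF that, of "adj Y" p y] mel_adj[of "adj Y * column_op s" "(y, l)" p] by (simp add: adj_mult adj_adj)
  have "adj (column_op s) * X * column_op s \<in> mult_domain (compress (\<lambda>x. (x, 0 :: nat)))"
  proof (rule mult_domain_compress[OF inj_Pair0])
    fix i :: 'x and k :: "'x \<times> nat" assume "k \<notin> range (\<lambda>x. (x, 0))"
    then obtain y l where k: "k = (y, l)" "l \<noteq> 0" by (metis rangeI surj_pair)
    show "mel (adj (column_op s) * X * column_op s) (i, 0) k = 0 \<and>
        mel (adj (column_op s) * X * column_op s) k (i, 0) = 0"
      unfolding k(1) using z[OF k(2), of "adj (column_op s) * X"] z'[OF k(2), of "X * column_op s"] by (simp add: mult.assoc)
  qed
  from mult_domain_comp[OF conj_coisometry(2)[OF column_op_coisometry] this]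
  show ?thesis unfolding absorb_def[abs_def] .
qed

lemma absorb_tensor: "absorb (T \<otimes>\<^sub>o munit i j) = s i * T * adj (s j)"
proof -
  have t: "T \<otimes>\<^sub>o munit i j = (1 \<otimes>\<^sub>o munit i 0) * (T \<otimes>\<^sub>o munit 0 0) * (1 \<otimes>\<^sub>o munit 0 j)"
    by (simp add: tensor_mult munit_mult)
  have a: "adj (column_op s) * (1 \<otimes>\<^sub>o munit i 0) = s i \<otimes>\<^sub>o munit 0 0"
    using arg_cong[OF tensor_column_op[of i], of adj] by (simp add: adj_mult tensor_adj adj_adj)
  have "adj (column_op s) * (T \<otimes>\<^sub>o munit i j) * column_op s =
      (adj (column_op s) * (1 \<otimes>\<^sub>o munit i 0)) * (T \<otimes>\<^sub>o munit 0 0) * ((1 \<otimes>\<^sub>o munit 0 j) * column_op s)"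
    unfolding t by (simp only: mult.assoc)
  also have "\<dots> = (s i * T * adj (s j)) \<otimes>\<^sub>o munit 0 0"
    unfolding a tensor_column_op by (simp add: tensor_mult munit_mult mult.assoc)
  finally show ?thesis
    unfolding absorb_def by (intro cop_eqI_mel) (simp add: mel_compress[OF inj_Pair0] mel_tensor mel_munit)
qed

end

section \<open>Isometries with orthogonal ranges in the algebra\<close>

context irreducible_graph begin

text \<open>If every vertex emitted only one edge, each row would consist of a single 1. As no
  column vanishes, the resulting map of vertices is onto, hence bijective, and the matrix is a
  permutation matrix.\<close>

lemma branching:
  assumes "\<not> permutation_matrix A"
  shows "\<exists>a\<in>edges A. \<exists>b\<in>edges A. a \<noteq> b \<and> src a = src b"
proof (rule ccontr)
  assume "\<not> ?thesis"
  hence u: "a = b" if "a \<in> edges A" "b \<in> edges A" "src a = src b" for a b using that by blast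
  obtain p where p: "\<And>i. A $ i $ p i > 0" using irreducible_row[OF irr] by metis
  have m: "A $ i $ j = (if j = p i then 1 else 0)" for i j
  proof -
    have 1: "j = p i" if "A $ i $ j > 0"
      using u[of "(i, j, 0)" "(i, p i, 0)"] that p[of i] by (simp add: edges_def src_def)
    have "\<not> 1 < A $ i $ p i"
    proof
      assume "1 < A $ i $ p i"
      thus False using u[of "(i, p i, 0)" "(i, p i, 1)"] by (simp add: edges_def src_def)
    qed
    hence 2: "A $ i $ p i = 1" using p[of i] by linarith
    show ?thesis
    proof (cases "j = p i")
      case False
      hence "\<not> A $ i $ j > 0" using 1 by blast
      thus ?thesis using False by simp
    qed (simp add: 2)
  qed
  have "\<exists>i. p i = j" for j using irreducible_column[OF irr, of j] m by (metis less_irrefl)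
  hence s: "surj p" by (metis surjI)
  have "bij p" using finite_UNIV_surj_inj[OF finite s] s by (simp add: bij_def)
  moreover have "A = (\<chi> i j. if j = p i then 1 else 0)" by (simp add: vec_eq_iff m)
  ultimately show False using assms unfolding permutation_matrix_def by blast
qed

text \<open>\<open>T\<close> is a partial isometry from the space of \<open>w\<close> into that of
  \<open>v\<close>, such as the word of a path from \<open>v\<close> to \<open>w\<close>.\<close>

definition linked :: "'n \<Rightarrow> 'n \<Rightarrow> 'n ck_index cop \<Rightarrow> bool" where
  "linked v w T \<longleftrightarrow> T \<in> \<O> A \<and> vproj v * T = T \<and> adj T * T = vproj w"

lemma vproj_mem: "vproj v \<in> \<O> A"
  unfolding vproj_def
  by (intro star_subalgebra_sum[OF star_subalgebra_ck_algebra(1)] sub_mult[OF star_subalgebra_ck_algebra(1)]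
      sub_adj[OF star_subalgebra_ck_algebra(1)] ck_algebra_generator) auto

lemma linked_gen: "a \<in> edges A \<Longrightarrow> linked (src a) (tgt a) (ck_gen A a)"
  by (simp add: linked_def ck_algebra_generator vproj_gen source_proj)

lemma linked_mult:
  assumes "linked u v T" "linked v w T'" shows "linked u w (T * T')"
proof -
  have "adj (T * T') * (T * T') = adj T' * (adj T * T) * T'" by (simp only: adj_mult mult.assoc)
  also have "\<dots> = adj T' * (vproj v * T')" using assms by (simp add: linked_def mult.assoc)
  finally have 1: "adj (T * T') * (T * T') = vproj w" using assms by (simp add: linked_def)
  have 2: "vproj u * (T * T') = T * T'" using assms(1) by (simp add: linked_def mult.assoc[symmetric])
  have "T * T' \<in> \<O> A" using assms sub_mult[OF star_subalgebra_ck_algebra(1)] unfolding linked_def by blast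
  thus ?thesis unfolding linked_def using 1 2 by blast
qed

text \<open>The vertices that are linked from \<open>v\<close> are closed under successors, by
  multiplication with a generator on the right; irreducibility does the rest.\<close>

lemma linked_exists: "\<exists>T. linked v w T"
proof -
  obtain n where "((\<lambda>X. A ** X) ^^ n) (mat 1) $ v $ w > 0"
    using irr unfolding irreducible_matrix_def by blast
  moreover have "v \<in> {w. \<exists>T. linked v w T}"
    by (simp add: linked_def) (rule exI[of _ "vproj v"], simp add: vproj_mem)
  moreover have "l \<in> {w. \<exists>T. linked v w T}" if k: "k \<in> {w. \<exists>T. linked v w T}" and e: "A $ k $ l > 0" for k l
  proof -
    obtain T where T: "linked v k T" using k by blast
    obtain a where a: "a \<in> edges A" "src a = k" "tgt a = l" using edge_exists[OF e] by blast
    have "linked v l (T * ck_gen A a)" using linked_mult[OF T] linked_gen[OF a(1)] a by simp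
    thus ?thesis by blast
  qed
  ultimately have "w \<in> {w. \<exists>T. linked v w T}" by (rule card_matrix_power_pos)
  thus ?thesis by simp
qed

text \<open>Two orthogonal loops \<open>\<alpha>\<close>, \<open>\<beta>\<close> at a branching vertex give the orthogonal family \<open>\<alpha>\<^sup>n \<beta>\<close>.\<close>

lemma orthogonal_loops:
  assumes "\<not> permutation_matrix A"
  obtains w T where "\<And>n :: nat. linked w w (T n)" "\<And>m n. m \<noteq> n \<Longrightarrow> adj (T m) * T n = 0"
proof -
  obtain a b where ab: "a \<in> edges A" "b \<in> edges A" "a \<noteq> b" "src a = src b" using branching[OF assms] by blast
  define w where "w = src a"
  obtain X where X: "linked (tgt a) w X" using linked_exists by blast
  obtain Y where Y: "linked (tgt b) w Y" using linked_exists by blast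
  define \<alpha> \<beta> where "\<alpha> = ck_gen A a * X" and "\<beta> = ck_gen A b * Y"
  have \<alpha>: "linked w w \<alpha>" unfolding \<alpha>_def w_def by (rule linked_mult[OF linked_gen[OF ab(1)] X[unfolded w_def]])
  have \<beta>: "linked w w \<beta>"
    using linked_mult[OF linked_gen[OF ab(2)] Y] ab(4) by (simp add: \<beta>_def w_def)
  have "adj \<beta> * \<alpha> = adj Y * (adj (ck_gen A b) * ck_gen A a) * X" by (simp only: \<alpha>_def \<beta>_def adj_mult mult.assoc)
  hence o: "adj \<beta> * \<alpha> = 0" using ab by (simp add: adj_gen_mult)
  define T where "T = rec_nat \<beta> (\<lambda>_ t. \<alpha> * t)"
  have Ts: "T 0 = \<beta>" "T (Suc n) = \<alpha> * T n" for n by (simp_all add: T_def)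
  have T: "linked w w (T n)" for n by (induction n) (simp_all add: Ts \<beta> linked_mult[OF \<alpha>])
  have lt: "adj (T m) * T n = 0" if "m < n" for m n
    using that
  proof (induction n arbitrary: m)
    case (Suc n)
    show ?case
    proof (cases m)
      case 0
      thus ?thesis by (simp add: Ts o mult.assoc[symmetric])
    next
      case (Suc k)
      have "adj (T m) * T (Suc n) = adj (T k) * (adj \<alpha> * \<alpha>) * T n" by (simp only: Suc Ts adj_mult mult.assoc)
      also have "\<dots> = adj (T k) * T n" using \<alpha> T[of n] by (simp add: linked_def mult.assoc)
      also have "\<dots> = 0" using Suc.IH[of k] Suc.prems Suc by simp
      finally show ?thesis .
    qed
  qed simp
  have "adj (T m) * T n = 0" if "m \<noteq> n" for m n
  proof (cases "m < n")
    case False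
    thus ?thesis using arg_cong[OF lt[of n m], of adj] that by (simp add: adj_mult adj_adj)
  qed (rule lt)
  from that[OF T this] show thesis .
qed

lemma orthogonal_isometries:
  assumes "\<not> permutation_matrix A"
  obtains s :: "nat \<Rightarrow> 'n ck_index cop"
  where "\<And>i. s i \<in> \<O> A" "\<And>i j. adj (s i) * s j = (if i = j then 1 else 0)"
proof -
  obtain w T where T: "\<And>n :: nat. linked w w (T n)" "\<And>m n. m \<noteq> n \<Longrightarrow> adj (T m) * T n = 0"
    using orthogonal_loops[OF assms] by blast
  obtain G where G: "\<And>v. linked w v (G v)" using linked_exists by metis
  have "countable (UNIV :: (nat \<times> 'n) set)"
    by (rule countable_subset[of _ "UNIV \<times> UNIV"]) (simp_all add: countable_finite)
  then obtain e :: "nat \<times> 'n \<Rightarrow> nat" where e: "inj e" by (auto elim: countableE)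
  \<comment> \<open>One summand per vertex, because the source projection of
    \<open>T n * G v\<close> is that of \<open>v\<close> and these sum to 1. The injection
    \<open>e\<close> gives every pair its own \<open>T n\<close>, so that all the summands have
    orthogonal ranges.\<close>
  define s where "s i = (\<Sum>v\<in>UNIV. T (e (i, v)) * G v)" for i
  have lk: "linked w v (T n * G v)" for n v by (rule linked_mult[OF T(1) G])
  have "s i \<in> \<O> A" for i
    unfolding s_def using lk by (intro star_subalgebra_sum[OF star_subalgebra_ck_algebra(1)]) (simp add: linked_def)
  moreover have "adj (s i) * s j = (if i = j then 1 else 0)" for i j
  proof -
    have z: "adj (T m * G v) * (T n * G v') = 0" if "m \<noteq> n" for m n v v'
    proof -
      have "adj (T m * G v) * (T n * G v') = adj (G v) * (adj (T m) * T n) * G v'" by (simp only: adj_mult mult.assoc)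
      thus ?thesis by (simp add: T(2)[OF that])
    qed
    have d: "adj (T n * G v) * (T n * G v) = vproj v" for n v using lk[of v n] by (simp add: linked_def)
    have "adj (s i) * s j = (\<Sum>v\<in>UNIV. \<Sum>v'\<in>UNIV. adj (T (e (i, v)) * G v) * (T (e (j, v')) * G v'))"
      unfolding s_def adj_sum sum_product ..
    also have "\<dots> = (\<Sum>v\<in>UNIV. \<Sum>v'\<in>UNIV. if v' = v then (if i = j then vproj v else 0) else 0)"
    proof (intro sum.cong refl)
      fix v v' :: 'n
      show "adj (T (e (i, v)) * G v) * (T (e (j, v')) * G v') = (if v' = v then (if i = j then vproj v else 0) else 0)"
      proof (cases "(i, v) = (j, v')")
        case True
        thus ?thesis by (simp add: d)
      next
        case False
        hence "e (i, v) \<noteq> e (j, v')" using e by (simp add: inj_eq)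
        from z[OF this] show ?thesis using False by auto
      qed
    qed
    also have "\<dots> = (if i = j then 1 else 0)" by (simp add: sum_vproj)
    finally show ?thesis .
  qed
  ultimately show thesis by (rule that)
qed

end

section \<open>Unitizations and the homomorphisms between them\<close>

lemma star_subalgebra_unitize:
  assumes "star_subalgebra F" shows "star_subalgebra (unitize F)"
  using assms
  by (auto simp: star_subalgebra_def unitize_def zero_unitization_def plus_unitization_def
      times_unitization_def scaleC_unitization_def adj_unitization_def)

lemma unitize_mem: "x \<in> F \<Longrightarrow> Unitz c x \<in> unitize F" by (auto simp: unitize_def)

lemma Unitz_zero_simps:
  "Unitz 0 0 = 0" "Unitz 0 x + Unitz 0 y = Unitz 0 (x + y)" "Unitz 0 x * Unitz 0 y = Unitz 0 (x * y)"
  "adj (Unitz 0 x) = Unitz 0 (adj x)"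
  by (simp_all add: zero_unitization_def plus_unitization_def times_unitization_def adj_unitization_def)

lemma Unitz_sum: "(\<Sum>k\<in>K. Unitz 0 (f k)) = Unitz 0 (\<Sum>k\<in>K. f k :: 'a :: star_algebra)"
  by (induction K rule: infinite_finite_induct) (simp_all add: Unitz_zero_simps)

lemma unitization_hom:
  fixes F :: "'a :: star_algebra set" and F' :: "'b :: star_algebra set"
  assumes F: "star_subalgebra F" "star_subalgebra F'" and im: "\<And>x. x \<in> F \<Longrightarrow> \<phi> x \<in> F'"
    and h: "\<And>x y. x \<in> F \<Longrightarrow> y \<in> F \<Longrightarrow> \<phi> (x + y) = \<phi> x + \<phi> y"
      "\<And>x y. x \<in> F \<Longrightarrow> y \<in> F \<Longrightarrow> \<phi> (x * y) = \<phi> x * \<phi> y"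
      "\<And>x. x \<in> F \<Longrightarrow> \<phi> (adj x) = adj (\<phi> x)" "\<And>c x. x \<in> F \<Longrightarrow> \<phi> (c *\<^sub>C x) = c *\<^sub>C \<phi> x"
  shows "matrix_star_hom (unitize F) (unitize F') (map_unitization \<phi>)"
proof
  show "star_subalgebra (unitize F)" "star_subalgebra (unitize F')" using F by (simp_all add: star_subalgebra_unitize)
  fix x y assume xy: "x \<in> unitize F"
  obtain c a where x: "x = Unitz c a" "a \<in> F" using xy by (auto simp: unitize_def)
  show "map_unitization \<phi> x \<in> unitize F'" using x im by (simp add: unitize_mem)
  show "map_unitization \<phi> (adj x) = adj (map_unitization \<phi> x)"
    using x h by (simp add: adj_unitization_def)
  assume "y \<in> unitize F"
  then obtain d b where y: "y = Unitz d b" "b \<in> F" by (auto simp: unitize_def)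
  have m: "c *\<^sub>C b \<in> F" "d *\<^sub>C a \<in> F" "a * b \<in> F" "c *\<^sub>C b + d *\<^sub>C a \<in> F"
    using F(1) x(2) y(2) by (simp_all add: star_subalgebra_def)
  show "map_unitization \<phi> (x + y) = map_unitization \<phi> x + map_unitization \<phi> y"
    using x y h by (simp add: plus_unitization_def)
  show "map_unitization \<phi> (x * y) = map_unitization \<phi> x * map_unitization \<phi> y"
    using x y h m by (simp add: times_unitization_def)
qed

lemma scalar_part_hom:
  assumes "star_subalgebra F" shows "matrix_star_hom (unitize F) UNIV scalar_part"
proof
  show "star_subalgebra (unitize F)" by (rule star_subalgebra_unitize[OF assms])
qed (simp_all add: star_subalgebra_def plus_unitization_def times_unitization_def adj_unitization_def adj_complex_def)

subsection \<open>The groups \<open>\<int>\<^sup>N / (1 - A\<^sup>t) \<int>\<^sup>N\<close>\<close>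

lemma int_vectors_simps [simp]:
  "carrier int_vectors = UNIV" "x \<otimes>\<^bsub>int_vectors\<^esub> y = x + y" "\<one>\<^bsub>int_vectors\<^esub> = 0"
  by (simp_all add: int_vectors_def)

lemma comm_group_int_vectors: "comm_group int_vectors"
  by (rule comm_groupI) (auto simp: add.assoc add.commute intro: exI[of _ "- _"])

lemma int_vectors_inv: "inv\<^bsub>int_vectors\<^esub> x = - x"
proof -
  interpret comm_group int_vectors by (rule comm_group_int_vectors)
  show ?thesis by (rule inv_equality) simp_all
qed

lemma matrix_vector_mult_uminus: "X *v (- u) = - (X *v u)" for X :: "'a :: ring_1 ^ 'n ^ 'm"
  by (simp add: matrix_vector_mult_def vec_eq_iff sum_negf)

lemma bf_imageI: "(mat 1 - transpose (map_matrix int A)) *v x \<in> bf_image A"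
  by (simp add: bf_image_def)

lemma bf_image_normal: "normal (bf_image A) int_vectors"
proof -
  interpret comm_group "int_vectors :: (int ^ 'a) monoid" by (rule comm_group_int_vectors)
  have "subgroup (bf_image A) int_vectors"
  proof
    show "bf_image A \<subseteq> carrier int_vectors" by simp
    show "\<one>\<^bsub>int_vectors\<^esub> \<in> bf_image A" using bf_imageI[of A 0] by simp
    fix x y assume "x \<in> bf_image A"
    then obtain u where u: "x = (mat 1 - transpose (map_matrix int A)) *v u" unfolding bf_image_def by blast
    show "inv\<^bsub>int_vectors\<^esub> x \<in> bf_image A"
      using bf_imageI[of A "- u"] by (simp add: int_vectors_inv u matrix_vector_mult_uminus)
    assume "y \<in> bf_image A"
    then obtain v where v: "y = (mat 1 - transpose (map_matrix int A)) *v v" unfolding bf_image_def by blast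
    show "x \<otimes>\<^bsub>int_vectors\<^esub> y \<in> bf_image A"
      using bf_imageI[of A "u + v"] by (simp add: u v matrix_vector_right_distrib)
  qed
  thus ?thesis by (rule subgroup_imp_normal)
qed

lemma bf_class_eq: "bf_class A x = {y. y - x \<in> bf_image A}"
proof -
  have "y \<in> bf_class A x \<longleftrightarrow> y - x \<in> bf_image A" for y
  proof
    assume "y - x \<in> bf_image A"
    thus "y \<in> bf_class A x" unfolding bf_class_def r_coset_def by (intro UN_I[of "y - x"]) simp_all
  qed (auto simp: bf_class_def r_coset_def)
  thus ?thesis by blast
qed

lemma bf_image_closed:
  shows "0 \<in> bf_image A" "u \<in> bf_image A \<Longrightarrow> v \<in> bf_image A \<Longrightarrow> u + v \<in> bf_image A"
    "u \<in> bf_image A \<Longrightarrow> - u \<in> bf_image A"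
proof -
  interpret subgroup "bf_image A" int_vectors using bf_image_normal by (rule normal_imp_subgroup)
  show "0 \<in> bf_image A" using one_closed by simp
  show "u \<in> bf_image A \<Longrightarrow> v \<in> bf_image A \<Longrightarrow> u + v \<in> bf_image A" using m_closed[of u v] by simp
  show "u \<in> bf_image A \<Longrightarrow> - u \<in> bf_image A" using m_inv_closed[of u] by (simp add: int_vectors_inv)
qed

lemma bf_class_eq_iff: "bf_class A x = bf_class A y \<longleftrightarrow> x - y \<in> bf_image A"
proof -
  note z = bf_image_closed(1) and a = bf_image_closed(2) and n = bf_image_closed(3)
  show ?thesis
  proof
    assume "bf_class A x = bf_class A y"
    moreover have "x \<in> bf_class A x" by (simp add: bf_class_eq z)
    ultimately have "x \<in> bf_class A y" by (simp only:)
    thus "x - y \<in> bf_image A" by (simp add: bf_class_eq)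
  next
    assume xy: "x - y \<in> bf_image A"
    have "w - x \<in> bf_image A \<longleftrightarrow> w - y \<in> bf_image A" for w
      using a[OF _ xy, of "w - x"] a[OF _ n[OF xy], of "w - y"] by auto
    thus "bf_class A x = bf_class A y" by (simp add: bf_class_eq)
  qed
qed

lemma bf_class_mult: "bf_class A x \<otimes>\<^bsub>bf_group A\<^esub> bf_class A y = bf_class A (x + y)"
  unfolding bf_group_def bf_class_def
  using normal.rcos_sum[OF bf_image_normal, of x y A] by (simp add: FactGroup_def)

lemma bf_carrier: "carrier (bf_group A) = range (bf_class A)"
  unfolding bf_group_def FactGroup_def RCOSETS_def bf_class_def by auto

lemma map_matrix_int_mult: "map_matrix int (X ** Y) = map_matrix int X ** map_matrix int Y"
  by (simp add: vec_eq_iff map_matrix_def matrix_matrix_mult_def)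

context
  fixes A :: "nat ^ 'n ^ 'n" and B :: "nat ^ 'm ^ 'm" and C :: "nat ^ 'm ^ 'n" and D :: "nat ^ 'n ^ 'm"
  assumes AB: "A = C ** D" "B = D ** C"
begin

text \<open>\<open>C^t (1 - A^t) = (1 - B^t) C^t\<close>, because
  \<open>C^t A^t = C^t D^t C^t = B^t C^t\<close>.\<close>

lemma transpose_bf_image:
  assumes "u \<in> bf_image A" shows "transpose (map_matrix int C) *v u \<in> bf_image B"
proof -
  obtain x where u: "u = (mat 1 - transpose (map_matrix int A)) *v x" using assms unfolding bf_image_def by blast
  have "transpose (map_matrix int C) *v u = (mat 1 - transpose (map_matrix int B)) *v (transpose (map_matrix int C) *v x)"
    by (simp only: u matrix_vector_mult_diff_rdistrib matrix_vector_mult_diff_distrib matrix_vector_mul_lid)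
      (simp only: AB map_matrix_int_mult matrix_transpose_mul matrix_vector_mul_assoc matrix_mul_assoc)
  thus ?thesis by (simp only: bf_imageI)
qed

lemma bf_map_class: "bf_map B C (bf_class A x) = bf_class B (transpose (map_matrix int C) *v x)"
  unfolding bf_map_def
proof (rule UN_const)
  have "x \<in> bf_class A x" by (simp add: bf_class_eq bf_image_closed)
  thus "bf_class A x \<noteq> {}" by blast
  fix y assume "y \<in> bf_class A x"
  hence "transpose (map_matrix int C) *v (y - x) \<in> bf_image B" by (intro transpose_bf_image) (simp add: bf_class_eq)
  thus "bf_class B (transpose (map_matrix int C) *v y) = bf_class B (transpose (map_matrix int C) *v x)"
    by (simp add: bf_class_eq_iff matrix_vector_mult_diff_distrib del: transpose_matrix_vector)
qed

lemma bf_class_transpose: "bf_class A (transpose (map_matrix int A) *v x) = bf_class A x"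
proof -
  have "(mat 1 - transpose (map_matrix int A)) *v (- x) = transpose (map_matrix int A) *v x - x"
    by (simp add: matrix_vector_mult_diff_rdistrib matrix_vector_mult_uminus del: transpose_matrix_vector)
  thus ?thesis using bf_imageI[of A "- x"] by (simp add: bf_class_eq_iff del: transpose_matrix_vector)
qed

end

text \<open>The inverse is induced by \<open>D^t\<close>: the product \<open>D^t C^t = A^t\<close>
  acts as the identity modulo the image of \<open>1 - A^t\<close>, and likewise for
  \<open>B\<close>.\<close>

lemma bf_map_iso:
  fixes A :: "nat ^ 'n ^ 'n" and B :: "nat ^ 'm ^ 'm" and C :: "nat ^ 'm ^ 'n" and D :: "nat ^ 'n ^ 'm"
  assumes AB: "A = C ** D" "B = D ** C"
  shows "bf_map B C \<in> iso (bf_group A) (bf_group B)"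
proof -
  note c = bf_map_class[OF AB] and d = bf_map_class[OF AB(2,1)]
  have DC: "bf_map A D (bf_map B C (bf_class A x)) = bf_class A x" for x
    unfolding c d matrix_vector_mul_assoc matrix_transpose_mul[symmetric] map_matrix_int_mult[symmetric] AB(1)[symmetric]
    by (rule bf_class_transpose[OF AB])
  have CD: "bf_map B C (bf_map A D (bf_class B y)) = bf_class B y" for y
    unfolding c d matrix_vector_mul_assoc matrix_transpose_mul[symmetric] map_matrix_int_mult[symmetric] AB(2)[symmetric]
    by (rule bf_class_transpose[OF AB(2,1)])
  have "bij_betw (bf_map B C) (carrier (bf_group A)) (carrier (bf_group B))"
    by (rule bij_betw_byWitness[of _ "bf_map A D"]) (auto simp: bf_carrier DC CD, auto simp: c d)
  moreover have "bf_map B C \<in> hom (bf_group A) (bf_group B)"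
    by (rule homI) (auto simp: bf_carrier c bf_class_mult matrix_vector_right_distrib simp del: transpose_matrix_vector)
  ultimately show ?thesis by (simp add: iso_def)
qed

subsection \<open>\<open>K\<^sub>0\<close> of Cuntz-Krieger algebras\<close>

lemma (in matrix_star_algebra) mvcl_dg_cong:
  assumes "\<And>a. a \<in> set L \<Longrightarrow> proj (f a) \<and> proj (g a) \<and> mvn R (fsingle 0 0 (f a)) (fsingle 0 0 (g a))"
  shows "mvcl (dg (map f L)) = mvcl (dg (map g L))"
  using assms
proof (induction L)
  case (Cons a L)
  have "dg (map f L) \<in> projs R" "dg (map g L) \<in> projs R"
    by (rule dg_projs, use Cons.prems in force)+
  moreover have "mvcl (dg (map f L)) = mvcl (dg (map g L))" by (rule Cons.IH, rule Cons.prems) simp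
  moreover have "fsingle 0 0 (f a) \<in> projs R" "fsingle 0 0 (g a) \<in> projs R" "mvcl (fsingle 0 0 (f a)) = mvcl (fsingle 0 0 (g a))"
    using Cons.prems[of a] by (simp_all add: single_projs mvcl_eq_iff)
  ultimately show ?case by (simp add: mvcl_oplus)
qed simp

text \<open>A representative of the value of \<epsilon> on the sum of the classes of the range
  projections of the listed edges.\<close>

definition evec :: "('n, 'n) edge list \<Rightarrow> int ^ 'n" where
  "evec L = (\<Sum>a\<leftarrow>L. axis (tgt a) 1)"

lemma evec_simps [simp]: "evec [] = 0" "evec (a # L) = axis (tgt a) 1 + evec L" "evec (L @ L') = evec L + evec L'"
  by (simp_all add: evec_def)

lemma evec_replicate: "evec (replicate n a) $ w = (if w = tgt a then int n else 0)"
  by (induction n) (simp_all add: axis_def)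

lemma evec_concat: "distinct vs \<Longrightarrow> evec (concat (map f vs)) = (\<Sum>v\<in>set vs. evec (f v))"
  by (induction vs) simp_all

context irreducible_graph begin

abbreviation "unital \<equiv> unitize (\<O> A)"
abbreviation "stable_unital \<equiv> unitize (\<O> A \<otimes>\<^sub>* compacts)"

definition range_proj :: "('n, 'n) edge \<Rightarrow> 'n ck_index cop" where
  "range_proj a = ck_gen A a * adj (ck_gen A a)"

definition pdiag :: "('n, 'n) edge list \<Rightarrow> 'n ck_index cop unitization fmat" where
  "pdiag L = dg (map (\<lambda>a. Unitz 0 (range_proj a)) L)"

definition spdiag :: "('n, 'n) edge list \<Rightarrow> ('n ck_index \<times> nat) cop unitization fmat" where
  "spdiag L = dg (map (\<lambda>a. Unitz 0 (range_proj a \<otimes>\<^sub>o munit 0 0)) L)"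

sublocale K: matrix_star_algebra unital
  by (rule matrix_star_algebra.intro[OF star_subalgebra_unitize[OF star_subalgebra_ck_algebra(1)]])

sublocale KS: matrix_star_algebra stable_unital
  by (rule matrix_star_algebra.intro[OF star_subalgebra_unitize[OF star_subalgebra_ck_stable(1)]])

lemma range_proj:
  assumes "a \<in> edges A"
  shows "range_proj a \<in> \<O> A" "range_proj a * range_proj a = range_proj a" "adj (range_proj a) = range_proj a"
  using ck_algebra_generator[OF assms] partial_isometry[OF assms]
  unfolding range_proj_def
  by (simp_all add: sub_mult[OF star_subalgebra_ck_algebra(1)] sub_adj[OF star_subalgebra_ck_algebra(1)]
      adj_mult adj_adj mult.assoc[symmetric])

lemma K_proj: "a \<in> edges A \<Longrightarrow> K.proj (Unitz 0 (range_proj a))"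
  by (simp add: K.proj_def unitize_mem range_proj Unitz_zero_simps)

lemma KS_proj: "a \<in> edges A \<Longrightarrow> KS.proj (Unitz 0 (range_proj a \<otimes>\<^sub>o munit i i))"
  by (simp add: KS.proj_def unitize_mem ck_tensor_mem range_proj Unitz_zero_simps tensor_mult tensor_adj munit_mult)

lemma pdiag_projs: "set L \<subseteq> edges A \<Longrightarrow> pdiag L \<in> projs unital"
  unfolding pdiag_def by (rule K.dg_projs) (use K_proj in auto)

lemma spdiag_projs: "set L \<subseteq> edges A \<Longrightarrow> spdiag L \<in> projs stable_unital"
  unfolding spdiag_def by (rule KS.dg_projs) (use KS_proj in auto)

text \<open>All entries have scalar part 0, so the class lies in the kernel that defines
  \<open>K0\<close>.\<close>

lemma kc_pdiag_carrier:
  assumes "set L \<subseteq> edges A" "set L' \<subseteq> edges A"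
  shows "kc unital (pdiag L) (pdiag L') \<in> carrier (K0 (\<O> A))"
proof -
  interpret h: matrix_star_hom unital UNIV scalar_part by (rule scalar_part_hom[OF star_subalgebra_ck_algebra(1)])
  have z: "dg (map (\<lambda>_. 0 :: complex) L) = 0" for L :: "('n, 'n) edge list"
    by (induction L) (simp_all add: oplus_zero_zero)
  have s: "fmap scalar_part (pdiag L) = 0" for L
    by (simp add: pdiag_def fmap_dg[of scalar_part, OF h.zero] o_def z)
  show ?thesis
    using pdiag_projs[OF assms(1)] pdiag_projs[OF assms(2)]
    by (simp add: K0_def kernel_def K.kc_carrier h.K00_map_kc s h.R'.kc_one)
qed

lemma K0_mult: "X \<otimes>\<^bsub>K0 F\<^esub> Y = X \<otimes>\<^bsub>K00 (unitize F)\<^esub> Y"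
  by (simp add: K0_def)

lemma K0_class_eq:
  assumes a: "a \<in> edges A"
  shows "K0_class (\<O> A) (ck_gen A a * adj (ck_gen A a)) = kc unital (pdiag [a]) 0"
proof -
  have p: "fsingle 0 0 (Unitz 0 (range_proj a)) \<in> projs unital" by (rule K.single_projs[OF K_proj[OF a]])
  have "K0_class (\<O> A) (range_proj a) = kc unital (fsingle 0 0 (Unitz 0 (range_proj a))) 0"
    unfolding K0_class_def kc_def by (rule arg_cong[of _ _ "\<lambda>z. _ `` {z}"]) (simp add: fun_eq_iff ent_fsingle ent_simps)
  also have "\<dots> = kc unital (fsingle 0 0 (Unitz 0 (range_proj a)) \<oplus>\<^sub>f 0) 0"
    by (rule K.kc_mvn[OF p K.projs_zero K.projs_oplus[OF p K.projs_zero] K.projs_zero K.mvn_sym[OF K.mvn_oplus_zero[OF p]]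
        K.mvn_refl[OF K.projs_zero]])
  finally show ?thesis by (simp add: pdiag_def range_proj_def)
qed

lemma epsilon_kc:
  assumes \<epsilon>: "is_epsilon A \<epsilon>" and L: "set L \<subseteq> edges A" and L': "set L' \<subseteq> edges A"
  shows "\<epsilon> (kc unital (pdiag L) (pdiag L')) = bf_class A (evec L - evec L')"
proof -
  interpret M: comm_monoid K.mvmon by (rule K.comm_monoid_mvmon)
  have iso: "\<epsilon> \<in> hom (K0 (\<O> A)) (bf_group A)" "bij_betw \<epsilon> (carrier (K0 (\<O> A))) (carrier (bf_group A))"
    using \<epsilon> by (auto simp: is_epsilon_def iso_def)
  have m: "\<epsilon> (kc unital (P \<oplus>\<^sub>f P') (Q \<oplus>\<^sub>f Q')) = \<epsilon> (kc unital P Q) \<otimes>\<^bsub>bf_group A\<^esub> \<epsilon> (kc unital P' Q')"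
    if "P \<in> projs unital" "Q \<in> projs unital" "P' \<in> projs unital" "Q' \<in> projs unital"
      "kc unital P Q \<in> carrier (K0 (\<O> A))" "kc unital P' Q' \<in> carrier (K0 (\<O> A))" for P Q P' Q'
    using hom_mult[OF iso(1) that(5,6)] K.kc_mult[OF that(1-4)] by (simp add: K0_mult)
  have nil: "pdiag [] = 0" by (simp add: pdiag_def)
  have car: "kc unital (pdiag K) 0 \<in> carrier (K0 (\<O> A))" if "set K \<subseteq> edges A" for K
    using kc_pdiag_carrier[OF that, of "[]"] by (simp add: nil)
  have val: "\<exists>x. \<epsilon> (kc unital (pdiag K) (pdiag K')) = bf_class A x" if "set K \<subseteq> edges A" "set K' \<subseteq> edges A" for K K'
    using hom_in_carrier[OF iso(1) kc_pdiag_carrier[OF that]] unfolding bf_carrier by blast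
  note p = pdiag_projs and z = K.projs_zero
  have pos: "\<epsilon> (kc unital (pdiag K) 0) = bf_class A (evec K)" if "set K \<subseteq> edges A" for K
    using that
  proof (induction K)
    case Nil
    obtain x where x: "\<epsilon> (kc unital 0 0) = bf_class A x" using val[of "[]" "[]"] by (auto simp: nil)
    have c: "kc unital 0 0 \<in> carrier (K0 (\<O> A))" using car[of "[]"] by (simp add: nil)
    \<comment> \<open>The class of 0 is idempotent, so its value is an idempotent of the group
      \<open>bf_group A\<close> and hence trivial.\<close>
    have "bf_class A x = bf_class A (x + x)"
      using m[OF z z z z c c] by (simp add: oplus_zero_zero x bf_class_mult)
    hence "bf_class A x = bf_class A 0" using bf_image_closed(3)[of "- x" A] by (simp add: bf_class_eq_iff)
    thus ?case by (simp add: nil x)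
  next
    case (Cons a K)
    have a: "a \<in> edges A" and K: "set K \<subseteq> edges A" using Cons.prems by simp_all
    have a1: "set [a] \<subseteq> edges A" using a by simp
    have single: "\<epsilon> (kc unital (pdiag [a]) 0) = bf_class A (axis (tgt a) 1)"
      using \<epsilon> a unfolding is_epsilon_def K0_class_eq[OF a, symmetric] by blast
    have "mvn unital (pdiag (a # K)) (pdiag [a] \<oplus>\<^sub>f pdiag K)"
      using K.single_projs[OF K_proj[OF a]] p[OF K]
      by (simp add: pdiag_def K.mvn_oplus K.mvn_refl K.mvn_sym K.mvn_oplus_zero)
    hence "kc unital (pdiag (a # K)) 0 = kc unital (pdiag [a] \<oplus>\<^sub>f pdiag K) (0 \<oplus>\<^sub>f 0)"
      unfolding oplus_zero_zero using p[OF Cons.prems] p[OF a1] p[OF K] z K.projs_oplus K.mvn_refl by (intro K.kc_mvn) blast+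
    also have "\<epsilon> \<dots> = bf_class A (evec (a # K))"
      using m[OF p[OF a1] z p[OF K] z car[OF a1] car[OF K]] Cons.IH[OF K] by (simp add: single bf_class_mult)
    finally show ?case .
  qed
  obtain x where x: "\<epsilon> (kc unital (pdiag L) (pdiag L')) = bf_class A x" using val[OF L L'] by blast
  \<comment> \<open>Adding the class of \<open>pdiag L'\<close> turns the difference into a class
    with subtrahend 0, whose value is known.\<close>
  have "kc unital (pdiag L \<oplus>\<^sub>f pdiag L') (pdiag L' \<oplus>\<^sub>f 0) = kc unital (pdiag L) 0"
    by (rule K.kc_eqI) (simp_all add: p[OF L] p[OF L'] z K.projs_oplus K.mvcl_oplus K.mvcl_zero K.mvcl_carrier M.m_ac)
  hence "bf_class A (x + evec L') = bf_class A (evec L)"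
    using m[OF p[OF L] p[OF L'] p[OF L'] z kc_pdiag_carrier[OF L L'] car[OF L']] by (simp add: pos L L' x bf_class_mult)
  thus ?thesis by (simp add: x bf_class_eq_iff algebra_simps)
qed

text \<open>Every vertex is the end of some edge. The positive and the negative part of a coordinate
  say how often to repeat that edge in the two lists.\<close>

lemma evec_surj: "\<exists>L L'. set L \<subseteq> edges A \<and> set L' \<subseteq> edges A \<and> evec L - evec L' = x"
proof -
  have "\<exists>a\<in>edges A. tgt a = v" for v using irreducible_column[OF irr, of v] edge_exists by metis
  then obtain e where e: "\<And>v. e v \<in> edges A \<and> tgt (e v) = v" by metis
  obtain vs :: "'n list" where vs: "set vs = UNIV" "distinct vs" using finite_distinct_list[OF finite[of "UNIV :: 'n set"]] by blast
  let ?L = "\<lambda>n :: 'n \<Rightarrow> nat. concat (map (\<lambda>v. replicate (n v) (e v)) vs)"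
  have c: "evec (?L n) $ w = int (n w)" for n w
    by (simp add: evec_concat[OF vs(2)] vs(1) evec_replicate e)
  have s: "set (?L n) \<subseteq> edges A" for n using e by auto
  have d: "evec (?L (\<lambda>v. nat (x $ v))) - evec (?L (\<lambda>v. nat (- x $ v))) = x"
    by (simp add: vec_eq_iff c)
  show ?thesis by (rule exI, rule exI, rule conjI[OF s conjI[OF s d]])
qed

text \<open>The differences of the \<open>evec\<close> exhaust the target of
  \<open>\<epsilon>\<close>, and \<open>\<epsilon>\<close> is injective. So the given isomorphism
  itself provides the generators of the group.\<close>

lemma K0_cases:
  assumes \<epsilon>: "is_epsilon A \<epsilon>" and x: "x \<in> carrier (K0 (\<O> A))"
  obtains L L' where "set L \<subseteq> edges A" "set L' \<subseteq> edges A" "x = kc unital (pdiag L) (pdiag L')"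
proof -
  have iso: "\<epsilon> \<in> hom (K0 (\<O> A)) (bf_group A)" "inj_on \<epsilon> (carrier (K0 (\<O> A)))"
    using \<epsilon> by (auto simp: is_epsilon_def iso_def bij_betw_def)
  obtain u where u: "\<epsilon> x = bf_class A u" using hom_in_carrier[OF iso(1) x] unfolding bf_carrier by blast
  obtain L L' where L: "set L \<subseteq> edges A" "set L' \<subseteq> edges A" "evec L - evec L' = u" using evec_surj by blast
  have "x = kc unital (pdiag L) (pdiag L')"
    by (rule inj_onD[OF iso(2) _ x kc_pdiag_carrier[OF L(1,2)]]) (simp add: u epsilon_kc[OF \<epsilon> L(1,2)] L(3))
  thus thesis using that L by blast
qed

lemma stab_hom: "matrix_star_hom unital stable_unital (map_unitization (\<lambda>S. S \<otimes>\<^sub>o rank_one_proj))"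
  unfolding rank_one_proj_eq
  by (rule unitization_hom[OF star_subalgebra_ck_algebra(1) star_subalgebra_ck_stable(1) ck_tensor_mem])
    (simp_all add: tensor_add_left tensor_mult munit_mult tensor_adj tensor_scaleC_left)

lemma K0_stab_kc:
  assumes "set L \<subseteq> edges A" "set L' \<subseteq> edges A"
  shows "K0_stab (\<O> A) (kc unital (pdiag L) (pdiag L')) = kc stable_unital (spdiag L) (spdiag L')"
proof -
  interpret h: matrix_star_hom unital stable_unital "map_unitization (\<lambda>S. S \<otimes>\<^sub>o rank_one_proj)" by (rule stab_hom)
  have "fmap (map_unitization (\<lambda>S. S \<otimes>\<^sub>o rank_one_proj)) (pdiag L) = spdiag L" for L
    unfolding pdiag_def spdiag_def fmap_dg[of "map_unitization _", OF h.zero] by (simp add: o_def rank_one_proj_eq)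
  thus ?thesis
    unfolding K0_stab_def K0_map_def using h.K00_map_kc[OF pdiag_projs[OF assms(1)] pdiag_projs[OF assms(2)]] by simp
qed

lemma absorb_hom:
  assumes s: "\<And>i. s i \<in> \<O> A" "\<And>i j. adj (s i) * s j = (if i = j then 1 else 0)"
  shows "matrix_star_hom stable_unital unital (map_unitization (absorb s))"
proof -
  have sm: "star_map (absorb s)" and md: "x \<in> mult_domain (absorb s)" for x
    using star_map_absorb[of s] mult_domain_absorb[of s] s(2) by blast+
  have "absorb s ` (\<O> A \<otimes>\<^sub>* compacts) \<subseteq> \<O> A"
    unfolding ck_stable_generators
  proof (rule star_map_generated_subset(2)[OF sm _ _ star_subalgebra_ck_algebra])
    show "absorb s ` {ck_gen A a \<otimes>\<^sub>o (munit i j :: nat cop) |a i j. a \<in> edges A} \<subseteq> \<O> A"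
    proof (rule image_subsetI)
      fix y assume "y \<in> {ck_gen A a \<otimes>\<^sub>o (munit i j :: nat cop) |a i j. a \<in> edges A}"
      then obtain a i j where y: "y = ck_gen A a \<otimes>\<^sub>o munit i j" "a \<in> edges A" by blast
      have "absorb s y = s i * ck_gen A a * adj (s j)" unfolding y(1) by (rule absorb_tensor[OF s(2)])
      thus "absorb s y \<in> \<O> A"
        using s(1) ck_algebra_generator[OF y(2)] sub_mult[OF star_subalgebra_ck_algebra(1)] sub_adj[OF star_subalgebra_ck_algebra(1)]
        by metis
    qed
  qed (use md in blast)
  thus ?thesis
    by (intro unitization_hom star_subalgebra_ck_algebra star_subalgebra_ck_stable)
      (auto simp: star_map_add[OF sm] star_map_adj[OF sm] star_map_scaleC[OF sm] mult_domainD(1)[OF md])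
qed

text \<open>Followed by the map that \<open>absorb s\<close> induces, stabilization sends a range
  projection \<open>p\<close> to \<open>s 0 * p * adj (s 0)\<close>, which is equivalent to
  \<open>p\<close> through \<open>s 0 * p\<close>. Injectivity is what gives
  \<open>the_inv_into\<close> in \<open>K0_induced\<close> its intended value.\<close>

lemma inj_on_K0_stab:
  assumes np: "\<not> permutation_matrix A" and \<epsilon>: "is_epsilon A \<epsilon>"
  shows "inj_on (K0_stab (\<O> A)) (carrier (K0 (\<O> A)))"
proof (rule inj_onI)
  obtain s :: "nat \<Rightarrow> 'n ck_index cop" where s: "\<And>i. s i \<in> \<O> A" "\<And>i j. adj (s i) * s j = (if i = j then 1 else 0)"
    using orthogonal_isometries[OF np] by blast
  interpret h: matrix_star_hom stable_unital unital "map_unitization (absorb s)" by (rule absorb_hom[OF s])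
  have cl: "K.mvcl (fmap (map_unitization (absorb s)) (spdiag L)) = K.mvcl (pdiag L)" if L: "set L \<subseteq> edges A" for L
  proof -
    have "fmap (map_unitization (absorb s)) (spdiag L) = dg (map (\<lambda>a. Unitz 0 (s 0 * range_proj a * adj (s 0))) L)"
      unfolding spdiag_def fmap_dg[of "map_unitization _", OF h.zero] by (simp add: o_def absorb_tensor[OF s(2)])
    moreover have "K.mvcl (dg (map (\<lambda>a. Unitz 0 (s 0 * range_proj a * adj (s 0))) L)) = K.mvcl (pdiag L)"
      unfolding pdiag_def
    proof (rule K.mvcl_dg_cong)
      fix a assume "a \<in> set L"
      hence a: "a \<in> edges A" using L by blast
      let ?v = "s 0 * range_proj a"
      have v: "?v \<in> \<O> A" using s(1) range_proj(1)[OF a] sub_mult[OF star_subalgebra_ck_algebra(1)] by blast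
      have 1: "adj ?v * ?v = range_proj a"
      proof -
        have "adj ?v * ?v = range_proj a * (adj (s 0) * s 0) * range_proj a"
          by (simp only: adj_mult range_proj(3)[OF a] mult.assoc)
        thus ?thesis by (simp add: s(2) range_proj(2)[OF a])
      qed
      have 2: "?v * adj ?v = s 0 * range_proj a * adj (s 0)"
      proof -
        have "?v * adj ?v = s 0 * (range_proj a * range_proj a) * adj (s 0)"
          by (simp only: adj_mult range_proj(3)[OF a] mult.assoc)
        thus ?thesis by (simp add: range_proj(2)[OF a])
      qed
      have m: "mvn unital (fsingle 0 0 (Unitz 0 (range_proj a))) (fsingle 0 0 (Unitz 0 (s 0 * range_proj a * adj (s 0))))"
        using K.single_mvn[OF unitize_mem[OF v, of 0]] by (simp only: Unitz_zero_simps 1 2)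
      have "?v * adj ?v * (?v * adj ?v) = ?v * (adj ?v * ?v) * adj ?v" by (simp only: mult.assoc)
      also have "\<dots> = ?v * adj ?v" unfolding 1 by (simp add: mult.assoc range_proj(2)[OF a] flip: mult.assoc[of "range_proj a" "range_proj a"])
      finally have i: "s 0 * range_proj a * adj (s 0) * (s 0 * range_proj a * adj (s 0)) = s 0 * range_proj a * adj (s 0)"
        unfolding 2 .
      have "K.proj (Unitz 0 (s 0 * range_proj a * adj (s 0)))"
        unfolding K.proj_def Unitz_zero_simps i
        using sub_mult[OF star_subalgebra_ck_algebra(1) v sub_adj[OF star_subalgebra_ck_algebra(1) s(1)]]
        by (simp add: unitize_mem adj_mult adj_adj range_proj(3)[OF a] mult.assoc)
      thus "K.proj (Unitz 0 (s 0 * range_proj a * adj (s 0))) \<and> K.proj (Unitz 0 (range_proj a)) \<and>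
          mvn unital (fsingle 0 0 (Unitz 0 (s 0 * range_proj a * adj (s 0)))) (fsingle 0 0 (Unitz 0 (range_proj a)))"
        using K_proj[OF a] K.mvn_sym[OF m] by blast
    qed
    ultimately show ?thesis by simp
  qed
  fix x y assume x: "x \<in> carrier (K0 (\<O> A))" and y: "y \<in> carrier (K0 (\<O> A))"
    and eq: "K0_stab (\<O> A) x = K0_stab (\<O> A) y"
  obtain L L' where L: "set L \<subseteq> edges A" "set L' \<subseteq> edges A" "x = kc unital (pdiag L) (pdiag L')"
    using K0_cases[OF \<epsilon> x] by blast
  obtain M M' where M: "set M \<subseteq> edges A" "set M' \<subseteq> edges A" "y = kc unital (pdiag M) (pdiag M')"
    using K0_cases[OF \<epsilon> y] by blast
  have inv: "K00_map unital (map_unitization (absorb s)) (K0_stab (\<O> A) (kc unital (pdiag L) (pdiag L'))) =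
      kc unital (pdiag L) (pdiag L')" if L: "set L \<subseteq> edges A" "set L' \<subseteq> edges A" for L L'
    unfolding K0_stab_kc[OF L] h.K00_map_kc[OF spdiag_projs[OF L(1)] spdiag_projs[OF L(2)]]
    by (rule K.kc_eqI) (simp_all add: h.fmap_projs spdiag_projs pdiag_projs L cl)
  show "x = y" using arg_cong[OF eq, of "K00_map unital (map_unitization (absorb s))"]
    unfolding L(3) M(3) inv[OF L(1,2)] inv[OF M(1,2)] .
qed

end

lemma card_edges_between: "card {c \<in> edges C. src c = v \<and> tgt c = w} = C $ v $ w"
proof -
  have "{c \<in> edges C. src c = v \<and> tgt c = w} = (\<lambda>l. (v, w, l)) ` {..< C $ v $ w}"
    by (auto simp: edges_def src_def tgt_def)
  thus ?thesis by (simp add: card_image inj_on_def)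
qed

section \<open>The map induced on \<open>K\<^sub>0\<close> by the stable isomorphism\<close>

context factorization begin

text \<open>The coordinate at \<open>w\<close> of the left hand side counts the edges of
  \<open>C\<close> from \<open>v\<close> to \<open>w\<close>.\<close>

lemma sum_follow_axis:
  "(\<Sum>c\<in>follow v. axis (tgt c) 1) = transpose (map_matrix int C) *v axis v 1"
proof -
  have "(\<Sum>c\<in>follow v. axis (tgt c) 1 :: int ^ 'm) $ w = int (C $ v $ w)" for w
  proof -
    have "(\<Sum>c\<in>follow v. axis (tgt c) 1 :: int ^ 'm) $ w = (\<Sum>c\<in>follow v. if tgt c = w then 1 else 0)"
      by (simp add: axis_def) (rule sum.cong[OF refl], simp)
    also have "\<dots> = int (card {c \<in> follow v. tgt c = w})"
      by (simp add: sum.If_cases Int_def)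
    also have "{c \<in> follow v. tgt c = w} = {c \<in> edges C. src c = v \<and> tgt c = w}" by blast
    finally show ?thesis by (simp only: card_edges_between)
  qed
  moreover have "(transpose (map_matrix int C) *v axis v 1) $ w = int (C $ v $ w)" for w
    by (simp add: matrix_vector_mult_def transpose_def map_matrix_def axis_def if_distrib[of "(*) _"] cong: if_cong
        del: transpose_matrix_vector)
  ultimately show ?thesis by (simp only: vec_eq_iff simp_thms)
qed

definition out_list :: "'n \<Rightarrow> ('n, 'm) edge list" where
  "out_list v = (SOME cs. distinct cs \<and> set cs = follow v)"

lemma out_list: "distinct (out_list v)" "set (out_list v) = follow v"
proof -
  have "\<exists>cs. distinct cs \<and> set cs = follow v" using finite_distinct_list[OF finite_follow[of v]] by blast
  from someI_ex[OF this] show "distinct (out_list v)" "set (out_list v) = follow v" by (simp_all add: out_list_def)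
qed

definition successors :: "('n, 'n) edge \<Rightarrow> ('m, 'm) edge list" where
  "successors a = map (edgeB (dA a)) (out_list (tgt a))"

lemma successors_edges: "a \<in> edges A \<Longrightarrow> set (successors a) \<subseteq> edges B"
  using edgeB_mem by (simp add: successors_def out_list image_subset_iff)

lemma evec_successors:
  assumes a: "a \<in> edges A" shows "evec (successors a) = transpose (map_matrix int C) *v axis (tgt a) 1"
proof -
  have "evec (successors a) = (\<Sum>c\<leftarrow>out_list (tgt a). axis (tgt c) 1)"
    unfolding evec_def successors_def map_map o_def
    by (rule arg_cong[of _ _ sum_list], rule map_cong[OF refl]) (simp only: out_list tgt_edgeB[OF a])
  also have "\<dots> = (\<Sum>c\<in>follow (tgt a). axis (tgt c) 1)"
    by (simp only: sum_list_distinct_conv_sum_set[OF out_list(1)] out_list(2))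
  finally show ?thesis by (simp only: sum_follow_axis)
qed

lemma evec_concat_successors:
  "set L \<subseteq> edges A \<Longrightarrow> evec (concat (map successors L)) = transpose (map_matrix int C) *v evec L"
  by (induction L) (simp_all add: evec_successors matrix_vector_right_distrib del: transpose_matrix_vector)

lemma stable_iso_hom: "matrix_star_hom IA.stable_unital IB.stable_unital (map_unitization stable_iso)"
  by (rule unitization_hom[OF star_subalgebra_ck_stable(1) star_subalgebra_ck_stable(1)])
    (use stable_iso_subset(2) in \<open>auto simp: star_map_add[OF star_map_stable_iso] star_map_adj[OF star_map_stable_iso]
      star_map_scaleC[OF star_map_stable_iso] stable_iso_mult\<close>)

lemma stable_iso_range_proj:
  assumes a: "a \<in> edges A"
  shows "stable_iso (IA.range_proj a \<otimes>\<^sub>o munit 0 0) = (\<Sum>c\<in>follow (tgt a).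
    IB.range_proj (edgeB (dA a) c) \<otimes>\<^sub>o munit (leg_index C (cA a) 0) (leg_index C (cA a) 0))"
proof -
  have p: "[a] \<in> finite_paths A" using a by (simp add: finite_paths_Cons)
  show ?thesis using stable_iso_wproj[OF p, of 0] by (simp add: ck_proj_def IA.range_proj_def IB.range_proj_def)
qed

text \<open>For each \<open>a\<close> the image is a sum of orthogonal projections
  \<open>p_b \<otimes> e_mm\<close> over the successors \<open>b\<close> of \<open>a\<close>. Such a
  sum has the class of the diagonal matrix of its summands, and \<open>p_b \<otimes> e_0m\<close>
  moves each of them from \<open>e_mm\<close> back to \<open>e_00\<close>.\<close>

lemma mvcl_stable_iso_spdiag:
  assumes L: "set L \<subseteq> edges A"
  shows "IB.KS.mvcl (fmap (map_unitization stable_iso) (IA.spdiag L)) = IB.KS.mvcl (IB.spdiag (concat (map successors L)))"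
proof -
  interpret h: matrix_star_hom IA.stable_unital IB.stable_unital "map_unitization stable_iso" by (rule stable_iso_hom)
  define m where "m a = leg_index C (cA a) 0" for a
  define p where "p i b = Unitz 0 (IB.range_proj b \<otimes>\<^sub>o munit i i)" for i :: nat and b
  have p: "IB.KS.proj (p i b)" if "b \<in> edges B" for i b unfolding p_def by (rule IB.KS_proj[OF that])
  have r: "mvn IB.stable_unital (fsingle 0 0 (p i b)) (fsingle 0 0 (p 0 b))" if b: "b \<in> edges B" for i b
  proof -
    let ?v = "Unitz 0 (IB.range_proj b \<otimes>\<^sub>o (munit 0 i :: nat cop))"
    have "?v \<in> IB.stable_unital" by (intro unitize_mem ck_tensor_mem IB.range_proj b)
    moreover have "adj ?v * ?v = p i b" "?v * adj ?v = p 0 b"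
      by (simp_all add: p_def Unitz_zero_simps tensor_adj tensor_mult munit_mult IB.range_proj[OF b])
    ultimately show ?thesis using IB.KS.single_mvn[of ?v] by simp
  qed
  have "fmap (map_unitization stable_iso) (IA.spdiag L) = dg (map (\<lambda>a. Unitz 0 (stable_iso (IA.range_proj a \<otimes>\<^sub>o munit 0 0))) L)"
    unfolding IA.spdiag_def fmap_dg[of "map_unitization _", OF h.zero] by (simp add: o_def)
  also have "\<dots> = dg (map (\<lambda>a. \<Sum>c\<in>set (out_list (tgt a)). p (m a) (edgeB (dA a) c)) L)"
    by (rule arg_cong[of _ _ dg], rule map_cong[OF refl])
      (use L in \<open>simp add: stable_iso_range_proj subsetD Unitz_sum p_def m_def out_list\<close>)
  also have "IB.KS.mvcl \<dots> = IB.KS.mvcl (dg (concat (map (\<lambda>a. map (p 0) (successors a)) L)))"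
  proof (rule IB.KS.mvcl_dg_concat)
    fix a assume "a \<in> set L"
    hence a: "a \<in> edges A" using L by blast
    have eb: "edgeB (dA a) c \<in> edges B" if "c \<in> set (out_list (tgt a))" for c
      using edgeB_mem[OF a] that by (simp only: out_list)
    have o: "p (m a) (edgeB (dA a) c) * p (m a) (edgeB (dA a) d) = 0"
      if c: "c \<in> set (out_list (tgt a))" and d: "d \<in> set (out_list (tgt a))" and cd: "c \<noteq> d" for c d
    proof -
      have "edgeB (dA a) c \<noteq> edgeB (dA a) d" using c d cd edgeB_follow_inj[OF a, of c d] by (simp only: out_list not_False_eq_True)
      hence "IB.range_proj (edgeB (dA a) c) * IB.range_proj (edgeB (dA a) d) = 0"
        unfolding IB.range_proj_def using GB.range_proj_orthogonal[OF eb[OF c] eb[OF d]] by blast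
      thus ?thesis by (simp add: p_def Unitz_zero_simps tensor_mult)
    qed
    have s: "IB.KS.proj (\<Sum>c\<in>set (out_list (tgt a)). p (m a) (edgeB (dA a) c)) \<and>
        IB.KS.mvcl (fsingle 0 0 (\<Sum>c\<in>set (out_list (tgt a)). p (m a) (edgeB (dA a) c))) =
        IB.KS.mvcl (dg (map (\<lambda>c. p (m a) (edgeB (dA a) c)) (out_list (tgt a))))"
      by (rule IB.KS.mvcl_dg_sum[OF out_list(1) p[OF eb] o])
    have e: "IB.KS.mvcl (dg (map (\<lambda>c. p (m a) (edgeB (dA a) c)) (out_list (tgt a)))) =
        IB.KS.mvcl (dg (map (\<lambda>c. p 0 (edgeB (dA a) c)) (out_list (tgt a))))"
      by (rule IB.KS.mvcl_dg_cong, intro conjI p r eb)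
    have q: "\<forall>x\<in>set (map (p 0) (successors a)). IB.KS.proj x"
    proof
      fix x assume "x \<in> set (map (p 0) (successors a))"
      then obtain b where "b \<in> set (successors a)" "x = p 0 b" by (simp only: set_map) blast
      thus "IB.KS.proj x" using p[OF subsetD[OF successors_edges[OF a]]] by simp
    qed
    show "IB.KS.proj (\<Sum>c\<in>set (out_list (tgt a)). p (m a) (edgeB (dA a) c)) \<and>
        (\<forall>x\<in>set (map (p 0) (successors a)). IB.KS.proj x) \<and>
        IB.KS.mvcl (fsingle 0 0 (\<Sum>c\<in>set (out_list (tgt a)). p (m a) (edgeB (dA a) c))) =
        IB.KS.mvcl (dg (map (p 0) (successors a)))"
      using s e q by (simp add: successors_def o_def)
  qed
  also have "concat (map (\<lambda>a. map (p 0) (successors a)) L) = map (p 0) (concat (map successors L))"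
    by (simp add: map_concat o_def)
  finally show ?thesis unfolding IB.spdiag_def p_def .
qed

text \<open>The image in the stabilization for \<open>B\<close> is recognized as a value of
  \<open>K0_stab\<close>, and injectivity of that map identifies the argument.\<close>

lemma K0_induced_kc:
  assumes np: "\<not> permutation_matrix B" and \<epsilon>: "is_epsilon B \<epsilon>\<^sub>B" and L: "set L \<subseteq> edges A" "set L' \<subseteq> edges A"
  shows "K0_induced (\<O> A) (\<O> B) stable_iso (kc IA.unital (IA.pdiag L) (IA.pdiag L')) =
    kc IB.unital (IB.pdiag (concat (map successors L))) (IB.pdiag (concat (map successors L')))"
proof -
  interpret h: matrix_star_hom IA.stable_unital IB.stable_unital "map_unitization stable_iso" by (rule stable_iso_hom)
  let ?L = "concat (map successors L)" and ?L' = "concat (map successors L')"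
  have s: "set ?L \<subseteq> edges B" "set ?L' \<subseteq> edges B"
    using L successors_edges by (simp_all only: set_concat set_map) blast+
  have "K0_map (\<O> B \<otimes>\<^sub>* compacts) stable_iso (K0_stab (\<O> A) (kc IA.unital (IA.pdiag L) (IA.pdiag L'))) =
      kc IB.stable_unital (fmap (map_unitization stable_iso) (IA.spdiag L)) (fmap (map_unitization stable_iso) (IA.spdiag L'))"
    unfolding IA.K0_stab_kc[OF L] K0_map_def by (rule h.K00_map_kc[OF IA.spdiag_projs[OF L(1)] IA.spdiag_projs[OF L(2)]])
  also have "\<dots> = kc IB.stable_unital (IB.spdiag ?L) (IB.spdiag ?L')"
    using mvcl_stable_iso_spdiag[OF L(1)] mvcl_stable_iso_spdiag[OF L(2)]
    by (intro IB.KS.kc_eqI h.fmap_projs IA.spdiag_projs IB.spdiag_projs L s) simp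
  also have "\<dots> = K0_stab (\<O> B) (kc IB.unital (IB.pdiag ?L) (IB.pdiag ?L'))"
    by (rule IB.K0_stab_kc[OF s, symmetric])
  finally show ?thesis
    unfolding K0_induced_def o_def
    by (simp only: the_inv_into_f_f[OF IB.inj_on_K0_stab[OF np \<epsilon>] IB.kc_pdiag_carrier[OF s]])
qed

end

theorem theorem1p3:
  fixes A :: "nat ^ 'n ^ 'n" and B :: "nat ^ 'm ^ 'm"
    and C :: "nat ^ 'm ^ 'n" and D :: "nat ^ 'n ^ 'm"
    and \<kappa>\<^sub>A :: "('n, 'n) edge \<Rightarrow> ('n, 'm) edge \<times> ('m, 'n) edge"
    and \<kappa>\<^sub>B :: "('m, 'm) edge \<Rightarrow> ('m, 'n) edge \<times> ('n, 'm) edge"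
  assumes "irreducible_matrix A" "\<not> permutation_matrix A"
    and "irreducible_matrix B" "\<not> permutation_matrix B"
    and "A = C ** D" "B = D ** C"
    and "edge_splitting A C D \<kappa>\<^sub>A" "edge_splitting B D C \<kappa>\<^sub>B"
  shows "\<exists>\<Phi> :: ('n ck_index \<times> nat) cop \<Rightarrow> ('m ck_index \<times> nat) cop.
    cstar_isomorphism (\<O> A \<otimes>\<^sub>* compacts) (\<O> B \<otimes>\<^sub>* compacts) \<Phi> \<and>
    \<Phi> ` (\<D> A \<otimes>\<^sub>* diagonal_compacts) = \<D> B \<otimes>\<^sub>* diagonal_compacts \<and>
    (\<forall>f\<in>C_int A. \<exists>u. circle_unitary_rep (\<D> A \<otimes>\<^sub>* diagonal_compacts) u \<and>
      (\<forall>t. \<forall>x \<in> \<O> A \<otimes>\<^sub>* compacts.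
        \<Phi> (Ad (u t) (stabilize (\<O> A) (\<rho> A f t) x)) =
        stabilize (\<O> B) (\<rho> B (shift_map A \<kappa>\<^sub>A \<kappa>\<^sub>B f) t) (\<Phi> x))) \<and>
    bf_map B C \<in> iso (bf_group A) (bf_group B) \<and>
    (\<forall>\<epsilon>\<^sub>A \<epsilon>\<^sub>B. is_epsilon A \<epsilon>\<^sub>A \<longrightarrow> is_epsilon B \<epsilon>\<^sub>B \<longrightarrow>
      (\<forall>x \<in> carrier (K0 (\<O> A)).
        \<epsilon>\<^sub>B (K0_induced (\<O> A) (\<O> B) \<Phi> x) = bf_map B C (\<epsilon>\<^sub>A x)))"
proof -
  interpret factorization A B C D \<kappa>\<^sub>A \<kappa>\<^sub>B by (rule factorization.intro[OF assms(1,3,7,8)])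
  show ?thesis
  proof (intro exI[of _ stable_iso] conjI ballI allI impI)
    show "cstar_isomorphism (\<O> A \<otimes>\<^sub>* compacts) (\<O> B \<otimes>\<^sub>* compacts) stable_iso" by (rule stable_iso_isomorphism)
    show "stable_iso ` (\<D> A \<otimes>\<^sub>* diagonal_compacts) = \<D> B \<otimes>\<^sub>* diagonal_compacts" by (rule stable_iso_diagonal_eq)
    show "bf_map B C \<in> iso (bf_group A) (bf_group B)" by (rule bf_map_iso[OF assms(5,6)])
  next
    fix f assume "f \<in> C_int A"
    then obtain N where f: "IA.level f N" using IA.C_int_level by blast
    show "\<exists>u. circle_unitary_rep (\<D> A \<otimes>\<^sub>* diagonal_compacts) u \<and>
      (\<forall>t. \<forall>x \<in> \<O> A \<otimes>\<^sub>* compacts.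
        stable_iso (Ad (u t) (stabilize (\<O> A) (\<rho> A f t) x)) =
        stabilize (\<O> B) (\<rho> B (shift_map A \<kappa>\<^sub>A \<kappa>\<^sub>B f) t) (stable_iso x))"
    proof (rule exI[of _ "\<lambda>t. U_fun A f (- t) \<otimes>\<^sub>o 1"], intro conjI allI ballI)
      show "circle_unitary_rep (\<D> A \<otimes>\<^sub>* diagonal_compacts) (\<lambda>t. U_fun A f (- t) \<otimes>\<^sub>o 1)"
        by (rule IA.circle_unitary_rep_U[OF f])
    qed (rule stable_iso_gauge[OF f])
  next
    fix \<epsilon>\<^sub>A \<epsilon>\<^sub>B x
    assume \<epsilon>: "is_epsilon A \<epsilon>\<^sub>A" "is_epsilon B \<epsilon>\<^sub>B" and x: "x \<in> carrier (K0 (\<O> A))"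
    obtain L L' where L: "set L \<subseteq> edges A" "set L' \<subseteq> edges A" "x = kc IA.unital (IA.pdiag L) (IA.pdiag L')"
      using IA.K0_cases[OF \<epsilon>(1) x] by blast
    have s: "set (concat (map successors L)) \<subseteq> edges B" "set (concat (map successors L')) \<subseteq> edges B"
      using L(1,2) successors_edges by (simp_all only: set_concat set_map) blast+
    have "\<epsilon>\<^sub>B (K0_induced (\<O> A) (\<O> B) stable_iso x) =
        bf_class B (transpose (map_matrix int C) *v evec L - transpose (map_matrix int C) *v evec L')"
      unfolding L(3) K0_induced_kc[OF assms(4) \<epsilon>(2) L(1,2)] IB.epsilon_kc[OF \<epsilon>(2) s]
        evec_concat_successors[OF L(1)] evec_concat_successors[OF L(2)] ..
    also have "\<dots> = bf_map B C (\<epsilon>\<^sub>A x)"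
      unfolding L(3) IA.epsilon_kc[OF \<epsilon>(1) L(1,2)] bf_map_class[OF assms(5,6)] matrix_vector_mult_diff_distrib ..
    finally show "\<epsilon>\<^sub>B (K0_induced (\<O> A) (\<O> B) stable_iso x) = bf_map B C (\<epsilon>\<^sub>A x)" .
  qed
qed

end
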